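(* Assume $a_{-s}=a_s$ for $1\le s\le m$. On the generic simple-root locus, the $C_{m+1}$-dimensional symmetry-adapted determinant state space (obtained by Catalan straightening of the symmetric row-column boundary states, see the context) is a realization of the primitive middle exterior module $P_m$. If $$q(z)=a_m\prod_{i=1}^m(z-x_i)(z-x_i^{-1}),$$ then the autonomous transfer on this module has weights $$\varepsilon=(\varepsilon_1,\ldots,\varepsilon_m)\in\{-1,0,1\}^m,\qquad s(\varepsilon)\equiv m\pmod 2,$$ with transfer eigenvalue $$\lambda_\varepsilon=(-1)^m a_m\,x_1^{\varepsilon_1}\cdots x_m^{\varepsilon_m}.$$ If $s=s(\varepsilon)$ and $m-s=2r$, then the multiplicity of this weight in $P_m$ is the Catalan number $$\operatorname{mult}_{P_m}(\varepsilon)=C_r=\frac1{r+1}\binom{2r}{r}.$$ Consequently the minimal polynomial of the symmetry-adapted autonomous transfer has degree at most $$\#\{\varepsilon\in\{-1,0,1\}^m:\ s(\varepsilon)\equiv m\ (\mathrm{mod}\ 2)\}=\frac{3^m+1}{2},$$ and this transfer minimal-polynomial degree is generically exactly $(3^m+1)/2$.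
   Context: Setting: $A_n=(a_{j-i})_{i,j=1}^n$ is the $n\times n$ section of a balanced banded Toeplitz matrix of lower and upper semibandwidth $m$ (so $a_s=0$ for $|s|>m$, and $a_m\ne0$), $q(z)=z^m\sum_{s=-m}^m a_sz^s$, and $s(\varepsilon)=|\{i:\varepsilon_i\ne0\}|$. One works over a splitting field of $q$, on the open set where the roots of $q$ are simple; in the symmetric case the roots come in reciprocal pairs $x_i,x_i^{-1}$. "Generically" means on a nonempty Zariski-open subset of the symmetric parameter space. $C_k=\frac1{k+1}\binom{2k}k$. Symmetry-adapted state space and transfer: the row-column construction is the finite-state linear transfer obtained by Laplace expansion along boundary rows and columns of Toeplitz sections. Its level-$j$ boundary states ($0\le j\le m$) are, after undoing normalizing translations and up to fixed cofactor signs, complementary minors $\det T_N[I^c,J^c]$ of large Toeplitz sections $T_N$, where $I,J$ are the deleted row and column positions in a common boundary window, viewed as $j$-subsets of $\{1,\dots,m\}$. For symmetric sections every such state is a linear combination, with coefficients independent of the parameters $a_s$, of the states with $I\preceq J$ (that is, the $k$-th smallest element of $I$ is at most that of $J$ for all $k$); there are $C_{m+1}$ such pairs in all levels together. Straightening to these states after each Laplace step gives a closed transfer independent of the section size: the symmetry-adapted autonomous transfer on the $C_{m+1}$-dimensional symmetry-adapted determinant state space. In its compound realization, the balanced determinant evolution is given by $$T=(-1)^ma_m\,\textstyle\bigwedge^m C_q,$$ where $C_q$ is the Frobenius companion matrix of $q(z)/a_m$. Primitive module: let $V$ be a $2m$-dimensional symplectic vector space with symplectic basis $\{e_i,f_i\}_{i=1}^m$,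 $\Omega(e_i,f_j)=\delta_{ij}$, $\Omega(e_i,e_j)=\Omega(f_i,f_j)=0$. Let $\Lambda_\Omega:\bigwedge^mV\to\bigwedge^{m-2}V$ be contraction by $\Omega$, and $P_m=\ker\Lambda_\Omega$, which has dimension $\binom{2m}{m}-\binom{2m}{m-2}=C_{m+1}$. For the weights, $e_i,f_i$ are taken to be eigenvectors of $C_q$ with eigenvalues $x_i,x_i^{-1}$, normalized so that the two vectors of each reciprocal pair are paired by $\Omega$; then $C_q$ preserves $\Omega$ and $T$ preserves $P_m$. A wedge of basis vectors has weight $\varepsilon$ with $\varepsilon_i=1$ if it uses $e_i$ but not $f_i$, $\varepsilon_i=-1$ if it uses $f_i$ but not $e_i$, and $\varepsilon_i=0$ if it uses both or neither; the multiplicity of $\varepsilon$ in $P_m$ is the dimension of the $\varepsilon$-weight space of $P_m$. *)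

theory Defs
  imports
    "Jordan_Normal_Form.Char_Poly"
    "Jordan_Normal_Form.DL_Submatrix"
    "HOL-Library.Function_Algebras"
    "HOL-Library.FuncSet"
begin

text \<open>
  Index sets are zero-based throughout. Coordinate spaces are spaces of functions with values in
  the ground field, with pointwise addition, and supported on the finite set of coordinates.
\<close>

definition fscale :: "'a::field \<Rightarrow> ('i \<Rightarrow> 'a) \<Rightarrow> 'i \<Rightarrow> 'a" where
  "fscale c v = (\<lambda>i. c * v i)"

interpretation fs: vector_space "fscale :: 'a::field \<Rightarrow> ('i \<Rightarrow> 'a) \<Rightarrow> 'i \<Rightarrow> 'a"
  by unfold_locales (auto simp: fscale_def algebra_simps)

definition coord_space :: "'i set \<Rightarrow> ('i \<Rightarrow> 'a::field) set" where
  "coord_space X = {v. \<forall>i. i \<notin> X \<longrightarrow> v i = 0}"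

definition catalan :: "nat \<Rightarrow> nat" where
  "catalan k = (2 * k choose k) div (k + 1)"


section \<open>Symmetric banded Toeplitz sections\<close>

text \<open>
  A parameter point is the coefficient function \<open>s \<mapsto> a\<^sub>s\<close>.
\<close>

definition sym_params :: "nat \<Rightarrow> (int \<Rightarrow> 'a::field) set" where
  "sym_params m =
     {a. (\<forall>s. \<bar>s\<bar> > int m \<longrightarrow> a s = 0) \<and> (\<forall>s. a (- s) = a s) \<and> a (int m) \<noteq> 0}"

definition toeplitz :: "(int \<Rightarrow> 'a) \<Rightarrow> nat \<Rightarrow> 'a mat" where
  "toeplitz a N = mat N N (\<lambda>(i, j). a (int j - int i))"

definition symbol_poly :: "nat \<Rightarrow> (int \<Rightarrow> 'a::field) \<Rightarrow> 'a poly" where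
  "symbol_poly m a = (\<Sum>s\<in>{- int m..int m}. monom (a s) (nat (s + int m)))"

definition reciprocal_roots :: "nat \<Rightarrow> (int \<Rightarrow> 'a::field) \<Rightarrow> (nat \<Rightarrow> 'a) \<Rightarrow> bool" where
  "reciprocal_roots m a x \<longleftrightarrow>
     symbol_poly m a = Polynomial.smult (a (int m)) (\<Prod>i<m. [:- x i, 1:] * [:- inverse (x i), 1:])"


section \<open>Boundary states and the row-column transfer\<close>

definition boundary_pairs :: "nat \<Rightarrow> (nat set \<times> nat set) set" where
  "boundary_pairs m = {(I, J). I \<subseteq> {..<m} \<and> J \<subseteq> {..<m} \<and> card I = card J}"

text \<open>\<open>pick I k\<close> is the \<open>k\<close>-th smallest element of \<open>I\<close>, counting from \<open>0\<close>.\<close>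

definition std_pairs :: "nat \<Rightarrow> (nat set \<times> nat set) set" where
  "std_pairs m = {(I, J) \<in> boundary_pairs m. \<forall>k<card I. pick I k \<le> pick J k}"

definition compl_minor :: "'a::comm_ring_1 mat \<Rightarrow> nat set \<times> nat set \<Rightarrow> 'a" where
  "compl_minor A p = det (submatrix A ({..<dim_row A} - fst p) ({..<dim_col A} - snd p))"

text \<open>
  \<open>laplace_transfer m a\<close> computes the boundary states of the section of size \<open>N + 1\<close> from
  those of the section of size \<open>N\<close> (for \<open>N \<ge> m\<close>). If row \<open>0\<close> is not yet deleted, the minor
  is expanded along that row, whose entry in column \<open>c\<close> is \<open>a\<^sub>c\<close>; then, if column \<open>0\<close> is not
  yet deleted, the minor is expanded along that column, whose entry in row \<open>r\<close> is \<open>a\<^bsub>-r\<^esub>\<close>.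
  The exponents of \<open>-1\<close> are the positions of the entry among the remaining columns and rows.
  After both steps row and column \<open>0\<close> are deleted, and removing them translates the remaining
  deleted positions by one.
\<close>

definition translate :: "nat set \<Rightarrow> nat set" where
  "translate S = (\<lambda>i. i - 1) ` (S - {0})"

definition col_expansion ::
  "nat \<Rightarrow> (int \<Rightarrow> 'a::field) \<Rightarrow> (nat set \<times> nat set \<Rightarrow> 'a) \<Rightarrow> nat set \<Rightarrow> nat set \<Rightarrow> 'a" where
  "col_expansion m a v I J =
     (if 0 \<in> J then v (translate I, translate J)
      else \<Sum>r\<in>{..m} - I. (- 1) ^ card ({..<r} - I) * a (- int r)
             * v (translate (insert r I), translate (insert 0 J)))"

definition row_expansion ::
  "nat \<Rightarrow> (int \<Rightarrow> 'a::field) \<Rightarrow> (nat set \<times> nat set \<Rightarrow> 'a) \<Rightarrow> nat set \<Rightarrow> nat set \<Rightarrow> 'a" where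
  "row_expansion m a v I J =
     (if 0 \<in> I then col_expansion m a v I J
      else \<Sum>c\<in>{..m} - J. (- 1) ^ card ({..<c} - J) * a (int c)
             * col_expansion m a v (insert 0 I) (insert c J))"

definition laplace_transfer ::
  "nat \<Rightarrow> (int \<Rightarrow> 'a::field) \<Rightarrow> (nat set \<times> nat set \<Rightarrow> 'a) \<Rightarrow> nat set \<times> nat set \<Rightarrow> 'a" where
  "laplace_transfer m a v =
     (\<lambda>p. if p \<in> boundary_pairs m then row_expansion m a v (fst p) (snd p) else 0)"


section \<open>Catalan straightening and the symmetry-adapted transfer\<close>

text \<open>
  The coefficients \<open>c p q\<close> express the state \<open>p\<close> of a symmetric section through the standard
  states \<open>q\<close>. They depend neither on the entries nor on the size of the section. The identity is
  required for all symmetric matrices, not only for the Toeplitz sections among them: this makes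
  the values of \<open>c\<close> on boundary pairs and standard pairs unique.
\<close>

definition catalan_straightening ::
  "nat \<Rightarrow> (nat set \<times> nat set \<Rightarrow> nat set \<times> nat set \<Rightarrow> 'a::field) \<Rightarrow> bool" where
  "catalan_straightening m c \<longleftrightarrow>
     (\<forall>N\<ge>m. \<forall>A\<in>carrier_mat N N. transpose_mat A = A \<longrightarrow>
        (\<forall>p\<in>boundary_pairs m.
           compl_minor A p = (\<Sum>q\<in>std_pairs m. c p q * compl_minor A q)))"

definition straighten ::
  "nat \<Rightarrow> (nat set \<times> nat set \<Rightarrow> nat set \<times> nat set \<Rightarrow> 'a::field)
     \<Rightarrow> (nat set \<times> nat set \<Rightarrow> 'a) \<Rightarrow> nat set \<times> nat set \<Rightarrow> 'a" where
  "straighten m c w =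
     (\<lambda>p. if p \<in> boundary_pairs m then \<Sum>q\<in>std_pairs m. c p q * w q else 0)"

definition sym_state_space :: "nat \<Rightarrow> (nat set \<times> nat set \<Rightarrow> 'a::field) set" where
  "sym_state_space m = coord_space (std_pairs m)"

definition sym_state :: "nat \<Rightarrow> 'a::field mat \<Rightarrow> nat set \<times> nat set \<Rightarrow> 'a" where
  "sym_state m A = (\<lambda>q. if q \<in> std_pairs m then compl_minor A q else 0)"

definition sym_transfer ::
  "nat \<Rightarrow> (nat set \<times> nat set \<Rightarrow> nat set \<times> nat set \<Rightarrow> 'a::field) \<Rightarrow> (int \<Rightarrow> 'a)
     \<Rightarrow> (nat set \<times> nat set \<Rightarrow> 'a) \<Rightarrow> nat set \<times> nat set \<Rightarrow> 'a" where
  "sym_transfer m c a w =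
     (\<lambda>q. if q \<in> std_pairs m then laplace_transfer m a (straighten m c w) q else 0)"


section \<open>Exterior powers in coordinates\<close>

text \<open>
  For \<open>V = K\<^sup>n\<close> with standard basis \<open>u\<^sub>0, \<dots>, u\<^bsub>n-1\<^esub>\<close>, an element of the \<open>k\<close>-th exterior power
  is given by its coordinates with respect to the basis \<open>u\<^sub>S = u\<^bsub>s\<^sub>1\<^esub> \<and> \<dots> \<and> u\<^bsub>s\<^sub>k\<^esub>\<close>, where
  \<open>S = {s\<^sub>1 < \<dots> < s\<^sub>k}\<close>.
\<close>

definition ksubsets :: "nat \<Rightarrow> nat \<Rightarrow> nat set set" where
  "ksubsets n k = {S. S \<subseteq> {..<n} \<and> card S = k}"

definition ext_power :: "nat \<Rightarrow> nat \<Rightarrow> (nat set \<Rightarrow> 'a::field) set" where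
  "ext_power n k = coord_space (ksubsets n k)"

definition wedge :: "nat \<Rightarrow> 'a::field vec list \<Rightarrow> nat set \<Rightarrow> 'a" where
  "wedge n vs =
     (\<lambda>S. if S \<in> ksubsets n (length vs)
          then det (submatrix (mat_of_cols n vs) S {..<length vs}) else 0)"

definition compound :: "nat \<Rightarrow> nat \<Rightarrow> 'a::field mat \<Rightarrow> (nat set \<Rightarrow> 'a) \<Rightarrow> nat set \<Rightarrow> 'a" where
  "compound n k A \<omega> =
     (\<lambda>S. if S \<in> ksubsets n k then \<Sum>R\<in>ksubsets n k. det (submatrix A S R) * \<omega> R else 0)"

text \<open>
  Contraction by the alternating form with Gram matrix \<open>G\<close>,
  \<open>v\<^sub>1 \<and> \<dots> \<and> v\<^sub>k \<mapsto> \<Sum>\<^bsub>a<b\<^esub> (-1)\<^bsup>a+b-1\<^esup> \<Omega>(v\<^sub>a, v\<^sub>b) v\<^sub>1 \<and> \<dots> \<and> v\<^sub>k\<close> (with \<open>v\<^sub>a, v\<^sub>b\<close> omitted),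
  read off at the coordinate \<open>R\<close>: for \<open>i < j\<close> outside \<open>R\<close> the positions of \<open>i\<close> and \<open>j\<close> in
  \<open>R \<union> {i, j}\<close> are \<open>a = |R \<inter> {..<i}| + 1\<close> and \<open>b = |R \<inter> {..<j}| + 2\<close>.
\<close>

definition contraction :: "nat \<Rightarrow> nat \<Rightarrow> 'a::field mat \<Rightarrow> (nat set \<Rightarrow> 'a) \<Rightarrow> nat set \<Rightarrow> 'a" where
  "contraction n k G \<omega> =
     (\<lambda>R. if R \<subseteq> {..<n} \<and> card R + 2 = k
          then \<Sum>(i, j)\<in>{(i, j). i < j \<and> j < n \<and> i \<notin> R \<and> j \<notin> R}.
                 (- 1) ^ (card (R \<inter> {..<i}) + card (R \<inter> {..<j})) * G $$ (i, j)
                   * \<omega> (insert i (insert j R))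
          else 0)"

definition primitive_module :: "nat \<Rightarrow> 'a::field mat \<Rightarrow> (nat set \<Rightarrow> 'a) set" where
  "primitive_module m G = {\<omega> \<in> ext_power (2 * m) m. contraction (2 * m) m G \<omega> = 0}"


section \<open>Companion matrix, compound transfer and weights\<close>

definition frobenius_companion :: "'a::field poly \<Rightarrow> 'a mat" where
  "frobenius_companion p =
     mat (degree p) (degree p)
       (\<lambda>(i, j). if j + 1 = degree p then - coeff p i else if i = j + 1 then 1 else 0)"

definition C_q :: "nat \<Rightarrow> (int \<Rightarrow> 'a::field) \<Rightarrow> 'a mat" where
  "C_q m a = frobenius_companion (Polynomial.smult (inverse (a (int m))) (symbol_poly m a))"

definition compound_transfer :: "nat \<Rightarrow> (int \<Rightarrow> 'a::field) \<Rightarrow> (nat set \<Rightarrow> 'a) \<Rightarrow> nat set \<Rightarrow> 'a"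
  where
  "compound_transfer m a \<omega> = fscale ((- 1) ^ m * a (int m)) (compound (2 * m) m (C_q m a) \<omega>)"

text \<open>
  The vectors \<open>e i, f i\<close> form a symplectic basis of \<open>K\<^bsup>2m\<^esup>\<close> for the alternating form \<open>\<Omega>\<close>
  with Gram matrix \<open>G\<close> and consist of eigenvectors of \<open>C\<close>; linear independence follows from the
  pairing relations.
\<close>

definition symplectic_eigenbasis ::
  "nat \<Rightarrow> 'a::field mat \<Rightarrow> (nat \<Rightarrow> 'a) \<Rightarrow> (nat \<Rightarrow> 'a vec) \<Rightarrow> (nat \<Rightarrow> 'a vec) \<Rightarrow> 'a mat \<Rightarrow> bool"
  where
  "symplectic_eigenbasis m C x e f G \<longleftrightarrow>
     G \<in> carrier_mat (2 * m) (2 * m) \<and>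
     (\<forall>i<2 * m. G $$ (i, i) = 0) \<and> (\<forall>i<2 * m. \<forall>j<2 * m. G $$ (j, i) = - G $$ (i, j)) \<and>
     (\<forall>i<m. eigenvector C (e i) (x i) \<and> eigenvector C (f i) (inverse (x i))) \<and>
     (\<forall>i<m. \<forall>j<m. e i \<bullet> (G *\<^sub>v f j) = (if i = j then 1 else 0) \<and>
        e i \<bullet> (G *\<^sub>v e j) = 0 \<and> f i \<bullet> (G *\<^sub>v f j) = 0)"

text \<open>
  In \<open>basis_wedge\<close> and \<open>wedge_weight\<close> the position \<open>i < m\<close> stands for \<open>e i\<close> and the position
  \<open>m + i\<close> for \<open>f i\<close>.
\<close>

definition basis_wedge :: "nat \<Rightarrow> (nat \<Rightarrow> 'a::field vec) \<Rightarrow> (nat \<Rightarrow> 'a vec) \<Rightarrow> nat set \<Rightarrow> nat set \<Rightarrow> 'a"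
  where
  "basis_wedge m e f B =
     wedge (2 * m) (map (\<lambda>k. if k < m then e k else f (k - m)) (sorted_list_of_set B))"

definition wedge_weight :: "nat \<Rightarrow> nat set \<Rightarrow> nat \<Rightarrow> int" where
  "wedge_weight m B =
     (\<lambda>i\<in>{..<m}. if i \<in> B \<and> m + i \<notin> B then 1 else if i \<notin> B \<and> m + i \<in> B then - 1 else 0)"

definition sign_vectors :: "nat \<Rightarrow> (nat \<Rightarrow> int) set" where
  "sign_vectors m = {..<m} \<rightarrow>\<^sub>E {- 1, 0, 1}"

definition support_size :: "nat \<Rightarrow> (nat \<Rightarrow> int) \<Rightarrow> nat" where
  "support_size m \<epsilon> = card {i. i < m \<and> \<epsilon> i \<noteq> 0}"

definition primitive_weight_space ::
  "nat \<Rightarrow> (nat \<Rightarrow> 'a::field vec) \<Rightarrow> (nat \<Rightarrow> 'a vec) \<Rightarrow> 'a mat \<Rightarrow> (nat \<Rightarrow> int) \<Rightarrow> (nat set \<Rightarrow> 'a) set"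
  where
  "primitive_weight_space m e f G \<epsilon> =
     primitive_module m G \<inter>
     fs.span {basis_wedge m e f B | B. B \<in> ksubsets (2 * m) m \<and> wedge_weight m B = \<epsilon>}"

definition transfer_eigenvalue ::
  "nat \<Rightarrow> (int \<Rightarrow> 'a::field) \<Rightarrow> (nat \<Rightarrow> 'a) \<Rightarrow> (nat \<Rightarrow> int) \<Rightarrow> 'a" where
  "transfer_eigenvalue m a x \<epsilon> = (- 1) ^ m * a (int m) * (\<Prod>i<m. x i powi \<epsilon> i)"


section \<open>Minimal polynomials and the Zariski topology\<close>

definition op_poly :: "'a::field poly \<Rightarrow> (('i \<Rightarrow> 'a) \<Rightarrow> 'i \<Rightarrow> 'a) \<Rightarrow> ('i \<Rightarrow> 'a) \<Rightarrow> 'i \<Rightarrow> 'a" where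
  "op_poly p L w = (\<Sum>k\<le>degree p. fscale (coeff p k) ((L ^^ k) w))"

definition annihilates ::
  "'a::field poly \<Rightarrow> (('i \<Rightarrow> 'a) \<Rightarrow> 'i \<Rightarrow> 'a) \<Rightarrow> ('i \<Rightarrow> 'a) set \<Rightarrow> bool" where
  "annihilates p L W \<longleftrightarrow> (\<forall>w\<in>W. op_poly p L w = 0)"

definition min_poly :: "(('i \<Rightarrow> 'a::field) \<Rightarrow> 'i \<Rightarrow> 'a) \<Rightarrow> ('i \<Rightarrow> 'a) set \<Rightarrow> 'a poly" where
  "min_poly L W =
     (THE p. lead_coeff p = 1 \<and> annihilates p L W \<and> (\<forall>r. annihilates r L W \<longrightarrow> p dvd r))"

inductive_set poly_functions :: "((int \<Rightarrow> 'a::field) \<Rightarrow> 'a) set" where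
  const: "(\<lambda>a. k) \<in> poly_functions"
| coordinate: "(\<lambda>a. a s) \<in> poly_functions"
| add: "P \<in> poly_functions \<Longrightarrow> Q \<in> poly_functions \<Longrightarrow> (\<lambda>a. P a + Q a) \<in> poly_functions"
| mult: "P \<in> poly_functions \<Longrightarrow> Q \<in> poly_functions \<Longrightarrow> (\<lambda>a. P a * Q a) \<in> poly_functions"

definition zariski_open :: "(int \<Rightarrow> 'a::field) set \<Rightarrow> (int \<Rightarrow> 'a) set \<Rightarrow> bool" where
  "zariski_open X U \<longleftrightarrow> (\<exists>F\<subseteq>poly_functions. U = {a \<in> X. \<exists>P\<in>F. P a \<noteq> 0})"

end

theory Submission
  imports "HOL-Algebra.Algebraic_Closure_Type"
    Defs
begin

text \<open>
  A level-\<open>j\<close> boundary state \<open>(I, J)\<close> is read as the basis wedge of degree \<open>m\<close> in \<open>K\<^bsup>2m\<^esup>\<close> indexed by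
  \<open>({0, \<dots>, m - 1} - I) \<union> (m + J)\<close>. Under this identification a Laplace expansion along a row is an
  annihilation operator and one along a column a creation operator on the exterior algebra, and the
  two steps together act as \<open>(-1)\<^bsup>m\<^esup> a\<^sub>m \<And>\<^bsup>m\<^esup> M\<close> for a \<open>2m \<times> 2m\<close> matrix \<open>M\<close>. The linear relations among the
  complementary minors of symmetric matrices become the vanishing of the symplectic contraction, so
  the states of symmetric sections span the primitive module, and standard pairs are coordinates on
  it because their number is its dimension. For a zero \<open>z\<close> of the symbol, \<open>M\<close> has an explicit
  eigenvector with eigenvalue \<open>z\<close>; vectors of different reciprocal pairs are orthogonal, which gives
  a symplectic eigenbasis. The weight multiplicities follow from the \<open>sl\<^sub>2\<close> action of contraction
  and its adjoint, as a difference of two binomial coefficients.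

  For the generic degree, the independence of the first \<open>(3\<^bsup>m\<^esup> + 1) / 2\<close> powers of the transfer is a
  polynomial condition that holds at one parameter point with distinct eigenvalues. The upper bound
  away from the split locus is obtained over the algebraic closure, where reciprocal roots exist,
  and descends by applying a linear retraction to the coefficients of the annihilating polynomial.
\<close>

text \<open>The two Laplace steps together form a sum of wedge and contraction operators in which
  nothing looks multiplicative. The sum is an exterior power for this reason: in the enlarged window
  its result is always divisible by one fixed vector E, so wedging the result with E gives 0. The
  m-th coordinate of E is -a_m, and contracting this relation along coordinate m recovers the result
  from its contraction. Here the factor a_m and the condition a_m \<noteq> 0 enter. The matrix M
  obtained in this way is not the companion matrix C_q. The two are linked by diagonalization: M has
  a symplectic eigenbasis for the fixed standard form with the same eigenvalues, so both transfers
  become the same diagonal operator in eigencoordinates, and the realization map is composed of the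
  two changes of basis. Primitive modules of different forms are compared by the same transport. All
  choices of straightening coefficients give the same transfer, because the states of symmetric
  matrices span the module on which straightening inverts the restriction to standard pairs.\<close>

declare zero_fun_def [simp del] plus_fun_def [simp del]

section \<open>Creation and annihilation operators\<close>

text \<open>The sign of carrying a factor with index \<open>i\<close> past the factors of smaller
  index to its place in an increasing wedge. With it \<open>cr i\<close> is left multiplication by
  the i-th basis vector, and \<open>an i\<close> is contraction with the dual vector.\<close>

definition sg :: "nat \<Rightarrow> nat set \<Rightarrow> 'a::field" where
  "sg i S = (- 1) ^ card (S \<inter> {..<i})"

definition cr :: "nat \<Rightarrow> (nat set \<Rightarrow> 'a::field) \<Rightarrow> nat set \<Rightarrow> 'a" where
  "cr i \<omega> = (\<lambda>S. if i \<in> S then sg i S * \<omega> (S - {i}) else 0)"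

definition an :: "nat \<Rightarrow> (nat set \<Rightarrow> 'a::field) \<Rightarrow> nat set \<Rightarrow> 'a" where
  "an i \<omega> = (\<lambda>S. if i \<notin> S then sg i S * \<omega> (insert i S) else 0)"

lemma sg_sq [simp]: "sg i S * sg i S = (1::'a::field)"
  by (simp add: sg_def flip: power_add mult_2)

lemma sg_sq_left [simp]: "sg i S * (sg i S * x) = (x::'a::field)"
  by (simp flip: mult.assoc)

lemma sg_insert:
  "sg i (insert j S) = (if j < i \<and> j \<notin> S then - sg i S else (sg i S :: 'a::field))"
proof (cases "j < i \<and> j \<notin> S")
  case True
  then have "insert j S \<inter> {..<i} = insert j (S \<inter> {..<i})" by auto
  with True show ?thesis by (simp add: sg_def)
next
  case False
  then have "insert j S \<inter> {..<i} = S \<inter> {..<i}" by auto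
  with False show ?thesis unfolding sg_def by auto
qed

lemma sg_remove:
  "sg i (S - {j}) = (if j < i \<and> j \<in> S then - sg i S else (sg i S :: 'a::field))"
proof (cases "j \<in> S")
  case True
  then have "S = insert j (S - {j})" by auto
  then have "sg i S = (if j < i then - sg i (S - {j}) else (sg i (S - {j}) :: 'a))"
    by (metis sg_insert Diff_iff insertI1)
  with True show ?thesis by auto
qed simp

text \<open>Together with the lemmas on \<open>an\<close> and \<open>cr\<close> below these are the
  canonical anticommutation relations. The identities for vectors, induced maps and contractions are
  derived from them rather than from index signs.\<close>

lemma cr_cr: "cr i (cr j \<omega>) = - cr j (cr i \<omega>)"
proof
  fix S
  have "S - {i} - {j} = S - {j} - {i}" by auto
  then show "cr i (cr j \<omega>) S = (- cr j (cr i \<omega>)) S"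
    by (cases i j rule: linorder_cases) (auto simp: cr_def sg_remove)
qed

lemma cr_cr_same [simp]: "cr i (cr i \<omega>) = 0"
  by (auto simp: cr_def)

lemma an_cr_same: "an i (cr i \<omega>) = \<omega> - cr i (an i \<omega>)"
proof
  fix S
  show "an i (cr i \<omega>) S = (\<omega> - cr i (an i \<omega>)) S"
    by (auto simp: an_def cr_def sg_insert sg_remove insert_absorb)
qed

lemma an_cr_diff:
  assumes "i \<noteq> j"
  shows "an i (cr j \<omega>) = - cr j (an i \<omega>)"
proof
  fix S
  have "insert i S - {j} = insert i (S - {j})" using assms by auto
  then show "an i (cr j \<omega>) S = (- cr j (an i \<omega>)) S"
    using assms by (cases i j rule: linorder_cases) (auto simp: an_def cr_def sg_insert sg_remove)
qed

text \<open>The occupation number of position \<open>i\<close>. Summed over all positions it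
  multiplies by the degree, which is how the degree enters the \<open>sl2\<close> relation
  later.\<close>

lemma cr_an_same: "cr i (an i \<omega>) S = (if i \<in> S then \<omega> S else 0)"
  by (auto simp: an_def cr_def sg_insert sg_remove insert_absorb)

lemma cr_add: "cr i (\<omega> + \<eta>) = cr i \<omega> + cr i \<eta>"
  by (auto simp: cr_def algebra_simps)
lemma cr_scale: "cr i (fscale c \<omega>) = fscale c (cr i \<omega>)"
  by (auto simp: cr_def fscale_def)
lemma an_add: "an i (\<omega> + \<eta>) = an i \<omega> + an i \<eta>"
  by (auto simp: an_def algebra_simps)
lemma an_scale: "an i (fscale c \<omega>) = fscale c (an i \<omega>)"
  by (auto simp: an_def fscale_def)
lemma cr_0 [simp]: "cr i 0 = 0" by (auto simp: cr_def)
lemma an_0 [simp]: "an i 0 = 0" by (auto simp: an_def)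
lemma cr_minus: "cr i (- \<omega>) = - cr i \<omega>" by (auto simp: cr_def)
lemma an_minus: "an i (- \<omega>) = - an i \<omega>" by (auto simp: an_def)
lemma cr_diff: "cr i (\<omega> - \<eta>) = cr i \<omega> - cr i \<eta>"
  by (auto simp: cr_def algebra_simps)
lemma an_diff: "an i (\<omega> - \<eta>) = an i \<omega> - an i \<eta>"
  by (auto simp: an_def algebra_simps)

lemma fscale_add: "fscale c (v + w) = fscale c v + fscale c w"
  by (rule fs.scale_right_distrib)
lemma fscale_apply: "fscale c v i = c * v i" by (simp add: fscale_def)
lemma sum_fun_apply: "(\<Sum>x\<in>A. f x) y = (\<Sum>x\<in>A. f x y)"
  by (induction A rule: infinite_finite_induct) auto

lemma cr_sum: "cr i (\<Sum>x\<in>A. f x) = (\<Sum>x\<in>A. cr i (f x))"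
  by (induction A rule: infinite_finite_induct) (simp_all only: not_False_eq_True sum.infinite sum.empty sum.insert cr_add cr_0)
lemma an_sum: "an i (\<Sum>x\<in>A. f x) = (\<Sum>x\<in>A. an i (f x))"
  by (induction A rule: infinite_finite_induct) (simp_all only: not_False_eq_True sum.infinite sum.empty sum.insert an_add an_0)

section \<open>Creation along a vector and contraction by a covector\<close>

definition crv :: "nat \<Rightarrow> (nat \<Rightarrow> 'a::field) \<Rightarrow> (nat set \<Rightarrow> 'a) \<Rightarrow> nat set \<Rightarrow> 'a" where
  "crv n v \<omega> = (\<Sum>i<n. fscale (v i) (cr i \<omega>))"

definition anv :: "nat \<Rightarrow> (nat \<Rightarrow> 'a::field) \<Rightarrow> (nat set \<Rightarrow> 'a) \<Rightarrow> nat set \<Rightarrow> 'a" where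
  "anv n v \<omega> = (\<Sum>i<n. fscale (v i) (an i \<omega>))"

lemma crv_add: "crv n v (\<omega> + \<eta>) = crv n v \<omega> + crv n v \<eta>"
  by (simp add: crv_def cr_add fscale_add sum.distrib)
lemma crv_scale: "crv n v (fscale c \<omega>) = fscale c (crv n v \<omega>)"
  by (simp add: crv_def cr_scale fs.scale_sum_right mult.commute)
lemma anv_add: "anv n v (\<omega> + \<eta>) = anv n v \<omega> + anv n v \<eta>"
  by (simp add: anv_def an_add fscale_add sum.distrib)
lemma anv_scale: "anv n v (fscale c \<omega>) = fscale c (anv n v \<omega>)"
  by (simp add: anv_def an_scale fs.scale_sum_right mult.commute)
lemma crv_0 [simp]: "crv n v 0 = 0" by (simp add: crv_def)
lemma crv_minus: "crv n v (- \<omega>) = - crv n v \<omega>"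
  by (simp add: crv_def cr_minus sum_negf)
lemma anv_minus: "anv n v (- \<omega>) = - anv n v \<omega>"
  by (simp add: anv_def an_minus sum_negf)
lemma crv_diff: "crv n v (\<omega> - \<eta>) = crv n v \<omega> - crv n v \<eta>"
  by (simp add: crv_def cr_diff fs.scale_right_diff_distrib sum_subtractf)
lemma crv_sum: "crv n v (\<Sum>x\<in>A. f x) = (\<Sum>x\<in>A. crv n v (f x))"
  by (induction A rule: infinite_finite_induct) (simp_all only: not_False_eq_True sum.infinite sum.empty sum.insert crv_add crv_0)
lemma crv_cong: "(\<And>i. i < n \<Longrightarrow> v i = w i) \<Longrightarrow> crv n v \<omega> = crv n w \<omega>"
  by (simp add: crv_def)
lemma anv_cong: "(\<And>i. i < n \<Longrightarrow> v i = w i) \<Longrightarrow> anv n v \<omega> = anv n w \<omega>"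
  by (simp add: anv_def)

lemma crv_vec_add: "crv n (\<lambda>i. v i + w i) \<omega> = crv n v \<omega> + crv n w \<omega>"
  by (simp add: crv_def fs.scale_left_distrib sum.distrib)
lemma crv_vec_scale: "crv n (\<lambda>i. c * v i) \<omega> = fscale c (crv n v \<omega>)"
  by (simp add: crv_def fs.scale_sum_right)
lemma crv_unit:
  assumes "j < n" shows "crv n (\<lambda>i. if i = j then 1 else 0) \<omega> = cr j \<omega>"
proof -
  have "crv n (\<lambda>i. if i = j then 1 else 0) \<omega> = (\<Sum>i<n. if i = j then cr i \<omega> else 0)"
    unfolding crv_def by (rule sum.cong) auto
  then show ?thesis using assms by simp
qed

lemma cr_crv: "cr i (crv n v \<omega>) = - crv n v (cr i \<omega>)"
proof -
  have "cr i (crv n v \<omega>) = (\<Sum>j<n. fscale (v j) (cr i (cr j \<omega>)))"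
    by (simp add: crv_def cr_sum cr_scale)
  also have "\<dots> = (\<Sum>j<n. - fscale (v j) (cr j (cr i \<omega>)))"
    by (subst cr_cr) simp
  also have "\<dots> = - crv n v (cr i \<omega>)" by (simp add: crv_def sum_negf)
  finally show ?thesis .
qed

lemma crv_crv: "crv n v (crv n w \<omega>) = - crv n w (crv n v \<omega>)"
proof -
  have "crv n v (crv n w \<omega>) = (\<Sum>j<n. fscale (v j) (cr j (crv n w \<omega>)))"
    by (simp add: crv_def)
  also have "\<dots> = - (\<Sum>j<n. fscale (v j) (crv n w (cr j \<omega>)))"
    by (simp add: cr_crv sum_negf)
  also have "\<dots> = - crv n w (crv n v \<omega>)" by (simp add: crv_def[of n v] crv_sum crv_scale)
  finally show ?thesis .
qed

text \<open>Anticommutation only yields that twice the left side is 0, so the characteristic of the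
  field matters here.\<close>

lemma crv_crv_same [simp]: "crv n v (crv n v (\<omega> :: nat set \<Rightarrow> 'a::field_char_0)) = 0"
proof
  fix S
  have "crv n v (crv n v \<omega>) S = (- crv n v (crv n v \<omega>)) S"
    using crv_crv[of n v v \<omega>] by metis
  then have "2 * crv n v (crv n v \<omega>) S = 0" by simp
  then show "crv n v (crv n v \<omega>) S = 0 S" by simp
qed

lemma an_crv:
  assumes "i < n"
  shows "an i (crv n v \<omega>) = fscale (v i) \<omega> - crv n v (an i \<omega>)"
proof -
  have "an i (crv n v \<omega>) = (\<Sum>j<n. fscale (v j) (an i (cr j \<omega>)))"
    by (simp add: crv_def an_sum an_scale)
  also have "\<dots> = (\<Sum>j<n. (if j = i then fscale (v i) \<omega> else 0) - fscale (v j) (cr j (an i \<omega>)))"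
    by (rule sum.cong) (auto simp: an_cr_same an_cr_diff fs.scale_right_diff_distrib)
  also have "\<dots> = fscale (v i) \<omega> - crv n v (an i \<omega>)"
    using assms by (simp add: sum_subtractf crv_def)
  finally show ?thesis .
qed

text \<open>Contraction is an antiderivation; the scalar is the pairing of the covector \<phi> with
  the vector \<open>v\<close>.\<close>

lemma anv_crv:
  "anv n \<phi> (crv n v \<omega>) = fscale (\<Sum>i<n. \<phi> i * v i) \<omega> - crv n v (anv n \<phi> \<omega>)"
proof -
  have "anv n \<phi> (crv n v \<omega>) =
      (\<Sum>i<n. fscale (\<phi> i) (fscale (v i) \<omega> - crv n v (an i \<omega>)))"
    by (simp add: anv_def an_crv)
  also have "\<dots> = fscale (\<Sum>i<n. \<phi> i * v i) \<omega> - crv n v (anv n \<phi> \<omega>)"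
    by (simp add: fs.scale_right_diff_distrib sum_subtractf fs.scale_sum_left
        anv_def[of n \<phi> \<omega>] crv_sum crv_scale)
  finally show ?thesis .
qed

lemma anv_cr:
  assumes "b < n"
  shows "anv n \<phi> (cr b \<omega>) = fscale (\<phi> b) \<omega> - cr b (anv n \<phi> \<omega>)"
proof -
  have "(\<Sum>i<n. \<phi> i * (if i = b then 1 else 0)) = \<phi> b"
    using assms by (simp add: if_distrib cong: if_cong)
  then show ?thesis
    using anv_crv[of n \<phi> "\<lambda>i. if i = b then 1 else 0" \<omega>] assms by (simp add: crv_unit)
qed

subsection \<open>Induction\<close>

definition ind :: "'i \<Rightarrow> 'i \<Rightarrow> 'a::field" where
  "ind B = (\<lambda>S. if S = B then 1 else 0)"

abbreviation fock :: "nat \<Rightarrow> (nat set \<Rightarrow> 'a::field) set" where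
  "fock n \<equiv> coord_space (Pow {..<n})"

lemma coord_space_expand:
  assumes "finite Z" "\<omega> \<in> coord_space Z"
  shows "\<omega> = (\<Sum>B\<in>Z. fscale (\<omega> B) (ind B))"
proof
  fix S
  have "(\<Sum>B\<in>Z. fscale (\<omega> B) (ind B)) S = (\<Sum>B\<in>Z. if B = S then \<omega> S else 0)"
    unfolding sum_fun_apply by (rule sum.cong) (auto simp: fscale_def ind_def)
  also have "\<dots> = \<omega> S" using assms by (auto simp: coord_space_def)
  finally show "\<omega> S = (\<Sum>B\<in>Z. fscale (\<omega> B) (ind B)) S" by simp
qed

lemma ind_in_coord_space: "B \<in> Z \<Longrightarrow> ind B \<in> coord_space Z"
  by (auto simp: ind_def coord_space_def)

lemma cr_ind:
  "cr b (ind B) = (if b \<in> B then 0 else fscale (sg b B) (ind (insert b B)))"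
proof
  fix S
  show "cr b (ind B) S = (if b \<in> B then 0 else fscale (sg b B) (ind (insert b B))) S"
    by (auto simp: cr_def ind_def fscale_def sg_insert)
qed

text \<open>The exterior algebra is generated from the vacuum \<open>ind {}\<close> by creation. An
  identity between linear operators therefore only has to be checked on the vacuum and shown to
  survive \<open>cr b\<close>; the naturality statements for induced maps and contractions are
  proved in this way.\<close>

lemma fock_induct [consumes 1, case_names vac cr add scale]:
  fixes \<omega> :: "nat set \<Rightarrow> 'a::field"
  assumes "\<omega> \<in> fock n"
    and vac: "P (ind {})"
    and cr: "\<And>b \<eta>. b < n \<Longrightarrow> \<eta> \<in> fock n \<Longrightarrow> P \<eta> \<Longrightarrow> P (cr b \<eta>)"
    and add: "\<And>\<eta> \<theta>. \<eta> \<in> fock n \<Longrightarrow> \<theta> \<in> fock n \<Longrightarrow> P \<eta> \<Longrightarrow> P \<theta> \<Longrightarrow> P (\<eta> + \<theta>)"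
    and scale: "\<And>c \<eta>. \<eta> \<in> fock n \<Longrightarrow> P \<eta> \<Longrightarrow> P (fscale c \<eta>)"
  shows "P \<omega>"
proof -
  have basis: "P (ind B)" if "B \<subseteq> {..<n}" for B
  proof -
    have "finite B" using that finite_subset by blast
    then show ?thesis using that
    proof (induction B rule: finite_induct)
      case (insert b B)
      then have "P (fscale (sg b B) (cr b (ind B)))"
        by (intro scale cr) (auto simp: coord_space_def cr_def ind_def)
      moreover have "fscale (sg b B) (cr b (ind B)) = (ind (insert b B) :: nat set \<Rightarrow> 'a)"
        using insert by (simp add: cr_ind)
      ultimately show ?case by simp
    qed (rule vac)
  qed
  \<comment> \<open>The induction has no case for the zero vector, so it is reached by scaling the
    vacuum by 0.\<close>
  have "fscale 0 (ind {}) = (0 :: nat set \<Rightarrow> 'a)" by (rule fs.scale_zero_left)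
  then have zero: "P 0"
    using scale[OF ind_in_coord_space vac, of 0] by (metis Pow_bottom)
  have "P (\<Sum>B\<in>Z. fscale (\<omega> B) (ind B)) \<and> (\<Sum>B\<in>Z. fscale (\<omega> B) (ind B)) \<in> fock n"
    if "finite Z" "Z \<subseteq> Pow {..<n}" for Z
    using that
  proof (induction Z rule: finite_induct)
    case empty
    have "(0 :: nat set \<Rightarrow> 'a) \<in> fock n" by (simp add: coord_space_def)
    with zero show ?case by (simp only: sum.empty)
  next
    case (insert B Z)
    have i: "ind B \<in> fock n" using insert by (simp add: ind_in_coord_space)
    then have "fscale (\<omega> B) (ind B) \<in> fock n" by (auto simp: coord_space_def fscale_def)
    moreover have "P (fscale (\<omega> B) (ind B))" using insert i basis[of B] by (intro scale) auto
    moreover have "P (\<Sum>B\<in>Z. fscale (\<omega> B) (ind B))" "(\<Sum>B\<in>Z. fscale (\<omega> B) (ind B)) \<in> fock n"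
      using insert by auto
    ultimately have "P (fscale (\<omega> B) (ind B) + (\<Sum>B\<in>Z. fscale (\<omega> B) (ind B)))"
      "fscale (\<omega> B) (ind B) + (\<Sum>B\<in>Z. fscale (\<omega> B) (ind B)) \<in> fock n"
      by (auto intro!: add simp: coord_space_def)
    then show ?case unfolding sum.insert[OF insert.hyps] by blast
  qed
  from this[of "Pow {..<n}"] show ?thesis
    using coord_space_expand[OF _ assms(1)] by simp
qed

lemma cr_fock: "b < n \<Longrightarrow> \<eta> \<in> fock n \<Longrightarrow> cr b \<eta> \<in> fock n"
  unfolding coord_space_def cr_def
proof (intro CollectI allI impI)
  fix S
  assume b: "b < n" and \<eta>: "\<eta> \<in> {v. \<forall>i. i \<notin> Pow {..<n} \<longrightarrow> v i = 0}" and S: "S \<notin> Pow {..<n}"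
  then have "S - {b} \<notin> Pow {..<n}" by auto
  with \<eta> show "(if b \<in> S then sg b S * \<eta> (S - {b}) else 0) = 0" by simp
qed
lemma an_fock: "\<eta> \<in> fock n \<Longrightarrow> an b \<eta> \<in> fock n"
  by (auto simp: coord_space_def an_def)
lemma coord_space_add: "\<eta> \<in> coord_space Z \<Longrightarrow> \<theta> \<in> coord_space Z \<Longrightarrow> \<eta> + \<theta> \<in> coord_space Z"
  by (auto simp: coord_space_def)
lemma coord_space_scale: "\<eta> \<in> coord_space Z \<Longrightarrow> fscale c \<eta> \<in> coord_space Z"
  by (auto simp: coord_space_def fscale_def)
lemma coord_space_0: "0 \<in> coord_space Z"
  by (auto simp: coord_space_def)
lemma coord_space_sum: "(\<And>x. x \<in> A \<Longrightarrow> f x \<in> coord_space Z) \<Longrightarrow> (\<Sum>x\<in>A. f x) \<in> coord_space Z"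
  by (induction A rule: infinite_finite_induct) (auto simp: coord_space_0 coord_space_add)
lemma crv_fock: "\<eta> \<in> fock n \<Longrightarrow> crv n v \<eta> \<in> fock n"
  unfolding crv_def by (intro coord_space_sum coord_space_scale cr_fock) auto
lemma anv_fock: "\<eta> \<in> fock n \<Longrightarrow> anv n v \<eta> \<in> fock n"
  unfolding anv_def by (intro coord_space_sum coord_space_scale an_fock) auto

lemma an_vac [simp]: "an i (ind {}) = 0"
  by (auto simp: an_def ind_def)
lemma anv_vac [simp]: "anv n v (ind {}) = 0"
  by (simp add: anv_def)

section \<open>Minors indexed by finite sets\<close>

text \<open>The entries are a function on all pairs of naturals, so rows can be added and index sets
  translated without changing a matrix dimension. \<open>pick\<close> lists the index sets
  increasingly; the size is read off from the row set, whence the recurring assumption that the two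
  cardinalities agree.\<close>

definition minor :: "(nat \<Rightarrow> nat \<Rightarrow> 'a::comm_ring_1) \<Rightarrow> nat set \<Rightarrow> nat set \<Rightarrow> 'a" where
  "minor f P Q = det (mat (card P) (card P) (\<lambda>(i, j). f (pick P i) (pick Q j)))"

lemma pick_eqI:
  assumes "x \<in> S" "card {a \<in> S. a < x} = k"
  shows "pick S k = x"
  using assms pick_card_in_set by metis

lemma pick_less_iff:
  assumes "i < card S" "j < card S"
  shows "pick S i < pick S j \<longleftrightarrow> i < j"
  using pick_mono_le[of j S i] pick_mono_le[of i S j] assms
  by (metis less_asym linorder_neqE_nat)

text \<open>Removing the i-th element moves the later positions down by one, which is the
  renumbering done by \<open>mat_delete\<close>. This turns cofactors into minors with one index
  removed.\<close>

lemma pick_insert_index: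
  assumes "finite S" "i < card S" "k < card S - 1"
  shows "pick (S - {pick S i}) k = pick S (insert_index i k)"
proof (rule pick_eqI)
  have l: "insert_index i k < card S" using assms by (auto simp: insert_index_def)
  have ne: "insert_index i k \<noteq> i" by (auto simp: insert_index_def)
  let ?x = "pick S (insert_index i k)"
  have "pick S i \<noteq> ?x"
    using pick_less_iff[OF assms(2) l] pick_less_iff[OF l assms(2)] ne by (metis less_irrefl linorder_neqE_nat)
  then show "?x \<in> S - {pick S i}" using l pick_in_set_le by auto
  have c: "card {a \<in> S. a < ?x} = insert_index i k" using l by (rule card_pick_le)
  have i: "pick S i \<in> S" using assms pick_in_set_le by blast
  have "{a \<in> S - {pick S i}. a < ?x} = {a \<in> S. a < ?x} - {pick S i}" by auto
  then show "card {a \<in> S - {pick S i}. a < ?x} = k"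
    using c i pick_less_iff[OF assms(2) l] by (auto simp: insert_index_def split: if_splits)
qed

lemma sg_pick:
  assumes "i < card S"
  shows "sg (pick S i) S = (- 1 :: 'a::field) ^ i"
proof -
  have "S \<inter> {..<pick S i} = {a \<in> S. a < pick S i}" by auto
  then show ?thesis using card_pick_le[OF assms] by (simp add: sg_def)
qed

lemma bij_betw_pick:
  assumes "finite S"
  shows "bij_betw (pick S) {..<card S} S"
proof -
  have "inj_on (pick S) {..<card S}"
    by (rule inj_onI) (metis lessThan_iff less_irrefl linorder_neqE_nat pick_less_iff)
  moreover have "pick S ` {..<card S} \<subseteq> S" using pick_in_set_le by auto
  ultimately show ?thesis
    using assms by (metis bij_betw_def card_image card_lessThan card_subset_eq)
qed

lemma minor_empty [simp]: "minor f {} {} = 1"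
  by (simp add: minor_def)

text \<open>Laplace expansion with the cofactor sign split into a row sign and a column sign, each
  given by \<open>sg\<close>. In this form the signs are those of creation and annihilation.\<close>

lemma minor_row:
  fixes f :: "nat \<Rightarrow> nat \<Rightarrow> 'a::field"
  assumes P: "finite P" and Q: "finite Q" and c: "card P = card Q" and r: "r \<in> P"
  shows "minor f P Q = (\<Sum>q\<in>Q. sg r P * sg q Q * f r q * minor f (P - {r}) (Q - {q}))"
proof -
  let ?n = "card P"
  define A where "A = mat ?n ?n (\<lambda>(i, j). f (pick P i) (pick Q j))"
  obtain i where i: "i < ?n" "r = pick P i"
    using bij_betw_pick[OF P] r by (auto simp: bij_betw_def)
  have "det A = (\<Sum>j<?n. A $$ (i, j) * cofactor A i j)"
    by (rule laplace_expansion_row) (auto simp: A_def i)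
  also have "\<dots> = (\<Sum>j<?n. sg r P * sg (pick Q j) Q * f r (pick Q j)
      * minor f (P - {r}) (Q - {pick Q j}))"
  proof (rule sum.cong)
    fix j assume "j \<in> {..<?n}"
    then have j: "j < card P" "j < card Q" using c by auto
    have "mat_delete A i j = mat (card (P - {r})) (card (P - {r}))
        (\<lambda>(k, l). f (pick (P - {r}) k) (pick (Q - {pick Q j}) l))"
      using P Q r i j c by (intro eq_matI)
        (auto simp: mat_delete_def A_def insert_index_def[symmetric] pick_insert_index)
    then show "A $$ (i, j) * cofactor A i j = sg r P * sg (pick Q j) Q * f r (pick Q j)
      * minor f (P - {r}) (Q - {pick Q j})"
      using i j by (simp add: A_def cofactor_def minor_def sg_pick power_add)
  qed simp
  also have "\<dots> = (\<Sum>q\<in>Q. sg r P * sg q Q * f r q * minor f (P - {r}) (Q - {q}))"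
    using sum.reindex_bij_betw[OF bij_betw_pick[OF Q]] c by simp
  finally show ?thesis by (simp add: minor_def A_def)
qed

lemma minor_transpose:
  assumes "card P = card Q"
  shows "minor f P Q = minor (\<lambda>i j. f j i) Q P"
proof -
  let ?A = "mat (card P) (card P) (\<lambda>(i, j). f (pick P i) (pick Q j))"
  have "transpose_mat ?A = mat (card Q) (card Q) (\<lambda>(i, j). f (pick P j) (pick Q i))"
    using assms by (intro eq_matI) auto
  then show ?thesis
    unfolding minor_def using det_transpose[of ?A "card P"] by (metis mat_carrier)
qed

lemma minor_col:
  fixes f :: "nat \<Rightarrow> nat \<Rightarrow> 'a::field"
  assumes P: "finite P" and Q: "finite Q" and c: "card P = card Q" and q: "q \<in> Q"
  shows "minor f P Q = (\<Sum>r\<in>P. sg r P * sg q Q * f r q * minor f (P - {r}) (Q - {q}))"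
proof -
  have "minor f P Q = (\<Sum>r\<in>P. sg q Q * sg r P * f r q * minor (\<lambda>i j. f j i) (Q - {q}) (P - {r}))"
    using minor_row[OF Q P c[symmetric] q, of "\<lambda>i j. f j i"] minor_transpose[OF c, of f] by simp
  also have "\<dots> = (\<Sum>r\<in>P. sg r P * sg q Q * f r q * minor f (P - {r}) (Q - {q}))"
  proof (rule sum.cong)
    fix r assume "r \<in> P"
    then have "card (P - {r}) = card (Q - {q})" using c q by simp
    from minor_transpose[OF this, of f]
    show "sg q Q * sg r P * f r q * minor (\<lambda>i j. f j i) (Q - {q}) (P - {r})
        = sg r P * sg q Q * f r q * minor f (P - {r}) (Q - {q})" by simp
  qed simp
  finally show ?thesis .
qed

lemma minor_cong:
  assumes "finite P" "finite Q" "card P = card Q" "\<And>i j. i \<in> P \<Longrightarrow> j \<in> Q \<Longrightarrow> f i j = g i j"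
  shows "minor f P Q = minor g P Q"
  unfolding minor_def using assms pick_in_set_le
  by (intro arg_cong[where f = det] eq_matI) auto

lemma minor_identical_rows:
  assumes "finite P" "card P = card Q" "r \<in> P" "s \<in> P" "r \<noteq> s"
    and "\<And>j. j \<in> Q \<Longrightarrow> f r j = f s j"
  shows "minor f P Q = 0"
proof -
  obtain i j where ij: "i < card P" "r = pick P i" "j < card P" "s = pick P j"
    using bij_betw_pick[OF assms(1)] assms(3,4) unfolding bij_betw_def by (metis imageE lessThan_iff)
  then have "i \<noteq> j" using assms by auto
  moreover have "row (mat (card P) (card P) (\<lambda>(i, j). f (pick P i) (pick Q j))) i =
      row (mat (card P) (card P) (\<lambda>(i, j). f (pick P i) (pick Q j))) j"
    using ij assms pick_in_set_le by (intro eq_vecI) auto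
  ultimately show ?thesis
    unfolding minor_def using ij(1,3) \<open>i \<noteq> j\<close> by (intro det_identical_rows[OF mat_carrier])
qed

lemma pick_image:
  assumes "finite S" "strict_mono_on S h" "k < card S"
  shows "pick (h ` S) k = h (pick S k)"
proof (rule pick_eqI)
  have p: "pick S k \<in> S" using assms pick_in_set_le by auto
  then show "h (pick S k) \<in> h ` S" by auto
  have inj: "inj_on h S" using assms(2) by (rule strict_mono_on_imp_inj_on)
  have "{a \<in> h ` S. a < h (pick S k)} = h ` {a \<in> S. a < pick S k}"
    using assms(2) p by (auto simp: strict_mono_on_less)
  then show "card {a \<in> h ` S. a < h (pick S k)} = k"
    using inj by (simp add: card_image inj_on_subset card_pick_le[OF assms(3)])
qed

lemma minor_image:
  assumes "finite P" "finite Q" "strict_mono_on P g" "strict_mono_on Q h" "card P = card Q"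
  shows "minor f (g ` P) (h ` Q) = minor (\<lambda>i j. f (g i) (h j)) P Q"
proof -
  have "card (g ` P) = card P" using assms by (simp add: card_image strict_mono_on_imp_inj_on)
  then show ?thesis
    unfolding minor_def using assms
    by (intro arg_cong[where f = det] eq_matI) (auto simp: pick_image)
qed

lemma det_submatrix:
  assumes "P \<subseteq> {..<dim_row A}" "Q \<subseteq> {..<dim_col A}" "card P = card Q"
  shows "det (submatrix A P Q) = minor (\<lambda>i j. A $$ (i, j)) P Q"
proof -
  have "{i. i < dim_row A \<and> i \<in> P} = P" "{j. j < dim_col A \<and> j \<in> Q} = Q" using assms by auto
  then have "submatrix A P Q = mat (card P) (card P) (\<lambda>(i, j). A $$ (pick P i, pick Q j))"
    unfolding submatrix_def using assms by simp
  then show ?thesis by (simp add: minor_def)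
qed

section \<open>Wedge products and functoriality\<close>

text \<open>The wedge as iterated creation on the vacuum, which makes determinants accessible to the
  operator calculus.\<close>

fun fw :: "nat \<Rightarrow> (nat \<Rightarrow> 'a::field) list \<Rightarrow> nat set \<Rightarrow> 'a" where
  "fw n [] = ind {}"
| "fw n (v # vs) = crv n v (fw n vs)"

lemma crv_apply:
  assumes "S \<subseteq> {..<n}"
  shows "crv n v \<omega> S = (\<Sum>i\<in>S. v i * (sg i S * \<omega> (S - {i})))"
proof -
  have "crv n v \<omega> S = (\<Sum>i<n. if i \<in> S then v i * (sg i S * \<omega> (S - {i})) else 0)"
    unfolding crv_def sum_fun_apply by (rule sum.cong) (auto simp: fscale_def cr_def)
  also have "\<dots> = (\<Sum>i\<in>{..<n} \<inter> S. v i * (sg i S * \<omega> (S - {i})))"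
    by (simp add: sum.If_cases)
  also have "{..<n} \<inter> S = S" using assms by auto
  finally show ?thesis .
qed

lemma fw_fock: "fw n vs \<in> fock n"
  by (induction vs) (auto simp: ind_in_coord_space crv_fock)

lemma fw_degree: "fw n vs \<in> coord_space (ksubsets n (length vs))"
proof (induction vs)
  case Nil
  then show ?case by (simp add: ind_in_coord_space ksubsets_def)
next
  case (Cons v vs)
  have "crv n v (fw n vs) S = 0" if "S \<notin> ksubsets n (Suc (length vs))" for S
  proof (cases "S \<subseteq> {..<n}")
    case True
    then have "finite S" "card S \<noteq> Suc (length vs)"
      using that finite_subset by (auto simp: ksubsets_def)
    have "fw n vs (S - {i}) = 0" if "i \<in> S" for i
    proof -
      have "card (S - {i}) \<noteq> length vs"
        using \<open>finite S\<close> \<open>card S \<noteq> Suc (length vs)\<close> that by (metis card_Suc_Diff1)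
      then show ?thesis using Cons by (auto simp: coord_space_def ksubsets_def)
    qed
    then show ?thesis using True by (simp add: crv_apply)
  next
    case False
    then show ?thesis using crv_fock[OF fw_fock[of n vs], of v] by (auto simp: coord_space_def)
  qed
  then show ?case by (simp add: coord_space_def)
qed

text \<open>Expansion along the first column is one creation step. Its column sign is 1 because the
  list is increasing and the column is the least one.\<close>

lemma minor_fw:
  assumes "sorted_wrt (<) l" "P \<subseteq> {..<n}" "card P = length l"
  shows "minor f P (set l) = fw n (map (\<lambda>j i. f i j) l) P"
  using assms
proof (induction l arbitrary: P)
  case Nil
  then have "P = {}" using finite_subset by fastforce
  then show ?case by (simp add: ind_def)
next
  case (Cons q l)
  have fin: "finite P" using Cons.prems finite_subset by blast
  have q: "q \<notin> set l" using Cons.prems by auto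
  have d: "distinct l" using Cons.prems by (simp add: strict_sorted_iff)
  have s: "sg q (insert q (set l)) = (1::'a)"
  proof -
    have "insert q (set l) \<inter> {..<q} = {}" using Cons.prems by auto
    then show ?thesis by (simp add: sg_def)
  qed
  have "minor f P (set (q # l)) = (\<Sum>r\<in>P. sg r P * sg q (set (q # l)) * f r q
      * minor f (P - {r}) (set (q # l) - {q}))"
    using Cons.prems fin q d by (intro minor_col) (auto simp: distinct_card)
  also have "\<dots> = (\<Sum>r\<in>P. f r q * (sg r P * fw n (map (\<lambda>j i. f i j) l) (P - {r})))"
  proof (rule sum.cong)
    fix r assume "r \<in> P"
    then have "minor f (P - {r}) (set l) = fw n (map (\<lambda>j i. f i j) l) (P - {r})"
      using Cons.prems fin by (intro Cons.IH) auto
    then show "sg r P * sg q (set (q # l)) * f r q * minor f (P - {r}) (set (q # l) - {q}) =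
        f r q * (sg r P * fw n (map (\<lambda>j i. f i j) l) (P - {r}))"
      using q s by simp
  qed simp
  also have "\<dots> = fw n (map (\<lambda>j i. f i j) (q # l)) P"
    using Cons.prems by (simp add: crv_apply)
  finally show ?case .
qed

lemma wedge_eq_fw:
  assumes "\<And>v. v \<in> set vs \<Longrightarrow> v \<in> carrier_vec n"
  shows "wedge n vs = fw n (map (\<lambda>v i. v $ i) vs)"
proof
  fix S
  show "wedge n vs S = fw n (map (\<lambda>v i. v $ i) vs) S"
  proof (cases "S \<in> ksubsets n (length vs)")
    case True
    then have S: "S \<subseteq> {..<n}" "card S = length vs" by (auto simp: ksubsets_def)
    have "wedge n vs S = minor (\<lambda>i j. mat_of_cols n vs $$ (i, j)) S {..<length vs}"
      using True S by (simp add: wedge_def det_submatrix)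
    also have "\<dots> = minor (\<lambda>i j. vs ! j $ i) S (set [0..<length vs])"
      unfolding atLeast_upt[symmetric]
      using S finite_subset[OF S(1)] by (intro minor_cong) (auto simp: mat_of_cols_index lessThan_atLeast0)
    also have "\<dots> = fw n (map (\<lambda>j i. vs ! j $ i) [0..<length vs]) S"
      using S by (intro minor_fw) auto
    also have "map (\<lambda>j i. vs ! j $ i) [0..<length vs] = map (\<lambda>v i. v $ i) vs"
      by (intro nth_equalityI) auto
    finally show ?thesis .
  next
    case False
    then show ?thesis using fw_degree[of n "map (\<lambda>v i. v $ i) vs"]
      by (auto simp: wedge_def coord_space_def)
  qed
qed

section \<open>The map induced on the exterior algebra by a matrix\<close>

definition eb :: "nat \<Rightarrow> 'a::field mat \<Rightarrow> nat set \<Rightarrow> nat set \<Rightarrow> 'a" where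
  "eb n A B = fw n (map (\<lambda>j i. A $$ (i, j)) (sorted_list_of_set B))"

text \<open>The induced map in all degrees at once, so that the induction over creation operators is
  available; \<open>compound\<close> is its part in one degree, see
  \<open>compound_eq_ext\<close>.\<close>

definition ext :: "nat \<Rightarrow> 'a::field mat \<Rightarrow> (nat set \<Rightarrow> 'a) \<Rightarrow> nat set \<Rightarrow> 'a" where
  "ext n A \<omega> = (\<Sum>B\<in>Pow {..<n}. fscale (\<omega> B) (eb n A B))"

lemma ext_add: "ext n A (\<omega> + \<eta>) = ext n A \<omega> + ext n A \<eta>"
  by (simp add: ext_def fs.scale_left_distrib sum.distrib)
lemma ext_scale: "ext n A (fscale c \<omega>) = fscale c (ext n A \<omega>)"
  by (simp add: ext_def fscale_apply fs.scale_sum_right)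

lemma ext_0 [simp]: "ext n A 0 = 0"
  using ext_scale[of n A 0 0] by simp
lemma ext_minus: "ext n A (- \<omega>) = - ext n A \<omega>"
  using ext_scale[of n A "- 1" \<omega>] by simp
lemma ext_diff: "ext n A (\<omega> - \<eta>) = ext n A \<omega> - ext n A \<eta>"
  using ext_add[of n A \<omega> "- \<eta>"] by (simp add: ext_minus)
lemma ext_sum: "ext n A (\<Sum>x\<in>Z. f x) = (\<Sum>x\<in>Z. ext n A (f x))"
  using sum_comp_morphism[of "ext n A" f Z] ext_add[of n A] by (simp add: o_def)

lemma ext_ind: "B \<subseteq> {..<n} \<Longrightarrow> ext n A (ind B) = eb n A B"
proof -
  assume B: "B \<subseteq> {..<n}"
  have "ext n A (ind B) = (\<Sum>C\<in>Pow {..<n}. if C = B then eb n A B else 0)"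
    unfolding ext_def by (rule sum.cong) (auto simp: ind_def)
  then show ?thesis using B by simp
qed

text \<open>Moving the new vector past each smaller list element costs a sign. If it already occurs,
  two equal factors meet and the wedge is 0.\<close>

lemma fw_insort:
  fixes c :: "nat \<Rightarrow> nat \<Rightarrow> 'a::field_char_0"
  assumes "sorted_wrt (<) l"
  shows "crv n (c j) (fw n (map c l)) =
    (if j \<in> set l then 0 else fscale (sg j (set l)) (fw n (map c (insort j l))))"
  using assms
proof (induction l)
  case Nil
  then show ?case by (simp add: sg_def)
next
  case (Cons k l)
  have e: "set (k # l) \<inter> {..<j} = {}" if "j \<le> k" using Cons.prems that by auto
  consider "j < k" | "j = k" | "k < j" by linarith
  then show ?case
  proof cases
    case 1
    then have "sg j (set (k # l)) = (1::'a)" "j \<notin> set l"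
      using e Cons.prems by (auto simp: sg_def)
    then show ?thesis using 1 by simp
  next
    case 3
    have "crv n (c j) (fw n (map c (k # l))) = - crv n (c k) (crv n (c j) (fw n (map c l)))"
      by (subst crv_crv) simp
    also have "\<dots> = (if j \<in> set (k # l) then 0
        else fscale (- sg j (set l)) (fw n (map c (insort j (k # l)))))"
      using Cons 3 by (simp add: crv_scale)
    also have "- sg j (set l) = (sg j (set (k # l)) :: 'a)"
      using 3 Cons.prems by (auto simp: sg_insert)
    finally show ?thesis .
  qed simp
qed

text \<open>The induced map is multiplicative and sends the b-th basis vector to the b-th column of
  \<open>A\<close>. Together with linearity and the value at the vacuum this determines it on
  \<open>fock n\<close>.\<close>

lemma ext_cr:
  fixes \<omega> :: "nat set \<Rightarrow> 'a::field_char_0"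
  assumes "\<omega> \<in> fock n" "b < n"
  shows "ext n A (cr b \<omega>) = crv n (\<lambda>i. A $$ (i, b)) (ext n A \<omega>)"
proof -
  have basis: "ext n A (cr b (ind B)) = crv n (\<lambda>i. A $$ (i, b)) (ext n A (ind B))"
    if B: "B \<subseteq> {..<n}" for B
  proof -
    have fin: "finite B" using B finite_subset by blast
    have "crv n (\<lambda>i. A $$ (i, b)) (eb n A B) =
        (if b \<in> B then 0 else fscale (sg b B) (eb n A (insert b B)))"
      using fw_insort[of "sorted_list_of_set B" n "\<lambda>j i. A $$ (i, j)" b] fin
      by (simp add: eb_def sorted_list_of_set_insert_remove[symmetric])
    then show ?thesis
      using B assms(2) by (simp add: cr_ind ext_ind ext_scale)
  qed
  have "ext n A (cr b \<omega>) = ext n A (cr b (\<Sum>B\<in>Pow {..<n}. fscale (\<omega> B) (ind B)))"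
    using coord_space_expand[OF _ assms(1)] by simp
  also have "\<dots> = (\<Sum>B\<in>Pow {..<n}. fscale (\<omega> B) (crv n (\<lambda>i. A $$ (i, b)) (ext n A (ind B))))"
    using basis by (simp add: cr_sum ext_sum cr_scale ext_scale)
  also have "\<dots> = crv n (\<lambda>i. A $$ (i, b)) (ext n A (\<Sum>B\<in>Pow {..<n}. fscale (\<omega> B) (ind B)))"
    by (simp add: ext_sum crv_sum crv_scale ext_scale)
  finally show ?thesis
    using coord_space_expand[OF _ assms(1)] by simp
qed

lemma ext_vac [simp]: "ext n A (ind {}) = ind {}"
  by (simp add: ext_ind eb_def)

lemma ext_fock: "ext n A \<omega> \<in> fock n"
  unfolding ext_def eb_def by (intro coord_space_sum coord_space_scale fw_fock)

lemma ext_degree: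
  assumes "\<omega> \<in> ext_power n k"
  shows "ext n A \<omega> \<in> ext_power n k"
  unfolding ext_def ext_power_def
proof (intro coord_space_sum)
  fix B assume B: "B \<in> Pow {..<n}"
  show "fscale (\<omega> B) (eb n A B) \<in> coord_space (ksubsets n k)"
  proof (cases "card B = k")
    case True
    then have "eb n A B \<in> coord_space (ksubsets n k)"
      using fw_degree[of n "map (\<lambda>j i. A $$ (i, j)) (sorted_list_of_set B)"] by (simp add: eb_def)
    then show ?thesis by (rule coord_space_scale)
  next
    case False
    then have "\<omega> B = 0" using assms by (auto simp: ext_power_def coord_space_def ksubsets_def)
    then show ?thesis by (simp add: coord_space_0)
  qed
qed

lemma compound_eq_ext:
  assumes "A \<in> carrier_mat n n" "\<omega> \<in> ext_power n k"
  shows "compound n k A \<omega> = ext n A \<omega>"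
proof
  fix S
  show "compound n k A \<omega> S = ext n A \<omega> S"
  proof (cases "S \<in> ksubsets n k")
    case True
    then have S: "S \<subseteq> {..<n}" "card S = k" by (auto simp: ksubsets_def)
    have "compound n k A \<omega> S = (\<Sum>R\<in>ksubsets n k. \<omega> R * eb n A R S)"
      unfolding compound_def using True
    proof (simp, intro sum.cong refl)
      fix R assume "R \<in> ksubsets n k"
      then have R: "R \<subseteq> {..<n}" "card R = k" by (auto simp: ksubsets_def)
      then have "finite R" using finite_subset by blast
      then have "det (submatrix A S R) = minor (\<lambda>i j. A $$ (i, j)) S (set (sorted_list_of_set R))"
        using assms R S by (subst det_submatrix) auto
      also have "\<dots> = eb n A R S"
        unfolding eb_def using S R by (intro minor_fw) auto
      finally show "det (submatrix A S R) * \<omega> R = \<omega> R * eb n A R S" by simp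
    qed
    also have "\<dots> = (\<Sum>R\<in>Pow {..<n}. \<omega> R * eb n A R S)"
      using assms(2) by (intro sum.mono_neutral_left)
        (auto simp: ksubsets_def ext_power_def coord_space_def)
    finally show ?thesis by (simp add: ext_def sum_fun_apply fscale_apply)
  next
    case False
    then show ?thesis using ext_degree[OF assms(2), of A]
      by (auto simp: compound_def ext_power_def coord_space_def)
  qed
qed

lemma ext_crv:
  fixes \<omega> :: "nat set \<Rightarrow> 'a::field_char_0"
  assumes "\<omega> \<in> fock n"
  shows "ext n A (crv n v \<omega>) = crv n (\<lambda>i. \<Sum>j<n. A $$ (i, j) * v j) (ext n A \<omega>)"
proof -
  have "ext n A (crv n v \<omega>) = (\<Sum>j<n. fscale (v j) (crv n (\<lambda>i. A $$ (i, j)) (ext n A \<omega>)))"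
    using assms by (simp add: crv_def[of n v] ext_sum ext_scale ext_cr)
  also have "\<dots> = (\<Sum>j<n. \<Sum>i<n. fscale (A $$ (i, j) * v j) (cr i (ext n A \<omega>)))"
    by (simp add: crv_def fs.scale_sum_right mult.commute)
  also have "\<dots> = crv n (\<lambda>i. \<Sum>j<n. A $$ (i, j) * v j) (ext n A \<omega>)"
    by (subst sum.swap) (simp add: crv_def fs.scale_sum_left)
  finally show ?thesis .
qed

text \<open>A covector contracts the image as its pullback contracts the source. Both sides obey the
  antiderivation rule with the same scalar, namely the covector on the b-th column.\<close>

lemma anv_ext:
  fixes \<omega> :: "nat set \<Rightarrow> 'a::field_char_0"
  assumes "\<omega> \<in> fock n"
  shows "anv n \<phi> (ext n A \<omega>) = ext n A (anv n (\<lambda>j. \<Sum>i<n. \<phi> i * A $$ (i, j)) \<omega>)"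
  using assms
proof (induction rule: fock_induct)
  case vac
  show ?case by (simp only: ext_vac anv_vac ext_0)
next
  case (cr b \<eta>)
  let ?\<psi> = "\<lambda>j. \<Sum>i<n. \<phi> i * A $$ (i, j)"
  have "anv n \<phi> (ext n A (cr b \<eta>)) =
      fscale (?\<psi> b) (ext n A \<eta>) - crv n (\<lambda>i. A $$ (i, b)) (ext n A (anv n ?\<psi> \<eta>))"
    using cr by (simp add: ext_cr anv_crv)
  also have "\<dots> = ext n A (anv n ?\<psi> (cr b \<eta>))"
    using cr by (simp add: anv_cr ext_diff ext_scale ext_cr anv_fock)
  finally show ?case .
next
  case (add \<eta> \<theta>)
  then show ?case by (simp only: ext_add anv_add)
next
  case (scale c \<eta>)
  then show ?case by (simp only: ext_scale anv_scale)
qed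

lemma ext_mult:
  fixes \<omega> :: "nat set \<Rightarrow> 'a::field_char_0"
  assumes A: "A \<in> carrier_mat n n" and B: "B \<in> carrier_mat n n" and "\<omega> \<in> fock n"
  shows "ext n (A * B) \<omega> = ext n A (ext n B \<omega>)"
  using assms(3)
proof (induction rule: fock_induct)
  case (cr b \<eta>)
  have "ext n A (ext n B (cr b \<eta>)) =
      crv n (\<lambda>i. \<Sum>j<n. A $$ (i, j) * B $$ (j, b)) (ext n A (ext n B \<eta>))"
    using cr by (simp add: ext_cr ext_crv ext_fock)
  also have "\<dots> = crv n (\<lambda>i. (A * B) $$ (i, b)) (ext n (A * B) \<eta>)"
    unfolding cr by (rule crv_cong) (use A B cr in \<open>auto simp: scalar_prod_def lessThan_atLeast0\<close>)
  finally show ?case using cr by (simp add: ext_cr)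
next
  case (add \<eta> \<theta>)
  then show ?case by (simp only: ext_add)
next
  case (scale c \<eta>)
  then show ?case by (simp only: ext_scale)
qed simp

lemma ext_one:
  fixes \<omega> :: "nat set \<Rightarrow> 'a::field_char_0"
  assumes "\<omega> \<in> fock n"
  shows "ext n (1\<^sub>m n) \<omega> = \<omega>"
  using assms
proof (induction rule: fock_induct)
  case (cr b \<eta>)
  have "crv n (\<lambda>i. 1\<^sub>m n $$ (i, b)) \<eta> = crv n (\<lambda>i. if i = b then 1 else 0) \<eta>"
    by (rule crv_cong) (use cr in auto)
  then show ?case using cr by (simp add: ext_cr crv_unit)
next
  case (add \<eta> \<theta>)
  then show ?case by (simp only: ext_add)
next
  case (scale c \<eta>)
  then show ?case by (simp only: ext_scale)
qed simp

text \<open>From here on simplification treats vectors as elements of a vector space, and evaluation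
  at a coordinate is unfolded only on request.\<close>

lemmas pointwise = plus_fun_apply zero_fun_apply minus_apply uminus_apply
declare pointwise [simp del]

section \<open>Contraction by an alternating form\<close>

definition lam :: "nat \<Rightarrow> 'a::field mat \<Rightarrow> (nat set \<Rightarrow> 'a) \<Rightarrow> nat set \<Rightarrow> 'a" where
  "lam n G \<omega> = (\<Sum>j<n. \<Sum>i<n. if i < j then fscale (G $$ (i, j)) (an j (an i \<omega>)) else 0)"

text \<open>Antisymmetry is enough as a record: in characteristic 0 it forces the diagonal to
  vanish, as derived in \<open>lam_crv\<close>.\<close>

definition alternating :: "nat \<Rightarrow> 'a::field mat \<Rightarrow> bool" where
  "alternating n G \<longleftrightarrow> G \<in> carrier_mat n n \<and> (\<forall>i<n. \<forall>j<n. G $$ (j, i) = - G $$ (i, j))"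

text \<open>Annihilating first \<open>i\<close> and then \<open>j\<close> with i < j gives just the
  two position signs relative to \<open>R\<close>, because \<open>j\<close> does not precede
  \<open>i\<close> and causes no extra sign.\<close>

lemma contraction_eq_lam:
  assumes "R \<subseteq> {..<n}" "card R + 2 = k"
  shows "contraction n k G \<omega> R = lam n G \<omega> R"
proof -
  let ?f = "\<lambda>i j. (- 1) ^ (card (R \<inter> {..<i}) + card (R \<inter> {..<j})) * G $$ (i, j)
    * \<omega> (insert i (insert j R))"
  let ?Z = "{(i, j). i < j \<and> j < n \<and> i \<notin> R \<and> j \<notin> R}"
  have "lam n G \<omega> R = (\<Sum>j<n. \<Sum>i<n. if (i, j) \<in> ?Z then ?f i j else 0)"
    unfolding lam_def sum_fun_apply
    by (intro sum.cong refl)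
      (auto simp: fscale_apply an_def sg_insert sg_def power_add insert_commute pointwise)
  also have "\<dots> = (\<Sum>i<n. \<Sum>j<n. if (i, j) \<in> ?Z then ?f i j else 0)"
    by (rule sum.swap)
  also have "\<dots> = (\<Sum>p\<in>{..<n} \<times> {..<n}. if p \<in> ?Z then (case p of (i, j) \<Rightarrow> ?f i j) else 0)"
    unfolding sum.cartesian_product
  proof (rule sum.cong)
    fix p assume "p \<in> {..<n} \<times> {..<n}"
    obtain i j where "p = (i, j)" by (cases p)
    then show "(case p of (i, j) \<Rightarrow> if (i, j) \<in> ?Z then ?f i j else 0) =
        (if p \<in> ?Z then (case p of (i, j) \<Rightarrow> ?f i j) else 0)" by simp
  qed simp
  also have "\<dots> = (\<Sum>p\<in>({..<n} \<times> {..<n}) \<inter> ?Z. case p of (i, j) \<Rightarrow> ?f i j)"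
    by (simp add: sum.inter_restrict)
  also have "({..<n} \<times> {..<n}) \<inter> ?Z = ?Z" by auto
  finally show ?thesis using assms by (simp add: contraction_def)
qed

lemma lam_add: "lam n G (\<omega> + \<eta>) = lam n G \<omega> + lam n G \<eta>"
proof -
  have "lam n G (\<omega> + \<eta>) = (\<Sum>j<n. \<Sum>i<n.
      (if i < j then fscale (G $$ (i, j)) (an j (an i \<omega>)) else 0) +
      (if i < j then fscale (G $$ (i, j)) (an j (an i \<eta>)) else 0))"
    unfolding lam_def by (intro sum.cong refl) (auto simp: an_add fscale_add)
  then show ?thesis by (simp add: lam_def sum.distrib)
qed

lemma lam_scale: "lam n G (fscale c \<omega>) = fscale c (lam n G \<omega>)"
  unfolding lam_def fs.scale_sum_right
  by (intro sum.cong refl) (auto simp: an_scale mult.commute)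

lemma lam_0 [simp]: "lam n G 0 = 0"
  using lam_scale[of n G 0 0] by simp
lemma lam_minus: "lam n G (- \<omega>) = - lam n G \<omega>"
  using lam_scale[of n G "- 1" \<omega>] by simp
lemma lam_diff: "lam n G (\<omega> - \<eta>) = lam n G \<omega> - lam n G \<eta>"
  using lam_add[of n G \<omega> "- \<eta>"] by (simp add: lam_minus)
lemma lam_sum: "lam n G (\<Sum>x\<in>Z. f x) = (\<Sum>x\<in>Z. lam n G (f x))"
  using sum_comp_morphism[of "lam n G" f Z] lam_add[of n G] by (simp add: o_def)
lemma lam_vac [simp]: "lam n G (ind {}) = 0"
  unfolding lam_def by (intro sum.neutral ballI) auto

lemma lam_fock: "\<omega> \<in> fock n \<Longrightarrow> lam n G \<omega> \<in> fock n"
  unfolding lam_def by (intro coord_space_sum) (auto intro: coord_space_scale an_fock coord_space_0)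

text \<open>The commutator of contraction with creation along \<open>v\<close> is contraction with
  the covector \<Omega>(v, -). The sum over i < j produces two families of terms; after exchanging
  the indices in one of them, antisymmetry merges them into a sum over all pairs.\<close>

lemma lam_crv:
  fixes \<omega> :: "nat set \<Rightarrow> 'a::field_char_0"
  assumes G: "alternating n G"
  shows "lam n G (crv n v \<omega>) = crv n v (lam n G \<omega>) + anv n (\<lambda>j. \<Sum>i<n. v i * G $$ (i, j)) \<omega>"
proof -
  let ?A = "\<lambda>i j. if i < j then fscale (G $$ (i, j) * v i) (an j \<omega>) else 0"
  let ?B = "\<lambda>i j. if i < j then fscale (G $$ (i, j) * v j) (an i \<omega>) else 0"
  let ?C = "\<lambda>i j. if i < j then fscale (G $$ (i, j)) (crv n v (an j (an i \<omega>))) else 0"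
  have diag: "G $$ (i, i) = 0" if "i < n" for i
  proof -
    have "G $$ (i, i) = - G $$ (i, i)" using G that unfolding alternating_def by blast
    then show ?thesis by simp
  qed
  have anan: "an j (an i (crv n v \<omega>)) =
      fscale (v i) (an j \<omega>) - fscale (v j) (an i \<omega>) + crv n v (an j (an i \<omega>))"
    if "i < n" "j < n" for i j
    unfolding an_crv[OF that(1)] an_diff an_scale an_crv[OF that(2)] by (rule diff_diff_eq2[THEN trans]) (rule diff_add_eq[symmetric])
  have "lam n G (crv n v \<omega>) = (\<Sum>j<n. \<Sum>i<n. ?A i j - ?B i j + ?C i j)"
    unfolding lam_def
  proof (intro sum.cong refl)
    fix i j assume "i \<in> {..<n}" "j \<in> {..<n}"
    then have ij: "i < n" "j < n" by auto
    show "(if i < j then fscale (G $$ (i, j)) (an j (an i (crv n v \<omega>))) else 0) =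
        ?A i j - ?B i j + ?C i j"
    proof (cases "i < j")
      case True
      then show ?thesis
        by (simp only: anan[OF ij] if_True fscale_add fs.scale_right_diff_distrib fs.scale_scale)
    next
      case False
      then show ?thesis by (simp only: if_False diff_zero add_0_right)
    qed
  qed
  also have "\<dots> = (\<Sum>j<n. \<Sum>i<n. ?A i j) - (\<Sum>j<n. \<Sum>i<n. ?B i j) + (\<Sum>j<n. \<Sum>i<n. ?C i j)"
    by (simp only: sum.distrib sum_subtractf)
  also have "(\<Sum>j<n. \<Sum>i<n. ?C i j) = crv n v (lam n G \<omega>)"
    unfolding lam_def crv_sum by (intro sum.cong refl) (auto simp: crv_scale)
  also have "(\<Sum>j<n. \<Sum>i<n. ?B i j) = (\<Sum>j<n. \<Sum>i<n. ?B j i)"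
    by (rule sum.swap)
  also have "(\<Sum>j<n. \<Sum>i<n. ?A i j) - (\<Sum>j<n. \<Sum>i<n. ?B j i) =
      (\<Sum>j<n. \<Sum>i<n. ?A i j - ?B j i)"
    by (simp only: sum_subtractf)
  also have "\<dots> = (\<Sum>j<n. \<Sum>i<n. fscale (v i * G $$ (i, j)) (an j \<omega>))"
  proof (intro sum.cong refl)
    fix i j assume "i \<in> {..<n}" "j \<in> {..<n}"
    then have ij: "i < n" "j < n" by auto
    then have G_ij: "G $$ (j, i) = - G $$ (i, j)" "i = j \<Longrightarrow> G $$ (i, j) = 0"
      using G diag unfolding alternating_def by blast+
    consider "i < j" | "i = j" | "j < i" by linarith
    then show "?A i j - ?B j i = fscale (v i * G $$ (i, j)) (an j \<omega>)"
    proof cases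
      case 1
      then have "\<not> j < i" by simp
      with 1 show ?thesis by (simp only: if_True if_False diff_zero mult.commute)
    next
      case 2
      then have "\<not> j < i" "\<not> i < j" by simp_all
      then show ?thesis
        by (simp only: if_False diff_zero G_ij(2)[OF 2] mult_zero_right fs.scale_zero_left)
    next
      case 3
      then have "\<not> i < j" by simp
      with 3 show ?thesis
        by (simp only: if_True if_False G_ij(1) diff_0 mult_minus_left mult_minus_right fs.scale_minus_left
            minus_minus mult.commute)
    qed
  qed
  also have "\<dots> = anv n (\<lambda>j. \<Sum>i<n. v i * G $$ (i, j)) \<omega>"
    by (simp add: anv_def fs.scale_sum_left)
  finally show ?thesis by (simp add: add.commute)
qed

lemma lam_cr:
  fixes \<omega> :: "nat set \<Rightarrow> 'a::field_char_0"
  assumes "alternating n G" "b < n"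
  shows "lam n G (cr b \<omega>) = cr b (lam n G \<omega>) + anv n (\<lambda>j. G $$ (b, j)) \<omega>"
proof -
  have "(\<Sum>i<n. (if i = b then 1 else 0) * G $$ (i, j)) = G $$ (b, j)" for j
    using assms(2) by (simp add: if_distrib[where f="\<lambda>x. x * _"] cong: if_cong)
  then show ?thesis
    using lam_crv[OF assms(1), of "\<lambda>i. if i = b then 1 else 0" \<omega>] assms(2)
    by (simp add: crv_unit)
qed

lemma alternating_congruence:
  assumes "alternating n G" "A \<in> carrier_mat n n"
  shows "alternating n (transpose_mat A * G * A)"
proof -
  have G: "G \<in> carrier_mat n n" using assms(1) by (simp add: alternating_def)
  have Gt: "transpose_mat G = - G"
  proof (rule eq_matI)
    fix i j assume "i < dim_row (- G)" "j < dim_col (- G)"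
    then have ij: "i < n" "j < n" using G by auto
    then have "transpose_mat G $$ (i, j) = G $$ (j, i)" using G by simp
    also have "\<dots> = - G $$ (i, j)" using assms(1) ij unfolding alternating_def by blast
    also have "\<dots> = (- G) $$ (i, j)" using G ij by simp
    finally show "transpose_mat G $$ (i, j) = (- G) $$ (i, j)" .
  qed (use G in auto)
  have "transpose_mat (transpose_mat A * G * A) = transpose_mat A * (transpose_mat G * A)"
    using assms(2) G by (simp add: transpose_mult[of _ n n _ n])
  also have "\<dots> = - (transpose_mat A * G * A)"
    unfolding Gt using assms(2) G by (simp add: assoc_mult_mat[of _ n n _ n _ n])
  finally have t: "transpose_mat (transpose_mat A * G * A) = - (transpose_mat A * G * A)" .
  have c: "transpose_mat A * G * A \<in> carrier_mat n n" using assms(2) G by simp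
  have "(transpose_mat A * G * A) $$ (j, i) = - (transpose_mat A * G * A) $$ (i, j)"
    if "i < n" "j < n" for i j
  proof -
    have "(transpose_mat A * G * A) $$ (j, i) = transpose_mat (transpose_mat A * G * A) $$ (i, j)"
      using c that by (simp only: index_transpose_mat carrier_matD)
    also have "\<dots> = - (transpose_mat A * G * A) $$ (i, j)"
      unfolding t using c that by (simp only: index_uminus_mat carrier_matD)
    finally show ?thesis .
  qed
  then show ?thesis using c unfolding alternating_def by blast
qed

text \<open>Contraction is natural in the form. For invertible \<open>A\<close> this identifies the
  primitive modules of congruent forms.\<close>

lemma lam_ext:
  fixes \<omega> :: "nat set \<Rightarrow> 'a::field_char_0"
  assumes G: "alternating n G" and A: "A \<in> carrier_mat n n" and "\<omega> \<in> fock n"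
  shows "lam n G (ext n A \<omega>) = ext n A (lam n (transpose_mat A * G * A) \<omega>)"
  using assms(3)
proof (induction rule: fock_induct)
  case vac
  show ?case by (simp only: ext_vac lam_vac ext_0)
next
  case (cr b \<eta>)
  let ?G' = "transpose_mat A * G * A"
  have G': "alternating n ?G'" by (rule alternating_congruence[OF G A])
  have Gc: "G \<in> carrier_mat n n" using G by (simp add: alternating_def)
  have "(\<Sum>i<n. (\<Sum>k<n. A $$ (k, b) * G $$ (k, i)) * A $$ (i, j)) = ?G' $$ (b, j)"
    if "j < n" for j
  proof -
    have "(transpose_mat A * G) $$ (b, i) = (\<Sum>k<n. A $$ (k, b) * G $$ (k, i))" if "i < n" for i
      using that cr A Gc by (simp add: scalar_prod_def lessThan_atLeast0)
    moreover have "?G' $$ (b, j) = (\<Sum>i<n. (transpose_mat A * G) $$ (b, i) * A $$ (i, j))"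
      using that cr A Gc by (simp add: scalar_prod_def lessThan_atLeast0 del: assoc_mult_mat)
    ultimately show ?thesis by simp
  qed
  then have "anv n (\<lambda>j. \<Sum>i<n. (\<Sum>k<n. A $$ (k, b) * G $$ (k, i)) * A $$ (i, j)) \<eta> =
      anv n (\<lambda>j. ?G' $$ (b, j)) \<eta>"
    by (intro anv_cong) auto
  then show ?case
    using cr by (simp only: ext_cr lam_crv[OF G] anv_ext lam_cr[OF G'] ext_add lam_fock)
next
  case (add \<eta> \<theta>)
  then show ?case by (simp only: ext_add lam_add)
next
  case (scale c \<eta>)
  then show ?case by (simp only: ext_scale lam_scale)
qed

lemma an_coord_space:
  assumes "\<omega> \<in> coord_space Z" "\<And>S. i \<notin> S \<Longrightarrow> insert i S \<in> Z \<Longrightarrow> S \<in> Y"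
  shows "an i \<omega> \<in> coord_space Y"
  using assms by (auto simp: coord_space_def an_def)

lemma lam_degree:
  assumes "\<omega> \<in> coord_space (ksubsets n k)"
  shows "lam n G \<omega> \<in> coord_space {R. R \<subseteq> {..<n} \<and> card R + 2 = k}"
proof -
  have "an j (an i \<omega>) \<in> coord_space {R. R \<subseteq> {..<n} \<and> card R + 2 = k}" for i j
  proof (rule an_coord_space[where Z = "{R. R \<subseteq> {..<n} \<and> card R + 1 = k}"])
    show "an i \<omega> \<in> coord_space {R. R \<subseteq> {..<n} \<and> card R + 1 = k}"
      by (rule an_coord_space[OF assms])
        (auto simp: ksubsets_def dest: finite_subset[OF _ finite_lessThan])
  qed (auto dest: finite_subset[OF _ finite_lessThan])
  then show ?thesis
    unfolding lam_def by (intro coord_space_sum) (auto intro: coord_space_scale coord_space_0)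
qed

lemma primitive_module_alt:
  "primitive_module m G = {\<omega> \<in> ext_power (2 * m) m. lam (2 * m) G \<omega> = 0}"
proof -
  have "contraction (2 * m) m G \<omega> = lam (2 * m) G \<omega>" if "\<omega> \<in> ext_power (2 * m) m" for \<omega>
  proof
    fix R
    show "contraction (2 * m) m G \<omega> R = lam (2 * m) G \<omega> R"
    proof (cases "R \<subseteq> {..<2 * m} \<and> card R + 2 = m")
      case True
      then show ?thesis by (simp add: contraction_eq_lam)
    next
      case False
      then have "lam (2 * m) G \<omega> R = 0"
        using lam_degree[of \<omega> "2 * m" m G] that by (auto simp: ext_power_def coord_space_def pointwise)
      with False show ?thesis by (auto simp: contraction_def pointwise)
    qed
  qed
  then show ?thesis by (auto simp: primitive_module_def)
qed

section \<open>The standard form and the Lefschetz operators\<close>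

definition std_form :: "nat \<Rightarrow> 'a::field mat" where
  "std_form m = mat (2 * m) (2 * m)
     (\<lambda>(i, j). if j = m + i then 1 else if i = m + j then - 1 else 0)"

abbreviation contr :: "nat \<Rightarrow> (nat set \<Rightarrow> 'a::field) \<Rightarrow> nat set \<Rightarrow> 'a" where
  "contr m \<equiv> lam (2 * m) (std_form m)"

lemma std_form_alternating: "alternating (2 * m) (std_form m)"
  by (auto simp: alternating_def std_form_def)

lemma contr_eq: "contr m \<omega> = (\<Sum>t<m. an (m + t) (an t \<omega>))"
proof -
  have "contr m \<omega> = (\<Sum>i<2 * m. \<Sum>j<2 * m.
      if i < j then fscale (std_form m $$ (i, j)) (an j (an i \<omega>)) else 0)"
    unfolding lam_def by (rule sum.swap)
  also have "\<dots> = (\<Sum>i<2 * m. if i < m then an (m + i) (an i \<omega>) else 0)"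
  proof (intro sum.cong refl)
    fix i assume i: "i \<in> {..<2 * m}"
    have "(\<Sum>j<2 * m. if i < j then fscale (std_form m $$ (i, j)) (an j (an i \<omega>)) else 0) =
        (\<Sum>j<2 * m. if j = m + i then (if i < m then an (m + i) (an i \<omega>) else 0) else 0)"
      using i by (intro sum.cong refl) (auto simp: std_form_def)
    then show "(\<Sum>j<2 * m. if i < j then fscale (std_form m $$ (i, j)) (an j (an i \<omega>)) else 0) =
        (if i < m then an (m + i) (an i \<omega>) else 0)" by simp
  qed
  also have "\<dots> = (\<Sum>i\<in>{..<2 * m} \<inter> {i. i < m}. an (m + i) (an i \<omega>))"
    by (simp add: sum.inter_restrict)
  also have "{..<2 * m} \<inter> {i. i < m} = {..<m}" by auto
  finally show ?thesis .
qed

lemma contr_cr: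
  fixes \<omega> :: "nat set \<Rightarrow> 'a::field_char_0"
  assumes "t < m"
  shows "contr m (cr t \<omega>) = cr t (contr m \<omega>) + an (m + t) \<omega>"
    and "contr m (cr (m + t) \<omega>) = cr (m + t) (contr m \<omega>) - an t \<omega>"
proof -
  have "anv (2 * m) (\<lambda>j. std_form m $$ (t, j)) \<omega> = (\<Sum>j<2 * m. if j = m + t then an j \<omega> else 0)"
    unfolding anv_def using assms by (intro sum.cong refl) (auto simp: std_form_def)
  then show "contr m (cr t \<omega>) = cr t (contr m \<omega>) + an (m + t) \<omega>"
    using assms by (simp add: lam_cr[OF std_form_alternating])
  have "anv (2 * m) (\<lambda>j. std_form m $$ (m + t, j)) \<omega> = (\<Sum>j<2 * m. if j = t then - an j \<omega> else 0)"
    unfolding anv_def using assms by (intro sum.cong refl) (auto simp: std_form_def)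
  then show "contr m (cr (m + t) \<omega>) = cr (m + t) (contr m \<omega>) - an t \<omega>"
    using assms by (simp add: lam_cr[OF std_form_alternating])
qed

text \<open>Wedge with the bivector dual to the standard form. Together with \<open>contr\<close> it
  generates an action of \<open>sl2\<close> on the exterior algebra.\<close>

definition raise :: "nat \<Rightarrow> (nat set \<Rightarrow> 'a::field) \<Rightarrow> nat set \<Rightarrow> 'a" where
  "raise m \<omega> = (\<Sum>t<m. cr t (cr (m + t) \<omega>))"

text \<open>Each pair contributes 1 minus its two occupation numbers; the sum over the m pairs is m
  minus the degree.\<close>

lemma contr_raise:
  fixes \<omega> :: "nat set \<Rightarrow> 'a::field_char_0"
  assumes \<omega>: "\<omega> \<in> coord_space (ksubsets (2 * m) d)"
  shows "contr m (raise m \<omega>) = raise m (contr m \<omega>) + fscale (of_nat m - of_nat d) \<omega>"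
proof -
  let ?N = "\<lambda>i. cr i (an i \<omega>)"
  have "contr m (cr t (cr (m + t) \<omega>)) = cr t (cr (m + t) (contr m \<omega>)) + (\<omega> - ?N t - ?N (m + t))"
    if "t < m" for t
    using that by (simp add: contr_cr cr_diff an_cr_same)
  then have "contr m (raise m \<omega>) =
      (\<Sum>t<m. cr t (cr (m + t) (contr m \<omega>)) + (\<omega> - ?N t - ?N (m + t)))"
    by (simp add: raise_def lam_sum)
  also have "\<dots> = raise m (contr m \<omega>) + (\<Sum>t<m. \<omega> - ?N t - ?N (m + t))"
    by (simp only: sum.distrib raise_def)
  also have "(\<Sum>t<m. \<omega> - ?N t - ?N (m + t)) = fscale (of_nat m - of_nat d) \<omega>"
  proof
    fix S
    have "(\<Sum>t<m. \<omega> - ?N t - ?N (m + t)) S =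
        of_nat m * \<omega> S - ((\<Sum>t<m. ?N t S) + (\<Sum>t<m. ?N (m + t) S))"
      by (simp add: sum_fun_apply sum_subtractf sum.distrib diff_diff_eq pointwise)
    also have "(\<Sum>t<m. ?N (m + t) S) = (\<Sum>t = m..<2 * m. ?N t S)"
      using sum.shift_bounds_nat_ivl[of "\<lambda>t. ?N t S" 0 m m]
      by (simp add: lessThan_atLeast0 add.commute mult_2)
    also have "(\<Sum>t<m. ?N t S) + \<dots> = (\<Sum>t<2 * m. ?N t S)"
      unfolding lessThan_atLeast0 by (rule sum.atLeastLessThan_concat) auto
    also have "\<dots> = of_nat (card ({..<2 * m} \<inter> S)) * \<omega> S"
      by (simp add: cr_an_same sum.If_cases Int_def)
    also have "of_nat m * \<omega> S - of_nat (card ({..<2 * m} \<inter> S)) * \<omega> S =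
        fscale (of_nat m - of_nat d) \<omega> S"
    proof (cases "S \<in> ksubsets (2 * m) d")
      case True
      then have "{..<2 * m} \<inter> S = S" "card S = d" by (auto simp: ksubsets_def)
      then show ?thesis by (simp only: fscale_apply left_diff_distrib)
    next
      case False
      then show ?thesis using \<omega> by (simp add: coord_space_def fscale_apply)
    qed
    finally show "(\<Sum>t<m. \<omega> - ?N t - ?N (m + t)) S = fscale (of_nat m - of_nat d) \<omega> S" .
  qed
  finally show ?thesis .
qed

text \<open>
  The \<open>sl\<^sub>2\<close> argument below is run on the span of the basis wedges whose index set satisfies a
  property \<open>Q\<close> that is not affected by adding a pair \<open>t, m + t\<close>, such as having a given weight.
\<close>

definition graded :: "nat \<Rightarrow> (nat set \<Rightarrow> bool) \<Rightarrow> nat \<Rightarrow> nat set set" where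
  "graded m Q d = {S. S \<subseteq> {..<2 * m} \<and> card S = d \<and> Q S}"

definition pair_invariant :: "nat \<Rightarrow> (nat set \<Rightarrow> bool) \<Rightarrow> bool" where
  "pair_invariant m Q \<longleftrightarrow> (\<forall>t<m. \<forall>S. S \<subseteq> {..<2 * m} \<longrightarrow> t \<notin> S \<longrightarrow> m + t \<notin> S \<longrightarrow>
     Q (insert (m + t) (insert t S)) = Q S)"

lemma contr_graded:
  assumes "pair_invariant m Q" "\<omega> \<in> coord_space (graded m Q (d + 2))"
  shows "contr m \<omega> \<in> coord_space (graded m Q d)"
  unfolding contr_eq
proof (intro coord_space_sum)
  fix t assume t: "t \<in> {..<m}"
  have "an (m + t) (an t \<omega>) S = 0" if S: "S \<notin> graded m Q d" for S
  proof (cases "m + t \<notin> S \<and> t \<notin> S")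
    case True
    have "insert t (insert (m + t) S) \<notin> graded m Q (d + 2)"
    proof
      assume i: "insert t (insert (m + t) S) \<in> graded m Q (d + 2)"
      then have "S \<subseteq> {..<2 * m}" "finite S"
        by (auto simp: graded_def dest: finite_subset[OF _ finite_lessThan])
      with i True t S assms(1) show False
        by (auto simp: graded_def pair_invariant_def insert_commute)
    qed
    then show ?thesis using assms(2) by (simp add: an_def coord_space_def)
  qed (auto simp: an_def)
  then show "an (m + t) (an t \<omega>) \<in> coord_space (graded m Q d)" by (simp add: coord_space_def)
qed

lemma contr_graded_low:
  assumes "\<omega> \<in> coord_space (graded m Q d)" "d < 2"
  shows "contr m \<omega> = 0"
proof -
  have "\<omega> \<in> coord_space (ksubsets (2 * m) d)"
    using assms(1) by (auto simp: coord_space_def graded_def ksubsets_def)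
  then have "contr m \<omega> \<in> coord_space {R. R \<subseteq> {..<2 * m} \<and> card R + 2 = d}"
    by (rule lam_degree)
  with assms(2) show ?thesis by (auto simp: coord_space_def pointwise)
qed

lemma raise_graded:
  assumes "pair_invariant m Q" "\<omega> \<in> coord_space (graded m Q d)"
  shows "raise m \<omega> \<in> coord_space (graded m Q (d + 2))"
  unfolding raise_def
proof (intro coord_space_sum)
  fix t assume t: "t \<in> {..<m}"
  have "cr t (cr (m + t) \<omega>) S = 0" if S: "S \<notin> graded m Q (d + 2)" for S
  proof (cases "m + t \<in> S \<and> t \<in> S")
    case True
    let ?R = "S - {t} - {m + t}"
    have "?R \<notin> graded m Q d"
    proof
      assume i: "?R \<in> graded m Q d"
      have e: "S = insert (m + t) (insert t ?R)" using True by auto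
      have f: "finite ?R" using i by (auto simp: graded_def dest: finite_subset[OF _ finite_lessThan])
      have "card S = d + 2" using i t f by (subst e) (auto simp: graded_def)
      moreover have "Q S"
        using assms(1) i t unfolding pair_invariant_def graded_def
        by (subst e) auto
      ultimately have "S \<in> graded m Q (d + 2)" using i t e by (auto simp: graded_def)
      with S show False ..
    qed
    then show ?thesis using assms(2) by (simp add: cr_def coord_space_def)
  qed (auto simp: cr_def)
  then show "cr t (cr (m + t) \<omega>) \<in> coord_space (graded m Q (d + 2))" by (simp add: coord_space_def)
qed

lemma raise_0 [simp]: "raise m 0 = 0"
  by (simp add: raise_def sum.neutral)

lemma graded_ksubsets: "\<omega> \<in> coord_space (graded m Q d) \<Longrightarrow> \<omega> \<in> coord_space (ksubsets (2 * m) d)"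
  by (auto simp: coord_space_def graded_def ksubsets_def)

lemma contr_pow_add: "(contr m ^^ j) (\<omega> + \<eta>) = (contr m ^^ j) \<omega> + (contr m ^^ j) \<eta>"
  by (induction j) (simp_all add: lam_add)
lemma contr_pow_scale: "(contr m ^^ j) (fscale c \<omega>) = fscale c ((contr m ^^ j) \<omega>)"
  by (induction j) (simp_all add: lam_scale)
lemma contr_pow_0: "(contr m ^^ j) 0 = 0"
  by (induction j) simp_all

text \<open>The scalar is the sum of m - (d - 2i) for i = 0, ..., j: the commutator is met once in
  each of the degrees d, d - 2, ..., d - 2j.\<close>

lemma contr_pow_raise:
  fixes \<omega> :: "nat set \<Rightarrow> 'a::field_char_0"
  assumes Q: "pair_invariant m Q" and "\<omega> \<in> coord_space (graded m Q d)"
  shows "(contr m ^^ Suc j) (raise m \<omega>) = raise m ((contr m ^^ Suc j) \<omega>)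
    + fscale (of_nat (Suc j) * (of_nat m - of_nat d + of_nat j)) ((contr m ^^ j) \<omega>)"
  using assms(2)
proof (induction j arbitrary: \<omega> d)
  case 0
  then show ?case using contr_raise[OF graded_ksubsets] by (simp)
next
  case (Suc j)
  let ?D = "contr m"
  have "(?D ^^ Suc (Suc j)) (raise m \<omega>) = (?D ^^ Suc j) (?D (raise m \<omega>))"
    by (simp only: funpow_Suc_right o_apply)
  also have "\<dots> = (?D ^^ Suc j) (raise m (?D \<omega>))
      + fscale (of_nat m - of_nat d) ((?D ^^ Suc j) \<omega>)"
    by (simp only: contr_raise[OF graded_ksubsets[OF Suc.prems]] contr_pow_add contr_pow_scale)
  also have "(?D ^^ Suc j) (raise m (?D \<omega>)) = raise m ((?D ^^ Suc (Suc j)) \<omega>)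
      + fscale (of_nat (Suc j) * (of_nat m - of_nat d + 2 + of_nat j)) ((?D ^^ Suc j) \<omega>)"
  \<comment> \<open>Below degree 2 there is no degree d - 2 for the induction hypothesis, but there
    contraction is already 0.\<close>
  proof (cases "d < 2")
    case True
    then have "?D \<omega> = 0" using contr_graded_low Suc.prems by blast
    then show ?thesis
      unfolding funpow_Suc_right o_apply by (simp only: raise_0 lam_0 contr_pow_0 fs.scale_zero_right add_0_right)
  next
    case False
    then obtain d' where d: "d = d' + 2" by (metis add.commute le_Suc_ex not_less)
    then have "?D \<omega> \<in> coord_space (graded m Q d')" using contr_graded[OF Q] Suc.prems by blast
    from Suc.IH[OF this] have "(?D ^^ Suc j) (raise m (?D \<omega>)) = raise m ((?D ^^ Suc j) (?D \<omega>))
        + fscale (of_nat (Suc j) * (of_nat m - of_nat d' + of_nat j)) ((?D ^^ j) (?D \<omega>))" .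
    then show ?thesis unfolding d by (simp only: funpow_Suc_right o_apply of_nat_add of_nat_numeral) (simp add: algebra_simps)
  qed
  finally show ?case
    by (simp add: add.assoc flip: fs.scale_left_distrib) (simp add: algebra_simps)
qed

text \<open>Write D and R for \<open>contr\<close> and \<open>raise\<close>. If the power D^(j+1)
  kills \<omega>, then D^j kills D R \<omega> - c \<omega> for the scalar c of
  \<open>contr_pow_raise\<close>, so by induction on j this vector is in the image of D, and then so
  is \<omega>. For d < m the scalar c is a positive integer.\<close>

lemma contr_onto:
  fixes \<omega> :: "nat set \<Rightarrow> 'a::field_char_0"
  assumes Q: "pair_invariant m Q" and d: "d < m" and \<omega>: "\<omega> \<in> coord_space (graded m Q d)"
  shows "\<exists>\<eta>\<in>coord_space (graded m Q (d + 2)). contr m \<eta> = \<omega>"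
proof -
  let ?W = "coord_space (graded m Q d) :: (nat set \<Rightarrow> 'a) set"
  have onto: "\<exists>\<eta>\<in>coord_space (graded m Q (d + 2)). contr m \<eta> = \<omega>"
    if "(contr m ^^ j) \<omega> = 0" "\<omega> \<in> ?W" for j \<omega>
    using that
  proof (induction j arbitrary: \<omega>)
    case 0
    then show ?case by (intro bexI[of _ 0]) (simp_all add: coord_space_0)
  next
    case (Suc j)
    define c :: 'a where "c = of_nat (Suc j) * (of_nat m - of_nat d + of_nat j)"
    have "c = of_nat (Suc j * (m - d + j))"
      using d unfolding c_def by (simp only: of_nat_mult of_nat_add of_nat_diff[OF less_imp_le])
    then have c: "c \<noteq> 0" using d by (simp only: of_nat_eq_0_iff) simp
    let ?h = "contr m (raise m \<omega>) - fscale c \<omega>"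
    have r: "raise m \<omega> \<in> coord_space (graded m Q (d + 2))" by (rule raise_graded[OF Q Suc.prems(2)])
    have "?h = contr m (raise m \<omega>) + fscale (- c) \<omega>" by simp
    then have "(contr m ^^ j) ?h = (contr m ^^ j) (contr m (raise m \<omega>)) + fscale (- c) ((contr m ^^ j) \<omega>)"
      by (simp only: contr_pow_add contr_pow_scale)
    also have "(contr m ^^ j) (contr m (raise m \<omega>)) = (contr m ^^ Suc j) (raise m \<omega>)"
      by (simp only: funpow_Suc_right o_apply)
    also have "\<dots> = raise m 0 + fscale c ((contr m ^^ j) \<omega>)"
      unfolding contr_pow_raise[OF Q Suc.prems(2)] Suc.prems(1) c_def ..
    finally have "(contr m ^^ j) ?h = 0" by simp
    moreover have "?h \<in> ?W"
      using contr_graded[OF Q r] Suc.prems(2) by (auto simp: coord_space_def fscale_apply pointwise)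
    ultimately obtain \<eta> where \<eta>: "\<eta> \<in> coord_space (graded m Q (d + 2))" "contr m \<eta> = ?h"
      using Suc.IH by blast
    have "contr m (fscale (inverse c) (raise m \<omega> - \<eta>)) = \<omega>"
      unfolding lam_scale lam_diff \<eta>(2) using c by simp
    moreover have "fscale (inverse c) (raise m \<omega> - \<eta>) \<in> coord_space (graded m Q (d + 2))"
      using r \<eta>(1) by (auto simp: coord_space_def fscale_apply pointwise)
    ultimately show ?case by blast
  qed
  \<comment> \<open>Nilpotency starts the induction. The exponent d + 1 is generous, since every
    contraction lowers the degree by 2.\<close>
  have "(contr m ^^ Suc d) \<omega> = 0" if "\<omega> \<in> coord_space (graded m Q d)" for d and \<omega> :: "nat set \<Rightarrow> 'a"
    using that
  proof (induction d arbitrary: \<omega> rule: less_induct)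
    case (less d)
    show ?case
    proof (cases "d < 2")
      case True
      then have "contr m \<omega> = 0" using contr_graded_low less.prems by blast
      then show ?thesis unfolding funpow_Suc_right o_apply by (simp only: contr_pow_0)
    next
      case False
      then obtain e where e: "d = e + 2" by (metis add.commute le_Suc_ex not_less)
      then have "contr m \<omega> \<in> coord_space (graded m Q e)" using contr_graded[OF Q] less.prems by blast
      then have "(contr m ^^ Suc e) (contr m \<omega>) = 0" using less.IH e by auto
      moreover have "(contr m ^^ Suc d) \<omega> = contr m ((contr m ^^ Suc e) (contr m \<omega>))"
        unfolding e by (simp add: funpow_swap1)
      ultimately show ?thesis by simp
    qed
  qed
  from onto[OF this[OF \<omega>] \<omega>] show ?thesis .
qed

section \<open>Dimension counts\<close>

abbreviation flinear :: "(('i \<Rightarrow> 'a::field) \<Rightarrow> 'j \<Rightarrow> 'a) \<Rightarrow> bool" where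
  "flinear \<equiv> Vector_Spaces.linear fscale fscale"

interpretation fsp: vector_space_pair "fscale :: 'a::field \<Rightarrow> ('i \<Rightarrow> 'a) \<Rightarrow> 'i \<Rightarrow> 'a"
  "fscale :: 'a \<Rightarrow> ('j \<Rightarrow> 'a) \<Rightarrow> 'j \<Rightarrow> 'a" ..

lemma flinearI:
  assumes "\<And>v w. f (v + w) = f v + f w" "\<And>c v. f (fscale c v) = fscale c (f v)"
  shows "flinear f"
  unfolding Vector_Spaces.linear_iff by (intro conjI allI fs.vector_space_axioms assms)

lemma flinear_add: "flinear f \<Longrightarrow> f (v + w) = f v + f w"
  unfolding Vector_Spaces.linear_iff by blast
lemma flinear_scale: "flinear f \<Longrightarrow> f (fscale c v) = fscale c (f v)"
  unfolding Vector_Spaces.linear_iff by blast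
lemma flinear_0: "flinear f \<Longrightarrow> f 0 = 0"
  using flinear_scale[of f 0 0] by simp
lemma flinear_sum: "flinear f \<Longrightarrow> f (\<Sum>x\<in>A. g x) = (\<Sum>x\<in>A. f (g x))"
  using sum_comp_morphism[of f g A] by (simp add: flinear_0 flinear_add o_def)
lemma flinear_minus: "flinear f \<Longrightarrow> f (- v) = - f v"
  using flinear_scale[of f "- 1" v] by simp
lemma flinear_diff: "flinear f \<Longrightarrow> f (v - w) = f v - f w"
  using flinear_add[of f v "- w"] by (simp add: flinear_minus)
lemma flinear_comp: "flinear f \<Longrightarrow> flinear g \<Longrightarrow> flinear (\<lambda>v. f (g v))"
  by (rule flinearI) (simp_all add: flinear_add flinear_scale)

lemma flinear_ext: "flinear (ext n A)"
  by (rule flinearI) (simp_all add: ext_add ext_scale)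
lemma flinear_lam: "flinear (lam n G)"
  by (rule flinearI) (simp_all add: lam_add lam_scale)

lemma subspace_coord_space: "fs.subspace (coord_space Z)"
  by (simp add: fs.subspace_def coord_space_0 coord_space_add coord_space_scale)

lemma subspace_kernel: "fs.subspace V \<Longrightarrow> flinear D \<Longrightarrow> fs.subspace {v \<in> V. D v = 0}"
  by (auto simp: fs.subspace_def flinear_0 flinear_add flinear_scale)

lemma independent_ind: "fs.independent (ind ` Z :: ('i \<Rightarrow> 'a::field) set)" if "finite Z"
proof (rule fs.independent_if_scalars_zero)
  show "finite (ind ` Z :: ('i \<Rightarrow> 'a) set)" using that by simp
  fix f :: "('i \<Rightarrow> 'a) \<Rightarrow> 'a" and b :: "'i \<Rightarrow> 'a"
  have inj: "inj_on (ind :: 'i \<Rightarrow> 'i \<Rightarrow> 'a) Z"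
    by (rule inj_onI) (metis ind_def zero_neq_one)
  assume 0: "(\<Sum>v\<in>ind ` Z. fscale (f v) v) = 0" and "b \<in> ind ` Z"
  then obtain x where x: "x \<in> Z" "b = ind x" by auto
  have "0 = (\<Sum>v\<in>ind ` Z. fscale (f v) v) x" using 0 by (simp add: pointwise)
  also have "\<dots> = (\<Sum>y\<in>Z. if y = x then f (ind x) else 0)"
    unfolding sum_fun_apply sum.reindex[OF inj] by (rule sum.cong) (auto simp: fscale_apply ind_def)
  also have "\<dots> = f b" using x that by simp
  finally show "f b = 0" by simp
qed

lemma dim_coord_space:
  assumes "finite Z"
  shows "fs.dim (coord_space Z :: ('i \<Rightarrow> 'a::field) set) = card Z"
proof -
  have inj: "inj_on (ind :: 'i \<Rightarrow> 'i \<Rightarrow> 'a) Z"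
    by (rule inj_onI) (metis ind_def zero_neq_one)
  have "v \<in> fs.span (ind ` Z)" if "v \<in> coord_space Z" for v :: "'i \<Rightarrow> 'a"
    by (subst coord_space_expand[OF assms that]) (intro fs.span_sum fs.span_scale fs.span_base imageI)
  then have "card (ind ` Z :: ('i \<Rightarrow> 'a) set) = fs.dim (coord_space Z :: ('i \<Rightarrow> 'a) set)"
    using independent_ind[OF assms]
    by (intro fs.basis_card_eq_dim) (auto simp: ind_in_coord_space)
  then show ?thesis by (simp add: card_image[OF inj])
qed

text \<open>\<open>fs.dim\<close> is informative only for finitely generated subspaces. Confinement
  to finitely many coordinates provides this.\<close>

lemma finite_basis:
  fixes V :: "('i \<Rightarrow> 'a::field) set"
  assumes "finite Z" "V \<subseteq> coord_space Z"
  obtains B where "finite B" "B \<subseteq> V" "fs.independent B" "V \<subseteq> fs.span B" "card B = fs.dim V"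
proof -
  obtain B where B: "B \<subseteq> V" "fs.independent B" "V \<subseteq> fs.span B" "card B = fs.dim V"
    using fs.basis_exists by blast
  have "v \<in> fs.span (ind ` Z)" if "v \<in> coord_space Z" for v :: "'i \<Rightarrow> 'a"
    by (subst coord_space_expand[OF assms(1) that]) (intro fs.span_sum fs.span_scale fs.span_base imageI)
  then have "B \<subseteq> fs.span (ind ` Z)" using B assms(2) by blast
  then have "finite B"
    using fs.independent_span_bound[of "ind ` Z" B] assms(1) B(2) by blast
  with B that show ?thesis by blast
qed

lemma dim_0_imp_trivial:
  fixes V :: "('i \<Rightarrow> 'a::field) set"
  assumes "finite Z" "V \<subseteq> coord_space Z" "fs.dim V = 0"
  shows "V \<subseteq> {0}"
  using finite_basis[OF assms(1,2)] assms(3) by (metis card_0_eq fs.span_empty)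

text \<open>A basis of the kernel together with preimages of the unit vectors on \<open>Y\<close> is
  a basis of \<open>V\<close>. Surjectivity is phrased through unit vectors because this is what the
  applications produce.\<close>

lemma rank_nullity:
  fixes V :: "('i \<Rightarrow> 'a::field) set" and D :: "('i \<Rightarrow> 'a) \<Rightarrow> 'j \<Rightarrow> 'a"
  assumes Z: "finite Z" and VX: "V \<subseteq> coord_space Z" and V: "fs.subspace V"
    and D: "flinear D" and Y: "finite Y" and DV: "\<And>v. v \<in> V \<Longrightarrow> D v \<in> coord_space Y"
    and onto: "\<And>y. y \<in> Y \<Longrightarrow> \<exists>v\<in>V. D v = ind y"
  shows "fs.dim {v \<in> V. D v = 0} + card Y = fs.dim V"
proof -
  let ?K = "{v \<in> V. D v = 0}"
  obtain B where B: "finite B" "B \<subseteq> ?K" "fs.independent B" "?K \<subseteq> fs.span B" "card B = fs.dim ?K"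
    by (rule finite_basis[OF Z, of ?K]) (use VX in auto)
  obtain g where g: "\<And>y. y \<in> Y \<Longrightarrow> g y \<in> V \<and> D (g y) = ind y" using onto by metis
  have injg: "inj_on g Y"
    by (rule inj_onI) (metis g ind_def zero_neq_one)
  have ind_nz: "ind y \<noteq> (0 :: 'j \<Rightarrow> 'a)" for y
    by (metis ind_def zero_fun_apply zero_neq_one)
  have disj: "B \<inter> g ` Y = {}" using B(2) g ind_nz by fastforce
  have ind: "fs.independent (B \<union> g ` Y)"
  proof (rule fs.independent_if_scalars_zero)
    show "finite (B \<union> g ` Y)" using B Y by simp
    fix f b
    assume 0: "(\<Sum>v\<in>B \<union> g ` Y. fscale (f v) v) = 0" and b: "b \<in> B \<union> g ` Y"
    have split: "(\<Sum>v\<in>B \<union> g ` Y. fscale (f v) v) =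
        (\<Sum>v\<in>B. fscale (f v) v) + (\<Sum>y\<in>Y. fscale (f (g y)) (g y))"
      using B(1) Y disj by (simp add: sum.union_disjoint sum.reindex[OF injg])
    have DB: "D (\<Sum>v\<in>B. fscale (f v) v) = 0"
      unfolding flinear_sum[OF D] flinear_scale[OF D] using B(2) by (intro sum.neutral) auto
    have "0 = D (\<Sum>v\<in>B \<union> g ` Y. fscale (f v) v)" using 0 flinear_0[OF D] by simp
    also have "\<dots> = (\<Sum>y\<in>Y. fscale (f (g y)) (D (g y)))"
      unfolding split flinear_add[OF D] DB by (simp add: flinear_sum[OF D] flinear_scale[OF D])
    also have "\<dots> = (\<Sum>y\<in>Y. fscale (f (g y)) (ind y))"
      using g by (intro sum.cong) auto
    finally have *: "(\<Sum>y\<in>Y. fscale (f (g y)) (ind y)) z = (0 :: 'a)" for z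
      by (metis zero_fun_apply)
    have fg: "f (g z) = 0" if z: "z \<in> Y" for z
    proof -
      have "(\<Sum>y\<in>Y. fscale (f (g y)) (ind y)) z = (\<Sum>y\<in>Y. if y = z then f (g z) else 0)"
        unfolding sum_fun_apply by (rule sum.cong) (auto simp: fscale_apply ind_def)
      then show ?thesis using z Y *[of z] by simp
    qed
    then have "(\<Sum>v\<in>B. fscale (f v) v) = 0"
      using 0 unfolding split by (simp add: sum.neutral)
    then have "f v = 0" if "v \<in> B" for v
      using fs.independentD[OF B(3) B(1) subset_refl] that by blast
    with b fg show "f b = 0" by blast
  qed
  have "v \<in> fs.span (B \<union> g ` Y)" if v: "v \<in> V" for v
  proof -
    let ?u = "\<Sum>y\<in>Y. fscale (D v y) (g y)"
    have "D ?u = (\<Sum>y\<in>Y. fscale (D v y) (ind y))"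
      unfolding flinear_sum[OF D] flinear_scale[OF D] using g by (intro sum.cong) auto
    also have "\<dots> = D v" using coord_space_expand[OF Y DV[OF v]] by simp
    finally have "D (v - ?u) = 0" by (simp add: flinear_diff[OF D])
    moreover have "v - ?u \<in> V"
      using v g V by (intro fs.subspace_diff fs.subspace_sum fs.subspace_scale) auto
    ultimately have "v - ?u \<in> fs.span (B \<union> g ` Y)"
      using B(4) fs.span_mono[of B "B \<union> g ` Y"] by auto
    moreover have "?u \<in> fs.span (B \<union> g ` Y)"
      by (intro fs.span_sum fs.span_scale fs.span_base) auto
    ultimately show ?thesis using fs.span_add by fastforce
  qed
  then have "card (B \<union> g ` Y) = fs.dim V"
    using ind B(2) g by (intro fs.basis_card_eq_dim) auto
  then show ?thesis using B Y disj by (simp add: card_Un_disjoint card_image[OF injg])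
qed

lemma dim_image:
  fixes V :: "('i \<Rightarrow> 'a::field) set" and D :: "('i \<Rightarrow> 'a) \<Rightarrow> 'j \<Rightarrow> 'a"
  assumes "fs.subspace V" "flinear D" "inj_on D V"
  shows "fs.dim (D ` V) = fs.dim V"
proof -
  obtain B where B: "B \<subseteq> V" "fs.independent B" "V \<subseteq> fs.span B" "card B = fs.dim V"
    using fs.basis_exists by blast
  have sp: "fs.span B = V" using B assms(1) fs.span_minimal by blast
  have "fs.independent (D ` B)"
    using fsp.linear_independent_injective_image[OF assms(2) B(2)] assms(3) sp by simp
  moreover have "D ` V \<subseteq> fs.span (D ` B)"
    using fsp.linear_span_image[OF assms(2), of B] sp by simp
  ultimately have "card (D ` B) = fs.dim (D ` V)"
    using B by (intro fs.basis_card_eq_dim) auto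
  moreover have "card (D ` B) = card B"
    using assms(3) B(1) by (meson card_image inj_on_subset)
  ultimately show ?thesis using B by simp
qed

subsection \<open>Binomial coefficients\<close>

lemma choose_step: "(Suc (Suc n)) choose (Suc (Suc k)) = (n choose (k + 2)) + 2 * (n choose (k + 1)) + (n choose k)"
  by simp

lemma binomial_ratio: "Suc k * (n choose Suc k) = (n - k) * (n choose k)"
  by (simp only: binomial_absorb_comp binomial_absorption)

text \<open>The shape in which a weight multiplicity appears: the number of wedges in degree m minus
  the number in the degree that contraction covers.\<close>

lemma catalan_eq_diff: "catalan r + (2 * r choose (r + 1)) = (2 * r choose r)"
proof -
  have a: "(r + 1) * (2 * r choose (r + 1)) = r * (2 * r choose r)"
    using binomial_ratio[of r "2 * r"] by (simp only: mult_2 add_diff_cancel_left' Suc_eq_plus1)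
  have "(r + 1) * (2 * r choose (r + 1)) \<le> (r + 1) * (2 * r choose r)"
    unfolding a by (intro mult_right_mono) auto
  then have "(2 * r choose (r + 1)) \<le> (2 * r choose r)"
    by (simp only: mult_le_cancel1)
  moreover have "(r + 1) * ((2 * r choose r) - (2 * r choose (r + 1))) = 2 * r choose r"
    unfolding diff_mult_distrib2 a by (simp add: algebra_simps)
  ultimately show ?thesis
    unfolding catalan_def by (metis add.commute le_add_diff_inverse nonzero_mult_div_cancel_left
        add_is_0 one_neq_zero)
qed

text \<open>After multiplication by m + 2 everything reduces to the binomials C(2m, m) and C(2m,
  m+1). The entry m + 2 stands, by symmetry, for the degree m - 2.\<close>

lemma catalan_Suc_eq_diff: "catalan (m + 1) + (2 * m choose (m + 2)) = (2 * m choose m)"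
proof -
  let ?c = "2 * m choose m" and ?c1 = "2 * m choose (m + 1)" and ?c2 = "2 * m choose (m + 2)"
  have a: "(m + 1) * ?c1 = m * ?c"
    using binomial_ratio[of m "2 * m"] by (simp only: mult_2 add_diff_cancel_left' Suc_eq_plus1)
  have b: "(m + 2) * ?c2 = (m - 1) * ?c1"
  proof -
    have "2 * m - (m + 1) = m - 1" "Suc (m + 1) = m + 2" by auto
    then show ?thesis using binomial_ratio[of "m + 1" "2 * m"] by metis
  qed
  have "2 * (m + 1) choose (m + 1) = 2 * ?c + 2 * ?c1"
  proof (cases m)
    case (Suc k)
    have "2 * m choose k = 2 * m choose (m + 1)"
      using binomial_symmetric[of k "2 * m"] Suc by simp
    moreover have "2 * (m + 1) choose (m + 1) = (2 * m choose (k + 2)) + 2 * (2 * m choose (k + 1)) + (2 * m choose k)"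
      using choose_step[of "2 * m" k] Suc by simp
    ultimately show ?thesis using Suc by simp
  qed simp
  moreover have "(m + 2) * ?c2 + (2 * ?c + 2 * ?c1) = (m + 2) * ?c"
  proof (cases m)
    case (Suc k)
    then have "(m + 2) * ?c2 + 2 * ?c1 = m * ?c" unfolding b a[symmetric] by (simp add: algebra_simps)
    then show ?thesis by (simp add: algebra_simps)
  qed simp
  ultimately have *: "(m + 2) * ?c2 + (2 * (m + 1) choose (m + 1)) = (m + 2) * ?c" by simp
  then have "(m + 2) * ?c2 \<le> (m + 2) * ?c" by linarith
  then have le: "?c2 \<le> ?c" by (simp only: mult_le_cancel1)
  have "(m + 2) * (?c - ?c2) = 2 * (m + 1) choose (m + 1)"
    unfolding diff_mult_distrib2 using * by linarith
  then have "catalan (m + 1) = ?c - ?c2"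
    unfolding catalan_def by (metis add_Suc_right add_is_0 nonzero_mult_div_cancel_left
        numeral_2_eq_2 one_add_one plus_1_eq_Suc add.assoc zero_neq_numeral)
  with le show ?thesis by simp
qed

lemma card_ksubsets: "card (ksubsets n k) = n choose k"
  unfolding ksubsets_def using n_subsets[of "{..<n}" k] by simp

lemma finite_ksubsets: "finite (ksubsets n k)"
  by (rule finite_subset[of _ "Pow {..<n}"]) (auto simp: ksubsets_def)

lemma card_lower_degree: "card {R. R \<subseteq> {..<2 * m} \<and> card R + 2 = m} = 2 * m choose (m + 2)"
proof (cases "m < 2")
  case True
  then have "m = 0 \<or> m = 1" by auto
  then show ?thesis by (auto simp: binomial_eq_0)
next
  case False
  then have "{R. R \<subseteq> {..<2 * m} \<and> card R + 2 = m} = ksubsets (2 * m) (m - 2)"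
    by (auto simp: ksubsets_def)
  moreover have "2 * m choose (m - 2) = 2 * m choose (m + 2)"
    using binomial_symmetric[of "m - 2" "2 * m"] False by (simp add: numeral_2_eq_2)
  ultimately show ?thesis by (simp add: card_ksubsets)
qed

text \<open>Contraction maps degree m onto degree m - 2, so its kernel has as dimension the
  difference of the two numbers of index sets.\<close>

lemma dim_primitive:
  "fs.dim (primitive_module m (std_form m) :: (nat set \<Rightarrow> 'a::field_char_0) set) = catalan (m + 1)"
proof -
  let ?Y = "{R. R \<subseteq> {..<2 * m} \<and> card R + 2 = m}"
  let ?V = "ext_power (2 * m) m :: (nat set \<Rightarrow> 'a) set"
  have Q: "pair_invariant m (\<lambda>_. True)" by (simp add: pair_invariant_def)
  have "fs.dim {v \<in> ?V. contr m v = 0} + card ?Y = fs.dim ?V"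
  proof (rule rank_nullity[OF finite_ksubsets[of "2 * m" m]])
    show "finite ?Y" by (rule finite_subset[of _ "Pow {..<2 * m}"]) auto
    fix y assume y: "y \<in> ?Y"
    then have "ind y \<in> coord_space (graded m (\<lambda>_. True) (m - 2))"
      by (auto simp: graded_def ind_in_coord_space)
    moreover have "m - 2 < m" using y by auto
    ultimately obtain \<eta> :: "nat set \<Rightarrow> 'a"
      where \<eta>: "\<eta> \<in> coord_space (graded m (\<lambda>_. True) (m - 2 + 2))" "contr m \<eta> = ind y"
      using contr_onto[OF Q] by blast
    have "m - 2 + 2 = m" using y by auto
    then have "\<eta> \<in> ?V" using \<eta>(1) graded_ksubsets unfolding ext_power_def by metis
    with \<eta> show "\<exists>v\<in>?V. contr m v = ind y" by blast
  next
    fix v assume "v \<in> ?V"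
    then show "contr m v \<in> coord_space ?Y" unfolding ext_power_def by (rule lam_degree)
  qed (auto simp: ext_power_def subspace_coord_space flinear_lam)
  then have "fs.dim {v \<in> ?V. contr m v = 0} + (2 * m choose (m + 2)) = 2 * m choose m"
    unfolding card_lower_degree ext_power_def dim_coord_space[OF finite_ksubsets] card_ksubsets .
  then show ?thesis using catalan_Suc_eq_diff[of m] by (simp add: primitive_module_alt)
qed

subsection \<open>Ballot sequences\<close>

text \<open>The k-th element of a set, counted from 0, lies below t exactly if more than k of its
  elements do. Comparing elements in order is therefore comparing counting functions.\<close>

lemma pick_le_iff_ballot:
  assumes I: "finite I" and J: "finite J" and c: "card I = card J"
  shows "(\<forall>k<card I. pick I k \<le> pick J k) \<longleftrightarrow> (\<forall>t. card (J \<inter> {..<t}) \<le> card (I \<inter> {..<t}))"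
proof (intro iffI allI impI)
  fix t assume le: "\<forall>k<card I. pick I k \<le> pick J k"
  define n where "n = card (J \<inter> {..<t})"
  have n: "n \<le> card J" unfolding n_def using J by (intro card_mono) auto
  have less: "pick J k < t" if k: "k < n" for k
  proof (rule ccontr)
    assume "\<not> pick J k < t"
    then have "J \<inter> {..<t} \<subseteq> {a \<in> J. a < pick J k}" by auto
    then have "n \<le> card {a \<in> J. a < pick J k}" unfolding n_def using J by (intro card_mono) auto
    also have "\<dots> = k" using k n by (intro card_pick_le) auto
    finally show False using k by simp
  qed
  have "pick I ` {..<n} \<subseteq> I \<inter> {..<t}"
  proof safe
    fix k assume "k < n"
    then have "k < card I" using c n by simp
    then show "pick I k \<in> I" by (rule pick_in_set_le)
    show "pick I k < t"
      using le \<open>k < card I\<close> less[OF \<open>k < n\<close>] by (meson order_le_less_trans)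
  qed
  then have "card (pick I ` {..<n}) \<le> card (I \<inter> {..<t})" using I by (intro card_mono) auto
  moreover have "inj_on (pick I) {..<n}"
    using bij_betw_imp_inj_on[OF bij_betw_pick[OF I]] by (rule inj_on_subset) (use c n in auto)
  ultimately show "card (J \<inter> {..<t}) \<le> card (I \<inter> {..<t})" by (simp add: card_image n_def)
next
  fix k assume b: "\<forall>t. card (J \<inter> {..<t}) \<le> card (I \<inter> {..<t})" and k: "k < card I"
  show "pick I k \<le> pick J k"
  proof (rule ccontr)
    let ?t = "Suc (pick J k)"
    assume "\<not> pick I k \<le> pick J k"
    then have "I \<inter> {..<?t} \<subseteq> {a \<in> I. a < pick I k}" by auto
    then have "card (I \<inter> {..<?t}) \<le> card {a \<in> I. a < pick I k}" using I by (intro card_mono) auto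
    also have "\<dots> = k" using k by (rule card_pick_le)
    finally have "card (J \<inter> {..<?t}) \<le> k" using b le_trans by blast
    moreover have "J \<inter> {..<?t} = insert (pick J k) {a \<in> J. a < pick J k}"
      using k c pick_in_set_le[of k J] by auto
    then have "card (J \<inter> {..<?t}) = Suc k" using J k c by (simp add: card_pick_le)
    ultimately show False by simp
  qed
qed

text \<open>Read upwards, a position in \<open>I\<close> only is a step up, one in \<open>J\<close>
  only a step down, and the other two kinds are level. The pairs are the paths that stay nonnegative
  and end at height \<open>h\<close>; standard pairs have h = 0, and other heights serve the
  recursion.\<close>

definition ballot :: "nat \<Rightarrow> nat \<Rightarrow> (nat set \<times> nat set) set" where
  "ballot m h = {(I, J). I \<subseteq> {..<m} \<and> J \<subseteq> {..<m} \<and> card I = card J + h \<and>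
     (\<forall>t\<le>m. card (J \<inter> {..<t}) \<le> card (I \<inter> {..<t}))}"

lemma card_upto: "I \<subseteq> {..<m} \<Longrightarrow> m \<le> t \<Longrightarrow> I \<inter> {..<t} = I" for m t :: nat
  by fastforce

lemma std_pairs_eq_ballot: "std_pairs m = ballot m 0"
proof -
  have "(\<forall>k<card I. pick I k \<le> pick J k) \<longleftrightarrow> (\<forall>t\<le>m. card (J \<inter> {..<t}) \<le> card (I \<inter> {..<t}))"
    if "I \<subseteq> {..<m}" "J \<subseteq> {..<m}" "card I = card J" for I J
  proof -
    have "finite I" "finite J" using that finite_subset by blast+
    then have "(\<forall>k<card I. pick I k \<le> pick J k) \<longleftrightarrow> (\<forall>t. card (J \<inter> {..<t}) \<le> card (I \<inter> {..<t}))"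
      using that by (intro pick_le_iff_ballot)
    also have "\<dots> \<longleftrightarrow> (\<forall>t\<le>m. card (J \<inter> {..<t}) \<le> card (I \<inter> {..<t}))"
      using card_upto[OF that(1)] card_upto[OF that(2)] that(3) by (metis le_refl nat_le_linear)
    finally show ?thesis .
  qed
  then have "(I, J) \<in> std_pairs m \<longleftrightarrow> (I, J) \<in> ballot m 0" for I J
    by (cases "I \<subseteq> {..<m} \<and> J \<subseteq> {..<m} \<and> card I = card J")
      (simp add: std_pairs_def boundary_pairs_def ballot_def del: all_simps,
       auto simp: std_pairs_def boundary_pairs_def ballot_def)
  then show ?thesis by auto
qed

lemma finite_ballot: "finite (ballot m h)"
  by (rule finite_subset[of _ "Pow {..<m} \<times> Pow {..<m}"]) (auto simp: ballot_def)

lemma ballot_split: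
  "ballot (Suc m) h = ballot m h
     \<union> (\<lambda>(I, J). (insert m I, insert m J)) ` ballot m h
     \<union> (\<lambda>(I, J). (I, insert m J)) ` ballot m (Suc h)
     \<union> (if h = 0 then {} else (\<lambda>(I, J). (insert m I, J)) ` ballot m (h - 1))"
  (is "?L = ?A \<union> ?f ` ?A \<union> ?g ` ?B \<union> ?C")
proof (intro Set.set_eqI iffI)
  fix p assume p: "p \<in> ?L"
  obtain I J where IJ: "p = (I, J)" by (cases p)
  let ?I = "I - {m}" and ?J = "J - {m}"
  have s: "I \<subseteq> {..<Suc m}" "J \<subseteq> {..<Suc m}" "card I = card J + h" "finite I" "finite J"
    and b: "\<And>t. t \<le> Suc m \<Longrightarrow> card (J \<inter> {..<t}) \<le> card (I \<inter> {..<t})"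
    using p IJ finite_subset by (auto simp: ballot_def)
  have s': "?I \<subseteq> {..<m}" "?J \<subseteq> {..<m}" using s by auto
  have b': "card (?J \<inter> {..<t}) \<le> card (?I \<inter> {..<t})" if "t \<le> m" for t
  proof -
    have "?J \<inter> {..<t} = J \<inter> {..<t}" "?I \<inter> {..<t} = I \<inter> {..<t}" using that by auto
    with b[of t] that show ?thesis by simp
  qed
  \<comment> \<open>The shortened path also ends at a nonnegative height. This rules out a final
    step up that would end at height 0.\<close>
  have bm: "card ?J \<le> card ?I" using b'[of m] card_upto[OF s'(1)] card_upto[OF s'(2)] by simp
  have ci: "m \<in> I \<Longrightarrow> card I = Suc (card ?I)" "m \<notin> I \<Longrightarrow> card I = card ?I"
    and cj: "m \<in> J \<Longrightarrow> card J = Suc (card ?J)" "m \<notin> J \<Longrightarrow> card J = card ?J"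
    using card.remove[OF s(4), of m] card.remove[OF s(5), of m] by simp_all
  have mem: "(?I, ?J) \<in> ballot m k" if "card ?I = card ?J + k" for k
    unfolding ballot_def mem_Collect_eq case_prod_conv using s' b' that by blast
  consider "m \<notin> I" "m \<notin> J" | "m \<in> I" "m \<in> J" | "m \<notin> I" "m \<in> J" | "m \<in> I" "m \<notin> J" by blast
  then show "p \<in> ?A \<union> ?f ` ?A \<union> ?g ` ?B \<union> ?C"
  proof cases
    case 1
    then have "card ?I = card ?J + h" using s(3) ci cj by linarith
    moreover have "p = (?I, ?J)" using 1 IJ by simp
    ultimately show ?thesis using mem by blast
  next
    case 2
    then have "card ?I = card ?J + h" using s(3) ci cj by linarith
    moreover have "p = ?f (?I, ?J)" using 2 IJ by (simp add: insert_absorb)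
    ultimately show ?thesis using mem by blast
  next
    case 3
    then have "card ?I = card ?J + Suc h" using s(3) ci cj by linarith
    moreover have "p = ?g (?I, ?J)" using 3 IJ by (simp add: insert_absorb)
    ultimately show ?thesis using mem by blast
  next
    case 4
    then have h: "h \<noteq> 0" "card ?I = card ?J + (h - 1)" using s(3) ci cj bm by linarith+
    moreover have "p = (\<lambda>(I, J). (insert m I, J)) (?I, ?J)" using 4 IJ by (simp add: insert_absorb)
    ultimately have "p \<in> (\<lambda>(I, J). (insert m I, J)) ` ballot m (h - 1)" using mem by blast
    then show ?thesis using h(1) by simp
  qed
next
  have ext: "card (insert m I \<inter> {..<t}) = card (I \<inter> {..<t}) + (if t = Suc m then 1 else 0)"
    "card (I \<inter> {..<Suc m}) = card I"
    if "I \<subseteq> {..<m}" "t \<le> Suc m" for I t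
  proof -
    have f: "finite I" "m \<notin> I" using that finite_subset by auto
    show "card (I \<inter> {..<Suc m}) = card I" using card_upto[OF that(1), of "Suc m"] by simp
    show "card (insert m I \<inter> {..<t}) = card (I \<inter> {..<t}) + (if t = Suc m then 1 else 0)"
    proof (cases "t = Suc m")
      case True
      then have "insert m I \<inter> {..<t} = insert m (I \<inter> {..<t})" by auto
      then show ?thesis using f True by simp
    next
      case False
      then have "insert m I \<inter> {..<t} = I \<inter> {..<t}" using that by auto
      then show ?thesis using False by simp
    qed
  qed
  fix p assume "p \<in> ?A \<union> ?f ` ?A \<union> ?g ` ?B \<union> ?C"
  then consider "p \<in> ?A" | "p \<in> ?f ` ?A" | "p \<in> ?g ` ?B"
    | k where "h = Suc k" "p \<in> (\<lambda>(I, J). (insert m I, J)) ` ballot m k"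
  proof (cases h)
    case 0
    with \<open>p \<in> ?A \<union> ?f ` ?A \<union> ?g ` ?B \<union> ?C\<close> have "p \<in> ?A \<union> ?f ` ?A \<union> ?g ` ?B" by simp
    with that show ?thesis by blast
  next
    case (Suc k)
    with \<open>p \<in> ?A \<union> ?f ` ?A \<union> ?g ` ?B \<union> ?C\<close>
    have "p \<in> ?A \<union> ?f ` ?A \<union> ?g ` ?B \<union> (\<lambda>(I, J). (insert m I, J)) ` ballot m k" by simp
    with that Suc show ?thesis by blast
  qed
  then obtain I J k where q: "(I, J) \<in> ballot m k"
    and p: "p = (I, J) \<and> k = h \<or> p = (insert m I, insert m J) \<and> k = h \<or>
      p = (I, insert m J) \<and> k = Suc h \<or> p = (insert m I, J) \<and> h = Suc k"
    by cases (metis surj_pair, fastforce+)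
  have s: "I \<subseteq> {..<m}" "J \<subseteq> {..<m}" "card I = card J + k" "finite I" "finite J"
    and b: "\<And>t. t \<le> m \<Longrightarrow> card (J \<inter> {..<t}) \<le> card (I \<inter> {..<t})"
    using q finite_subset by (auto simp: ballot_def)
  have m: "m \<notin> I" "m \<notin> J" using s by auto
  have b1: "card (J \<inter> {..<t}) \<le> card (I \<inter> {..<t})"
    "t = Suc m \<Longrightarrow> card (J \<inter> {..<t}) + k = card (I \<inter> {..<t})" if "t \<le> Suc m" for t
    using that b[of t] ext(2)[OF s(1) le_refl] ext(2)[OF s(2) le_refl] s(3)
    by (cases "t = Suc m", auto)
  show "p \<in> ?L"
    using p s m b1 by (auto simp: ballot_def ext(1)[OF s(1)] ext(1)[OF s(2)] trans_le_add1
        intro: le_SucI)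
qed

text \<open>A ballot number in reflection form. The four kinds of last step match the terms of
  Pascal's rule applied twice.\<close>

lemma card_ballot: "card (ballot m h) + (2 * m choose (m + h + 2)) = 2 * m choose (m + h)"
proof (induction m arbitrary: h)
  case 0
  have "ballot 0 h = (if h = 0 then {({}, {})} else {})" by (auto simp: ballot_def)
  then show ?case by (cases h) auto
next
  case (Suc m)
  let ?f = "\<lambda>(I, J). (insert m I, insert m J)" and ?g = "\<lambda>(I, J). (I, insert m J)"
    and ?h = "\<lambda>(I, J). (insert m I, J)"
  have notin: "m \<notin> I" "m \<notin> J" if "(I, J) \<in> ballot m k" for I J k
    using that by (auto simp: ballot_def)
  have ins: "insert m I = insert m I' \<longleftrightarrow> I = I'" if "m \<notin> I" "m \<notin> I'" for I I' :: "nat set"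
    using that by (metis insert_ident)
  have inj: "inj_on ?f (ballot m k)" "inj_on ?g (ballot m k)" "inj_on ?h (ballot m k)" for k
    by (auto intro!: inj_onI simp: ins notin dest: notin)
  define c where "c = (if h = 0 then 0 else card (ballot m (h - 1)))"
  have "card (ballot (Suc m) h) = 2 * card (ballot m h) + card (ballot m (Suc h)) + c"
  proof -
    let ?C = "if h = 0 then {} else ?h ` ballot m (h - 1)"
    have "card ?C = c" by (simp add: c_def card_image[OF inj(3)])
    moreover have "ballot m h \<inter> ?f ` ballot m h = {}"
      "(ballot m h \<union> ?f ` ballot m h) \<inter> ?g ` ballot m (Suc h) = {}"
      "(ballot m h \<union> ?f ` ballot m h \<union> ?g ` ballot m (Suc h)) \<inter> ?C = {}"
      by (auto dest: notin)
    ultimately show ?thesis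
      unfolding ballot_split
      by (simp add: card_Un_disjoint finite_ballot card_image[OF inj(1)] card_image[OF inj(2)])
  qed
  moreover have "card (ballot m (Suc h)) + (2 * m choose (m + h + 3)) = 2 * m choose (m + h + 1)"
    using Suc.IH[of "Suc h"] by (simp add: numeral_3_eq_3)
  moreover have "c = 0" if "h = 0" using that by (simp add: c_def)
  \<comment> \<open>The term for a last step up. For h = 0 there is none, and the two binomials
    agree by symmetry; m = h = 0 is an exception because m + h - 1 is truncated at 0.\<close>
  moreover have "c + (2 * m choose (m + h + 1)) = 2 * m choose (m + h - 1)
      \<or> (m = 0 \<and> h = 0 \<and> c = 0)"
  proof (cases h)
    case 0
    show ?thesis
    proof (cases m)
      case (Suc k)
      then have "2 * m choose k = 2 * m choose (m + 1)"
        using binomial_symmetric[of k "2 * m"] by simp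
      then show ?thesis using 0 Suc by (simp add: c_def)
    qed (use 0 in \<open>simp add: c_def\<close>)
  next
    case (Suc k)
    then show ?thesis using Suc.IH[of k] by (simp add: c_def)
  qed
  moreover have "2 * Suc m choose (Suc m + h + 2) =
      (2 * m choose (m + h + 3)) + 2 * (2 * m choose (m + h + 2)) + (2 * m choose (m + h + 1))"
    using choose_step[of "2 * m" "m + h + 1"] by (simp add: numeral_3_eq_3)
  moreover have "2 * Suc m choose (Suc m + h) =
      (2 * m choose (m + h + 1)) + 2 * (2 * m choose (m + h)) + (2 * m choose (m + h - 1))"
    if nz: "m + h \<noteq> 0"
  proof -
    obtain k where k: "m + h = Suc k" using not0_implies_Suc[OF nz] by blast
    then show ?thesis using choose_step[of "2 * m" k] by simp
  qed
  ultimately show ?case using Suc.IH[of h]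
    by (cases "m + h = 0") (auto simp: numeral_2_eq_2)
qed

lemma card_std_pairs: "card (std_pairs m) = catalan (m + 1)"
  using card_ballot[of m 0] catalan_Suc_eq_diff[of m] by (simp add: std_pairs_eq_ballot)

lemma finite_std_pairs: "finite (std_pairs m)"
  by (simp add: std_pairs_eq_ballot finite_ballot)

lemma dim_sym_state_space:
  "fs.dim (sym_state_space m :: (nat set \<times> nat set \<Rightarrow> 'a::field) set) = catalan (m + 1)"
  by (simp add: sym_state_space_def dim_coord_space finite_std_pairs card_std_pairs)

section \<open>Weights\<close>

lemma finite_sign_vectors: "finite (sign_vectors m)"
  by (auto simp: sign_vectors_def intro: finite_PiE)

lemma card_sign_vectors: "card (sign_vectors m) = 3 ^ m"
  by (simp add: sign_vectors_def card_PiE numeral_3_eq_3)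

lemma support_size_upd:
  "support_size (Suc m) (g(m := y)) = support_size m g + (if y \<noteq> 0 then 1 else 0)"
proof -
  have "{i. i < Suc m \<and> (g(m := y)) i \<noteq> 0} =
      {i. i < m \<and> g i \<noteq> 0} \<union> (if y \<noteq> 0 then {m} else {})"
    by (auto simp: less_Suc_eq)
  then show ?thesis by (auto simp: support_size_def)
qed

lemma support_size_le: "support_size m \<epsilon> \<le> m"
proof -
  have "card {i. i < m \<and> \<epsilon> i \<noteq> 0} \<le> card {..<m}" by (intro card_mono) auto
  then show ?thesis by (simp add: support_size_def)
qed

text \<open>Appending a nonzero entry preserves the parity condition and appending 0 reverses it, so
  the number e of solutions satisfies e(m+1) = 2 e(m) + (3^m - e(m)).\<close>

lemma card_parity_sign_vectors:
  "card {\<epsilon> \<in> sign_vectors m. support_size m \<epsilon> mod 2 = m mod 2} = (3 ^ m + 1) div 2"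
proof -
  let ?E = "\<lambda>m. {\<epsilon> \<in> sign_vectors m. support_size m \<epsilon> mod 2 = m mod 2}"
  have "2 * card (?E m) = 3 ^ m + 1"
  proof (induction m)
    case 0
    have "?E 0 = {\<lambda>_. undefined}" by (auto simp: sign_vectors_def support_size_def)
    then show ?case by simp
  next
    case (Suc m)
    let ?N = "sign_vectors m - ?E m"
    let ?u = "\<lambda>(y, g). g(m := y :: int)"
    have s: "sign_vectors (Suc m) = ?u ` ({- 1, 0, 1} \<times> sign_vectors m)"
      unfolding sign_vectors_def lessThan_Suc by (rule PiE_insert_eq)
    have und: "g m = undefined" if "g \<in> sign_vectors m" for g
      using that by (auto simp: sign_vectors_def PiE_def extensional_def)
    have inj: "inj_on ?u (UNIV \<times> sign_vectors m)"
    proof (rule inj_onI, clarify)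
      fix y z g h assume g: "g \<in> sign_vectors m" and h: "h \<in> sign_vectors m"
        and e: "g(m := y) = h(m := z)"
      have "y = z" using fun_cong[OF e, of m] by simp
      moreover have "g i = h i" for i
        using fun_cong[OF e, of i] und[OF g] und[OF h] by (cases "i = m") auto
      ultimately show "y = z \<and> g = h" by auto
    qed
    have "?E (Suc m) = ?u ` ({- 1, 1} \<times> ?E m \<union> {0} \<times> ?N)"
    proof -
      have "(support_size (Suc m) (g(m := y)) mod 2 = Suc m mod 2) \<longleftrightarrow>
          (if y = 0 then \<not> support_size m g mod 2 = m mod 2 else support_size m g mod 2 = m mod 2)"
        for y g
        unfolding support_size_upd by (simp add: mod_Suc)
      then show ?thesis unfolding s by (fastforce split: if_splits)
    qed
    moreover have "card (?u ` ({- 1, 1} \<times> ?E m \<union> {0} \<times> ?N)) = card ({- 1, 1 :: int} \<times> ?E m \<union> {0} \<times> ?N)"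
      by (intro card_image inj_on_subset[OF inj]) auto
    moreover have "card ({- 1, 1 :: int} \<times> ?E m \<union> {0} \<times> ?N) = 2 * card (?E m) + card ?N"
      using finite_sign_vectors[of m] by (subst card_Un_disjoint) auto
    moreover have "card ?N + card (?E m) = 3 ^ m"
    proof -
      have "card ?N = card (sign_vectors m) - card (?E m)"
        using finite_sign_vectors[of m] by (intro card_Diff_subset) auto
      moreover have "card (?E m) \<le> card (sign_vectors m)"
        using finite_sign_vectors[of m] by (intro card_mono) auto
      ultimately show ?thesis by (simp add: card_sign_vectors)
    qed
    ultimately show ?case using Suc by simp
  qed
  then show ?thesis by simp
qed

lemma wedge_weight_apply:
  "i < m \<Longrightarrow> wedge_weight m S i =
     (if i \<in> S \<and> m + i \<notin> S then 1 else if i \<notin> S \<and> m + i \<in> S then - 1 else 0)"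
  by (simp add: wedge_weight_def)

lemma wedge_weight_sign_vector: "wedge_weight m S \<in> sign_vectors m"
  by (auto simp: wedge_weight_def sign_vectors_def)

lemma sign_vector_eqI:
  "\<epsilon> \<in> sign_vectors m \<Longrightarrow> \<delta> \<in> sign_vectors m \<Longrightarrow> (\<And>i. i < m \<Longrightarrow> \<epsilon> i = \<delta> i) \<Longrightarrow> \<epsilon> = \<delta>"
  unfolding sign_vectors_def by (rule PiE_ext) auto

lemma pair_invariant_weight: "pair_invariant m (\<lambda>S. wedge_weight m S = \<epsilon>)"
proof -
  have "wedge_weight m (insert (m + t) (insert t S)) = wedge_weight m S"
    if "t < m" "t \<notin> S" "m + t \<notin> S" for t S
    by (rule sign_vector_eqI[OF wedge_weight_sign_vector wedge_weight_sign_vector])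
      (use that in \<open>auto simp: wedge_weight_apply\<close>)
  then show ?thesis by (simp add: pair_invariant_def)
qed

definition full_pairs :: "nat \<Rightarrow> nat set \<Rightarrow> nat set" where
  "full_pairs m S = {i. i < m \<and> i \<in> S \<and> m + i \<in> S}"

lemma card_eq_support_size:
  assumes S: "S \<subseteq> {..<2 * m}"
  shows "card S = support_size m (wedge_weight m S) + 2 * card (full_pairs m S)"
proof -
  let ?e = "{i. i < m \<and> i \<in> S \<and> m + i \<notin> S}" and ?f = "{i. i < m \<and> i \<notin> S \<and> m + i \<in> S}"
  let ?z = "full_pairs m S"
  have "S = (?e \<union> ?z) \<union> (+) m ` (?f \<union> ?z)"
  proof (intro Set.set_eqI iffI)
    fix k assume k: "k \<in> S"
    show "k \<in> (?e \<union> ?z) \<union> (+) m ` (?f \<union> ?z)"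
    proof (cases "k < m")
      case False
      moreover have "k < 2 * m" using k S by blast
      ultimately obtain j where j: "k = m + j" "j < m" using le_Suc_ex[of m k] by fastforce
      with k have "j \<in> ?f \<union> ?z" by (simp add: full_pairs_def)
      with j show ?thesis by blast
    qed (use k in \<open>simp add: full_pairs_def\<close>)
  next
    fix k assume "k \<in> (?e \<union> ?z) \<union> (+) m ` (?f \<union> ?z)"
    then show "k \<in> S" by (elim UnE imageE) (simp_all add: full_pairs_def)
  qed
  moreover have "card ((?e \<union> ?z) \<union> (+) m ` (?f \<union> ?z)) = card (?e \<union> ?z) + card ((+) m ` (?f \<union> ?z))"
    by (rule card_Un_disjoint) (auto simp: full_pairs_def)
  moreover have "card (?e \<union> ?z) = card ?e + card ?z"
    by (rule card_Un_disjoint) (auto simp: full_pairs_def)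
  moreover have "card (?f \<union> ?z) = card ?f + card ?z"
    by (rule card_Un_disjoint) (auto simp: full_pairs_def)
  moreover have "card ((+) m ` (?f \<union> ?z)) = card (?f \<union> ?z)"
    by (rule card_image) simp
  moreover have "{i. i < m \<and> wedge_weight m S i \<noteq> 0} = ?e \<union> ?f"
    by (auto simp: wedge_weight_apply split: if_splits)
  moreover have "card (?e \<union> ?f) = card ?e + card ?f"
    by (rule card_Un_disjoint) auto
  ultimately show ?thesis by (simp add: support_size_def)
qed

text \<open>A weight prescribes which positions are used exactly once. The only freedom left is
  which of its zeros are used twice rather than never.\<close>

lemma bij_betw_full_pairs:
  assumes \<epsilon>: "\<epsilon> \<in> sign_vectors m"
  shows "bij_betw (full_pairs m) {S. S \<subseteq> {..<2 * m} \<and> wedge_weight m S = \<epsilon>} (Pow {i. i < m \<and> \<epsilon> i = 0})"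
proof -
  let ?f = "\<lambda>T. {i. i < m \<and> \<epsilon> i = 1} \<union> (+) m ` {i. i < m \<and> \<epsilon> i = - 1} \<union> T \<union> (+) m ` T"
  have vals: "\<epsilon> i = - 1 \<or> \<epsilon> i = 0 \<or> \<epsilon> i = 1" if "i < m" for i
    using \<epsilon> that by (auto simp: sign_vectors_def)
  have low: "k \<in> ?f T \<longleftrightarrow> \<epsilon> k = 1 \<or> k \<in> T" if "k < m" "T \<subseteq> {i. i < m \<and> \<epsilon> i = 0}" for k T
    using that by auto
  have high: "m + k \<in> ?f T \<longleftrightarrow> \<epsilon> k = - 1 \<or> k \<in> T" if "k < m" "T \<subseteq> {i. i < m \<and> \<epsilon> i = 0}" for k T
    using that by auto
  show ?thesis
  proof (rule bij_betw_byWitness[where f' = ?f])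
    show "\<forall>S\<in>{S. S \<subseteq> {..<2 * m} \<and> wedge_weight m S = \<epsilon>}. ?f (full_pairs m S) = S"
    proof (intro ballI Set.set_eqI)
      fix S k assume "S \<in> {S. S \<subseteq> {..<2 * m} \<and> wedge_weight m S = \<epsilon>}"
      then have S: "S \<subseteq> {..<2 * m}" and w: "\<And>i. i < m \<Longrightarrow> \<epsilon> i = wedge_weight m S i" by auto
      have T: "full_pairs m S \<subseteq> {i. i < m \<and> \<epsilon> i = 0}"
        by (auto simp: full_pairs_def w wedge_weight_apply)
      consider "k < m" | j where "j < m" "k = m + j" | "k \<ge> 2 * m"
        by (metis add_less_cancel_left le_Suc_ex mult_2 not_less)
      then show "k \<in> ?f (full_pairs m S) \<longleftrightarrow> k \<in> S"
      proof cases
        case 1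
        then show ?thesis unfolding low[OF 1 T] by (auto simp: w wedge_weight_apply full_pairs_def)
      next
        case 2
        then show ?thesis unfolding 2(2) high[OF 2(1) T] by (auto simp: w wedge_weight_apply full_pairs_def)
      next
        case 3
        then show ?thesis using S T by auto
      qed
    qed
    show "\<forall>T\<in>Pow {i. i < m \<and> \<epsilon> i = 0}. full_pairs m (?f T) = T"
    proof (intro ballI Set.set_eqI)
      fix T k assume "T \<in> Pow {i. i < m \<and> \<epsilon> i = 0}"
      then have T: "T \<subseteq> {i. i < m \<and> \<epsilon> i = 0}" by auto
      have "k \<in> full_pairs m (?f T) \<longleftrightarrow> k < m \<and> k \<in> ?f T \<and> m + k \<in> ?f T"
        unfolding full_pairs_def by blast
      also have "\<dots> \<longleftrightarrow> k < m \<and> (\<epsilon> k = 1 \<or> k \<in> T) \<and> (\<epsilon> k = - 1 \<or> k \<in> T)"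
        using low[OF _ T] high[OF _ T] by blast
      also have "\<dots> \<longleftrightarrow> k \<in> T" using T by auto
      finally show "k \<in> full_pairs m (?f T) \<longleftrightarrow> k \<in> T" .
    qed
    show "full_pairs m ` {S. S \<subseteq> {..<2 * m} \<and> wedge_weight m S = \<epsilon>} \<subseteq> Pow {i. i < m \<and> \<epsilon> i = 0}"
      by (auto simp: full_pairs_def wedge_weight_apply)
    show "?f ` Pow {i. i < m \<and> \<epsilon> i = 0} \<subseteq> {S. S \<subseteq> {..<2 * m} \<and> wedge_weight m S = \<epsilon>}"
    proof (rule image_subsetI)
      fix T assume "T \<in> Pow {i. i < m \<and> \<epsilon> i = 0}"
      then have T: "T \<subseteq> {i. i < m \<and> \<epsilon> i = 0}" by auto
      have "?f T \<subseteq> {..<2 * m}" using T by auto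
      moreover have "wedge_weight m (?f T) i = \<epsilon> i" if i: "i < m" for i
        unfolding wedge_weight_apply[OF i] low[OF i T] high[OF i T] using vals[OF i] T by auto
      then have "wedge_weight m (?f T) = \<epsilon>"
        by (intro sign_vector_eqI[OF wedge_weight_sign_vector \<epsilon>])
      ultimately show "?f T \<in> {S. S \<subseteq> {..<2 * m} \<and> wedge_weight m S = \<epsilon>}" by blast
    qed
  qed
qed

section \<open>Weight multiplicities for the standard form\<close>

abbreviation weight_sets :: "nat \<Rightarrow> (nat \<Rightarrow> int) \<Rightarrow> nat \<Rightarrow> nat set set" where
  "weight_sets m \<epsilon> \<equiv> graded m (\<lambda>S. wedge_weight m S = \<epsilon>)"

lemma weight_sets_degree:
  assumes "S \<in> weight_sets m \<epsilon> d"
  shows "d = support_size m \<epsilon> + 2 * card (full_pairs m S)"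
  using assms card_eq_support_size by (auto simp: graded_def)

lemma card_weight_sets:
  assumes \<epsilon>: "\<epsilon> \<in> sign_vectors m"
  shows "card (weight_sets m \<epsilon> (support_size m \<epsilon> + 2 * k)) = (m - support_size m \<epsilon>) choose k"
proof -
  let ?Z = "{i. i < m \<and> \<epsilon> i = 0}"
  have "bij_betw (full_pairs m) (weight_sets m \<epsilon> (support_size m \<epsilon> + 2 * k)) {T. T \<subseteq> ?Z \<and> card T = k}"
  proof (rule bij_betw_subset[OF bij_betw_full_pairs[OF \<epsilon>]])
    show "weight_sets m \<epsilon> (support_size m \<epsilon> + 2 * k) \<subseteq> {S. S \<subseteq> {..<2 * m} \<and> wedge_weight m S = \<epsilon>}"
      by (auto simp: graded_def)
    have "weight_sets m \<epsilon> (support_size m \<epsilon> + 2 * k) =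
        {S \<in> {S. S \<subseteq> {..<2 * m} \<and> wedge_weight m S = \<epsilon>}. card (full_pairs m S) = k}"
      using card_eq_support_size by (auto simp: graded_def)
    moreover have "f ` {S \<in> F. card (f S) = k} = {T \<in> f ` F. card T = k}" for f :: "nat set \<Rightarrow> nat set" and F
      by blast
    ultimately show "full_pairs m ` weight_sets m \<epsilon> (support_size m \<epsilon> + 2 * k) = {T. T \<subseteq> ?Z \<and> card T = k}"
      using bij_betw_imp_surj_on[OF bij_betw_full_pairs[OF \<epsilon>]] by (simp only: Pow_iff)
  qed
  moreover have "card ?Z = m - support_size m \<epsilon>"
  proof -
    have "?Z = {..<m} - {i. i < m \<and> \<epsilon> i \<noteq> 0}" by auto
    moreover have "card ({..<m} - {i. i < m \<and> \<epsilon> i \<noteq> 0}) = m - support_size m \<epsilon>"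
      unfolding support_size_def by (subst card_Diff_subset) auto
    ultimately show ?thesis by simp
  qed
  ultimately show ?thesis using n_subsets[of ?Z k] by (simp add: bij_betw_same_card)
qed

lemma finite_graded: "finite (graded m Q d)"
  by (rule finite_subset[of _ "Pow {..<2 * m}"]) (auto simp: graded_def)

definition std_weight_space :: "nat \<Rightarrow> (nat \<Rightarrow> int) \<Rightarrow> (nat set \<Rightarrow> 'a::field) set" where
  "std_weight_space m \<epsilon> = {\<omega> \<in> coord_space (weight_sets m \<epsilon> m). contr m \<omega> = 0}"

lemma subspace_std_weight_space: "fs.subspace (std_weight_space m \<epsilon>)"
  unfolding std_weight_space_def by (intro subspace_kernel subspace_coord_space flinear_lam)

text \<open>Full pairs are chosen among the 2r zeros of the weight: r of them in degree m and r - 1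
  in degree m - 2. Contraction is onto within the weight, so the multiplicity is C(2r, r) - C(2r,
  r-1).\<close>

lemma dim_std_weight_space:
  assumes \<epsilon>: "\<epsilon> \<in> sign_vectors m" and r: "m - support_size m \<epsilon> = 2 * r"
  shows "fs.dim (std_weight_space m \<epsilon> :: (nat set \<Rightarrow> 'a::field_char_0) set) = catalan r"
proof -
  let ?V = "coord_space (weight_sets m \<epsilon> m) :: (nat set \<Rightarrow> 'a) set"
  \<comment> \<open>The conjunct 2 \<le> m empties the set when m - 2 is truncated.\<close>
  let ?Y = "{R. R \<in> weight_sets m \<epsilon> (m - 2) \<and> 2 \<le> m}"
  have m: "m = support_size m \<epsilon> + 2 * r" using r support_size_le[of m \<epsilon>] by simp
  note Q = pair_invariant_weight[of m \<epsilon>]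
  have "fs.dim {v \<in> ?V. contr m v = 0} + card ?Y = fs.dim ?V"
  proof (rule rank_nullity[OF finite_graded[of m "\<lambda>S. wedge_weight m S = \<epsilon>" m]])
    show "finite ?Y" using finite_graded[of m "\<lambda>S. wedge_weight m S = \<epsilon>"] by auto
    fix y assume y: "y \<in> ?Y"
    then have "ind y \<in> coord_space (weight_sets m \<epsilon> (m - 2))" by (simp add: ind_in_coord_space)
    moreover have "m - 2 < m" using y by auto
    ultimately obtain \<eta> :: "nat set \<Rightarrow> 'a"
      where \<eta>: "\<eta> \<in> coord_space (weight_sets m \<epsilon> (m - 2 + 2))" "contr m \<eta> = ind y"
      using contr_onto[OF Q] by blast
    have "m - 2 + 2 = m" using y by auto
    with \<eta> show "\<exists>v\<in>?V. contr m v = ind y" by metis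
  next
    fix v assume v: "v \<in> ?V"
    show "contr m v \<in> coord_space ?Y"
    proof (cases "m < 2")
      case True
      then show ?thesis using contr_graded_low[OF v] by (simp add: coord_space_0)
    next
      case False
      then have "m - 2 + 2 = m" by simp
      with v have "contr m v \<in> coord_space (weight_sets m \<epsilon> (m - 2))"
        using contr_graded[OF Q] by metis
      with False show ?thesis by simp
    qed
  qed (simp_all add: subspace_coord_space flinear_lam)
  moreover have "card ?Y = 2 * r choose (r + 1)"
  \<comment> \<open>For r = 0 the weight occupies m positions already and cannot occur in degree m -
    2.\<close>
  proof (cases r)
    case 0
    have "?Y = {}"
    proof (rule ccontr)
      assume "?Y \<noteq> {}"
      then obtain R where R: "R \<in> weight_sets m \<epsilon> (m - 2)" "2 \<le> m" by auto
      from weight_sets_degree[OF R(1)] R(2) m 0 show False by linarith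
    qed
    then show ?thesis unfolding 0 by (simp only: card.empty) simp
  next
    case (Suc k)
    then have "m - 2 = support_size m \<epsilon> + 2 * k" "2 \<le> m" using m by auto
    then have "card ?Y = (m - support_size m \<epsilon>) choose k" using card_weight_sets[OF \<epsilon>, of k] by simp
    also have "\<dots> = 2 * r choose (r + 1)"
      using binomial_symmetric[of k "2 * r"] Suc r by simp
    finally show ?thesis .
  qed
  moreover have "fs.dim ?V = 2 * r choose r"
    using card_weight_sets[OF \<epsilon>, of r] m r by (simp add: dim_coord_space finite_graded)
  ultimately show ?thesis
    using catalan_eq_diff[of r] by (simp add: std_weight_space_def)
qed

lemma catalan_pos: "catalan r > 0"
proof -
  have "r + 1 \<le> 2 * r choose r"
  proof (cases "r = 0")
    case False
    have "2 * r choose 1 \<le> 2 * r choose r" by (rule binomial_maximum')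
    with False show ?thesis by simp
  qed simp
  then show ?thesis by (simp add: catalan_def div_greater_zero_iff)
qed

text \<open>With the wrong parity no basis wedge of degree m has the weight; with the right one the
  dimension is a Catalan number, which is positive.\<close>

lemma std_weight_space_nontrivial:
  assumes \<epsilon>: "\<epsilon> \<in> sign_vectors m"
  shows "(std_weight_space m \<epsilon> :: (nat set \<Rightarrow> 'a::field_char_0) set) \<noteq> {0} \<longleftrightarrow>
    support_size m \<epsilon> mod 2 = m mod 2"
proof
  assume "support_size m \<epsilon> mod 2 = m mod 2"
  then have "2 dvd m - support_size m \<epsilon>"
    using support_size_le[of m \<epsilon>] by (metis mod_eq_dvd_iff_nat)
  then obtain r where "m - support_size m \<epsilon> = 2 * r" by blast
  from dim_std_weight_space[OF \<epsilon> this, where 'a = 'a] catalan_pos[of r]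
  show "(std_weight_space m \<epsilon> :: (nat set \<Rightarrow> 'a) set) \<noteq> {0}"
    using fs.dim_le_card[of "{0}" "{} :: (nat set \<Rightarrow> 'a) set"] by auto
next
  assume nz: "(std_weight_space m \<epsilon> :: (nat set \<Rightarrow> 'a) set) \<noteq> {0}"
  have "weight_sets m \<epsilon> m \<noteq> {}"
  proof
    assume e: "weight_sets m \<epsilon> m = {}"
    have "\<omega> = 0" if "\<omega> \<in> std_weight_space m \<epsilon>" for \<omega> :: "nat set \<Rightarrow> 'a"
      using that unfolding std_weight_space_def e by (auto simp: coord_space_def pointwise)
    moreover have "0 \<in> (std_weight_space m \<epsilon> :: (nat set \<Rightarrow> 'a) set)"
      using subspace_std_weight_space by (rule fs.subspace_0)
    ultimately show False using nz by blast
  qed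
  then obtain S where "S \<in> weight_sets m \<epsilon> m" by blast
  from weight_sets_degree[OF this] show "support_size m \<epsilon> mod 2 = m mod 2"
    by (metis mod_mult_self2)
qed

definition weight_part :: "nat \<Rightarrow> (nat \<Rightarrow> int) \<Rightarrow> (nat set \<Rightarrow> 'a::field) \<Rightarrow> nat set \<Rightarrow> 'a" where
  "weight_part m \<epsilon> \<omega> = (\<lambda>S. if wedge_weight m S = \<epsilon> then \<omega> S else 0)"

text \<open>Contraction removes a pair, which leaves the weight unchanged, so it commutes with
  projection to a weight.\<close>

lemma weight_part_in_std_weight_space:
  assumes "\<omega> \<in> primitive_module m (std_form m)"
  shows "weight_part m \<epsilon> \<omega> \<in> std_weight_space m \<epsilon>"
proof -
  have \<omega>: "\<omega> \<in> coord_space (ksubsets (2 * m) m)" "contr m \<omega> = 0"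
    using assms by (auto simp: primitive_module_alt ext_power_def)
  have g: "weight_part m \<epsilon> \<omega> \<in> coord_space (weight_sets m \<epsilon> m)"
    using \<omega>(1) by (auto simp: weight_part_def coord_space_def graded_def ksubsets_def)
  have "contr m (weight_part m \<epsilon> \<omega>) R = 0" for R
  proof (cases "R \<subseteq> {..<2 * m} \<and> wedge_weight m R = \<epsilon>")
    case True
    have "an (m + t) (an t (weight_part m \<epsilon> \<omega>)) R = an (m + t) (an t \<omega>) R" if "t < m" for t
      using pair_invariant_weight[of m \<epsilon>] True that
      by (auto simp: an_def weight_part_def pair_invariant_def insert_commute)
    then have "contr m (weight_part m \<epsilon> \<omega>) R = contr m \<omega> R"
      by (simp add: contr_eq sum_fun_apply)
    then show ?thesis using \<omega>(2) by (simp add: pointwise)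
  next
    case False
    show ?thesis
    proof (cases "m < 2")
      case True
      then show ?thesis using contr_graded_low[OF g] by (simp add: pointwise)
    next
      case m: False
      then have "m - 2 + 2 = m" by simp
      then have "contr m (weight_part m \<epsilon> \<omega>) \<in> coord_space (weight_sets m \<epsilon> (m - 2))"
        using g contr_graded[OF pair_invariant_weight] by metis
      with False show ?thesis by (auto simp: coord_space_def graded_def)
    qed
  qed
  then have "contr m (weight_part m \<epsilon> \<omega>) = 0" by (intro ext) (simp add: pointwise)
  with g show ?thesis by (simp add: std_weight_space_def)
qed

lemma sum_weight_part: "(\<Sum>\<epsilon>\<in>sign_vectors m. weight_part m \<epsilon> \<omega>) = \<omega>"
proof
  fix S
  have "(\<Sum>\<epsilon>\<in>sign_vectors m. weight_part m \<epsilon> \<omega>) S =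
      (\<Sum>\<epsilon>\<in>sign_vectors m. if wedge_weight m S = \<epsilon> then \<omega> S else 0)"
    by (simp add: sum_fun_apply weight_part_def)
  then show "(\<Sum>\<epsilon>\<in>sign_vectors m. weight_part m \<epsilon> \<omega>) S = \<omega> S"
    using wedge_weight_sign_vector[of m S] finite_sign_vectors[of m] by simp
qed

lemma std_weight_space_subset: "std_weight_space m \<epsilon> \<subseteq> primitive_module m (std_form m)"
  by (auto simp: std_weight_space_def primitive_module_alt ext_power_def graded_ksubsets)

lemma subspace_primitive_module: "fs.subspace (primitive_module m G)"
  unfolding primitive_module_alt ext_power_def
  by (intro subspace_kernel subspace_coord_space flinear_lam)

section \<open>Transport along a symplectic eigenbasis\<close>

definition diag_op :: "(nat \<Rightarrow> 'a::field) \<Rightarrow> (nat set \<Rightarrow> 'a) \<Rightarrow> nat set \<Rightarrow> 'a" where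
  "diag_op d \<omega> = (\<lambda>S. (\<Prod>k\<in>S. d k) * \<omega> S)"

lemma ext_diag:
  fixes \<omega> :: "nat set \<Rightarrow> 'a::field_char_0"
  assumes "\<omega> \<in> fock n"
  shows "ext n (mat n n (\<lambda>(i, j). if i = j then d j else 0)) \<omega> = diag_op d \<omega>"
  using assms
proof (induction rule: fock_induct)
  case vac
  have "ind {} = diag_op d (ind {})" by (rule ext) (auto simp: diag_op_def ind_def)
  then show ?case by (simp only: ext_vac)
next
  case (cr b \<eta>)
  let ?D = "mat n n (\<lambda>(i, j). if i = j then d j else 0)"
  have "crv n (\<lambda>i. ?D $$ (i, b)) (diag_op d \<eta>) =
      crv n (\<lambda>i. d b * (if i = b then 1 else 0)) (diag_op d \<eta>)"
    using cr by (intro crv_cong) auto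
  also have "\<dots> = fscale (d b) (cr b (diag_op d \<eta>))"
    using cr by (simp only: crv_vec_scale crv_unit)
  also have "\<dots> = diag_op d (cr b \<eta>)"
  proof
    fix S
    have "(\<Prod>k\<in>S. d k) = d b * (\<Prod>k\<in>S - {b}. d k)" if "finite S" "b \<in> S"
      using that by (rule prod.remove)
    \<comment> \<open>Infinite index sets lie outside the support. They are treated apart because a
      product over an infinite set is 1 and does not split off a factor.\<close>
    moreover have "\<eta> (S - {b}) = 0" if "infinite S"
    proof -
      have "S - {b} \<notin> Pow {..<n}"
        using that finite_subset[of "S - {b}" "{..<n}"] by auto
      then show ?thesis using cr(2) by (simp add: coord_space_def)
    qed
    ultimately show "fscale (d b) (cr b (diag_op d \<eta>)) S = diag_op d (cr b \<eta>) S"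
      by (cases "finite S") (auto simp: fscale_apply cr_def diag_op_def)
  qed
  finally show ?case using cr by (simp only: ext_cr)
next
  case (add \<eta> \<theta>)
  have "diag_op d (\<eta> + \<theta>) = diag_op d \<eta> + diag_op d \<theta>"
    by (rule ext) (simp add: diag_op_def pointwise algebra_simps)
  with add show ?case by (simp only: ext_add)
next
  case (scale c \<eta>)
  have "diag_op d (fscale c \<eta>) = fscale c (diag_op d \<eta>)"
    by (rule ext) (simp add: diag_op_def fscale_apply)
  with scale show ?case by (simp only: ext_scale)
qed

definition pair_diag :: "nat \<Rightarrow> (nat \<Rightarrow> 'a::field) \<Rightarrow> nat \<Rightarrow> 'a" where
  "pair_diag m x k = (if k < m then x k else inverse (x (k - m)))"

text \<open>A full pair contributes a root times its inverse, so only the positions used once leave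
  a factor.\<close>

lemma prod_pair_diag:
  fixes x :: "nat \<Rightarrow> 'a::field"
  assumes S: "S \<subseteq> {..<2 * m}" and x: "\<And>i. i < m \<Longrightarrow> x i \<noteq> 0"
  shows "(\<Prod>k\<in>S. pair_diag m x k) = (\<Prod>i<m. x i powi wedge_weight m S i)"
proof -
  have split: "S = (S \<inter> {..<m}) \<union> (+) m ` {i. i < m \<and> m + i \<in> S}"
  proof (intro Set.set_eqI iffI)
    fix k assume k: "k \<in> S"
    show "k \<in> (S \<inter> {..<m}) \<union> (+) m ` {i. i < m \<and> m + i \<in> S}"
    proof (cases "k < m")
      case False
      moreover have "k < 2 * m" using k S by blast
      ultimately obtain j where j: "k = m + j" "j < m" using le_Suc_ex[of m k] by fastforce
      with k have "j \<in> {i. i < m \<and> m + i \<in> S}" by simp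
      with j show ?thesis by blast
    qed (use k in simp)
  next
    fix k assume "k \<in> (S \<inter> {..<m}) \<union> (+) m ` {i. i < m \<and> m + i \<in> S}"
    then show "k \<in> S" by (elim UnE imageE) simp_all
  qed
  have "(\<Prod>k\<in>S. pair_diag m x k) =
      (\<Prod>k\<in>S \<inter> {..<m}. pair_diag m x k) * (\<Prod>k\<in>(+) m ` {i. i < m \<and> m + i \<in> S}. pair_diag m x k)"
  proof -
    have "finite ((+) m ` {i. i < m \<and> m + i \<in> S})" by simp
    moreover have "finite (S \<inter> {..<m})" by simp
    moreover have "(S \<inter> {..<m}) \<inter> (+) m ` {i. i < m \<and> m + i \<in> S} = {}" by auto
    ultimately have "prod (pair_diag m x) ((S \<inter> {..<m}) \<union> (+) m ` {i. i < m \<and> m + i \<in> S}) =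
      (\<Prod>k\<in>S \<inter> {..<m}. pair_diag m x k) * (\<Prod>k\<in>(+) m ` {i. i < m \<and> m + i \<in> S}. pair_diag m x k)"
      by (intro prod.union_disjoint)
    then show ?thesis unfolding split[symmetric] .
  qed
  also have "(\<Prod>k\<in>(+) m ` {i. i < m \<and> m + i \<in> S}. pair_diag m x k) =
      (\<Prod>i\<in>{i. i < m \<and> m + i \<in> S}. inverse (x i))"
    by (subst prod.reindex) (auto simp: pair_diag_def)
  also have "\<dots> = (\<Prod>i<m. if m + i \<in> S then inverse (x i) else 1)"
  proof -
    have "{i. i < m \<and> m + i \<in> S} = {i \<in> {..<m}. m + i \<in> S}" by auto
    then show ?thesis by (simp only: prod.inter_filter finite_lessThan)
  qed
  also have "(\<Prod>k\<in>S \<inter> {..<m}. pair_diag m x k) = (\<Prod>i<m. if i \<in> S then x i else 1)"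
  proof -
    have "(\<Prod>k\<in>S \<inter> {..<m}. pair_diag m x k) = (\<Prod>k\<in>{i \<in> {..<m}. i \<in> S}. x k)"
      by (rule prod.cong) (auto simp: pair_diag_def)
    then show ?thesis by (simp only: prod.inter_filter finite_lessThan)
  qed
  also have "(\<Prod>i<m. if i \<in> S then x i else 1) * (\<Prod>i<m. if m + i \<in> S then inverse (x i) else 1)
      = (\<Prod>i<m. x i powi wedge_weight m S i)"
    unfolding prod.distrib[symmetric] using x by (intro prod.cong) (auto simp: wedge_weight_apply)
  finally show ?thesis .
qed

lemma ext_power_fock: "\<omega> \<in> ext_power n k \<Longrightarrow> \<omega> \<in> fock n"
  by (auto simp: ext_power_def coord_space_def ksubsets_def)

lemma ext_inverse:
  fixes \<omega> :: "nat set \<Rightarrow> 'a::field_char_0"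
  assumes "A \<in> carrier_mat n n" "B \<in> carrier_mat n n" "A * B = 1\<^sub>m n" "\<omega> \<in> fock n"
  shows "ext n A (ext n B \<omega>) = \<omega>"
  using ext_mult[OF assms(1,2,4)] ext_one[OF assms(4)] assms(3) by simp

lemma bij_betw_ext:
  fixes A :: "'a::field_char_0 mat"
  assumes "A \<in> carrier_mat n n" "B \<in> carrier_mat n n" "A * B = 1\<^sub>m n" "B * A = 1\<^sub>m n"
  shows "bij_betw (ext n A) (ext_power n k) (ext_power n k)"
  by (rule bij_betw_byWitness[where f' = "ext n B"])
    (auto simp: ext_inverse[OF assms(1-3)] ext_inverse[OF assms(2,1,4)] ext_power_fock intro: ext_degree)

lemma bij_betw_ext_primitive:
  fixes A :: "'a::field_char_0 mat"
  assumes A: "A \<in> carrier_mat (2 * m) (2 * m)" and B: "B \<in> carrier_mat (2 * m) (2 * m)"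
    and AB: "A * B = 1\<^sub>m (2 * m)" and BA: "B * A = 1\<^sub>m (2 * m)"
    and G: "alternating (2 * m) G"
  shows "bij_betw (ext (2 * m) A) (primitive_module m (transpose_mat A * G * A)) (primitive_module m G)"
proof (rule bij_betw_byWitness[where f' = "ext (2 * m) B"])
  let ?G' = "transpose_mat A * G * A"
  show "\<forall>\<omega>\<in>primitive_module m ?G'. ext (2 * m) B (ext (2 * m) A \<omega>) = \<omega>"
    "\<forall>\<omega>\<in>primitive_module m G. ext (2 * m) A (ext (2 * m) B \<omega>) = \<omega>"
    by (auto simp: primitive_module_alt ext_inverse[OF A B AB] ext_inverse[OF B A BA] ext_power_fock)
  show "ext (2 * m) A ` primitive_module m ?G' \<subseteq> primitive_module m G"
    by (auto simp: primitive_module_alt lam_ext[OF G A] ext_power_fock intro: ext_degree)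
  show "ext (2 * m) B ` primitive_module m G \<subseteq> primitive_module m ?G'"
  proof (rule image_subsetI)
    fix \<omega> assume "\<omega> \<in> primitive_module m G"
    then have \<omega>: "\<omega> \<in> ext_power (2 * m) m" "lam (2 * m) G \<omega> = 0" by (auto simp: primitive_module_alt)
    let ?\<eta> = "ext (2 * m) B \<omega>"
    have \<eta>: "?\<eta> \<in> ext_power (2 * m) m" using \<omega>(1) by (rule ext_degree)
    have "ext (2 * m) A (lam (2 * m) ?G' ?\<eta>) = lam (2 * m) G (ext (2 * m) A ?\<eta>)"
      by (rule lam_ext[OF G A ext_power_fock[OF \<eta>], symmetric])
    also have "\<dots> = 0" using \<omega> by (simp add: ext_inverse[OF A B AB] ext_power_fock)
    finally have "ext (2 * m) B (ext (2 * m) A (lam (2 * m) ?G' ?\<eta>)) = 0" by simp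
    then have "lam (2 * m) ?G' ?\<eta> = 0"
      using ext_inverse[OF B A BA lam_fock[OF ext_power_fock[OF \<eta>]]] by simp
    with \<eta> show "?\<eta> \<in> primitive_module m ?G'" by (simp add: primitive_module_alt)
  qed
qed

lemma std_form_inverse:
  "std_form m * std_form m = (- 1\<^sub>m (2 * m) :: 'a::field mat)"
proof (rule eq_matI)
  fix i j assume "i < dim_row (- 1\<^sub>m (2 * m) :: 'a mat)" "j < dim_col (- 1\<^sub>m (2 * m) :: 'a mat)"
  then have ij: "i < 2 * m" "j < 2 * m" by auto
  have "(std_form m * std_form m :: 'a mat) $$ (i, j) =
      (\<Sum>k<2 * m. std_form m $$ (i, k) * std_form m $$ (k, j))"
    using ij by (simp add: std_form_def scalar_prod_def lessThan_atLeast0)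
  also have "\<dots> = (\<Sum>k<2 * m. if k = (if i < m then m + i else i - m) then
      std_form m $$ (i, k) * std_form m $$ (k, j) else 0)"
    using ij by (intro sum.cong refl) (auto simp: std_form_def)
  also have "\<dots> = (- 1\<^sub>m (2 * m) :: 'a mat) $$ (i, j)"
    using ij by (auto simp: std_form_def)
  finally show "(std_form m * std_form m :: 'a mat) $$ (i, j) = (- 1\<^sub>m (2 * m) :: 'a mat) $$ (i, j)" .
qed (auto simp: std_form_def)

text \<open>The congruence itself provides the left inverse, since the square of the standard form
  is -1.\<close>

lemma symplectic_invertible:
  fixes A :: "'a::field mat"
  assumes A: "A \<in> carrier_mat (2 * m) (2 * m)" and G: "G \<in> carrier_mat (2 * m) (2 * m)"
    and AGA: "transpose_mat A * G * A = std_form m"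
  obtains B where "B \<in> carrier_mat (2 * m) (2 * m)" "A * B = 1\<^sub>m (2 * m)" "B * A = 1\<^sub>m (2 * m)"
proof -
  let ?B = "- (std_form m * (transpose_mat A * G))"
  have J: "std_form m \<in> carrier_mat (2 * m) (2 * m)" by (simp add: std_form_def)
  have AG: "transpose_mat A * G \<in> carrier_mat (2 * m) (2 * m)" using A G by simp
  have B: "?B \<in> carrier_mat (2 * m) (2 * m)" by (intro uminus_carrier_mat mult_carrier_mat[OF J AG])
  have "?B * A = - (std_form m * (transpose_mat A * G * A))"
    using A B J AG by (simp only: assoc_mult_mat[OF J AG A] uminus_mult_left_mat[OF mult_carrier_mat[OF J AG, THEN carrier_matD(2), THEN trans, OF carrier_matD(1)[OF A, symmetric]]])
  also have "\<dots> = 1\<^sub>m (2 * m)" unfolding AGA std_form_inverse by (rule eq_matI) auto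
  finally have BA: "?B * A = 1\<^sub>m (2 * m)" .
  have "A * ?B = 1\<^sub>m (2 * m)" by (rule mat_mult_left_right_inverse[OF B A BA])
  with B BA that show ?thesis by blast
qed

section \<open>The Laplace transfer as an exterior power\<close>

text \<open>
  The sign \<open>tau\<close> absorbs the position signs of the Laplace expansions. After both steps row and
  column \<open>0\<close> are deleted and the window is translated; \<open>shift\<close> reindexes the states of the smaller
  section into the enlarged window \<open>{0, \<dots>, 2m + 1}\<close> and \<open>trunc\<close> restricts back to pairs inside
  \<open>{0, \<dots>, m - 1}\<close>.
\<close>

definition lo_set :: "nat \<Rightarrow> nat set \<Rightarrow> nat set" where
  "lo_set m S = {..<m} - S"

definition hi_set :: "nat \<Rightarrow> nat set \<Rightarrow> nat set" where
  "hi_set m S = {j. j < m \<and> m + j \<in> S}"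

definition pair_set :: "nat \<Rightarrow> nat set \<Rightarrow> nat set \<Rightarrow> nat set" where
  "pair_set m I J = ({..<m} - I) \<union> (+) m ` J"

definition tau :: "nat \<Rightarrow> nat set \<Rightarrow> 'a::field" where
  "tau m J = (- 1) ^ (\<Sum>J + m * card J + card J * (card J - 1) div 2)"

definition psi :: "nat \<Rightarrow> (nat set \<times> nat set \<Rightarrow> 'a::field) \<Rightarrow> nat set \<Rightarrow> 'a" where
  "psi m v = (\<lambda>S. if S \<in> ksubsets (2 * m) m then tau m (hi_set m S) * v (lo_set m S, hi_set m S) else 0)"

lemma pair_set_lo_hi:
  assumes "S \<subseteq> {..<2 * m}"
  shows "pair_set m (lo_set m S) (hi_set m S) = S"
proof (intro Set.set_eqI iffI)
  fix k assume k: "k \<in> S"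
  show "k \<in> pair_set m (lo_set m S) (hi_set m S)"
  proof (cases "k < m")
    case False
    moreover have "k < 2 * m" using k assms by blast
    ultimately obtain j where "k = m + j" "j < m" using le_Suc_ex[of m k] by fastforce
    with k show ?thesis by (simp add: pair_set_def hi_set_def)
  qed (use k in \<open>simp add: pair_set_def lo_set_def\<close>)
qed (auto simp: pair_set_def lo_set_def hi_set_def)

lemma lo_pair_set: "I \<subseteq> {..<m} \<Longrightarrow> lo_set m (pair_set m I J) = I"
  by (auto simp: lo_set_def pair_set_def)

lemma hi_pair_set: "J \<subseteq> {..<m} \<Longrightarrow> hi_set m (pair_set m I J) = J"
  by (auto simp: hi_set_def pair_set_def)

lemma card_pair_set:
  assumes "I \<subseteq> {..<m}" "J \<subseteq> {..<m}"
  shows "card (pair_set m I J) + card I = m + card J"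
proof -
  have f: "finite I" "finite J" using assms finite_subset by blast+
  have "card (pair_set m I J) = card ({..<m} - I) + card ((+) m ` J)"
    unfolding pair_set_def using f by (intro card_Un_disjoint) auto
  moreover have "card ((+) m ` J) = card J" by (rule card_image) simp
  moreover have "card ({..<m} - I) = m - card I" using assms f by (simp add: card_Diff_subset)
  moreover have "card I \<le> m" using card_mono[OF _ assms(1)] by simp
  ultimately show ?thesis by simp
qed

lemma pair_set_subset: "J \<subseteq> {..<m} \<Longrightarrow> pair_set m I J \<subseteq> {..<2 * m}"
  by (auto simp: pair_set_def)

lemma lo_hi_boundary:
  assumes "S \<in> ksubsets (2 * m) m"
  shows "(lo_set m S, hi_set m S) \<in> boundary_pairs m"
proof -
  have S: "S \<subseteq> {..<2 * m}" "card S = m" using assms by (auto simp: ksubsets_def)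
  have "lo_set m S \<subseteq> {..<m}" "hi_set m S \<subseteq> {..<m}" by (auto simp: lo_set_def hi_set_def)
  with card_pair_set[OF this] pair_set_lo_hi[OF S(1)] S(2) show ?thesis by (simp add: boundary_pairs_def)
qed

lemma pair_set_ksubsets:
  assumes "(I, J) \<in> boundary_pairs m"
  shows "pair_set m I J \<in> ksubsets (2 * m) m"
  using assms card_pair_set[of I m J] pair_set_subset[of J m I]
  by (simp add: boundary_pairs_def ksubsets_def)

lemma tau_sq [simp]: "tau m J * tau m J = (1 :: 'a::field)"
  by (simp add: tau_def flip: power_add mult_2)

text \<open>The triangular number in \<open>tau\<close> makes the effect of inserting
  \<open>c\<close> depend on \<open>J\<close> only through its size. This is the discrepancy between
  the sign of a column position in a wedge and the Laplace sign.\<close>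

lemma tau_insert:
  assumes "finite J" "c \<notin> J"
  shows "tau m (insert c J) = (- 1) ^ (c + m + card J) * (tau m J :: 'a::field)"
proof -
  have "Suc (card J) * card J = card J * (card J - 1) + 2 * card J"
    by (cases "card J") auto
  then have "Suc (card J) * card J div 2 = card J * (card J - 1) div 2 + card J" by simp
  with assms show ?thesis by (simp add: tau_def power_add mult.commute)
qed

lemma tau_Suc: "tau (Suc m) J = (- 1) ^ card J * (tau m J :: 'a::field)"
  by (simp add: tau_def power_add)

text \<open>Positions of the small window inside that of size m + 1 after both blocks have been
  translated by one. The values 0 and m + 1 are skipped: they belong to row 0 and column 0.\<close>

definition iota :: "nat \<Rightarrow> nat \<Rightarrow> nat" where
  "iota m s = (if s < m then s + 1 else s + 2)"

text \<open>The same two windows without translation. Here the skipped positions are m and 2m + 1,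
  those of row m and column m.\<close>

definition emb :: "nat \<Rightarrow> nat \<Rightarrow> nat" where
  "emb m s = (if s < m then s else s + 1)"

lemma iota_less: "iota m s < iota m t \<longleftrightarrow> s < t"
  by (auto simp: iota_def)
lemma iota_eq: "iota m s = iota m t \<longleftrightarrow> s = t"
  by (auto simp: iota_def)
lemma range_iota: "range (iota m) = - {0, m + 1}"
proof (intro Set.set_eqI iffI)
  fix k assume k: "k \<in> - {0, m + 1}"
  show "k \<in> range (iota m)"
  proof (cases "k \<le> m")
    case True
    with k have "k = iota m (k - 1)" by (auto simp: iota_def)
    then show ?thesis by blast
  next
    case False
    with k have "k = iota m (k - 2)" by (auto simp: iota_def)
    then show ?thesis by blast
  qed
qed (auto simp: iota_def split: if_splits)
lemma emb_less: "emb m s < emb m t \<longleftrightarrow> s < t"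
  by (auto simp: emb_def)
lemma emb_eq: "emb m s = emb m t \<longleftrightarrow> s = t"
  by (auto simp: emb_def)

definition shift :: "nat \<Rightarrow> (nat set \<Rightarrow> 'a::field) \<Rightarrow> nat set \<Rightarrow> 'a" where
  "shift m \<omega> = (\<lambda>S. if S \<subseteq> range (iota m) then \<omega> (iota m -` S) else 0)"

definition trunc :: "nat \<Rightarrow> (nat set \<Rightarrow> 'a::field) \<Rightarrow> nat set \<Rightarrow> 'a" where
  "trunc m \<omega> = (\<lambda>S. if S \<subseteq> {..<2 * m} then \<omega> (emb m ` S) else 0)"

lemma shift_add: "shift m (\<omega> + \<eta>) = shift m \<omega> + shift m \<eta>"
  by (rule ext) (simp add: shift_def pointwise)
lemma shift_scale: "shift m (fscale c \<omega>) = fscale c (shift m \<omega>)"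
  by (rule ext) (simp add: shift_def fscale_apply)
lemma trunc_add: "trunc m (\<omega> + \<eta>) = trunc m \<omega> + trunc m \<eta>"
  by (rule ext) (simp add: trunc_def pointwise)
lemma trunc_scale: "trunc m (fscale c \<omega>) = fscale c (trunc m \<omega>)"
  by (rule ext) (simp add: trunc_def fscale_apply)
lemma trunc_0 [simp]: "trunc m 0 = 0"
  by (rule ext) (simp add: trunc_def pointwise)
lemma trunc_sum: "trunc m (\<Sum>x\<in>A. f x) = (\<Sum>x\<in>A. trunc m (f x))"
  by (rule sum_comp_morphism[of "trunc m" f A, unfolded o_def, symmetric]) (simp_all add: trunc_add)

lemma shift_vac: "shift m (ind {}) = ind {}"
proof
  fix S :: "nat set"
  have "S \<subseteq> range (iota m) \<Longrightarrow> iota m -` S = {} \<longleftrightarrow> S = {}" by auto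
  then show "shift m (ind {}) S = ind {} S" by (auto simp: shift_def ind_def)
qed

lemma trunc_vac: "trunc m (ind {}) = ind {}"
  by (rule ext) (auto simp: trunc_def ind_def)

lemma shift_cr: "shift m (cr b \<omega>) = cr (iota m b) (shift m \<omega>)"
proof
  fix S
  show "shift m (cr b \<omega>) S = cr (iota m b) (shift m \<omega>) S"
  proof (cases "S \<subseteq> range (iota m)")
    case True
    have "S \<inter> {..<iota m b} = iota m ` (iota m -` S \<inter> {..<b})"
      using True by (auto simp: iota_less)
    moreover have "inj_on (iota m) Z" for Z by (auto intro: inj_onI simp: iota_eq)
    ultimately have "sg b (iota m -` S) = (sg (iota m b) S :: 'a)"
      by (simp add: sg_def card_image)
    moreover have "iota m -` (S - {iota m b}) = iota m -` S - {b}" by (auto simp: iota_eq)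
    moreover have "S - {iota m b} \<subseteq> range (iota m)" using True by blast
    ultimately show ?thesis using True by (simp add: shift_def cr_def)
  next
    case False
    then have "\<not> S - {iota m b} \<subseteq> range (iota m)" by blast
    with False show ?thesis by (simp add: shift_def cr_def)
  qed
qed

lemma trunc_cr:
  assumes "i' < 2 * m"
  shows "trunc m (cr (emb m i') \<omega>) = cr i' (trunc m \<omega>)"
proof
  fix S
  show "trunc m (cr (emb m i') \<omega>) S = cr i' (trunc m \<omega>) S"
  proof (cases "S \<subseteq> {..<2 * m}")
    case True
    have "emb m ` S \<inter> {..<emb m i'} = emb m ` (S \<inter> {..<i'})"
      by (auto simp: emb_less)
    moreover have "inj_on (emb m) Z" for Z by (auto intro: inj_onI simp: emb_eq)
    ultimately have "sg (emb m i') (emb m ` S) = (sg i' S :: 'a)"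
      by (simp add: sg_def card_image)
    moreover have "emb m ` S - {emb m i'} = emb m ` (S - {i'})" by (auto simp: emb_eq)
    moreover have "emb m i' \<in> emb m ` S \<longleftrightarrow> i' \<in> S" by (auto simp: emb_eq)
    moreover have "S - {i'} \<subseteq> {..<2 * m}" using True by blast
    ultimately show ?thesis using True by (simp add: trunc_def cr_def)
  next
    case False
    then have "\<not> S - {i'} \<subseteq> {..<2 * m}" using assms by auto
    with False show ?thesis by (simp add: trunc_def cr_def)
  qed
qed

text \<open>Components of the vector at the positions m and 2m + 1 are lost, since no set in the
  image of \<open>emb\<close> contains them.\<close>

lemma trunc_crv: "trunc m (crv (2 * m + 2) w \<omega>) = crv (2 * m) (\<lambda>i. w (emb m i)) (trunc m \<omega>)"
proof -
  have zero: "trunc m (cr i \<omega>) = 0" if "i \<notin> emb m ` {..<2 * m}" for i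
  proof
    fix S
    have "S \<subseteq> {..<2 * m} \<Longrightarrow> i \<notin> emb m ` S" using that by blast
    then show "trunc m (cr i \<omega>) S = 0 S" by (auto simp: trunc_def cr_def pointwise)
  qed
  have "trunc m (crv (2 * m + 2) w \<omega>) = (\<Sum>i<2 * m + 2. fscale (w i) (trunc m (cr i \<omega>)))"
    unfolding crv_def trunc_sum trunc_scale ..
  also have "\<dots> = (\<Sum>i\<in>emb m ` {..<2 * m}. fscale (w i) (trunc m (cr i \<omega>)))"
    using zero by (intro sum.mono_neutral_right) (auto simp: emb_def)
  also have "\<dots> = (\<Sum>i<2 * m. fscale (w (emb m i)) (trunc m (cr (emb m i) \<omega>)))"
    by (subst sum.reindex) (auto intro: inj_onI simp: emb_eq)
  also have "\<dots> = crv (2 * m) (\<lambda>i. w (emb m i)) (trunc m \<omega>)"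
    by (simp add: crv_def trunc_cr)
  finally show ?thesis .
qed

text \<open>Creation along \<open>beta\<close> is the column step: the component at m + 1 serves the
  case that column 0 is already deleted, the component at r the choice of row r in the expansion.
  Contraction with \<open>alpha\<close> below is the row step, deleting column c with weight
  a_c.\<close>

definition beta :: "nat \<Rightarrow> (int \<Rightarrow> 'a::field) \<Rightarrow> nat \<Rightarrow> 'a" where
  "beta m a i = (if i = m + 1 then 1 else if 1 \<le> i \<and> i \<le> m then - a (- int i) else 0)"

definition alpha :: "nat \<Rightarrow> (int \<Rightarrow> 'a::field) \<Rightarrow> nat \<Rightarrow> 'a" where
  "alpha m a i = (if m + 1 \<le> i then a (int (i - (m + 1))) else 0)"

lemma crv_beta:
  "crv (2 * m + 2) (beta m a) \<theta> = cr (m + 1) \<theta> - (\<Sum>r\<in>{1..m}. fscale (a (- int r)) (cr r \<theta>))"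
proof -
  have "crv (2 * m + 2) (beta m a) \<theta> =
      (\<Sum>i\<in>insert (m + 1) {1..m}. fscale (beta m a i) (cr i \<theta>))"
    unfolding crv_def by (intro sum.mono_neutral_right) (auto simp: beta_def)
  also have "\<dots> = cr (m + 1) \<theta> + (\<Sum>r\<in>{1..m}. fscale (beta m a r) (cr r \<theta>))"
    by (simp add: beta_def)
  also have "(\<Sum>r\<in>{1..m}. fscale (beta m a r) (cr r \<theta>)) = - (\<Sum>r\<in>{1..m}. fscale (a (- int r)) (cr r \<theta>))"
    unfolding sum_negf[symmetric] by (rule sum.cong) (auto simp: beta_def)
  finally show ?thesis by simp
qed

lemma anv_alpha:
  "anv (2 * m + 2) (alpha m a) \<theta> = (\<Sum>c\<le>m. fscale (a (int c)) (an (m + 1 + c) \<theta>))"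
proof -
  have "anv (2 * m + 2) (alpha m a) \<theta> = (\<Sum>i\<in>(+) (m + 1) ` {..m}. fscale (alpha m a i) (an i \<theta>))"
    unfolding anv_def
  proof (intro sum.mono_neutral_right ballI)
    fix i assume i: "i \<in> {..<2 * m + 2} - (+) (m + 1) ` {..m}"
    have "\<not> m + 1 \<le> i"
    proof
      assume "m + 1 \<le> i"
      then obtain c where "i = m + 1 + c" using le_Suc_ex by blast
      with i show False by auto
    qed
    then show "fscale (alpha m a i) (an i \<theta>) = 0" by (simp add: alpha_def)
  qed auto
  also have "\<dots> = (\<Sum>c\<le>m. fscale (alpha m a (m + 1 + c)) (an (m + 1 + c) \<theta>))"
    by (subst sum.reindex) auto
  also have "\<dots> = (\<Sum>c\<le>m. fscale (a (int c)) (an (m + 1 + c) \<theta>))"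
    by (rule sum.cong) (auto simp: alpha_def)
  finally show ?thesis .
qed

lemma translate_subset: "S \<subseteq> {..m} \<Longrightarrow> translate S \<subseteq> {..<m}"
  by (fastforce simp: translate_def)

lemma card_translate:
  assumes "finite S" shows "card (translate S) = card (S - {0})"
  unfolding translate_def by (rule card_image) (auto intro!: inj_onI)

lemma mem_translate: "k \<in> translate S \<longleftrightarrow> Suc k \<in> S"
  unfolding translate_def image_iff by (metis DiffE DiffI Suc_pred' diff_Suc_1 insertI1 nat.distinct(1) neq0_conv singletonD)

lemma sum_translate:
  assumes "finite S" shows "\<Sum>(translate S) + card (S - {0}) = \<Sum>S"
proof -
  have inj: "inj_on (\<lambda>i. i - 1) (S - {0})" by (auto intro!: inj_onI)
  have "\<Sum>(translate S) = (\<Sum>i\<in>S - {0}. i - 1)"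
    unfolding translate_def by (subst sum.reindex[OF inj]) simp
  then have "\<Sum>(translate S) + card (S - {0}) = (\<Sum>i\<in>S - {0}. i - 1) + (\<Sum>i\<in>S - {0}. 1)"
    by simp
  also have "\<dots> = (\<Sum>i\<in>S - {0}. i)"
    unfolding sum.distrib[symmetric] by (rule sum.cong) auto
  also have "\<dots> = \<Sum>S" using assms by (intro sum.mono_neutral_left) auto
  finally show ?thesis .
qed

lemma tau_translate:
  assumes "finite J" "0 \<notin> J"
  shows "tau m (translate J) = (- 1) ^ card J * (tau m J :: 'a::field)"
proof -
  have c: "card (translate J) = card J" "\<Sum>J = \<Sum>(translate J) + card J"
    using card_translate[OF assms(1)] sum_translate[OF assms(1)] assms(2) by simp_all
  show ?thesis unfolding tau_def c by (simp add: power_add)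
qed

lemma mem_pair_set:
  assumes "I \<subseteq> {..m}" "J \<subseteq> {..m}"
  shows "i \<le> m \<Longrightarrow> i \<in> pair_set (Suc m) I J \<longleftrightarrow> i \<notin> I"
    and "m + 1 + j \<in> pair_set (Suc m) I J \<longleftrightarrow> j \<in> J"
    and "Suc (m + j) \<in> pair_set (Suc m) I J \<longleftrightarrow> j \<in> J"
  using assms by (auto simp: pair_set_def)

text \<open>Translation lowers the sum of the elements of \<open>J\<close> by its size. This is the
  sign on the right.\<close>

lemma shift_psi:
  assumes I: "I \<subseteq> {..m}" and J: "J \<subseteq> {..m}" and 0: "0 \<in> I" "0 \<notin> J"
    and c: "card I = Suc (card J)"
  shows "shift m (psi m v) (pair_set (Suc m) I J) =
    (- 1) ^ card J * tau m J * v (translate I, translate J)"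
proof -
  have f: "finite I" "finite J" using I J finite_subset by blast+
  have r: "pair_set (Suc m) I J \<subseteq> range (iota m)"
    using mem_pair_set(1)[OF I J, of 0] mem_pair_set(3)[OF I J, of 0] 0 unfolding range_iota by auto
  have t: "translate I \<subseteq> {..<m}" "translate J \<subseteq> {..<m}" using I J translate_subset by blast+
  have "iota m -` pair_set (Suc m) I J = pair_set m (translate I) (translate J)"
  proof (intro Set.set_eqI)
    fix k
    consider "k < m" | j where "k = m + j" by (metis le_Suc_ex not_less)
    then show "k \<in> iota m -` pair_set (Suc m) I J \<longleftrightarrow> k \<in> pair_set m (translate I) (translate J)"
    proof cases
      case 1
      then show ?thesis
        using mem_pair_set(1)[OF I J, of "Suc k"] by (auto simp: iota_def pair_set_def mem_translate)
    next
      case 2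
      then show ?thesis
        using mem_pair_set(3)[OF I J, of "Suc j"] by (auto simp: iota_def pair_set_def mem_translate)
    qed
  qed
  moreover have "(translate I, translate J) \<in> boundary_pairs m"
    using t c 0 f by (simp add: boundary_pairs_def card_translate)
  ultimately show ?thesis
    using r t by (simp add: shift_def psi_def pair_set_ksubsets lo_pair_set hi_pair_set
        tau_translate[OF f(2) 0(2)])
qed

lemma shift_eq_0: "0 \<in> S \<or> m + 1 \<in> S \<Longrightarrow> shift m \<omega> S = 0"
  by (auto simp: shift_def range_iota)

lemma sg_lo:
  assumes "I \<subseteq> {..m}" "J \<subseteq> {..m}" "r \<le> m"
  shows "sg r (pair_set (Suc m) I J) = (- 1 :: 'a::field) ^ card ({..<r} - I)"
proof -
  have "pair_set (Suc m) I J \<inter> {..<r} = {..<r} - I" using assms by (auto simp: pair_set_def)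
  then show ?thesis by (simp add: sg_def)
qed

text \<open>Before column c stand the rows that are not deleted and the deleted columns below c. The
  Laplace sign counts instead the columns below c that are not deleted; the other summands of the
  exponent are the difference.\<close>

lemma sg_hi:
  assumes "I \<subseteq> {..m}" "J \<subseteq> {..m}" "c \<le> m"
  shows "sg (m + 1 + c) (pair_set (Suc m) I J) = (- 1 :: 'a::field) ^ (Suc m + card I + c + card ({..<c} - J))"
proof -
  have f: "finite I" "finite J" using assms finite_subset by blast+
  \<comment> \<open>The even summand on the left avoids subtraction of natural numbers.\<close>
  have arith: "x + 2 * (i + u) = M + i + c + u"
    if "x = y" "y = A + z" "z = B" "A + i = M" "B + u = c" for x y z A B i u c M :: nat
    unfolding that(1-3) that(4,5)[symmetric] by simp
  have "card (pair_set (Suc m) I J \<inter> {..<m + 1 + c}) =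
      card (({..<Suc m} - I) \<union> (+) (Suc m) ` (J \<inter> {..<c}))"
    by (rule arg_cong[where f = card]) (auto simp: pair_set_def)
  moreover have "card (({..<Suc m} - I) \<union> (+) (Suc m) ` (J \<inter> {..<c})) =
      card ({..<Suc m} - I) + card ((+) (Suc m) ` (J \<inter> {..<c}))"
    by (rule card_Un_disjoint) auto
  moreover have "card ((+) (Suc m) ` (J \<inter> {..<c})) = card (J \<inter> {..<c})"
    by (rule card_image) simp
  moreover have "card ({..<Suc m} - I) + card I = Suc m"
  proof -
    have "I \<subseteq> {..<Suc m}" using assms by auto
    then show ?thesis using f card_mono[of "{..<Suc m}" I] by (simp add: card_Diff_subset)
  qed
  moreover have "card (J \<inter> {..<c}) + card ({..<c} - J) = c"
    using card_Int_Diff[of "{..<c}" J] by (simp add: Int_commute)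
  ultimately have "card (pair_set (Suc m) I J \<inter> {..<m + 1 + c}) + 2 * (card I + card ({..<c} - J)) =
      Suc m + card I + c + card ({..<c} - J)"
    by (rule arith)
  then have "(- 1 :: 'a) ^ (Suc m + card I + c + card ({..<c} - J)) =
      (- 1) ^ card (pair_set (Suc m) I J \<inter> {..<m + 1 + c}) * ((- 1) ^ 2) ^ (card I + card ({..<c} - J))"
    by (metis power_add power_mult)
  then show ?thesis by (simp add: sg_def)
qed

text \<open>\<open>shift\<close> vanishes on sets containing m + 1. If column 0 is deleted, only the
  creation at m + 1 survives for this reason; if it is not, the set lacks m + 1 and only creations
  at rows survive.\<close>

lemma col_expansion_fock:
  fixes v :: "nat set \<times> nat set \<Rightarrow> 'a::field"
  assumes I: "I \<subseteq> {..m}" and J: "J \<subseteq> {..m}" and 0: "0 \<in> I" and c: "card I = card J"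
  shows "tau (Suc m) J * col_expansion m a v I J =
    - crv (2 * m + 2) (beta m a) (shift m (psi m v)) (pair_set (Suc m) I J)"
proof -
  let ?S = "pair_set (Suc m) I J" and ?\<theta> = "shift m (psi m v)"
  have f: "finite I" "finite J" using I J finite_subset by blast+
  have I0: "0 \<notin> ?S" using mem_pair_set(1)[OF I J, of 0] 0 by simp
  show ?thesis
  proof (cases "0 \<in> J")
    case True
    then have S0: "m + 1 \<in> ?S" using mem_pair_set(3)[OF I J, of 0] by simp
    have "cr r ?\<theta> ?S = 0" if "r \<in> {1..m}" for r
    proof -
      have "m + 1 \<in> ?S - {r}" using that S0 by auto
      then show ?thesis by (simp add: cr_def shift_eq_0)
    qed
    then have "crv (2 * m + 2) (beta m a) ?\<theta> ?S = cr (m + 1) ?\<theta> ?S"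
      unfolding crv_beta by (simp add: pointwise sum_fun_apply fscale_apply)
    also have "\<dots> = (- 1) ^ (Suc m + card I) * ?\<theta> (?S - {m + 1})"
    proof -
      have "sg (m + 1) ?S = (- 1 :: 'a) ^ (Suc m + card I)" using sg_hi[OF I J, of 0] by simp
      then show ?thesis using S0 by (simp add: cr_def)
    qed
    also have "?S - {m + 1} = pair_set (Suc m) I (J - {0})"
      using True by (auto simp: pair_set_def)
    also have "?\<theta> \<dots> = (- 1) ^ card (J - {0}) * tau m (J - {0}) * v (translate I, translate (J - {0}))"
    proof (rule shift_psi)
      show "card I = Suc (card (J - {0}))" unfolding c by (rule card.remove[OF f(2) True])
    qed (use I J 0 in auto)
    also have "translate (J - {0}) = translate J" by (simp add: translate_def)
    also have "(- 1) ^ card (J - {0}) * tau m (J - {0}) = (- 1) ^ m * (tau m J :: 'a)"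
    proof -
      have "tau m J = (- 1) ^ (m + card (J - {0})) * (tau m (J - {0}) :: 'a)"
        using tau_insert[of "J - {0}" 0 m] f True by (simp add: insert_absorb)
      then have "(- 1) ^ m * (tau m J :: 'a) = ((- 1) ^ m * (- 1) ^ m) * (- 1) ^ card (J - {0}) * tau m (J - {0})"
        by (simp add: power_add)
      then show ?thesis by (simp flip: power_add mult_2)
    qed
    finally have "crv (2 * m + 2) (beta m a) ?\<theta> ?S =
        (- 1) ^ (Suc m + card I) * ((- 1) ^ m * tau m J * v (translate I, translate J))" .
    also have "\<dots> = - (tau (Suc m) J * v (translate I, translate J))"
      unfolding tau_Suc c by (simp add: power_add)
    finally show ?thesis using True by (simp add: col_expansion_def)
  next
    case False
    then have S0: "m + 1 \<notin> ?S" using mem_pair_set(3)[OF I J, of 0] by simp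
    have cr_r: "cr r ?\<theta> ?S = (if r \<in> I then 0 else (- 1) ^ card ({..<r} - I) *
        ((- 1) ^ card J * tau m J * v (translate (insert r I), translate J)))"
      if r: "r \<in> {1..m}" for r
    proof (cases "r \<in> I")
      case rI: True
      then have "r \<notin> ?S" using r mem_pair_set(1)[OF I J, of r] by auto
      then show ?thesis using rI by (simp add: cr_def)
    next
      case rI: False
      then have "r \<in> ?S" using r mem_pair_set(1)[OF I J, of r] by auto
      moreover have "?S - {r} = pair_set (Suc m) (insert r I) J" using r by (auto simp: pair_set_def)
      moreover have "?\<theta> (pair_set (Suc m) (insert r I) J) =
          (- 1) ^ card J * tau m J * v (translate (insert r I), translate J)"
        using I J 0 c False r rI f by (intro shift_psi) auto
      ultimately show ?thesis using rI r sg_lo[OF I J, of r, where 'a = 'a] by (simp add: cr_def)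
    qed
    have "- crv (2 * m + 2) (beta m a) ?\<theta> ?S = (\<Sum>r\<in>{1..m}. a (- int r) * cr r ?\<theta> ?S)"
      unfolding crv_beta using S0 by (simp add: pointwise sum_fun_apply fscale_apply cr_def)
    also have "\<dots> = (\<Sum>r\<in>{..m} - I. a (- int r) * cr r ?\<theta> ?S)"
    proof (rule sum.mono_neutral_right)
      show "{..m} - I \<subseteq> {1..m}" using 0 by (auto simp: Suc_le_eq intro: gr0I)
      show "\<forall>r\<in>{1..m} - ({..m} - I). a (- int r) * cr r ?\<theta> ?S = 0" using cr_r by auto
    qed simp
    also have "\<dots> = (\<Sum>r\<in>{..m} - I. tau (Suc m) J * ((- 1) ^ card ({..<r} - I) * a (- int r)
             * v (translate (insert r I), translate (insert 0 J))))"
    proof (rule sum.cong)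
      fix r assume r: "r \<in> {..m} - I"
      then have "r \<in> {1..m}" "r \<notin> I" using 0 by (auto simp: Suc_le_eq intro: gr0I)
      then show "a (- int r) * cr r ?\<theta> ?S = tau (Suc m) J * ((- 1) ^ card ({..<r} - I) * a (- int r)
             * v (translate (insert r I), translate (insert 0 J)))"
        by (simp add: cr_r tau_Suc translate_def)
    qed simp
    also have "\<dots> = tau (Suc m) J * col_expansion m a v I J"
      using False by (simp add: col_expansion_def sum_distrib_left)
    finally show ?thesis by simp
  qed
qed

text \<open>Both Laplace steps in one operator. On sets without 0 the second term vanishes, on sets
  with 0 the first one does; these are the cases of row 0 being already deleted or still to be
  expanded.\<close>

definition row_col :: "nat \<Rightarrow> (int \<Rightarrow> 'a::field) \<Rightarrow> (nat set \<Rightarrow> 'a) \<Rightarrow> nat set \<Rightarrow> 'a" where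
  "row_col m a \<omega> = crv (2 * m + 2) (beta m a) (shift m \<omega>)
     - cr 0 (anv (2 * m + 2) (alpha m a) (crv (2 * m + 2) (beta m a) (shift m \<omega>)))"

lemma row_expansion_fock:
  fixes v :: "nat set \<times> nat set \<Rightarrow> 'a::field"
  assumes I: "I \<subseteq> {..m}" and J: "J \<subseteq> {..m}" and c: "card I = card J"
  shows "tau (Suc m) J * row_expansion m a v I J = - row_col m a (psi m v) (pair_set (Suc m) I J)"
proof -
  let ?S = "pair_set (Suc m) I J" and ?\<theta> = "shift m (psi m v)"
  let ?Z = "crv (2 * m + 2) (beta m a) ?\<theta>"
  have f: "finite I" "finite J" using I J finite_subset by blast+
  show ?thesis
  proof (cases "0 \<in> I")
    case True
    then have "0 \<notin> ?S" using mem_pair_set(1)[OF I J, of 0] by simp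
    then show ?thesis
      using col_expansion_fock[OF I J True c] True
      by (simp add: row_expansion_def row_col_def pointwise cr_def)
  next
    case False
    then have S0: "0 \<in> ?S" using mem_pair_set(1)[OF I J, of 0] by simp
    have "cr r ?\<theta> ?S = 0" if "r \<noteq> 0" for r
    proof -
      have "0 \<in> ?S - {r}" using that S0 by auto
      then show ?thesis by (simp add: cr_def shift_eq_0)
    qed
    then have Z0: "?Z ?S = 0" unfolding crv_beta by (simp add: pointwise sum_fun_apply fscale_apply)
    have I': "insert 0 I \<subseteq> {..m}" using I by auto
    have S': "?S - {0} = pair_set (Suc m) (insert 0 I) J" by (auto simp: pair_set_def)
    \<comment> \<open>The position sign and the change of \<open>tau\<close> combine to minus the
      Laplace sign, and the column step contributes a second minus.\<close>
    have an_c: "an (m + 1 + c) ?Z (?S - {0}) = (if c \<in> J then 0 else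
        - (tau (Suc m) J * ((- 1) ^ card ({..<c} - J) * col_expansion m a v (insert 0 I) (insert c J))) * (- 1) )"
      if cm: "c \<le> m" for c
    proof (cases "c \<in> J")
      case cJ: True
      then have "m + 1 + c \<in> ?S - {0}" using mem_pair_set(2)[OF I J, of c] by simp
      then show ?thesis using cJ by (simp add: an_def)
    next
      case cJ: False
      then have "m + 1 + c \<notin> ?S - {0}" using mem_pair_set(2)[OF I J, of c] by simp
      moreover have "insert (m + 1 + c) (?S - {0}) = pair_set (Suc m) (insert 0 I) (insert c J)"
        unfolding S' by (auto simp: pair_set_def)
      moreover have "?Z (pair_set (Suc m) (insert 0 I) (insert c J)) =
          - (tau (Suc m) (insert c J) * col_expansion m a v (insert 0 I) (insert c J))"
        using col_expansion_fock[OF I', of "insert c J" a v] J cm cJ f False \<open>card I = card J\<close> by simp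
      moreover have "sg (m + 1 + c) (?S - {0}) = (- 1 :: 'a) ^ (Suc m + Suc (card I) + c + card ({..<c} - J))"
        unfolding S' using sg_hi[OF I' J cm] f False by simp
      moreover have "tau (Suc m) (insert c J) = (- 1) ^ (c + Suc m + card J) * (tau (Suc m) J :: 'a)"
        using f cJ by (simp add: tau_insert)
      moreover have "(- 1 :: 'a) ^ (Suc m + Suc (card I) + c + card ({..<c} - J)) * (- 1) ^ (c + Suc m + card J)
          = - ((- 1) ^ card ({..<c} - J))"
      proof -
        have "Suc m + Suc (card I) + c + card ({..<c} - J) + (c + Suc m + card J) =
            Suc (card ({..<c} - J)) + 2 * (Suc m + c + card J)" using \<open>card I = card J\<close> by simp
        then have "(- 1 :: 'a) ^ (Suc m + Suc (card I) + c + card ({..<c} - J)) * (- 1) ^ (c + Suc m + card J)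
          = (- 1) ^ Suc (card ({..<c} - J)) * ((- 1) ^ 2) ^ (Suc m + c + card J)"
          by (metis power_add power_mult)
        then show ?thesis by simp
      qed
      ultimately show ?thesis using cJ by (simp add: an_def flip: mult.assoc)
    qed
    have "- row_col m a (psi m v) ?S = anv (2 * m + 2) (alpha m a) ?Z (?S - {0})"
      using S0 Z0 by (simp add: row_col_def pointwise cr_def sg_def)
    also have "\<dots> = (\<Sum>c\<le>m. a (int c) * an (m + 1 + c) ?Z (?S - {0}))"
      unfolding anv_alpha sum_fun_apply fscale_apply ..
    also have "\<dots> = (\<Sum>c\<in>{..m} - J. a (int c) * an (m + 1 + c) ?Z (?S - {0}))"
      using an_c by (intro sum.mono_neutral_right) auto
    also have "\<dots> = (\<Sum>c\<in>{..m} - J. tau (Suc m) J * ((- 1) ^ card ({..<c} - J) * a (int c)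
             * col_expansion m a v (insert 0 I) (insert c J)))"
      using an_c by (intro sum.cong) auto
    also have "\<dots> = tau (Suc m) J * row_expansion m a v I J"
      using False by (simp add: row_expansion_def sum_distrib_left)
    finally show ?thesis by simp
  qed
qed

text \<open>The expansions run in the window of size m + 1, the new state has a window of size m. So
  row m and column m must count as not deleted: the first puts m into the index set, which
  \<open>an m\<close> achieves, the second keeps 2m + 1 out of it, which \<open>emb\<close>
  achieves.\<close>

lemma psi_laplace_transfer:
  assumes S: "S \<in> ksubsets (2 * m) m"
  shows "psi m (laplace_transfer m a v) S = - ((- 1) ^ m * trunc m (an m (row_col m a (psi m v))) S)"
proof -
  let ?I = "lo_set m S" and ?J = "hi_set m S"
  have b: "(?I, ?J) \<in> boundary_pairs m" using S by (rule lo_hi_boundary)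
  then have IJ: "?I \<subseteq> {..m}" "?J \<subseteq> {..m}" "card ?I = card ?J"
    "?I \<subseteq> {..<m}" "?J \<subseteq> {..<m}" by (auto simp: boundary_pairs_def)
  have Ss: "S \<subseteq> {..<2 * m}" using S by (simp add: ksubsets_def)
  have e: "insert m (emb m ` S) = pair_set (Suc m) ?I ?J"
  proof -
    have "emb m ` S = ({..<m} - ?I) \<union> (+) (Suc m) ` ?J"
      unfolding arg_cong[OF pair_set_lo_hi[OF Ss], of "image (emb m)", symmetric]
      by (auto simp: pair_set_def emb_def lo_set_def hi_set_def image_iff)
    moreover have "m \<notin> ?I" using IJ by auto
    ultimately show ?thesis by (auto simp: pair_set_def less_Suc_eq)
  qed
  have nm: "m \<notin> emb m ` S" by (auto simp: emb_def)
  have sgm: "sg m (emb m ` S) = (- 1 :: 'a) ^ (m + card ?I)"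
  proof -
    have "emb m ` S \<inter> {..<m} = {..<m} - ?I" by (auto simp: emb_def lo_set_def image_iff split: if_splits)
    moreover have "card ({..<m} - ?I) + card ?I = m"
      using IJ(4) finite_subset[OF IJ(4)] card_mono[OF _ IJ(4)] by (simp add: card_Diff_subset)
    then have "m + card ?I = card ({..<m} - ?I) + 2 * card ?I" by linarith
    then have "(- 1 :: 'a) ^ (m + card ?I) = (- 1) ^ card ({..<m} - ?I) * ((- 1) ^ 2) ^ card ?I"
      by (metis power_add power_mult)
    ultimately show ?thesis by (simp add: sg_def)
  qed
  have "psi m (laplace_transfer m a v) S = tau m ?J * row_expansion m a v ?I ?J"
    using S b by (simp add: psi_def laplace_transfer_def)
  also have "tau m ?J = (- 1) ^ card ?J * (tau (Suc m) ?J :: 'a)"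
    unfolding tau_Suc by (simp flip: mult.assoc power_add mult_2)
  finally have "psi m (laplace_transfer m a v) S =
      - ((- 1) ^ card ?J * row_col m a (psi m v) (insert m (emb m ` S)))"
    using row_expansion_fock[OF IJ(1-3), of a v] unfolding e by (simp add: mult.assoc)
  moreover have "trunc m (an m (row_col m a (psi m v))) S =
      (- 1) ^ (m + card ?J) * row_col m a (psi m v) (insert m (emb m ` S))"
    using Ss nm sgm IJ(3) by (simp add: trunc_def an_def)
  moreover have "(- 1 :: 'a) ^ m * (- 1) ^ (m + card ?J) = (- 1) ^ card ?J"
    by (simp add: power_add flip: mult.assoc)
  ultimately show ?thesis by (simp flip: mult.assoc)
qed

text \<open>The columns are the truncated vectors \<open>w\<close> from the proof of
  \<open>row_col_ext\<close>. Basis vectors move up by one; the step across the middle brings in the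
  entries a_i / a_m, and the upper half a correction in coordinate 0.\<close>

definition transfer_mat :: "nat \<Rightarrow> (int \<Rightarrow> 'a::field) \<Rightarrow> 'a mat" where
  "transfer_mat m a = mat (2 * m) (2 * m) (\<lambda>(i, b).
     if b < m then
       (if i < m then (if i = b + 1 then 1 else 0) - (if b + 1 = m then a (int i) / a (int m) else 0)
        else if i = m \<and> b + 1 = m then 1 / a (int m) else 0)
     else (if i < m then (if i = 0 then - a (int (b - m + 1)) else 0)
        else if i = b + 1 then 1 else 0))"

text \<open>Creation by a basis vector passes through \<open>row_col\<close> as a wedge with some
  vector \<open>u b\<close>, up to sign. Contraction along m does not respect this, but after adding
  a multiple of E to \<open>u b\<close> it does. The claim then follows by induction from the
  vacuum.\<close>

lemma row_col_ext:
  fixes a :: "int \<Rightarrow> 'a::field_char_0"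
  assumes a: "a \<in> sym_params m" and "\<omega> \<in> fock (2 * m)"
  shows "- trunc m (an m (row_col m a \<omega>)) = fscale (a (int m)) (ext (2 * m) (transfer_mat m a) \<omega>)"
proof -
  let ?n = "2 * m + 2"
  let ?\<alpha> = "alpha m a" and ?\<beta> = "beta m a"
  \<comment> \<open>The correction at position 0 is the pairing of \<open>alpha\<close> with
    \<open>beta\<close>, which is a_0. It makes E a left factor of the whole result, see
    \<open>Yeq\<close>.\<close>
  define E where "E = (\<lambda>i. ?\<beta> i + (- a 0) * (if i = 0 then 1 else 0))"
  define Y where "Y = row_col m a"
  have am: "a (int m) \<noteq> 0" and sym: "\<And>s. a (- s) = a s" using a by (auto simp: sym_params_def)
  have ab: "(\<Sum>i<?n. ?\<alpha> i * ?\<beta> i) = a 0"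
  proof -
    have "(\<Sum>i<?n. ?\<alpha> i * ?\<beta> i) = (\<Sum>i<?n. if i = m + 1 then a 0 else 0)"
      by (rule sum.cong) (auto simp: alpha_def beta_def)
    then show ?thesis by simp
  qed
  have crvE: "crv ?n E \<eta> = crv ?n ?\<beta> \<eta> - fscale (a 0) (cr 0 \<eta>)" for \<eta>
    unfolding E_def crv_vec_add crv_vec_scale by (simp add: crv_unit)
  have Em: "E m = - a (int m)"
    by (cases "m = 0") (auto simp: E_def beta_def sym)
  have Yeq: "Y \<eta> = crv ?n E (shift m \<eta> - cr 0 (anv ?n ?\<alpha> (shift m \<eta>)))" for \<eta>
  proof -
    let ?\<theta> = "shift m \<eta>"
    have "cr 0 (anv ?n ?\<alpha> (crv ?n ?\<beta> ?\<theta>)) =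
        fscale (a 0) (cr 0 ?\<theta>) + crv ?n ?\<beta> (cr 0 (anv ?n ?\<alpha> ?\<theta>))"
      by (simp only: anv_crv ab cr_diff cr_scale cr_crv) simp
    then show ?thesis
      unfolding Y_def row_col_def crvE by (simp add: crv_diff cr_diff)
  qed
  have EY: "crv ?n E (Y \<eta>) = 0" for \<eta> unfolding Yeq by (rule crv_crv_same)
  \<comment> \<open>The relation \<open>EY\<close> contracted along m. Since E has coordinate -a_m
    there, Y is expressed through its own contraction.\<close>
  have elim: "fscale (- a (int m)) (Y \<eta>) = crv ?n E (an m (Y \<eta>))" for \<eta>
  proof -
    have "0 = an m (crv ?n E (Y \<eta>))" by (simp only: EY an_0)
    also have "\<dots> = fscale (- a (int m)) (Y \<eta>) - crv ?n E (an m (Y \<eta>))"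
      by (simp add: an_crv Em)
    finally show ?thesis by (metis eq_iff_diff_eq_0)
  qed
  \<comment> \<open>The reindexed basis vector, with a component at position 0 that accounts for its
    pairing with \<open>alpha\<close> in the row step.\<close>
  define u where "u = (\<lambda>b i. (if i = iota m b then 1 else 0) + (- ?\<alpha> (iota m b)) * (if i = 0 then 1 else (0 :: 'a)))"
  have Ycr: "Y (cr b \<eta>) = - crv ?n (u b) (Y \<eta>)" if b: "b < 2 * m" for b \<eta>
  proof -
    let ?c = "iota m b" and ?Z = "crv ?n ?\<beta> (shift m \<eta>)"
    have c: "?c < ?n" using b by (auto simp: iota_def)
    have Y: "Y \<eta> = ?Z - cr 0 (anv ?n ?\<alpha> ?Z)" by (simp add: Y_def row_col_def)
    have Z: "crv ?n ?\<beta> (shift m (cr b \<eta>)) = - cr ?c ?Z" by (simp add: shift_cr cr_crv)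
    have "Y (cr b \<eta>) = - cr ?c ?Z + cr 0 (anv ?n ?\<alpha> (cr ?c ?Z))"
      unfolding Y_def row_col_def Z by (simp add: anv_minus cr_minus)
    also have "\<dots> = - cr ?c ?Z + (fscale (?\<alpha> ?c) (cr 0 ?Z) - cr 0 (cr ?c (anv ?n ?\<alpha> ?Z)))"
      using c by (simp add: anv_cr cr_diff cr_scale)
    also have "cr 0 (cr ?c (anv ?n ?\<alpha> ?Z)) = - cr ?c (cr 0 (anv ?n ?\<alpha> ?Z))" by (rule cr_cr)
    also have "- cr ?c ?Z + (fscale (?\<alpha> ?c) (cr 0 ?Z) - - cr ?c (cr 0 (anv ?n ?\<alpha> ?Z))) =
        - (cr ?c (Y \<eta>) + fscale (- ?\<alpha> ?c) (cr 0 (Y \<eta>)))"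
      unfolding Y by (simp add: cr_diff)
    also have "cr ?c (Y \<eta>) + fscale (- ?\<alpha> ?c) (cr 0 (Y \<eta>)) = crv ?n (u b) (Y \<eta>)"
      unfolding u_def crv_vec_add crv_vec_scale using c by (simp add: crv_unit)
    finally show ?thesis .
  qed
  \<comment> \<open>The multiple of E cancels the coordinate m, so that contraction along m only
    changes the sign when it passes \<open>w b\<close>.\<close>
  define w where "w = (\<lambda>b i. u b i + (u b m / a (int m)) * E i)"
  have step: "- an m (Y (cr b \<eta>)) = crv ?n (w b) (- an m (Y \<eta>))" if b: "b < 2 * m" for b \<eta>
  proof -
    have "- an m (Y (cr b \<eta>)) = fscale (u b m) (Y \<eta>) - crv ?n (u b) (an m (Y \<eta>))"
      using b by (simp add: Ycr an_minus an_crv)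
    also have "fscale (u b m) (Y \<eta>) = fscale (- u b m / a (int m)) (fscale (- a (int m)) (Y \<eta>))"
      using am by simp
    also have "\<dots> = fscale (- u b m / a (int m)) (crv ?n E (an m (Y \<eta>)))" by (simp only: elim)
    also have "\<dots> - crv ?n (u b) (an m (Y \<eta>)) = crv ?n (w b) (- an m (Y \<eta>))"
      unfolding w_def crv_vec_add crv_vec_scale crv_minus by simp
    finally show ?thesis .
  qed
  have wM: "w b (emb m i) = transfer_mat m a $$ (i, b)" if "b < 2 * m" "i < 2 * m" for b i
  proof -
    have m: "m \<noteq> 0" using that by auto
    have um: "u b m = (if b + 1 = m then 1 else 0)"
      using that m by (auto simp: u_def iota_def)
    show ?thesis
    proof (cases "b < m")
      case True
      then have "?\<alpha> (iota m b) = 0" by (simp add: iota_def alpha_def)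
      then show ?thesis using that True m um
        by (cases "i = 0") (auto simp: w_def u_def iota_def E_def beta_def emb_def transfer_mat_def sym)
    next
      case False
      then have "?\<alpha> (iota m b) = a (int (b - m + 1))"
        by (simp add: iota_def alpha_def Suc_diff_le)
      then show ?thesis using that False m um
        by (cases "i = 0") (auto simp: w_def u_def iota_def E_def beta_def emb_def transfer_mat_def sym)
    qed
  qed
  have tm: "trunc m (- \<eta>) = - trunc m \<eta>" for \<eta> :: "nat set \<Rightarrow> 'a"
    using trunc_scale[of m "- 1" \<eta>] by simp
  have "trunc m (- an m (Y \<omega>)) = fscale (a (int m)) (ext (2 * m) (transfer_mat m a) \<omega>)"
    using assms(2)
  proof (induction rule: fock_induct)
    case vac
    \<comment> \<open>On the vacuum the result is E itself; its coordinate m is the origin of the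
      factor a_m.\<close>
    have "Y (ind {}) = crv ?n E (ind {})" unfolding Yeq by (simp add: shift_vac)
    then have "- an m (Y (ind {})) = fscale (a (int m)) (ind {})"
      by (simp add: an_crv Em)
    then show ?case by (simp only: ext_vac trunc_scale trunc_vac)
  next
    case (cr b \<eta>)
    have "trunc m (- an m (Y (cr b \<eta>))) =
        crv (2 * m) (\<lambda>i. w b (emb m i)) (trunc m (- an m (Y \<eta>)))"
      by (simp only: step[OF cr(1)] trunc_crv)
    also have "\<dots> = crv (2 * m) (\<lambda>i. transfer_mat m a $$ (i, b)) (trunc m (- an m (Y \<eta>)))"
      using wM cr(1) by (intro crv_cong) auto
    also have "\<dots> = fscale (a (int m)) (ext (2 * m) (transfer_mat m a) (cr b \<eta>))"
      by (simp only: cr(3) crv_scale ext_cr[OF cr(2,1)])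
    finally show ?case .
  next
    case (add \<eta> \<theta>)
    have "Y (\<eta> + \<theta>) = Y \<eta> + Y \<theta>"
      unfolding Y_def row_col_def by (simp add: shift_add crv_add anv_add cr_add)
    then have "- an m (Y (\<eta> + \<theta>)) = - an m (Y \<eta>) + - an m (Y \<theta>)" by (simp add: an_add)
    then show ?case by (simp only: trunc_add add ext_add fscale_add)
  next
    case (scale c \<eta>)
    have "Y (fscale c \<eta>) = fscale c (Y \<eta>)"
      unfolding Y_def row_col_def
      by (simp add: shift_scale crv_scale anv_scale cr_scale fs.scale_right_diff_distrib)
    then have "- an m (Y (fscale c \<eta>)) = fscale c (- an m (Y \<eta>))" by (simp add: an_scale)
    then show ?case by (simp only: trunc_scale scale ext_scale fs.scale_left_commute)
  qed
  then show ?thesis by (simp add: tm Y_def)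
qed

lemma psi_ext_power: "psi m v \<in> ext_power (2 * m) m"
  by (auto simp: psi_def ext_power_def coord_space_def)

lemma psi_laplace_ext:
  fixes a :: "int \<Rightarrow> 'a::field_char_0"
  assumes a: "a \<in> sym_params m"
  shows "psi m (laplace_transfer m a v) =
    fscale ((- 1) ^ m * a (int m)) (ext (2 * m) (transfer_mat m a) (psi m v))"
proof
  fix S
  let ?R = "ext (2 * m) (transfer_mat m a) (psi m v)"
  show "psi m (laplace_transfer m a v) S = fscale ((- 1) ^ m * a (int m)) ?R S"
  proof (cases "S \<in> ksubsets (2 * m) m")
    case True
    have "- trunc m (an m (row_col m a (psi m v))) S = a (int m) * ?R S"
      using fun_cong[OF row_col_ext[OF a ext_power_fock[OF psi_ext_power, of m v]], of S]
      by (simp add: pointwise fscale_apply)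
    then show ?thesis
      unfolding psi_laplace_transfer[OF True] fscale_apply by (metis mult.assoc mult_minus_right)
  next
    case False
    have "?R \<in> ext_power (2 * m) m" by (rule ext_degree[OF psi_ext_power])
    with False show ?thesis by (auto simp: psi_def fscale_apply ext_power_def coord_space_def)
  qed
qed

section \<open>Symplectic diagonalization of the transfer matrix\<close>

lemma coeff_symbol_poly:
  "coeff (symbol_poly m a) k = (if k \<le> 2 * m then a (int k - int m) else 0)"
proof -
  have "coeff (symbol_poly m a) k = (\<Sum>s\<in>{- int m..int m}. if s = int k - int m then a s else 0)"
    unfolding symbol_poly_def coeff_sum by (rule sum.cong) auto
  then show ?thesis by auto
qed

lemma degree_symbol_poly: "a \<in> sym_params m \<Longrightarrow> degree (symbol_poly m a) = 2 * m"
  by (intro antisym degree_le le_degree) (auto simp: coeff_symbol_poly sym_params_def)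

lemma lead_coeff_symbol_poly: "a \<in> sym_params m \<Longrightarrow> lead_coeff (symbol_poly m a) = a (int m)"
  by (simp add: degree_symbol_poly coeff_symbol_poly)

text \<open>The symbol as a Laurent polynomial, folded by its symmetry under z and 1/z.
  \<open>laurent_deriv\<close> is z times its derivative.\<close>

definition laurent :: "nat \<Rightarrow> (int \<Rightarrow> 'a::field) \<Rightarrow> 'a \<Rightarrow> 'a" where
  "laurent m a z = a 0 + (\<Sum>s\<in>{1..m}. a (int s) * (z ^ s + inverse z ^ s))"

definition laurent_deriv :: "nat \<Rightarrow> (int \<Rightarrow> 'a::field) \<Rightarrow> 'a \<Rightarrow> 'a" where
  "laurent_deriv m a z = (\<Sum>s\<in>{1..m}. of_nat s * a (int s) * (z ^ s - inverse z ^ s))"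

lemma sum_symmetric_interval:
  fixes f :: "int \<Rightarrow> 'b::comm_monoid_add"
  shows "(\<Sum>s\<in>{- int m..int m}. f s) = f 0 + (\<Sum>s\<in>{1..m}. f (int s) + f (- int s))"
proof -
  have "{- int m..int m} = insert 0 (int ` {1..m} \<union> (\<lambda>s. - int s) ` {1..m})"
  proof (intro Set.set_eqI iffI)
    fix s assume s: "s \<in> {- int m..int m}"
    consider "s = 0" | "s > 0" | "s < 0" by linarith
    then show "s \<in> insert 0 (int ` {1..m} \<union> (\<lambda>s. - int s) ` {1..m})"
    proof cases
      case 2
      then have "s = int (nat s)" "nat s \<in> {1..m}" using s by auto
      then show ?thesis by blast
    next
      case 3
      then have "s = - int (nat (- s))" "nat (- s) \<in> {1..m}" using s by auto
      then show ?thesis by blast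
    qed simp
  qed auto
  moreover have "sum f (insert 0 (int ` {1..m} \<union> (\<lambda>s. - int s) ` {1..m})) =
      f 0 + (sum f (int ` {1..m}) + sum f ((\<lambda>s. - int s) ` {1..m}))"
    by (subst sum.insert, simp, force, subst sum.union_disjoint) auto
  ultimately show ?thesis by (simp add: sum.reindex inj_on_def sum.distrib)
qed

lemma poly_symbol_poly:
  assumes sym: "\<And>s. a (- s) = a s" and z: "(z :: 'a::field) \<noteq> 0"
  shows "poly (symbol_poly m a) z = z ^ m * laurent m a z"
proof -
  have "poly (symbol_poly m a) z = (\<Sum>s\<in>{- int m..int m}. a s * z ^ nat (s + int m))"
    by (simp add: symbol_poly_def poly_sum poly_monom)
  also have "\<dots> = a 0 * z ^ m +
      (\<Sum>s\<in>{1..m}. a (int s) * z ^ nat (int s + int m) + a (- int s) * z ^ nat (- int s + int m))"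
    by (subst sum_symmetric_interval) simp
  also have "(\<Sum>s\<in>{1..m}. a (int s) * z ^ nat (int s + int m) + a (- int s) * z ^ nat (- int s + int m)) =
      (\<Sum>s\<in>{1..m}. z ^ m * (a (int s) * (z ^ s + inverse z ^ s)))"
  proof (rule sum.cong)
    fix s assume s: "s \<in> {1..m}"
    then have "nat (int s + int m) = m + s" "nat (- int s + int m) = m - s" by auto
    moreover have "z ^ (m - s) = z ^ m * inverse z ^ s"
      using s z by (simp add: power_diff power_inverse field_simps)
    ultimately show "a (int s) * z ^ nat (int s + int m) + a (- int s) * z ^ nat (- int s + int m) =
        z ^ m * (a (int s) * (z ^ s + inverse z ^ s))"
      by (simp add: sym power_add algebra_simps)
  qed simp
  finally show ?thesis by (simp add: laurent_def sum_distrib_left algebra_simps)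
qed

text \<open>At a zero of the symbol the derivative of the factor z^m drops out, so a root of q is
  simple exactly if \<open>laurent_deriv\<close> does not vanish there.\<close>

lemma poly_pderiv_symbol_poly:
  assumes sym: "\<And>s. a (- s) = a s" and z: "(z :: 'a::field) \<noteq> 0" and root: "laurent m a z = 0"
  shows "z * poly (pderiv (symbol_poly m a)) z = z ^ m * laurent_deriv m a z"
proof -
  have monom: "z * poly (pderiv (monom c k)) z = of_nat k * c * z ^ k" for c :: 'a and k
    by (cases k) (simp_all add: pderiv_monom poly_monom mult_ac)
  have "z * poly (pderiv (symbol_poly m a)) z =
      (\<Sum>s\<in>{- int m..int m}. z * poly (pderiv (monom (a s) (nat (s + int m)))) z)"
    by (simp add: symbol_poly_def pderiv_sum poly_sum sum_distrib_left)
  also have "\<dots> = (\<Sum>s\<in>{- int m..int m}. of_nat (nat (s + int m)) * a s * z ^ nat (s + int m))"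
    unfolding monom ..
  also have "\<dots> = of_nat m * a 0 * z ^ m +
      (\<Sum>s\<in>{1..m}. of_nat (nat (int s + int m)) * a (int s) * z ^ nat (int s + int m)
        + of_nat (nat (- int s + int m)) * a (- int s) * z ^ nat (- int s + int m))"
    by (subst sum_symmetric_interval) simp
  also have "(\<Sum>s\<in>{1..m}. of_nat (nat (int s + int m)) * a (int s) * z ^ nat (int s + int m)
        + of_nat (nat (- int s + int m)) * a (- int s) * z ^ nat (- int s + int m)) =
      (\<Sum>s\<in>{1..m}. of_nat m * z ^ m * (a (int s) * (z ^ s + inverse z ^ s))
        + z ^ m * (of_nat s * a (int s) * (z ^ s - inverse z ^ s)))"
  proof (rule sum.cong)
    fix s assume s: "s \<in> {1..m}"
    then have n: "nat (int s + int m) = m + s" "nat (- int s + int m) = m - s" by auto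
    have e: "z ^ (m - s) = z ^ m * inverse z ^ s"
      using s z by (simp add: power_diff power_inverse field_simps)
    have o: "of_nat (m - s) = (of_nat m - of_nat s :: 'a)" using s by (simp add: of_nat_diff)
    show "of_nat (nat (int s + int m)) * a (int s) * z ^ nat (int s + int m)
        + of_nat (nat (- int s + int m)) * a (- int s) * z ^ nat (- int s + int m) =
      of_nat m * z ^ m * (a (int s) * (z ^ s + inverse z ^ s))
        + z ^ m * (of_nat s * a (int s) * (z ^ s - inverse z ^ s))"
      unfolding n e o by (simp add: sym power_add algebra_simps)
  qed simp
  also have "of_nat m * a 0 * z ^ m + \<dots> = of_nat m * z ^ m * laurent m a z + z ^ m * laurent_deriv m a z"
    unfolding sum.distrib sum_distrib_left[symmetric] laurent_def laurent_deriv_def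
    by (simp add: distrib_left mult_ac)
  finally show ?thesis using root by simp
qed

text \<open>\<open>root_vec m a z\<close> is an eigenvector of \<open>transfer_mat m a\<close> with eigenvalue \<open>z\<close> when \<open>z\<close> is a zero of the symbol.\<close>

definition root_vec :: "nat \<Rightarrow> (int \<Rightarrow> 'a::field) \<Rightarrow> 'a \<Rightarrow> nat \<Rightarrow> 'a" where
  "root_vec m a z i = (if i < m then \<Sum>s\<in>{Suc i..m}. a (int s) * z ^ (s - i) else inverse z ^ (i - m))"

definition std_pairing :: "nat \<Rightarrow> (nat \<Rightarrow> 'a::field) \<Rightarrow> (nat \<Rightarrow> 'a) \<Rightarrow> 'a" where
  "std_pairing m v w = (\<Sum>t<m. v t * w (m + t) - v (m + t) * w t)"

lemma sum_double:
  fixes f :: "nat \<Rightarrow> 'b::comm_monoid_add"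
  shows "(\<Sum>b<2 * m. f b) = (\<Sum>b<m. f b) + (\<Sum>b<m. f (m + b))"
proof -
  have "(\<Sum>b<2 * m. f b) = (\<Sum>b = 0..<m. f b) + (\<Sum>b = m..<2 * m. f b)"
    unfolding lessThan_atLeast0 by (rule sum.atLeastLessThan_concat[symmetric]) auto
  also have "(\<Sum>b = m..<2 * m. f b) = (\<Sum>b = 0..<m. f (m + b))"
    using sum.shift_bounds_nat_ivl[of f 0 m m] by (simp add: add.commute mult_2)
  finally show ?thesis by (simp add: lessThan_atLeast0)
qed

text \<open>Rows other than 0 express the recursion satisfied by the entries of
  \<open>root_vec\<close>. Row 0 closes the recursion, and there the vanishing of the symbol is
  used.\<close>

lemma transfer_mat_root_vec:
  fixes z :: "'a::field"
  assumes a: "a \<in> sym_params m" and z: "z \<noteq> 0" and root: "laurent m a z = 0" and i: "i < 2 * m"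
  shows "(\<Sum>b<2 * m. transfer_mat m a $$ (i, b) * root_vec m a z b) = z * root_vec m a z i"
proof -
  have am: "a (int m) \<noteq> 0" using a by (simp add: sym_params_def)
  let ?w = "root_vec m a z"
  have m: "m \<noteq> 0" using i by auto
  have top: "?w (m - 1) = a (int m) * z" using m by (simp add: root_vec_def Suc_diff_le)
  have step: "?w b = z * ?w (Suc b) + a (int (Suc b)) * z" if "Suc b < m" for b
  proof -
    have "{Suc b..m} = insert (Suc b) {Suc (Suc b)..m}" using that by auto
    then have "?w b = a (int (Suc b)) * z + (\<Sum>s\<in>{Suc (Suc b)..m}. a (int s) * z ^ (s - b))"
      using that by (simp add: root_vec_def Suc_diff_le)
    also have "(\<Sum>s\<in>{Suc (Suc b)..m}. a (int s) * z ^ (s - b)) =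
        (\<Sum>s\<in>{Suc (Suc b)..m}. z * (a (int s) * z ^ (s - Suc b)))"
    proof (rule sum.cong)
      fix s assume "s \<in> {Suc (Suc b)..m}"
      then have "s - b = Suc (s - Suc b)" by auto
      then show "a (int s) * z ^ (s - b) = z * (a (int s) * z ^ (s - Suc b))" by simp
    qed simp
    finally show ?thesis using that by (simp add: root_vec_def sum_distrib_left algebra_simps)
  qed
  have low: "(\<Sum>b<m. transfer_mat m a $$ (i, b) * ?w b) =
      (if i < m then (if i = 0 then 0 else ?w (i - 1)) - a (int i) * z else if i = m then z else 0)"
  proof (cases "i < m")
    case True
    have "(\<Sum>b<m. transfer_mat m a $$ (i, b) * ?w b) =
        (\<Sum>b<m. (if i = b + 1 then ?w b else 0) - (if b = m - 1 then a (int i) / a (int m) * ?w b else 0))"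
      using True m by (intro sum.cong refl) (auto simp: transfer_mat_def algebra_simps)
    also have "\<dots> = (\<Sum>b<m. if i = b + 1 then ?w b else 0) - a (int i) / a (int m) * ?w (m - 1)"
      using m by (simp add: sum_subtractf)
    also have "(\<Sum>b<m. if i = b + 1 then ?w b else 0) = (if i = 0 then 0 else ?w (i - 1))"
    proof (cases i)
      case (Suc k)
      then have "(\<Sum>b<m. if i = b + 1 then ?w b else 0) = (\<Sum>b<m. if b = k then ?w b else 0)"
        by (intro sum.cong) auto
      then show ?thesis using True Suc by simp
    qed simp
    finally show ?thesis using True am top by simp
  next
    case False
    have "(\<Sum>b<m. transfer_mat m a $$ (i, b) * ?w b) =
        (\<Sum>b<m. if b = m - 1 then (if i = m then ?w b / a (int m) else 0) else 0)"
      using False m i by (intro sum.cong refl) (auto simp: transfer_mat_def)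
    then show ?thesis using False m am top by simp
  qed
  have high: "(\<Sum>b<m. transfer_mat m a $$ (i, m + b) * ?w (m + b)) =
      (if i = 0 then - (\<Sum>b<m. a (int (Suc b)) * inverse z ^ b)
       else if m < i then inverse z ^ (i - m - 1) else 0)"
  proof (cases "i < m")
    case True
    have "(\<Sum>b<m. transfer_mat m a $$ (i, m + b) * ?w (m + b)) =
        (\<Sum>b<m. if i = 0 then - (a (int (Suc b)) * inverse z ^ b) else 0)"
      using True by (intro sum.cong refl) (auto simp: transfer_mat_def root_vec_def add.commute)
    then show ?thesis using True by (simp add: sum_negf)
  next
    case False
    then obtain j where j: "i = m + j" "j < m" using i le_Suc_ex[of m i] by fastforce
    have "(\<Sum>b<m. transfer_mat m a $$ (i, m + b) * ?w (m + b)) =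
        (\<Sum>b<m. if j = b + 1 then inverse z ^ b else 0)"
      using j by (intro sum.cong refl) (auto simp: transfer_mat_def root_vec_def)
    also have "\<dots> = (if j = 0 then 0 else inverse z ^ (j - 1))"
    proof (cases j)
      case (Suc k)
      then have "(\<Sum>b<m. if j = b + 1 then inverse z ^ b else 0) = (\<Sum>b<m. if b = k then inverse z ^ b else 0)"
        by (intro sum.cong) auto
      then show ?thesis using j Suc by simp
    qed simp
    finally show ?thesis using j m by simp
  qed
  consider "i = 0" | k where "i = Suc k" "i < m" | "i = m" | j where "i = m + Suc j"
  proof -
    have "i = 0 \<or> (\<exists>k. i = Suc k \<and> i < m) \<or> i = m \<or> (\<exists>j. i = m + Suc j)"
      by (metis add_Suc_right less_imp_Suc_add linorder_neqE_nat not0_implies_Suc)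
    then show thesis using that by blast
  qed
  then show ?thesis
  proof cases
    case 1
    have "(\<Sum>b<m. a (int (Suc b)) * inverse z ^ b) = (\<Sum>s\<in>{1..m}. a (int s) * (z * inverse z ^ s))"
    proof -
      have "(\<Sum>s\<in>{1..m}. a (int s) * (z * inverse z ^ s)) =
          (\<Sum>b\<in>{0..<m}. a (int (Suc b)) * (z * inverse z ^ Suc b))"
        by (rule sum.reindex_bij_witness[of _ Suc "\<lambda>s. s - 1"]) auto
      then show ?thesis using z by (simp add: lessThan_atLeast0 field_simps)
    qed
    moreover have "z * ?w 0 = (\<Sum>s\<in>{1..m}. a (int s) * (z * z ^ s))"
      using m by (simp add: root_vec_def sum_distrib_left mult.left_commute)
    moreover have "z * laurent m a z = a 0 * z + (\<Sum>s\<in>{1..m}. a (int s) * (z * z ^ s))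
        + (\<Sum>s\<in>{1..m}. a (int s) * (z * inverse z ^ s))"
      by (simp add: laurent_def sum_distrib_left sum.distrib algebra_simps)
    ultimately have "a 0 * z + z * ?w 0 + (\<Sum>b<m. a (int (Suc b)) * inverse z ^ b) = 0"
      using root by (simp only: mult_zero_right)
    moreover have "x = (y + x + B) - y - B" for x y B :: 'a by simp
    ultimately have "z * ?w 0 = 0 - a 0 * z - (\<Sum>b<m. a (int (Suc b)) * inverse z ^ b)" by metis
    then show ?thesis using 1 m unfolding sum_double low high by simp
  next
    case 2
    then show ?thesis using step[of k] unfolding sum_double low high by simp
  next
    case 3
    then show ?thesis using m unfolding sum_double low high by (simp add: root_vec_def)
  next
    case 4
    then show ?thesis using z unfolding sum_double low high by (simp add: root_vec_def)
  qed
qed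

text \<open>Exchanging the summations collects, for each coefficient a_s, a geometric sum in
  1/(yz).\<close>

lemma std_pairing_root_vec:
  fixes y z :: "'a::field"
  assumes y: "y \<noteq> 0" and z: "z \<noteq> 0"
  shows "std_pairing m (root_vec m a y) (root_vec m a z) =
    (\<Sum>s\<in>{1..m}. a (int s) * ((y ^ s - z ^ s) * (\<Sum>t<s. (inverse y * inverse z) ^ t)))"
proof -
  have "std_pairing m (root_vec m a y) (root_vec m a z) =
      (\<Sum>t<m. \<Sum>s\<in>{Suc t..m}. a (int s) * (y ^ (s - t) * inverse z ^ t - inverse y ^ t * z ^ (s - t)))"
    by (simp add: std_pairing_def root_vec_def sum_distrib_left sum_distrib_right
        algebra_simps flip: sum_subtractf)
  also have "\<dots> = (\<Sum>t<m. \<Sum>s\<in>{1..m}. if t < s then a (int s) * ((y ^ s - z ^ s) * (inverse y * inverse z) ^ t) else 0)"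
  proof (rule sum.cong, rule refl)
    fix t assume "t \<in> {..<m}"
    have "(\<Sum>s\<in>{Suc t..m}. a (int s) * (y ^ (s - t) * inverse z ^ t - inverse y ^ t * z ^ (s - t))) =
        (\<Sum>s\<in>{Suc t..m}. a (int s) * ((y ^ s - z ^ s) * (inverse y * inverse z) ^ t))"
    proof (rule sum.cong)
      fix s assume "s \<in> {Suc t..m}"
      then have "y ^ (s - t) = y ^ s * inverse y ^ t" "z ^ (s - t) = z ^ s * inverse z ^ t"
        using y z by (simp_all add: power_diff power_inverse field_simps)
      then show "a (int s) * (y ^ (s - t) * inverse z ^ t - inverse y ^ t * z ^ (s - t)) =
          a (int s) * ((y ^ s - z ^ s) * (inverse y * inverse z) ^ t)"
        by (simp add: power_mult_distrib algebra_simps)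
    qed simp
    also have "\<dots> = (\<Sum>s\<in>{s \<in> {1..m}. t < s}. a (int s) * ((y ^ s - z ^ s) * (inverse y * inverse z) ^ t))"
      by (rule sum.cong) auto
    also have "\<dots> = (\<Sum>s\<in>{1..m}. if t < s then a (int s) * ((y ^ s - z ^ s) * (inverse y * inverse z) ^ t) else 0)"
      by (rule sum.inter_filter) simp
    finally show "(\<Sum>s\<in>{Suc t..m}. a (int s) * (y ^ (s - t) * inverse z ^ t - inverse y ^ t * z ^ (s - t))) =
        (\<Sum>s\<in>{1..m}. if t < s then a (int s) * ((y ^ s - z ^ s) * (inverse y * inverse z) ^ t) else 0)" .
  qed
  also have "\<dots> = (\<Sum>s\<in>{1..m}. \<Sum>t<m. if t < s then a (int s) * ((y ^ s - z ^ s) * (inverse y * inverse z) ^ t) else 0)"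
    by (rule sum.swap)
  also have "\<dots> = (\<Sum>s\<in>{1..m}. a (int s) * ((y ^ s - z ^ s) * (\<Sum>t<s. (inverse y * inverse z) ^ t)))"
  proof (rule sum.cong, rule refl)
    fix s assume s: "s \<in> {1..m}"
    have "(\<Sum>t<m. if t < s then a (int s) * ((y ^ s - z ^ s) * (inverse y * inverse z) ^ t) else 0) =
        (\<Sum>t\<in>{t \<in> {..<m}. t < s}. a (int s) * ((y ^ s - z ^ s) * (inverse y * inverse z) ^ t))"
      by (rule sum.inter_filter[symmetric]) simp
    also have "{t \<in> {..<m}. t < s} = {..<s}" using s by auto
    finally show "(\<Sum>t<m. if t < s then a (int s) * ((y ^ s - z ^ s) * (inverse y * inverse z) ^ t) else 0) =
        a (int s) * ((y ^ s - z ^ s) * (\<Sum>t<s. (inverse y * inverse z) ^ t))"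
      by (simp add: sum_distrib_left)
  qed
  finally show ?thesis .
qed

text \<open>Multiplication by 1 - 1/(yz) closes the geometric sums and turns the pairing into the
  difference of the values of the symbol at y and z.\<close>

lemma std_pairing_orthogonal:
  fixes y z :: "'a::field"
  assumes y: "y \<noteq> 0" and z: "z \<noteq> 0" and roots: "laurent m a y = 0" "laurent m a z = 0" and "y * z \<noteq> 1"
  shows "std_pairing m (root_vec m a y) (root_vec m a z) = 0"
proof -
  let ?p = "inverse y * inverse z"
  have p: "1 - ?p \<noteq> 0" using y z \<open>y * z \<noteq> 1\<close> by (simp add: field_simps)
  have "(1 - ?p) * std_pairing m (root_vec m a y) (root_vec m a z) =
      (\<Sum>s\<in>{1..m}. a (int s) * ((y ^ s - z ^ s) * ((1 - ?p) * (\<Sum>t<s. ?p ^ t))))"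
    by (simp add: std_pairing_root_vec[OF y z] sum_distrib_left mult_ac)
  also have "\<dots> = (\<Sum>s\<in>{1..m}. a (int s) * (y ^ s + inverse y ^ s) - a (int s) * (z ^ s + inverse z ^ s))"
  proof (rule sum.cong)
    fix s
    have "(1 - ?p) * (\<Sum>t<s. ?p ^ t) = 1 - ?p ^ s" by (rule one_diff_power_eq[symmetric])
    moreover have "(y ^ s - z ^ s) * (1 - ?p ^ s) = (y ^ s + inverse y ^ s) - (z ^ s + inverse z ^ s)"
      using y z by (simp add: power_mult_distrib power_inverse field_simps)
    ultimately show "a (int s) * ((y ^ s - z ^ s) * ((1 - ?p) * (\<Sum>t<s. ?p ^ t))) =
        a (int s) * (y ^ s + inverse y ^ s) - a (int s) * (z ^ s + inverse z ^ s)"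
      by (simp only: right_diff_distrib)
  qed simp
  also have "\<dots> = laurent m a y - laurent m a z" by (simp add: laurent_def sum_subtractf)
  finally show ?thesis using p roots by simp
qed

text \<open>For reciprocal arguments all terms of the geometric sums are 1. Hence the pairing of an
  eigenvector with its partner is nonzero exactly when the root is simple.\<close>

lemma std_pairing_inverse:
  fixes z :: "'a::field"
  assumes z: "z \<noteq> 0"
  shows "std_pairing m (root_vec m a z) (root_vec m a (inverse z)) = laurent_deriv m a z"
proof -
  have "inverse z * inverse (inverse z) = 1" using z by simp
  then show ?thesis
    using z unfolding std_pairing_root_vec[OF z nonzero_imp_inverse_nonzero[OF z]] laurent_deriv_def
    by (intro sum.cong refl) (simp add: algebra_simps)
qed

lemma std_pairing_swap: "std_pairing m v w = - std_pairing m w v"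
  by (simp add: std_pairing_def sum_negf[symmetric] algebra_simps)

lemma std_form_congruence:
  fixes A :: "'a::field mat"
  assumes A: "A \<in> carrier_mat (2 * m) (2 * m)" and k: "k < 2 * m" and l: "l < 2 * m"
  shows "(transpose_mat A * std_form m * A) $$ (k, l) =
    std_pairing m (\<lambda>i. A $$ (i, k)) (\<lambda>i. A $$ (i, l))"
proof -
  have J: "(std_form m :: 'a mat) \<in> carrier_mat (2 * m) (2 * m)" by (simp add: std_form_def)
  have 1: "(transpose_mat A * std_form m :: 'a mat) $$ (k, j) =
      (if j < m then - A $$ (m + j, k) else A $$ (j - m, k))" if j: "j < 2 * m" for j
  proof -
    have "(transpose_mat A * std_form m :: 'a mat) $$ (k, j) = (\<Sum>i<2 * m. A $$ (i, k) * std_form m $$ (i, j))"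
      using k j carrier_matD[OF A] carrier_matD[OF J] by (simp add: scalar_prod_def lessThan_atLeast0)
    also have "\<dots> = (\<Sum>i<2 * m. if i = (if j < m then m + j else j - m) then A $$ (i, k) * std_form m $$ (i, j) else 0)"
      using j by (intro sum.cong refl) (auto simp: std_form_def)
    also have "\<dots> = (if j < m then - A $$ (m + j, k) else A $$ (j - m, k))"
      using j by (auto simp: std_form_def)
    finally show ?thesis .
  qed
  have "(transpose_mat A * std_form m * A) $$ (k, l) =
      (\<Sum>j<2 * m. (transpose_mat A * std_form m) $$ (k, j) * A $$ (j, l))"
    using k l carrier_matD[OF A] carrier_matD[OF J]
    by (simp add: scalar_prod_def lessThan_atLeast0 del: assoc_mult_mat)
  also have "\<dots> = (\<Sum>j<2 * m. (if j < m then - A $$ (m + j, k) else A $$ (j - m, k)) * A $$ (j, l))"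
    using 1 by (intro sum.cong) auto
  also have "\<dots> = std_pairing m (\<lambda>i. A $$ (i, k)) (\<lambda>i. A $$ (i, l))"
    unfolding sum_double by (simp add: std_pairing_def sum_negf sum_subtractf)
  finally show ?thesis .
qed

lemma prod_double:
  fixes f :: "nat \<Rightarrow> 'b::comm_monoid_mult"
  shows "(\<Prod>b<2 * m. f b) = (\<Prod>b<m. f b) * (\<Prod>b<m. f (m + b))"
proof -
  have "(\<Prod>b<2 * m. f b) = (\<Prod>b = 0..<m. f b) * (\<Prod>b = m..<2 * m. f b)"
    unfolding lessThan_atLeast0 by (rule prod.atLeastLessThan_concat[symmetric]) auto
  also have "(\<Prod>b = m..<2 * m. f b) = (\<Prod>b = 0..<m. f (m + b))"
    using prod.shift_bounds_nat_ivl[of f 0 m m] by (simp add: add.commute mult_2)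
  finally show ?thesis by (simp add: lessThan_atLeast0)
qed

lemma symbol_poly_roots:
  assumes "reciprocal_roots m a x"
  shows "symbol_poly m a = Polynomial.smult (a (int m)) (\<Prod>k<2 * m. [:- pair_diag m x k, 1:])"
proof -
  have "(\<Prod>k<m. [:- pair_diag m x k, 1:]) = (\<Prod>k<m. [:- x k, 1:])"
    "(\<Prod>k<m. [:- pair_diag m x (m + k), 1:]) = (\<Prod>k<m. [:- inverse (x k), 1:])"
    by (rule prod.cong; simp add: pair_diag_def)+
  then show ?thesis
    using assms unfolding reciprocal_roots_def prod_double by (simp only: prod.distrib)
qed

lemma reciprocal_roots_nonzero:
  fixes a :: "int \<Rightarrow> 'a::field"
  assumes a: "a \<in> sym_params m" and r: "reciprocal_roots m a x" and i: "i < m"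
  shows "x i \<noteq> 0"
proof
  assume "x i = 0"
  then have "poly (symbol_poly m a) 0 = 0"
    using i r unfolding reciprocal_roots_def by (auto simp: poly_prod)
  moreover have "poly (symbol_poly m a) 0 = a (int m)"
    using a by (simp add: poly_0_coeff_0 coeff_symbol_poly sym_params_def)
  ultimately show False using a by (simp add: sym_params_def)
qed

lemma simple_roots_inj:
  fixes r :: "nat \<Rightarrow> 'a::field"
  assumes "rsquarefree (Polynomial.smult c (\<Prod>k<n. [:- r k, 1:]))"
  shows "inj_on r {..<n}"
proof (rule inj_onI, rule ccontr)
  let ?q = "Polynomial.smult c (\<Prod>k<n. [:- r k, 1:])"
  fix k l assume kl: "k \<in> {..<n}" "l \<in> {..<n}" "r k = r l" "k \<noteq> l"
  have "(\<Prod>k<n. [:- r k, 1:]) = [:- r k, 1:] * ([:- r l, 1:] * (\<Prod>k\<in>{..<n} - {k} - {l}. [:- r k, 1:]))"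
    using kl by (subst prod.remove[of _ k], simp, simp, subst prod.remove[of _ l]) auto
  then have "(\<Prod>k<n. [:- r k, 1:]) = [:- r k, 1:] ^ 2 * (\<Prod>k\<in>{..<n} - {k} - {l}. [:- r k, 1:])"
    by (simp only: kl(3) power2_eq_square mult.assoc)
  then have "[:- r k, 1:] ^ 2 dvd ?q" by (metis dvd_smult dvd_triv_left)
  moreover have "?q \<noteq> 0" using assms by (auto simp: rsquarefree_def)
  ultimately have "2 \<le> order (r k) ?q" by (simp add: order_divides)
  with assms show False unfolding rsquarefree_def by (metis one_le_numeral not_numeral_le_zero numeral_le_one_iff semiring_norm(69))
qed

theorem transfer_mat_diagonalization:
  fixes a :: "int \<Rightarrow> 'a::field_char_0"
  assumes a: "a \<in> sym_params m" and sf: "rsquarefree (symbol_poly m a)" and rr: "reciprocal_roots m a x"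
  obtains A where "A \<in> carrier_mat (2 * m) (2 * m)" "transpose_mat A * std_form m * A = std_form m"
    "transfer_mat m a * A = A * mat (2 * m) (2 * m) (\<lambda>(i, j). if i = j then pair_diag m x j else 0)"
proof -
  let ?r = "pair_diag m x" and ?q = "symbol_poly m a"
  have sym: "\<And>s. a (- s) = a s" and am: "a (int m) \<noteq> 0" using a by (auto simp: sym_params_def)
  have r0: "?r k \<noteq> 0" if "k < 2 * m" for k
    using reciprocal_roots_nonzero[OF a rr] that by (auto simp: pair_diag_def)
  have inj: "inj_on ?r {..<2 * m}"
    using sf unfolding symbol_poly_roots[OF rr] by (rule simple_roots_inj)
  have root: "poly ?q (?r k) = 0" if "k < 2 * m" for k
    using that unfolding symbol_poly_roots[OF rr] by (auto simp: poly_prod)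
  have laur: "laurent m a (?r k) = 0" if "k < 2 * m" for k
    using root[OF that] poly_symbol_poly[of a "?r k" m, OF sym r0[OF that]] r0[OF that] by simp
  have der: "laurent_deriv m a (?r k) \<noteq> 0" if k: "k < 2 * m" for k
  proof
    assume "laurent_deriv m a (?r k) = 0"
    then have "poly (pderiv ?q) (?r k) = 0"
      using poly_pderiv_symbol_poly[of a "?r k" m, OF sym r0[OF k] laur[OF k]] r0[OF k] by simp
    with root[OF k] sf show False by (metis rsquarefree_roots)
  qed
  \<comment> \<open>\<open>p k\<close> is the position of the reciprocal root. As the roots are
    distinct, no other product of two of them is 1.\<close>
  define p where "p = (\<lambda>k. if k < m then m + k else k - m)"
  have p: "p k < 2 * m" "?r (p k) = inverse (?r k)" if "k < 2 * m" for k
    using that by (auto simp: p_def pair_diag_def)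
  have unit: "?r k * ?r l = 1 \<longleftrightarrow> l = p k" if kl: "k < 2 * m" "l < 2 * m" for k l
  proof -
    have "?r k * ?r l = 1 \<longleftrightarrow> ?r l = ?r (p k)"
      using r0[OF kl(1)] by (simp add: p(2)[OF kl(1)] field_simps)
    also have "\<dots> \<longleftrightarrow> l = p k" using inj_on_eq_iff[OF inj] kl p(1)[OF kl(1)] by simp
    finally show ?thesis .
  qed
  \<comment> \<open>Scaling one vector of each reciprocal pair normalizes the pairing to 1.\<close>
  define c where "c = (\<lambda>k. if k < m then inverse (laurent_deriv m a (?r k)) else 1)"
  define A where "A = mat (2 * m) (2 * m) (\<lambda>(i, k). c k * root_vec m a (?r k) i)"
  have Ac: "A \<in> carrier_mat (2 * m) (2 * m)" by (simp add: A_def)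
  have pair: "std_pairing m (\<lambda>i. A $$ (i, k)) (\<lambda>i. A $$ (i, l)) =
      c k * c l * std_pairing m (root_vec m a (?r k)) (root_vec m a (?r l))"
    if "k < 2 * m" "l < 2 * m" for k l
    using that by (simp add: std_pairing_def A_def sum_distrib_left algebra_simps)
  have "transpose_mat A * std_form m * A = std_form m"
  proof (rule eq_matI)
    fix k l assume "k < dim_row (std_form m :: 'a mat)" "l < dim_col (std_form m :: 'a mat)"
    then have kl: "k < 2 * m" "l < 2 * m" by (auto simp: std_form_def)
    have "std_pairing m (\<lambda>i. A $$ (i, k)) (\<lambda>i. A $$ (i, l)) = std_form m $$ (k, l)"
    proof (cases "l = p k")
      case False
      then have "std_pairing m (root_vec m a (?r k)) (root_vec m a (?r l)) = 0"
        using unit[OF kl] kl r0 laur by (intro std_pairing_orthogonal) auto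
      moreover have "std_form m $$ (k, l) = (0 :: 'a)"
        using kl False by (auto simp: std_form_def p_def split: if_splits)
      ultimately show ?thesis unfolding pair[OF kl] by simp
    next
      case True
      show ?thesis
      proof (cases "k < m")
        case k: True
        have "std_pairing m (root_vec m a (?r k)) (root_vec m a (?r l)) = laurent_deriv m a (?r k)"
          unfolding True p(2)[OF kl(1)] using r0[OF kl(1)] by (rule std_pairing_inverse)
        then show ?thesis
          unfolding pair[OF kl] using k kl True der[OF kl(1)] by (simp add: c_def p_def std_form_def)
      next
        case k: False
        then have l: "l < m" "k = m + l" using True kl by (auto simp: p_def)
        have "?r k = inverse (?r l)" using l by (simp add: pair_diag_def)
        then have "std_pairing m (root_vec m a (?r k)) (root_vec m a (?r l)) = - laurent_deriv m a (?r l)"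
          using std_pairing_inverse[OF r0[OF kl(2)], of m a] by (subst std_pairing_swap) simp
        then show ?thesis
          unfolding pair[OF kl] using l kl der[OF kl(2)] by (simp add: c_def std_form_def)
      qed
    qed
    then show "(transpose_mat A * std_form m * A) $$ (k, l) = std_form m $$ (k, l)"
      by (simp add: std_form_congruence[OF Ac kl])
  qed (use Ac in \<open>auto simp: std_form_def\<close>)
  moreover have "transfer_mat m a * A = A * mat (2 * m) (2 * m) (\<lambda>(i, j). if i = j then ?r j else 0)"
    (is "_ = A * ?D")
  proof (rule eq_matI)
    fix i k assume "i < dim_row (A * ?D)" "k < dim_col (A * ?D)"
    then have ik: "i < 2 * m" "k < 2 * m" using Ac by auto
    have "(transfer_mat m a * A) $$ (i, k) = (\<Sum>b<2 * m. transfer_mat m a $$ (i, b) * A $$ (b, k))"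
      using ik Ac by (simp add: transfer_mat_def scalar_prod_def lessThan_atLeast0)
    also have "\<dots> = c k * (\<Sum>b<2 * m. transfer_mat m a $$ (i, b) * root_vec m a (?r k) b)"
      using ik by (simp add: A_def sum_distrib_left mult_ac)
    also have "\<dots> = A $$ (i, k) * ?r k"
      using ik unfolding transfer_mat_root_vec[OF a r0[OF ik(2)] laur[OF ik(2)] ik(1)]
      by (simp add: A_def mult_ac)
    also have "\<dots> = (\<Sum>b<2 * m. A $$ (i, b) * ?D $$ (b, k))"
    proof -
      have "(\<Sum>b<2 * m. A $$ (i, b) * ?D $$ (b, k)) = (\<Sum>b<2 * m. if b = k then A $$ (i, k) * ?r k else 0)"
        using ik by (intro sum.cong) auto
      then show ?thesis using ik by simp
    qed
    also have "\<dots> = (A * ?D) $$ (i, k)"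
      using ik Ac by (simp add: scalar_prod_def lessThan_atLeast0)
    finally show "(transfer_mat m a * A) $$ (i, k) = (A * ?D) $$ (i, k)" .
  qed (use Ac in \<open>auto simp: transfer_mat_def\<close>)
  ultimately show ?thesis using Ac that by blast
qed

section \<open>Complementary minors of symmetric matrices\<close>

lemma compl_minor_eq:
  assumes "A \<in> carrier_mat N N" "I \<subseteq> {..<N}" "J \<subseteq> {..<N}" "card I = card J"
  shows "compl_minor A (I, J) = minor (\<lambda>i j. A $$ (i, j)) ({..<N} - I) ({..<N} - J)"
proof -
  have "finite I" "finite J" using assms finite_subset by blast+
  then have "card ({..<N} - I) = card ({..<N} - J)" using assms by (simp add: card_Diff_subset)
  then show ?thesis
    using assms unfolding compl_minor_def fst_conv snd_conv by (subst det_submatrix) auto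
qed

text \<open>A copy of row \<open>t\<close> is added at a fresh index above \<open>P\<close>. The
  enlarged minor has two equal rows, and expanding it along the copy gives the sum.\<close>

lemma minor_expand_repeated_row:
  fixes f :: "nat \<Rightarrow> nat \<Rightarrow> 'a::field"
  assumes P: "finite P" and Q: "finite Q" and c: "card Q = Suc (card P)" and t: "t \<in> P"
  shows "(\<Sum>s\<in>Q. sg s Q * f t s * minor f P (Q - {s})) = 0"
proof -
  obtain N where N: "P \<subseteq> {..<N}" using finite_nat_iff_bounded P by blast
  let ?f = "\<lambda>i j. if i = N then f t j else f i j"
  have NP: "N \<notin> P" "t \<noteq> N" using N t by auto
  have "minor ?f (insert N P) Q = 0"
    using P c NP t by (intro minor_identical_rows[of _ _ N t]) auto
  moreover have "minor ?f (insert N P) Q =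
      (\<Sum>s\<in>Q. sg N (insert N P) * sg s Q * ?f N s * minor ?f (insert N P - {N}) (Q - {s}))"
    using P Q c NP by (intro minor_row) auto
  moreover have "\<dots> = sg N (insert N P) * (\<Sum>s\<in>Q. sg s Q * f t s * minor f P (Q - {s}))"
    unfolding sum_distrib_left
  proof (rule sum.cong)
    fix s assume "s \<in> Q"
    then have "minor ?f P (Q - {s}) = minor f P (Q - {s})"
      using P Q c NP by (intro minor_cong) auto
    then show "sg N (insert N P) * sg s Q * ?f N s * minor ?f (insert N P - {N}) (Q - {s}) =
        sg N (insert N P) * (sg s Q * f t s * minor f P (Q - {s}))"
      using NP by (simp add: mult.assoc)
  qed simp
  ultimately show ?thesis by (simp add: sg_def)
qed

text \<open>Expanding each minor along row t gives a double sum over pairs (t, s). The entry is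
  symmetric in t and s while the signs are antisymmetric, so the sum is its own negative. Indices t
  in \<open>P\<close> contribute nothing, by the repeated row.\<close>

lemma symmetric_minor_relation:
  fixes f :: "nat \<Rightarrow> nat \<Rightarrow> 'a::field_char_0"
  assumes P: "finite P" and Q: "finite Q" and c: "card Q = card P + 2"
    and sym: "\<And>i j. f i j = f j i"
  shows "(\<Sum>t\<in>Q - P. sg t Q * sg t P * minor f (insert t P) (Q - {t})) = 0"
proof -
  let ?g = "\<lambda>t s. if s = t then 0 else sg t Q * (sg s (Q - {t}) * f t s * minor f P (Q - {t} - {s}))"
  let ?Z = "\<Sum>t\<in>Q. \<Sum>s\<in>Q. ?g t s"
  have row: "(\<Sum>s\<in>Q. ?g t s) = (if t \<in> P then 0 else sg t Q * sg t P * minor f (insert t P) (Q - {t}))"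
    if t: "t \<in> Q" for t
  proof -
    have ct: "card (Q - {t}) = Suc (card P)" using t Q c by simp
    have "(\<Sum>s\<in>Q. ?g t s) = sg t Q * (\<Sum>s\<in>Q - {t}. sg s (Q - {t}) * f t s * minor f P (Q - {t} - {s}))"
      unfolding sum_distrib_left using Q by (intro sum.mono_neutral_cong_right) auto
    also have "(\<Sum>s\<in>Q - {t}. sg s (Q - {t}) * f t s * minor f P (Q - {t} - {s})) =
        (if t \<in> P then 0 else sg t P * minor f (insert t P) (Q - {t}))"
    proof (cases "t \<in> P")
      case True
      then show ?thesis using minor_expand_repeated_row[OF P _ ct True, of f] Q by simp
    next
      case False
      have "minor f (insert t P) (Q - {t}) = (\<Sum>s\<in>Q - {t}. sg t (insert t P) * sg s (Q - {t}) * f t s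
          * minor f (insert t P - {t}) (Q - {t} - {s}))"
        using P Q ct False by (intro minor_row) auto
      also have "\<dots> = sg t P * (\<Sum>s\<in>Q - {t}. sg s (Q - {t}) * f t s * minor f P (Q - {t} - {s}))"
        using False by (simp add: sg_insert sum_distrib_left mult.assoc)
      finally show ?thesis using False by simp
    qed
    finally show ?thesis by simp
  qed
  have Z: "?Z = (\<Sum>t\<in>Q - P. sg t Q * sg t P * minor f (insert t P) (Q - {t}))"
  proof -
    have "?Z = (\<Sum>t\<in>Q. if t \<in> P then 0 else sg t Q * sg t P * minor f (insert t P) (Q - {t}))"
      by (rule sum.cong) (use row in auto)
    also have "\<dots> = (\<Sum>t\<in>Q - P. sg t Q * sg t P * minor f (insert t P) (Q - {t}))"
      using Q by (intro sum.mono_neutral_cong_right) auto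
    finally show ?thesis .
  qed
  have anti: "?Z = - ?Z"
  proof -
    have "?Z = (\<Sum>s\<in>Q. \<Sum>t\<in>Q. ?g t s)" by (rule sum.swap)
    also have "\<dots> = (\<Sum>s\<in>Q. \<Sum>t\<in>Q. - ?g s t)"
    proof (intro sum.cong refl)
      fix s t assume st: "s \<in> Q" "t \<in> Q"
      show "?g t s = - ?g s t"
      proof (cases "s = t")
        case False
        have "sg t Q * sg s (Q - {t}) = - (sg s Q * sg t (Q - {s}) :: 'a)"
          using False st by (cases s t rule: linorder_cases) (auto simp: sg_remove)
        moreover have "Q - {t} - {s} = Q - {s} - {t}" by auto
        ultimately show ?thesis using False sym[of s t] by (simp flip: mult.assoc)
      qed simp
    qed
    also have "\<dots> = - ?Z" by (simp add: sum_negf)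
    finally show ?thesis .
  qed
  have zero: "x = 0" if "x = - x" for x :: 'a
  proof -
    have "2 * x = 0" using that by (metis add.right_inverse mult_2)
    then show ?thesis by simp
  qed
  show ?thesis using zero[OF anti] unfolding Z .
qed

section \<open>States of symmetric matrices as primitive vectors\<close>

definition bstate :: "nat \<Rightarrow> 'a::field mat \<Rightarrow> nat set \<times> nat set \<Rightarrow> 'a" where
  "bstate m A = (\<lambda>p. if p \<in> boundary_pairs m then compl_minor A p else 0)"

definition sym_module :: "nat \<Rightarrow> (nat set \<times> nat set \<Rightarrow> 'a::field) set" where
  "sym_module m = {v \<in> coord_space (boundary_pairs m). psi m v \<in> primitive_module m (std_form m)}"

lemma sg_lo_pair:
  assumes "I \<subseteq> {..<m}" "t < m"
  shows "sg t (pair_set m I J) = (- 1 :: 'a::field) ^ card ({..<t} - I)"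
proof -
  have "pair_set m I J \<inter> {..<t} = {..<t} - I" using assms by (auto simp: pair_set_def)
  then show ?thesis by (simp add: sg_def)
qed

lemma sg_hi_pair:
  assumes "I \<subseteq> {..<m}" "J \<subseteq> {..<m}" "t < m"
  shows "sg (m + t) (pair_set m I J) = (- 1 :: 'a::field) ^ (card ({..<m} - I) + card (J \<inter> {..<t}))"
proof -
  have "pair_set m I J \<inter> {..<m + t} = ({..<m} - I) \<union> (+) m ` (J \<inter> {..<t})"
    by (auto simp: pair_set_def)
  moreover have "card (({..<m} - I) \<union> (+) m ` (J \<inter> {..<t})) =
      card ({..<m} - I) + card ((+) m ` (J \<inter> {..<t}))"
    by (rule card_Un_disjoint) auto
  moreover have "card ((+) m ` (J \<inter> {..<t})) = card (J \<inter> {..<t})" by (rule card_image) simp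
  ultimately show ?thesis by (simp add: sg_def)
qed

text \<open>At an index set of size m - 2 there are two more deleted rows than columns. Up to a
  common sign, contraction evaluated there is \<open>symmetric_minor_relation\<close> for the
  complements.\<close>

lemma bstate_in_sym_module:
  fixes A :: "'a::field_char_0 mat"
  assumes A: "A \<in> carrier_mat N N" "transpose_mat A = A" and N: "m \<le> N"
  shows "bstate m A \<in> sym_module m"
proof -
  \<comment> \<open>Clamping the indices extends the matrix to a function symmetric on all pairs of
    naturals, as \<open>symmetric_minor_relation\<close> demands.\<close>
  let ?f = "\<lambda>i j. A $$ (min i (N - 1), min j (N - 1))" and ?\<omega> = "psi m (bstate m A)"
  have symA: "A $$ (i, j) = A $$ (j, i)" if "i < N" "j < N" for i j
    using that A by (metis carrier_matD index_transpose_mat(1))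
  have "?f i j = ?f j i" for i j
  proof (cases "N = 0")
    case False
    then show ?thesis by (intro symA) auto
  next
    case True
    then show ?thesis using A by simp
  qed
  note sym = this
  have "contr m ?\<omega> R = 0" if R: "R \<subseteq> {..<2 * m}" "card R + 2 = m" for R
  proof -
    define I where "I = lo_set m R"
    define J where "J = hi_set m R"
    have IJ: "I \<subseteq> {..<m}" "J \<subseteq> {..<m}" by (auto simp: I_def J_def lo_set_def hi_set_def)
    have Rp: "R = pair_set m I J" using pair_set_lo_hi[OF R(1)] by (simp add: I_def J_def)
    have f: "finite I" "finite J" using IJ finite_subset by blast+
    have c: "card I = card J + 2" using card_pair_set[OF IJ] R(2) Rp by simp
    let ?P = "{..<N} - I" and ?Q = "{..<N} - J"
    \<comment> \<open>The part of the sign that is independent of t.\<close>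
    define K :: 'a where "K = (- 1) ^ (card ({..<m} - I) + m + card J) * tau m J"
    have mem: "t \<in> R \<longleftrightarrow> t \<notin> I" "m + t \<in> R \<longleftrightarrow> t \<in> J" if "t < m" for t
      using that IJ unfolding Rp by (auto simp: pair_set_def)
    have summand: "an (m + t) (an t ?\<omega>) R =
        (if t \<in> I - J then K * (sg t ?Q * sg t ?P * minor ?f (insert t ?P) (?Q - {t})) else 0)"
      if t: "t < m" for t
    proof (cases "t \<in> I - J")
      case False
      then show ?thesis using mem[OF t] by (auto simp: an_def)
    next
      case True
      have e: "insert t (insert (m + t) R) = pair_set m (I - {t}) (insert t J)"
        unfolding Rp using t by (auto simp: pair_set_def)
      have b: "(I - {t}, insert t J) \<in> boundary_pairs m"
        using IJ t True f c by (simp add: boundary_pairs_def subset_iff)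
      then have sub: "I - {t} \<subseteq> {..<m}" "insert t J \<subseteq> {..<m}" by (auto simp: boundary_pairs_def)
      have "?\<omega> (insert t (insert (m + t) R)) = tau m (insert t J) * compl_minor A (I - {t}, insert t J)"
        unfolding e using pair_set_ksubsets[OF b] b
        by (simp add: psi_def bstate_def lo_pair_set[OF sub(1)] hi_pair_set[OF sub(2)])
      also have "compl_minor A (I - {t}, insert t J) = minor ?f (insert t ?P) (?Q - {t})"
      proof -
        have E: "{..<N} - (I - {t}) = insert t ?P" "{..<N} - insert t J = ?Q - {t}"
          using t N by auto
        have sub': "I - {t} \<subseteq> {..<N}" "insert t J \<subseteq> {..<N}" "card (I - {t}) = card (insert t J)"
          using sub N b by (auto simp: boundary_pairs_def)
        have card_eq: "card (insert t ?P) = card (?Q - {t})"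
          unfolding E[symmetric] using sub' finite_subset[OF sub'(1)] finite_subset[OF sub'(2)]
          by (simp only: card_Diff_subset finite_lessThan)
        have "compl_minor A (I - {t}, insert t J) =
            minor (\<lambda>i j. A $$ (i, j)) (insert t ?P) (?Q - {t})"
          using compl_minor_eq[OF A(1) sub'] unfolding E .
        also have "\<dots> = minor ?f (insert t ?P) (?Q - {t})"
          using card_eq t N by (intro minor_cong) (auto simp: min_def)
        finally show ?thesis .
      qed
      also have "tau m (insert t J) = (- 1) ^ (t + m + card J) * tau m J"
        using f True by (intro tau_insert) auto
      finally have an: "an (m + t) (an t ?\<omega>) R = sg (m + t) R * sg t R *
          ((- 1) ^ (t + m + card J) * tau m J * minor ?f (insert t ?P) (?Q - {t}))"
        using True t mem[OF t] by (simp add: an_def sg_insert mult.assoc)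
      have sP: "sg t R = (sg t ?P :: 'a)"
      proof -
        have "?P \<inter> {..<t} = {..<t} - I" using t N by auto
        then show ?thesis unfolding Rp sg_lo_pair[OF IJ(1) t] by (simp add: sg_def)
      qed
      have sQ: "sg (m + t) R * (- 1) ^ (t + m + card J) * tau m J = K * sg t ?Q"
      proof -
        have Qt: "?Q \<inter> {..<t} = {..<t} - J" using t N by auto
        have "t = card ({..<t} - J) + card (J \<inter> {..<t})"
          using card_Int_Diff[of "{..<t}" J] by (simp add: Int_commute)
        then have pt: "(- 1 :: 'a) ^ t = (- 1) ^ card ({..<t} - J) * (- 1) ^ card (J \<inter> {..<t})"
          by (metis power_add)
        have square: "(- 1 :: 'a) ^ card (J \<inter> {..<t}) * (- 1) ^ card (J \<inter> {..<t}) = 1"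
          by (simp flip: power_add mult_2)
        have regroup: "x * y * (z * y * u * w) * k = y * y * (x * u * w * k * z)" for x y z u w k :: 'a
          by (simp add: mult_ac)
        show ?thesis
          unfolding Rp sg_hi_pair[OF IJ t] unfolding K_def sg_def power_add pt Qt regroup square by simp
      qed
      have regroup: "x * y * (u * w * z) = x * u * w * (y * z)" for x y u w z :: 'a
        by (simp add: mult_ac)
      show ?thesis unfolding an regroup sQ sP using True by (simp only: if_True mult.assoc)
    qed
    have "contr m ?\<omega> R = (\<Sum>t<m. if t \<in> I - J then K * (sg t ?Q * sg t ?P * minor ?f (insert t ?P) (?Q - {t})) else 0)"
      unfolding contr_eq sum_fun_apply using summand by (intro sum.cong) auto
    also have "\<dots> = (\<Sum>t\<in>?Q - ?P. K * (sg t ?Q * sg t ?P * minor ?f (insert t ?P) (?Q - {t})))"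
      using IJ N by (intro sum.mono_neutral_cong_right) auto
    also have "\<dots> = K * (\<Sum>t\<in>?Q - ?P. sg t ?Q * sg t ?P * minor ?f (insert t ?P) (?Q - {t}))"
      by (simp only: sum_distrib_left)
    also have "(\<Sum>t\<in>?Q - ?P. sg t ?Q * sg t ?P * minor ?f (insert t ?P) (?Q - {t})) = 0"
    proof (rule symmetric_minor_relation[OF _ _ _ sym])
      have "I \<subseteq> {..<N}" "J \<subseteq> {..<N}" using IJ N by auto
      then show "card ?Q = card ?P + 2"
        using f c card_mono[of "{..<N}" I] by (simp add: card_Diff_subset)
    qed auto
    finally show ?thesis by simp
  qed
  moreover have "contr m ?\<omega> \<in> coord_space {R. R \<subseteq> {..<2 * m} \<and> card R + 2 = m}"
    using psi_ext_power unfolding ext_power_def by (rule lam_degree)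
  ultimately have "contr m ?\<omega> = 0"
    by (intro ext) (auto simp: coord_space_def pointwise)
  then show ?thesis
    unfolding sym_module_def primitive_module_alt
    by (auto simp: psi_ext_power bstate_def coord_space_def)
qed

subsection \<open>Independence of the standard states\<close>

text \<open>
  Border a symmetric matrix by a row and column \<open>m\<close>. The standard pairs split according to which of
  the two sets contain \<open>m\<close>; the entry at \<open>(m, m)\<close> and the unit vectors in the border separate the
  resulting sums, and within the last one the largest remaining column is removed first.
\<close>

lemma ballot_complement_card:
  assumes "(I, J) \<in> ballot m h"
  shows "card ({..<m} - J) = card ({..<m} - I) + h" "finite I" "finite J"
proof -
  have s: "I \<subseteq> {..<m}" "J \<subseteq> {..<m}" "card I = card J + h" using assms by (auto simp: ballot_def)
  then show f: "finite I" "finite J" using finite_subset by blast+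
  have "card I \<le> m" using card_mono[OF _ s(1)] by simp
  then show "card ({..<m} - J) = card ({..<m} - I) + h" using s f by (simp add: card_Diff_subset)
qed

text \<open>Beyond c all positions belong to the new second set. The inequality at such a t
  therefore follows backwards from the equality of the total sizes.\<close>

lemma ballot_insert_max:
  assumes b: "(I, J) \<in> ballot m 1" and c: "c < m" "c \<notin> J" and max: "{Suc c..<m} \<subseteq> J"
  shows "(I, insert c J) \<in> ballot m 0"
proof -
  have s: "I \<subseteq> {..<m}" "J \<subseteq> {..<m}" "card I = card J + 1"
    and le: "\<And>t. t \<le> m \<Longrightarrow> card (J \<inter> {..<t}) \<le> card (I \<inter> {..<t})"
    using b by (auto simp: ballot_def)
  have f: "finite I" "finite J" using s finite_subset by blast+
  have "card (insert c J \<inter> {..<t}) \<le> card (I \<inter> {..<t})" if t: "t \<le> m" for t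
  proof (cases "t \<le> c")
    case True
    then have "insert c J \<inter> {..<t} = J \<inter> {..<t}" by auto
    then show ?thesis using le[OF t] by simp
  next
    case False
    have "{t..<m} \<subseteq> {Suc c..<m}" using False by auto
    then have "{t..<m} \<subseteq> J" using max by blast
    moreover have "insert c J \<subseteq> {..<m}" using s c by blast
    ultimately have "insert c J = (insert c J \<inter> {..<t}) \<union> {t..<m}" by auto
    then have "card (insert c J) = card ((insert c J \<inter> {..<t}) \<union> {t..<m})" by simp
    also have "\<dots> = card (insert c J \<inter> {..<t}) + (m - t)"
      using f by (subst card_Un_disjoint) auto
    finally have J: "card (insert c J) = card (insert c J \<inter> {..<t}) + (m - t)" .
    have "I \<subseteq> (I \<inter> {..<t}) \<union> {t..<m}" using s by auto
    then have "card I \<le> card ((I \<inter> {..<t}) \<union> {t..<m})" using f by (intro card_mono) auto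
    also have "\<dots> \<le> card (I \<inter> {..<t}) + (m - t)"
      using card_Un_le[of "I \<inter> {..<t}" "{t..<m}"] by simp
    finally show ?thesis using J s f c by simp
  qed
  then show ?thesis using s f c by (auto simp: ballot_def)
qed

lemma std_minors_independent:
  fixes \<kappa> :: "nat set \<times> nat set \<Rightarrow> 'a::field"
  assumes "\<And>f. (\<And>i j. f i j = f j i) \<Longrightarrow>
    (\<Sum>(I, J)\<in>ballot m 0. \<kappa> (I, J) * minor f ({..<m} - I) ({..<m} - J)) = 0"
  shows "\<forall>p\<in>ballot m 0. \<kappa> p = 0"
  using assms
proof (induction m arbitrary: \<kappa>)
  case 0
  have "ballot 0 0 = {({}, {})}" by (auto simp: ballot_def)
  then show ?case using "0.prems"[of "\<lambda>_ _. 0"] by simp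
next
  case (Suc m)
  let ?f = "\<lambda>(I, J). (insert m I, insert m J)" and ?g = "\<lambda>(I, J). (I, insert m J)"
  have notin: "m \<notin> I" "m \<notin> J" if "(I, J) \<in> ballot m k" for I J k
    using that by (auto simp: ballot_def)
  have ins: "insert m I = insert m I' \<longleftrightarrow> I = I'" if "m \<notin> I" "m \<notin> I'" for I I' :: "nat set"
    using that by (metis insert_ident)
  have inj: "inj_on ?f (ballot m k)" "inj_on ?g (ballot m k)" for k
    by (auto intro!: inj_onI simp: ins notin dest: notin)
  have comp: "{..<Suc m} - I = insert m ({..<m} - I)" "{..<Suc m} - insert m I = {..<m} - I"
    if "m \<notin> I" for I using that by auto
  define S1 where "S1 f = (\<Sum>(I, J)\<in>ballot m 0. \<kappa> (I, J) * minor f (insert m ({..<m} - I)) (insert m ({..<m} - J)))"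
    for f :: "nat \<Rightarrow> nat \<Rightarrow> 'a"
  define S2 where "S2 f = (\<Sum>(I, J)\<in>ballot m 0. \<kappa> (insert m I, insert m J) * minor f ({..<m} - I) ({..<m} - J))"
    for f :: "nat \<Rightarrow> nat \<Rightarrow> 'a"
  define S3 where "S3 f = (\<Sum>(I, J)\<in>ballot m 1. \<kappa> (I, insert m J) * minor f (insert m ({..<m} - I)) ({..<m} - J))"
    for f :: "nat \<Rightarrow> nat \<Rightarrow> 'a"
  have split: "S1 f + S2 f + S3 f = 0" if "\<And>i j. f i j = f j i" for f
  proof -
    let ?t = "\<lambda>(I, J). \<kappa> (I, J) * minor f ({..<Suc m} - I) ({..<Suc m} - J)"
    have d: "ballot m 0 \<inter> ?f ` ballot m 0 = {}" "(ballot m 0 \<union> ?f ` ballot m 0) \<inter> ?g ` ballot m 1 = {}"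
      by (auto dest: notin)
    have "sum ?t (ballot m 0) = S1 f"
      unfolding S1_def by (rule sum.cong) (auto simp: comp notin)
    moreover have "sum ?t (?f ` ballot m 0) = S2 f"
      unfolding S2_def sum.reindex[OF inj(1)] by (rule sum.cong) (auto simp: comp notin)
    moreover have "sum ?t (?g ` ballot m 1) = S3 f"
      unfolding S3_def sum.reindex[OF inj(2)] by (rule sum.cong) (auto simp: comp notin)
    moreover have "ballot (Suc m) 0 = ballot m 0 \<union> ?f ` ballot m 0 \<union> ?g ` ballot m 1"
      unfolding ballot_split[of m 0] by simp
    then have "sum ?t (ballot (Suc m) 0) = sum ?t (ballot m 0) + sum ?t (?f ` ballot m 0) + sum ?t (?g ` ballot m 1)"
      using d by (simp only: sum.union_disjoint finite_ballot finite_imageI finite_UnI)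
    ultimately show ?thesis using Suc.prems[OF that] by simp
  qed
  \<comment> \<open>\<open>d\<close> is the corner entry and \<open>b\<close> the border. With b = 0
    the choice d = 0 isolates pairs having m in both sets, then d = 1 those having m in
    neither.\<close>
  define border where "border d b g = (\<lambda>i j. if i = m then (if j = m then d else if j < m then b j else 0)
      else if j = m then (if i < m then b i else 0) else g i j)" for d :: 'a and b :: "nat \<Rightarrow> 'a" and g
  have bsym: "border d b g i j = border d b g j i" if "\<And>i j. g i j = g j i" for d b g i j
    using that by (auto simp: border_def)
  have inner: "minor (border d b g) P Q = minor g P Q"
    if "P \<subseteq> {..<m}" "Q \<subseteq> {..<m}" "card P = card Q" for d b g P Q
    using that finite_subset by (intro minor_cong) (auto simp: border_def)
  have rowm: "minor (border d b g) (insert m P) Q =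
      (\<Sum>q\<in>Q. sg m P * sg q Q * (if q = m then d else b q) * minor (border d b g) P (Q - {q}))"
    if "P \<subseteq> {..<m}" "Q \<subseteq> {..m}" "card Q = Suc (card P)" for d b g P Q
  proof -
    have f: "finite P" "finite Q" "m \<notin> P" using that finite_subset by auto
    have "minor (border d b g) (insert m P) Q = (\<Sum>q\<in>Q. sg m (insert m P) * sg q Q * border d b g m q
        * minor (border d b g) (insert m P - {m}) (Q - {q}))"
      using f that by (intro minor_row) auto
    also have "\<dots> = (\<Sum>q\<in>Q. sg m P * sg q Q * (if q = m then d else b q) * minor (border d b g) P (Q - {q}))"
      using f that by (intro sum.cong) (auto simp: sg_insert border_def)
    finally show ?thesis .
  qed
  have S3_unit: "S3 (border d b g) = (\<Sum>(I, J)\<in>ballot m 1. \<kappa> (I, insert m J) *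
      (\<Sum>q\<in>{..<m} - J. sg m ({..<m} - I) * sg q ({..<m} - J) * b q * minor g ({..<m} - I) ({..<m} - insert q J)))"
    for d b g
    unfolding S3_def
  proof (rule sum.cong, rule refl, clarify)
    fix I J assume IJ: "(I, J) \<in> ballot m 1"
    let ?P = "{..<m} - I" and ?Q = "{..<m} - J"
    have c: "card ?Q = Suc (card ?P)" using ballot_complement_card[OF IJ] by simp
    have "minor (border d b g) (insert m ?P) ?Q = (\<Sum>q\<in>?Q. sg m ?P * sg q ?Q * (if q = m then d else b q)
        * minor (border d b g) ?P (?Q - {q}))"
      using c by (intro rowm) auto
    also have "\<dots> = (\<Sum>q\<in>?Q. sg m ?P * sg q ?Q * b q * minor g ?P ({..<m} - insert q J))"
    proof (rule sum.cong)
      fix q assume q: "q \<in> ?Q"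
      have "?Q - {q} = {..<m} - insert q J" by auto
      moreover have "card (?Q - {q}) = card ?P" using c q by simp
      ultimately have "minor (border d b g) ?P (?Q - {q}) = minor g ?P ({..<m} - insert q J)"
        using inner[of ?P "?Q - {q}" d b g] by auto
      then show "sg m ?P * sg q ?Q * (if q = m then d else b q) * minor (border d b g) ?P (?Q - {q}) =
          sg m ?P * sg q ?Q * b q * minor g ?P ({..<m} - insert q J)"
        using q by simp
    qed simp
    finally show "\<kappa> (I, insert m J) * minor (border d b g) (insert m ?P) ?Q = \<kappa> (I, insert m J) *
      (\<Sum>q\<in>?Q. sg m ?P * sg q ?Q * b q * minor g ?P ({..<m} - insert q J))" by simp
  qed
  have S1_diag: "S1 (border d (\<lambda>_. 0) g) = (\<Sum>(I, J)\<in>ballot m 0. d * \<kappa> (I, J) * minor g ({..<m} - I) ({..<m} - J))"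
    for d g
    unfolding S1_def
  proof (rule sum.cong, rule refl, clarify)
    fix I J assume IJ: "(I, J) \<in> ballot m 0"
    let ?P = "{..<m} - I" and ?Q = "{..<m} - J"
    have c: "card ?Q = card ?P" using ballot_complement_card[OF IJ] by simp
    have "minor (border d (\<lambda>_. 0) g) (insert m ?P) (insert m ?Q) =
      (\<Sum>q\<in>insert m ?Q. sg m ?P * sg q (insert m ?Q) * (if q = m then d else 0)
        * minor (border d (\<lambda>_. 0) g) ?P (insert m ?Q - {q}))"
      using c by (intro rowm) auto
    also have "\<dots> = (\<Sum>q\<in>{m}. sg m ?P * sg q (insert m ?Q) * (if q = m then d else 0)
        * minor (border d (\<lambda>_. 0) g) ?P (insert m ?Q - {q}))"
      by (intro sum.mono_neutral_right) auto
    also have "\<dots> = sg m ?P * sg m ?Q * d * minor (border d (\<lambda>_. 0) g) ?P ?Q"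
      by (simp add: sg_insert)
    also have "minor (border d (\<lambda>_. 0) g) ?P ?Q = minor g ?P ?Q" using c by (intro inner) auto
    also have "sg m ?P * sg m ?Q = (1 :: 'a)"
    proof -
      have "?P \<inter> {..<m} = ?P" "?Q \<inter> {..<m} = ?Q" by auto
      then show ?thesis using c by (simp add: sg_def flip: power_add mult_2)
    qed
    finally show "\<kappa> (I, J) * minor (border d (\<lambda>_. 0) g) (insert m ?P) (insert m ?Q) = d * \<kappa> (I, J) * minor g ?P ?Q"
      by simp
  qed
  have S2_inner: "S2 (border d b g) = (\<Sum>(I, J)\<in>ballot m 0. \<kappa> (insert m I, insert m J) * minor g ({..<m} - I) ({..<m} - J))"
    for d b g
    unfolding S2_def
  proof (rule sum.cong, rule refl, clarify)
    fix I J assume IJ: "(I, J) \<in> ballot m 0"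
    have "minor (border d b g) ({..<m} - I) ({..<m} - J) = minor g ({..<m} - I) ({..<m} - J)"
      using ballot_complement_card[OF IJ] by (intro inner) auto
    then show "\<kappa> (insert m I, insert m J) * minor (border d b g) ({..<m} - I) ({..<m} - J) =
        \<kappa> (insert m I, insert m J) * minor g ({..<m} - I) ({..<m} - J)" by simp
  qed
  have S3_zero: "S3 (border d (\<lambda>_. 0) g) = 0" for d g
    unfolding S3_unit by (intro sum.neutral) auto
  have both: "\<forall>p\<in>ballot m 0. (case p of (I, J) \<Rightarrow> \<kappa> (insert m I, insert m J)) = 0"
  proof (rule Suc.IH)
    fix g :: "nat \<Rightarrow> nat \<Rightarrow> 'a" assume g: "\<And>i j. g i j = g j i"
    have "S1 (border 0 (\<lambda>_. 0) g) + S2 (border 0 (\<lambda>_. 0) g) + S3 (border 0 (\<lambda>_. 0) g) = 0"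
      by (intro split bsym g)
    then show "(\<Sum>(I, J)\<in>ballot m 0. (case (I, J) of (I, J) \<Rightarrow> \<kappa> (insert m I, insert m J)) *
        minor g ({..<m} - I) ({..<m} - J)) = 0"
      unfolding S1_diag S2_inner S3_zero by simp
  qed
  have S2_zero: "S2 f = 0" for f
    unfolding S2_def using both by (intro sum.neutral) auto
  have neither: "\<forall>p\<in>ballot m 0. \<kappa> p = 0"
  proof (rule Suc.IH)
    fix g :: "nat \<Rightarrow> nat \<Rightarrow> 'a" assume g: "\<And>i j. g i j = g j i"
    have "S1 (border 1 (\<lambda>_. 0) g) + S2 (border 1 (\<lambda>_. 0) g) + S3 (border 1 (\<lambda>_. 0) g) = 0"
      by (intro split bsym g)
    then show "(\<Sum>(I, J)\<in>ballot m 0. \<kappa> (I, J) * minor g ({..<m} - I) ({..<m} - J)) = 0"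
      unfolding S1_diag S2_zero S3_zero by simp
  qed
  have S1_zero: "S1 f = 0" for f
    unfolding S1_def using neither by (intro sum.neutral) auto
  \<comment> \<open>Here c is the largest position missing from J, and larger c are treated first. A
    unit border at c sees all J that miss c; those missing a larger position as well are already
    settled.\<close>
  have third: "\<kappa> (I, insert m J) = 0"
    if "(I, J) \<in> ballot m 1" "c < m" "c \<notin> J" "{Suc c..<m} \<subseteq> J" for I J c
    using that
  proof (induction "m - c" arbitrary: I J c rule: less_induct)
    case less
    let ?B = "{(I, J) \<in> ballot m 1. c \<notin> J \<and> {Suc c..<m} \<subseteq> J}"
    \<comment> \<open>The remaining coefficients, with the expansion signs, transported along the
      injection that adds c to J. Its image consists of standard pairs for m, so the outer induction
      hypothesis applies.\<close>
    define \<kappa>' where "\<kappa>' = (\<lambda>(I, J). if c \<in> J \<and> (I, J - {c}) \<in> ?B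
      then sg m ({..<m} - I) * sg c ({..<m} - (J - {c})) * \<kappa> (I, insert m (J - {c})) else 0)"
    have "\<forall>p\<in>ballot m 0. \<kappa>' p = 0"
    proof (rule Suc.IH)
      fix g :: "nat \<Rightarrow> nat \<Rightarrow> 'a" assume g: "\<And>i j. g i j = g j i"
      let ?b = "\<lambda>i. if i = c then 1 else (0::'a)"
      let ?h = "\<lambda>(I, J). (I, insert c J)"
      have "S1 (border 0 ?b g) + S2 (border 0 ?b g) + S3 (border 0 ?b g) = 0"
        by (intro split bsym g)
      then have "0 = S3 (border 0 ?b g)" by (simp add: S1_zero S2_zero)
      also have "\<dots> = (\<Sum>(I, J)\<in>ballot m 1. if (I, J) \<in> ?B then
          \<kappa>' (I, insert c J) * minor g ({..<m} - I) ({..<m} - insert c J) else 0)"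
        unfolding S3_unit
      proof (rule sum.cong, rule refl, clarify)
        fix I J assume IJ: "(I, J) \<in> ballot m 1"
        let ?P = "{..<m} - I" and ?Q = "{..<m} - J"
        have "(\<Sum>q\<in>?Q. sg m ?P * sg q ?Q * ?b q * minor g ?P ({..<m} - insert q J)) =
            (\<Sum>q\<in>?Q. if q = c then sg m ?P * sg c ?Q * minor g ?P ({..<m} - insert c J) else 0)"
          by (rule sum.cong) auto
        also have "\<dots> = (if c \<in> J then 0 else sg m ?P * sg c ?Q * minor g ?P ({..<m} - insert c J))"
          using less.prems by simp
        finally have e: "(\<Sum>q\<in>?Q. sg m ?P * sg q ?Q * ?b q * minor g ?P ({..<m} - insert q J)) = \<dots>" .
        show "\<kappa> (I, insert m J) * (\<Sum>q\<in>?Q. sg m ?P * sg q ?Q * ?b q * minor g ?P ({..<m} - insert q J)) =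
            (if (I, J) \<in> ?B then \<kappa>' (I, insert c J) * minor g ?P ({..<m} - insert c J) else 0)"
        proof (cases "(I, J) \<in> ?B")
          case True
          then have "insert c J - {c} = J" by auto
          with True show ?thesis unfolding e by (simp add: \<kappa>'_def)
        next
          case False
          show ?thesis
          proof (cases "c \<in> J")
            case True
            then show ?thesis unfolding e using False by simp
          next
            case cJ: False
            with False IJ have "\<not> {Suc c..<m} \<subseteq> J" by auto
            then obtain x where "x \<in> {Suc c..<m}" "x \<notin> J" by blast
            then have "x \<in> ?Q \<and> c < x" by auto
            then have ne: "?Q \<noteq> {}" "finite ?Q" "\<exists>q\<in>?Q. c < q" by (blast, simp, blast)
            let ?c = "Max ?Q"
            have c0: "?c \<in> ?Q" using ne(1,2) by (intro Max_in)
            moreover have c1: "c < ?c" using ne by (subst Max_gr_iff) blast+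
            moreover have "{Suc ?c..<m} \<subseteq> J"
            proof
              fix q assume q: "q \<in> {Suc ?c..<m}"
              show "q \<in> J"
              proof (rule ccontr)
                assume "q \<notin> J"
                then have "q \<le> ?c" using q ne(2) by (intro Max_ge) auto
                with q show False by simp
              qed
            qed
            moreover have "m - ?c < m - c" using c1 less.prems(2) by auto
            moreover have "?c < m" "?c \<notin> J" using c0 by auto
            ultimately have z: "\<kappa> (I, insert m J) = 0" using less.hyps[of ?c I J] IJ by blast
            show ?thesis by (simp only: z False if_False mult_zero_left)
          qed
        qed
      qed
      also have "\<dots> = (\<Sum>(I, J)\<in>?B. \<kappa>' (I, insert c J) * minor g ({..<m} - I) ({..<m} - insert c J))"
      proof -
        have B: "?B = {p \<in> ballot m 1. p \<in> ?B}" by auto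
        show ?thesis
          by (subst (2) B, subst sum.inter_filter[OF finite_ballot], rule sum.cong, rule refl, simp add: case_prod_beta)
      qed
      also have "\<dots> = (\<Sum>p\<in>?h ` ?B. case p of (I, J) \<Rightarrow> \<kappa>' (I, J) * minor g ({..<m} - I) ({..<m} - J))"
      proof -
        have "inj_on ?h ?B" by (auto intro!: inj_onI)
        then show ?thesis by (subst sum.reindex) (auto intro!: sum.cong)
      qed
      also have "\<dots> = (\<Sum>(I, J)\<in>ballot m 0. \<kappa>' (I, J) * minor g ({..<m} - I) ({..<m} - J))"
      proof (rule sum.mono_neutral_left[OF finite_ballot])
        show "?h ` ?B \<subseteq> ballot m 0" using ballot_insert_max less.prems(2) by auto
        show "\<forall>p\<in>ballot m 0 - ?h ` ?B. (case p of (I, J) \<Rightarrow> \<kappa>' (I, J) * minor g ({..<m} - I) ({..<m} - J)) = 0"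
        proof (intro ballI, clarify)
          fix I J assume n: "(I, J) \<notin> ?h ` ?B"
          have outside: "\<not> (c \<in> J \<and> (I, J - {c}) \<in> ?B)"
          proof
            assume a: "c \<in> J \<and> (I, J - {c}) \<in> ?B"
            then have "(I, J) = ?h (I, J - {c})" by auto
            with a n show False by blast
          qed
          show "\<kappa>' (I, J) * minor g ({..<m} - I) ({..<m} - J) = 0"
            unfolding \<kappa>'_def prod.case if_not_P[OF outside] by simp
        qed
      qed
      finally show "(\<Sum>(I, J)\<in>ballot m 0. \<kappa>' (I, J) * minor g ({..<m} - I) ({..<m} - J)) = 0" by simp
    qed
    moreover have "(I, insert c J) \<in> ballot m 0" using less.prems by (intro ballot_insert_max)
    ultimately have "\<kappa>' (I, insert c J) = 0" by blast
    moreover have "insert c J - {c} = J" using less.prems by auto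
    ultimately show ?case using less.prems by (simp add: \<kappa>'_def sg_def)
  qed
  have third': "\<kappa> (I, insert m J) = 0" if IJ: "(I, J) \<in> ballot m 1" for I J
  proof -
    let ?Q = "{..<m} - J"
    have "card ?Q \<noteq> 0" using ballot_complement_card[OF IJ] by simp
    then have Q: "?Q \<noteq> {}" "finite ?Q" by (metis card.empty, simp)
    have "Max ?Q \<in> ?Q" using Q by (rule Max_in[rotated])
    moreover have "{Suc (Max ?Q)..<m} \<subseteq> J"
    proof
      fix q assume q: "q \<in> {Suc (Max ?Q)..<m}"
      show "q \<in> J"
      proof (rule ccontr)
        assume "q \<notin> J"
        then have "q \<le> Max ?Q" using q Q(2) by (intro Max_ge) auto
        with q show False by simp
      qed
    qed
    ultimately show ?thesis using third[OF IJ, of "Max ?Q"] by auto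
  qed
  show ?case unfolding ballot_split[of m 0] using both neither third' by auto
qed

subsection \<open>Straightening\<close>

text \<open>A functional is represented as a map into functions on the one-point type, which keeps
  it within linear maps between function spaces.\<close>

lemma functional_separation:
  fixes V :: "('i \<Rightarrow> 'a::field) set"
  assumes V: "fs.subspace V" and w: "w \<notin> V"
  obtains \<phi> :: "('i \<Rightarrow> 'a) \<Rightarrow> unit \<Rightarrow> 'a"
  where "flinear \<phi>" "\<And>v. v \<in> V \<Longrightarrow> \<phi> v = 0" "\<phi> w = ind ()"
proof -
  obtain B where B: "B \<subseteq> V" "fs.independent B" "V \<subseteq> fs.span B" "card B = fs.dim V"
    using fs.basis_exists by blast
  have sp: "fs.span B = V" using B V fs.span_minimal by blast
  then have "fs.independent (insert w B)" using w B(2) by (intro fs.independent_insertI) auto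
  then obtain \<phi> :: "('i \<Rightarrow> 'a) \<Rightarrow> unit \<Rightarrow> 'a"
    where \<phi>: "flinear \<phi>" "\<forall>x\<in>insert w B. \<phi> x = (if x = w then ind () else 0)"
    using fsp.linear_independent_extend[of "insert w B" "\<lambda>x. if x = w then ind () else 0 :: unit \<Rightarrow> 'a"]
    by blast
  have "w \<notin> B" using w B by auto
  then have "\<phi> b = 0" if "b \<in> B" for b using \<phi>(2) that by auto
  then have "\<phi> v = 0" if "v \<in> V" for v
    using fsp.linear_eq_0_on_span[OF \<phi>(1), of B v] that sp by auto
  moreover have "\<phi> w = ind ()" using \<phi>(2) by simp
  ultimately show ?thesis using that \<phi>(1) by blast
qed

definition restr :: "'i set \<Rightarrow> ('i \<Rightarrow> 'a::field) \<Rightarrow> 'i \<Rightarrow> 'a" where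
  "restr Z v = (\<lambda>i. if i \<in> Z then v i else 0)"

lemma flinear_restr: "flinear (restr Z)"
  by (rule flinearI) (auto simp: restr_def pointwise fscale_apply)

lemma restr_coord_space: "restr Z v \<in> coord_space Z"
  by (simp add: restr_def coord_space_def)

lemma flinear_psi: "flinear (psi m)"
  by (rule flinearI) (auto simp: psi_def pointwise fscale_apply algebra_simps)

lemma flinear_straighten: "flinear (straighten m c)"
  by (rule flinearI)
    (auto simp: straighten_def pointwise fscale_apply algebra_simps sum.distrib sum_distrib_left)

lemma std_subset_boundary: "std_pairs m \<subseteq> boundary_pairs m"
  by (auto simp: std_pairs_def)

lemma finite_boundary_pairs: "finite (boundary_pairs m)"
  by (rule finite_subset[of _ "Pow {..<m} \<times> Pow {..<m}"]) (auto simp: boundary_pairs_def)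

definition unpsi :: "nat \<Rightarrow> (nat set \<Rightarrow> 'a::field) \<Rightarrow> nat set \<times> nat set \<Rightarrow> 'a" where
  "unpsi m \<omega> = (\<lambda>(I, J). if (I, J) \<in> boundary_pairs m then tau m J * \<omega> (pair_set m I J) else 0)"

lemma unpsi_psi:
  assumes "v \<in> coord_space (boundary_pairs m)"
  shows "unpsi m (psi m v) = v"
proof (rule ext, clarify)
  fix I J
  show "unpsi m (psi m v) (I, J) = v (I, J)"
  proof (cases "(I, J) \<in> boundary_pairs m")
    case True
    then have "I \<subseteq> {..<m}" "J \<subseteq> {..<m}" by (auto simp: boundary_pairs_def)
    with True show ?thesis
      by (simp add: unpsi_def psi_def pair_set_ksubsets lo_pair_set hi_pair_set flip: mult.assoc)
  next
    case False
    with assms show ?thesis by (simp add: unpsi_def coord_space_def)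
  qed
qed

lemma psi_unpsi:
  assumes "\<omega> \<in> ext_power (2 * m) m"
  shows "psi m (unpsi m \<omega>) = \<omega>"
proof
  fix S
  show "psi m (unpsi m \<omega>) S = \<omega> S"
  proof (cases "S \<in> ksubsets (2 * m) m")
    case True
    then have "S \<subseteq> {..<2 * m}" by (simp add: ksubsets_def)
    with True show ?thesis
      using lo_hi_boundary[OF True] pair_set_lo_hi by (simp add: unpsi_def psi_def flip: mult.assoc)
  next
    case False
    with assms show ?thesis by (simp add: psi_def ext_power_def coord_space_def)
  qed
qed

lemma unpsi_coord_space: "unpsi m \<omega> \<in> coord_space (boundary_pairs m)"
  by (auto simp: unpsi_def coord_space_def)

lemma bij_betw_psi: "bij_betw (psi m) (coord_space (boundary_pairs m)) (ext_power (2 * m) m)"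
  by (rule bij_betw_byWitness[where f' = "unpsi m"])
    (auto simp: unpsi_psi psi_unpsi psi_ext_power unpsi_coord_space)

lemma bij_betw_psi_sym_module: "bij_betw (psi m) (sym_module m) (primitive_module m (std_form m))"
  by (rule bij_betw_byWitness[where f' = "unpsi m"])
    (auto simp: sym_module_def unpsi_psi psi_unpsi unpsi_coord_space primitive_module_alt)

lemma subspace_sym_module: "fs.subspace (sym_module m)"
proof (rule fs.subspaceI)
  fix v w :: "nat set \<times> nat set \<Rightarrow> 'a" and k :: 'a
  assume "v \<in> sym_module m"
  then have v: "v \<in> coord_space (boundary_pairs m)" "psi m v \<in> primitive_module m (std_form m)"
    by (auto simp: sym_module_def)
  then show "fscale k v \<in> sym_module m"
    unfolding sym_module_def mem_Collect_eq flinear_scale[OF flinear_psi]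
    by (intro conjI coord_space_scale fs.subspace_scale[OF subspace_primitive_module])
  assume "w \<in> sym_module m"
  then have "w \<in> coord_space (boundary_pairs m)" "psi m w \<in> primitive_module m (std_form m)"
    by (auto simp: sym_module_def)
  with v show "v + w \<in> sym_module m"
    unfolding sym_module_def mem_Collect_eq flinear_add[OF flinear_psi]
    by (intro conjI coord_space_add fs.subspace_add[OF subspace_primitive_module])
qed (simp add: sym_module_def coord_space_0 flinear_0[OF flinear_psi] fs.subspace_0[OF subspace_primitive_module])

lemma dim_sym_module:
  "fs.dim (sym_module m :: (nat set \<times> nat set \<Rightarrow> 'a::field_char_0) set) = card (std_pairs m)"
proof -
  have "fs.dim (psi m ` sym_module m :: (nat set \<Rightarrow> 'a) set) = fs.dim (sym_module m :: (nat set \<times> nat set \<Rightarrow> 'a) set)"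
    using bij_betw_psi_sym_module by (intro dim_image subspace_sym_module flinear_psi) (rule bij_betw_imp_inj_on)
  then show ?thesis
    using bij_betw_imp_surj_on[OF bij_betw_psi_sym_module] dim_primitive card_std_pairs by metis
qed

text \<open>Size m is the smallest admissible one. By \<open>state_span_eq\<close> its states
  already span the whole module that contains the states of all sizes.\<close>

definition state_span :: "nat \<Rightarrow> (nat set \<times> nat set \<Rightarrow> 'a::field) set" where
  "state_span m = fs.span {bstate m A | A. A \<in> carrier_mat m m \<and> transpose_mat A = A}"

lemma state_span_subset: "state_span m \<subseteq> (sym_module m :: (nat set \<times> nat set \<Rightarrow> 'a::field_char_0) set)"
  unfolding state_span_def using bstate_in_sym_module[of _ m m]
  by (intro fs.span_minimal subspace_sym_module) auto

text \<open>If a unit vector were missed, a separating functional would give a linear relation among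
  the standard minors of all symmetric matrices, contrary to
  \<open>std_minors_independent\<close>.\<close>

lemma state_span_std:
  assumes q: "q \<in> std_pairs m"
  shows "\<exists>v\<in>state_span m. restr (std_pairs m) v = (ind q :: nat set \<times> nat set \<Rightarrow> 'a::field_char_0)"
proof (rule ccontr)
  let ?V = "restr (std_pairs m) ` (state_span m :: (nat set \<times> nat set \<Rightarrow> 'a) set)"
  assume "\<not> (\<exists>v\<in>state_span m. restr (std_pairs m) v = (ind q :: nat set \<times> nat set \<Rightarrow> 'a))"
  then have w: "ind q \<notin> ?V" by (metis imageE)
  have "fs.subspace ?V"
    unfolding state_span_def by (intro fsp.linear_subspace_image flinear_restr fs.subspace_span)
  then obtain \<phi> :: "(nat set \<times> nat set \<Rightarrow> 'a) \<Rightarrow> unit \<Rightarrow> 'a"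
    where \<phi>: "flinear \<phi>" "\<And>v. v \<in> ?V \<Longrightarrow> \<phi> v = 0" "\<phi> (ind q) = ind ()"
    using functional_separation[OF _ w] by metis
  define \<kappa> where "\<kappa> = (\<lambda>p. \<phi> (ind p) ())"
  have "\<forall>p\<in>ballot m 0. \<kappa> p = 0"
  proof (rule std_minors_independent)
    fix f :: "nat \<Rightarrow> nat \<Rightarrow> 'a" assume f: "\<And>i j. f i j = f j i"
    define A where "A = mat m m (\<lambda>(i, j). f i j)"
    have A: "A \<in> carrier_mat m m" "transpose_mat A = A"
      using f by (auto simp: A_def intro!: eq_matI)
    then have "bstate m A \<in> state_span m" unfolding state_span_def by (intro fs.span_base) blast
    then have "\<phi> (restr (std_pairs m) (bstate m A)) = 0" by (intro \<phi>(2)) blast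
    moreover have "restr (std_pairs m) (bstate m A) =
        (\<Sum>p\<in>std_pairs m. fscale (restr (std_pairs m) (bstate m A) p) (ind p))"
      by (rule coord_space_expand[OF finite_std_pairs restr_coord_space])
    ultimately have "(\<Sum>p\<in>std_pairs m. fscale (restr (std_pairs m) (bstate m A) p) (\<phi> (ind p))) = 0"
      by (metis (no_types, lifting) flinear_sum[OF \<phi>(1)] flinear_scale[OF \<phi>(1)] sum.cong)
    then have "(\<Sum>p\<in>std_pairs m. restr (std_pairs m) (bstate m A) p * \<kappa> p) = 0"
      unfolding \<kappa>_def by (metis (no_types, lifting) sum_fun_apply fscale_apply zero_fun_apply sum.cong)
    moreover have "restr (std_pairs m) (bstate m A) p * \<kappa> p =
        (case p of (I, J) \<Rightarrow> \<kappa> (I, J) * minor f ({..<m} - I) ({..<m} - J))" if p: "p \<in> std_pairs m" for p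
    proof -
      obtain I J where IJ: "p = (I, J)" by (cases p)
      have b: "(I, J) \<in> boundary_pairs m" using p std_subset_boundary IJ by blast
      then have s: "I \<subseteq> {..<m}" "J \<subseteq> {..<m}" "card I = card J" by (auto simp: boundary_pairs_def)
      then have "finite I" "finite J" using finite_subset by blast+
      then have "minor (\<lambda>i j. A $$ (i, j)) ({..<m} - I) ({..<m} - J) = minor f ({..<m} - I) ({..<m} - J)"
        using s by (intro minor_cong) (auto simp: A_def card_Diff_subset)
      then show ?thesis
        using p b unfolding IJ by (simp add: restr_def bstate_def compl_minor_eq[OF A(1) s])
    qed
    ultimately show "(\<Sum>(I, J)\<in>ballot m 0. \<kappa> (I, J) * minor f ({..<m} - I) ({..<m} - J)) = 0"
      unfolding std_pairs_eq_ballot by simp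
  qed
  then have "\<kappa> q = 0" using q by (simp add: std_pairs_eq_ballot)
  then show False using \<phi>(3) by (simp add: \<kappa>_def ind_def)
qed

text \<open>The restriction to standard pairs is onto between spaces of the same dimension, so its
  kernel is 0.\<close>

lemma restr_inj_on_sym_module:
  assumes v: "v \<in> sym_module m" and w: "w \<in> sym_module m"
    and e: "restr (std_pairs m) v = restr (std_pairs m) (w :: nat set \<times> nat set \<Rightarrow> 'a::field_char_0)"
  shows "v = w"
proof -
  let ?V = "sym_module m :: (nat set \<times> nat set \<Rightarrow> 'a) set"
  let ?K = "{v \<in> ?V. restr (std_pairs m) v = 0}"
  have sub: "?V \<subseteq> coord_space (boundary_pairs m)" by (auto simp: sym_module_def)
  have "fs.dim ?K + card (std_pairs m) = fs.dim ?V"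
    using state_span_std state_span_subset
    by (intro rank_nullity[OF finite_boundary_pairs sub subspace_sym_module flinear_restr finite_std_pairs
        restr_coord_space]) blast
  then have "fs.dim ?K = 0" by (simp add: dim_sym_module)
  moreover have "?K \<subseteq> coord_space (boundary_pairs m)" using sub by auto
  ultimately have "?K \<subseteq> {0}" using dim_0_imp_trivial[OF finite_boundary_pairs] by blast
  moreover have "v - w \<in> ?K"
    using v w e fs.subspace_diff[OF subspace_sym_module] by (simp add: flinear_diff[OF flinear_restr])
  ultimately show ?thesis by auto
qed

lemma state_span_eq: "state_span m = (sym_module m :: (nat set \<times> nat set \<Rightarrow> 'a::field_char_0) set)"
proof
  show "sym_module m \<subseteq> (state_span m :: (nat set \<times> nat set \<Rightarrow> 'a) set)"
  proof
    fix v :: "nat set \<times> nat set \<Rightarrow> 'a" assume v: "v \<in> sym_module m"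
    obtain g :: "nat set \<times> nat set \<Rightarrow> nat set \<times> nat set \<Rightarrow> 'a"
      where g: "\<And>q. q \<in> std_pairs m \<Longrightarrow> g q \<in> state_span m \<and> restr (std_pairs m) (g q) = ind q"
      using state_span_std by metis
    define u where "u = (\<Sum>q\<in>std_pairs m. fscale (v q) (g q))"
    have u: "u \<in> state_span m"
      unfolding u_def using g unfolding state_span_def by (intro fs.span_sum fs.span_scale) auto
    have "restr (std_pairs m) u = (\<Sum>q\<in>std_pairs m. fscale (restr (std_pairs m) v q) (ind q))"
      unfolding u_def flinear_sum[OF flinear_restr] flinear_scale[OF flinear_restr]
      using g by (intro sum.cong) (auto simp: restr_def)
    also have "\<dots> = restr (std_pairs m) v"
      by (rule coord_space_expand[OF finite_std_pairs restr_coord_space, symmetric])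
    finally have r: "restr (std_pairs m) u = restr (std_pairs m) v" .
    have "u = v" by (rule restr_inj_on_sym_module[OF _ v r]) (use u state_span_subset in blast)
    with u show "v \<in> state_span m" by simp
  qed
qed (rule state_span_subset)

text \<open>For fixed q the coefficients form the vector of the module with standard coordinates
  \<open>ind q\<close>. States of every size lie in the module and are determined there by their
  standard coordinates.\<close>

lemma catalan_straightening_exists:
  obtains c :: "nat set \<times> nat set \<Rightarrow> nat set \<times> nat set \<Rightarrow> 'a::field_char_0"
  where "catalan_straightening m c" "\<And>q. q \<in> std_pairs m \<Longrightarrow> (\<lambda>p. c p q) \<in> sym_module m"
    "\<And>q. q \<in> std_pairs m \<Longrightarrow> restr (std_pairs m) (\<lambda>p. c p q) = ind q"
proof -
  obtain g :: "nat set \<times> nat set \<Rightarrow> nat set \<times> nat set \<Rightarrow> 'a"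
    where g: "\<And>q. q \<in> std_pairs m \<Longrightarrow> g q \<in> sym_module m \<and> restr (std_pairs m) (g q) = ind q"
    using state_span_std state_span_subset by (metis subsetD)
  define c where "c = (\<lambda>p q. g q p)"
  have "catalan_straightening m c"
    unfolding catalan_straightening_def
  proof (intro allI impI ballI)
    fix N A p assume N: "m \<le> N" and A: "A \<in> carrier_mat N N" "transpose_mat A = (A :: 'a mat)"
      and p: "p \<in> boundary_pairs m"
    have v: "bstate m A \<in> sym_module m" by (rule bstate_in_sym_module[OF A N])
    define u where "u = (\<Sum>q\<in>std_pairs m. fscale (bstate m A q) (g q))"
    have u: "u \<in> sym_module m"
      unfolding u_def using g by (intro fs.subspace_sum fs.subspace_scale subspace_sym_module) auto
    have "restr (std_pairs m) u = (\<Sum>q\<in>std_pairs m. fscale (restr (std_pairs m) (bstate m A) q) (ind q))"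
      unfolding u_def flinear_sum[OF flinear_restr] flinear_scale[OF flinear_restr]
      using g by (intro sum.cong) (auto simp: restr_def)
    also have "\<dots> = restr (std_pairs m) (bstate m A)"
      by (rule coord_space_expand[OF finite_std_pairs restr_coord_space, symmetric])
    finally have "u = bstate m A" by (rule restr_inj_on_sym_module[OF u v])
    then have "compl_minor A p = u p" using p by (simp add: bstate_def)
    also have "\<dots> = (\<Sum>q\<in>std_pairs m. bstate m A q * g q p)"
      by (simp add: u_def sum_fun_apply fscale_apply)
    also have "\<dots> = (\<Sum>q\<in>std_pairs m. c p q * compl_minor A q)"
      using std_subset_boundary by (intro sum.cong) (auto simp: bstate_def c_def)
    finally show "compl_minor A p = (\<Sum>q\<in>std_pairs m. c p q * compl_minor A q)" .
  qed
  moreover have "(\<lambda>p. c p q) = g q" for q by (simp add: c_def)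
  ultimately show ?thesis using that g by simp
qed

text \<open>The defining identity of a straightening says this for the states of symmetric matrices,
  and these span the module.\<close>

lemma straighten_restr:
  assumes c: "catalan_straightening m c" and v: "v \<in> sym_module m"
  shows "straighten m c (restr (std_pairs m) v) = (v :: nat set \<times> nat set \<Rightarrow> 'a::field_char_0)"
proof -
  have "v \<in> fs.span {bstate m A | A. A \<in> carrier_mat m m \<and> transpose_mat A = A}"
    using v state_span_eq unfolding state_span_def by blast
  then show ?thesis
  proof (induction rule: fs.span_induct_alt)
    case base
    then show ?case by (metis flinear_0 flinear_comp flinear_restr flinear_straighten)
  next
    case (step k x y)
    then obtain A where A: "x = bstate m A" "A \<in> carrier_mat m m" "transpose_mat A = A" by blast
    have "straighten m c (restr (std_pairs m) x) = x"
    proof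
      fix p
      have "compl_minor A p = (\<Sum>q\<in>std_pairs m. c p q * compl_minor A q)" if "p \<in> boundary_pairs m"
        using c A that unfolding catalan_straightening_def by blast
      moreover have "(\<Sum>q\<in>std_pairs m. c p q * restr (std_pairs m) (bstate m A) q) =
          (\<Sum>q\<in>std_pairs m. c p q * compl_minor A q)"
        using std_subset_boundary by (intro sum.cong) (auto simp: restr_def bstate_def)
      ultimately show "straighten m c (restr (std_pairs m) x) p = x p"
        unfolding A(1) by (simp add: straighten_def bstate_def)
    qed
    with step.IH show ?case
      by (simp only: flinear_add[OF flinear_restr] flinear_scale[OF flinear_restr]
          flinear_add[OF flinear_straighten] flinear_scale[OF flinear_straighten])
  qed
qed

lemma restr_straighten:
  assumes c: "catalan_straightening m c" and w: "w \<in> sym_state_space m"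
  shows "straighten m c w \<in> sym_module m"
    "restr (std_pairs m) (straighten m c w) = (w :: nat set \<times> nat set \<Rightarrow> 'a::field_char_0)"
proof -
  obtain c' :: "nat set \<times> nat set \<Rightarrow> nat set \<times> nat set \<Rightarrow> 'a"
    where c': "\<And>q. q \<in> std_pairs m \<Longrightarrow> (\<lambda>p. c' p q) \<in> sym_module m"
      "\<And>q. q \<in> std_pairs m \<Longrightarrow> restr (std_pairs m) (\<lambda>p. c' p q) = ind q"
    using catalan_straightening_exists by metis
  define v where "v = (\<Sum>q\<in>std_pairs m. fscale (w q) (\<lambda>p. c' p q))"
  have v: "v \<in> sym_module m"
    unfolding v_def using c' by (intro fs.subspace_sum fs.subspace_scale subspace_sym_module) auto
  have "restr (std_pairs m) v = (\<Sum>q\<in>std_pairs m. fscale (w q) (ind q))"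
    unfolding v_def flinear_sum[OF flinear_restr] flinear_scale[OF flinear_restr]
    using c' by (intro sum.cong) auto
  also have "\<dots> = w"
    using coord_space_expand[OF finite_std_pairs] w unfolding sym_state_space_def by metis
  finally have r: "restr (std_pairs m) v = w" .
  then have "straighten m c w = v" using straighten_restr[OF c v] by simp
  then show "straighten m c w \<in> sym_module m" "restr (std_pairs m) (straighten m c w) = w"
    using v r by auto
qed

lemma bij_betw_straighten:
  fixes c :: "nat set \<times> nat set \<Rightarrow> nat set \<times> nat set \<Rightarrow> 'a::field_char_0"
  assumes "catalan_straightening m c"
  shows "bij_betw (straighten m c) (sym_state_space m) (sym_module m)"
  by (rule bij_betw_byWitness[where f' = "restr (std_pairs m)"])
    (auto simp: restr_straighten[OF assms] straighten_restr[OF assms] sym_state_space_def restr_coord_space)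

lemma sym_transfer_eq: "sym_transfer m c a w = restr (std_pairs m) (laplace_transfer m a (straighten m c w))"
  by (simp add: sym_transfer_def restr_def)

section \<open>The transfer computes the states of Toeplitz sections\<close>

text \<open>The entries depend only on the difference of the indices, so once row and column 0 are
  gone the minor can be moved by one.\<close>

lemma toeplitz_minor_shift:
  assumes I: "I \<subseteq> {..m}" "0 \<in> I" and J: "J \<subseteq> {..m}" "0 \<in> J" and c: "card I = card J" and N: "m \<le> N"
  shows "minor (\<lambda>i j. a (int j - int i)) ({..N} - I) ({..N} - J) =
    minor (\<lambda>i j. a (int j - int i)) ({..<N} - translate I) ({..<N} - translate J)"
proof -
  have img: "{..N} - S = Suc ` ({..<N} - translate S)" if "0 \<in> S" for S
  proof (intro Set.set_eqI iffI)
    fix k assume k: "k \<in> {..N} - S"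
    with that obtain j where j: "k = Suc j" by (cases k) auto
    then have "j \<in> {..<N} - translate S" using k by (auto simp: mem_translate)
    with j show "k \<in> Suc ` ({..<N} - translate S)" by blast
  qed (auto simp: mem_translate)
  have f: "finite I" "finite J" using I J finite_subset by blast+
  have s: "translate I \<subseteq> {..<N}" "translate J \<subseteq> {..<N}"
    using translate_subset[OF I(1)] translate_subset[OF J(1)] N by auto
  have "card (translate I) = card (translate J)" using c I J f by (simp add: card_translate)
  then have "card ({..<N} - translate I) = card ({..<N} - translate J)"
    using s finite_subset[OF s(1)] finite_subset[OF s(2)] by (simp add: card_Diff_subset)
  then show ?thesis
    unfolding img[OF I(2)] img[OF J(2)]
    by (subst minor_image) (auto simp: strict_mono_on_def)
qed

text \<open>The band cuts the expansions along row 0 and column 0 down to positions at most m, so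
  deleted positions stay in the window after translation. The bound m \<le> N ensures that these
  positions exist in the section of size N + 1.\<close>

lemma laplace_transfer_toeplitz:
  fixes a :: "int \<Rightarrow> 'a::field"
  assumes supp: "\<And>s. \<bar>s\<bar> > int m \<Longrightarrow> a s = 0" and N: "m \<le> N"
    and v: "\<And>p. p \<in> boundary_pairs m \<Longrightarrow> v p = compl_minor (toeplitz a N) p"
    and p: "p \<in> boundary_pairs m"
  shows "laplace_transfer m a v p = compl_minor (toeplitz a (N + 1)) p"
proof -
  let ?f = "\<lambda>i j. a (int j - int i)"
  have tm: "compl_minor (toeplitz a M) (I, J) = minor ?f ({..<M} - I) ({..<M} - J)"
    if "I \<subseteq> {..<M}" "J \<subseteq> {..<M}" "card I = card J" for M I J
  proof -
    have "finite I" "finite J" using that finite_subset by blast+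
    then have "card ({..<M} - I) = card ({..<M} - J)" using that by (simp add: card_Diff_subset)
    moreover have "compl_minor (toeplitz a M) (I, J) =
        minor (\<lambda>i j. toeplitz a M $$ (i, j)) ({..<M} - I) ({..<M} - J)"
      using that by (intro compl_minor_eq) (auto simp: toeplitz_def)
    ultimately show ?thesis by (simp, intro minor_cong) (auto simp: toeplitz_def)
  qed
  have band: "r \<le> m" if "a (- int r) \<noteq> 0 \<or> a (int r) \<noteq> 0" for r
    using supp[of "int r"] supp[of "- int r"] that by fastforce
  have base: "v (translate I, translate J) = minor ?f ({..N} - I) ({..N} - J)"
    if I: "I \<subseteq> {..m}" "0 \<in> I" and J: "J \<subseteq> {..m}" "0 \<in> J" and c: "card I = card J" for I J
  proof -
    have f: "finite I" "finite J" using I J finite_subset by blast+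
    have s: "translate I \<subseteq> {..<m}" "translate J \<subseteq> {..<m}" using I J translate_subset by blast+
    have c': "card (translate I) = card (translate J)" using c I J f by (simp add: card_translate)
    have "(translate I, translate J) \<in> boundary_pairs m" using s c' by (simp add: boundary_pairs_def)
    then have "v (translate I, translate J) = compl_minor (toeplitz a N) (translate I, translate J)"
      by (rule v)
    also have "\<dots> = minor ?f ({..<N} - translate I) ({..<N} - translate J)"
      using s c' N by (intro tm) auto
    also have "\<dots> = minor ?f ({..N} - I) ({..N} - J)"
      by (rule toeplitz_minor_shift[OF I J c N, symmetric])
    finally show ?thesis .
  qed
  have cards: "card ({..N} - I) = card ({..N} - J)"
    if "I \<subseteq> {..m}" "J \<subseteq> {..m}" "card I = card J" for I J
  proof -
    have "I \<subseteq> {..N}" "J \<subseteq> {..N}" using that N by auto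
    then show ?thesis using that finite_subset[of I "{..N}"] finite_subset[of J "{..N}"]
      by (simp add: card_Diff_subset)
  qed
  have sgS: "sg r ({..N} - S) = (- 1 :: 'a) ^ card ({..<r} - S)" if "r \<le> N" for r S
  proof -
    have "({..N} - S) \<inter> {..<r} = {..<r} - S" using that by auto
    then show ?thesis by (simp add: sg_def)
  qed
  have col: "col_expansion m a v I J = minor ?f ({..N} - I) ({..N} - J)"
    if I: "I \<subseteq> {..m}" "0 \<in> I" and J: "J \<subseteq> {..m}" and c: "card I = card J" for I J
  proof (cases "0 \<in> J")
    case True
    then show ?thesis using base[OF I J True c] by (simp add: col_expansion_def)
  next
    case False
    let ?P = "{..N} - I" and ?Q = "{..N} - J"
    have f: "finite I" "finite J" using I J finite_subset by blast+
    have "minor ?f ?P ?Q = (\<Sum>r\<in>?P. sg r ?P * sg 0 ?Q * ?f r 0 * minor ?f (?P - {r}) (?Q - {0}))"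
      using False cards[OF I(1) J c] by (intro minor_col) auto
    also have "\<dots> = (\<Sum>r\<in>{..m} - I. sg r ?P * sg 0 ?Q * ?f r 0 * minor ?f (?P - {r}) (?Q - {0}))"
      using N band by (intro sum.mono_neutral_right) auto
    also have "\<dots> = (\<Sum>r\<in>{..m} - I. (- 1) ^ card ({..<r} - I) * a (- int r)
             * v (translate (insert r I), translate (insert 0 J)))"
    proof (rule sum.cong)
      fix r assume r: "r \<in> {..m} - I"
      have "v (translate (insert r I), translate (insert 0 J)) =
          minor ?f ({..N} - insert r I) ({..N} - insert 0 J)"
        using I J r f c False by (intro base) auto
      moreover have "?P - {r} = {..N} - insert r I" "?Q - {0} = {..N} - insert 0 J" by auto
      moreover have "sg r ?P = (- 1 :: 'a) ^ card ({..<r} - I)" using r N by (intro sgS) auto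
      moreover have "sg 0 ?Q = (1 :: 'a)" by (simp add: sg_def)
      ultimately show "sg r ?P * sg 0 ?Q * ?f r 0 * minor ?f (?P - {r}) (?Q - {0}) =
          (- 1) ^ card ({..<r} - I) * a (- int r) * v (translate (insert r I), translate (insert 0 J))"
        by simp
    qed simp
    finally show ?thesis using False by (simp add: col_expansion_def)
  qed
  have row: "row_expansion m a v I J = minor ?f ({..N} - I) ({..N} - J)"
    if I: "I \<subseteq> {..m}" and J: "J \<subseteq> {..m}" and c: "card I = card J" for I J
  proof (cases "0 \<in> I")
    case True
    then show ?thesis using col[OF I True J c] by (simp add: row_expansion_def)
  next
    case False
    let ?P = "{..N} - I" and ?Q = "{..N} - J"
    have f: "finite I" "finite J" using I J finite_subset by blast+
    have "minor ?f ?P ?Q = (\<Sum>q\<in>?Q. sg 0 ?P * sg q ?Q * ?f 0 q * minor ?f (?P - {0}) (?Q - {q}))"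
      using False cards[OF I J c] by (intro minor_row) auto
    also have "\<dots> = (\<Sum>q\<in>{..m} - J. sg 0 ?P * sg q ?Q * ?f 0 q * minor ?f (?P - {0}) (?Q - {q}))"
      using N band by (intro sum.mono_neutral_right) auto
    also have "\<dots> = (\<Sum>q\<in>{..m} - J. (- 1) ^ card ({..<q} - J) * a (int q)
             * col_expansion m a v (insert 0 I) (insert q J))"
    proof (rule sum.cong)
      fix q assume q: "q \<in> {..m} - J"
      have "col_expansion m a v (insert 0 I) (insert q J) =
          minor ?f ({..N} - insert 0 I) ({..N} - insert q J)"
        using I J q f c False by (intro col) auto
      moreover have "?P - {0} = {..N} - insert 0 I" "?Q - {q} = {..N} - insert q J" by auto
      moreover have "sg q ?Q = (- 1 :: 'a) ^ card ({..<q} - J)" using q N by (intro sgS) auto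
      moreover have "sg 0 ?P = (1 :: 'a)" by (simp add: sg_def)
      ultimately show "sg 0 ?P * sg q ?Q * ?f 0 q * minor ?f (?P - {0}) (?Q - {q}) =
          (- 1) ^ card ({..<q} - J) * a (int q) * col_expansion m a v (insert 0 I) (insert q J)"
        by simp
    qed simp
    finally show ?thesis using False by (simp add: row_expansion_def)
  qed
  obtain I J where IJ: "p = (I, J)" by (cases p)
  have s: "I \<subseteq> {..<m}" "J \<subseteq> {..<m}" "card I = card J" using p IJ by (auto simp: boundary_pairs_def)
  have "laplace_transfer m a v p = row_expansion m a v I J" using p IJ by (simp add: laplace_transfer_def)
  also have "\<dots> = minor ?f ({..N} - I) ({..N} - J)" using s by (intro row) auto
  also have "{..N} = {..<N + 1}" by auto
  also have "minor ?f ({..<N + 1} - I) ({..<N + 1} - J) = compl_minor (toeplitz a (N + 1)) p"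
    unfolding IJ using s N by (intro tm[symmetric]) auto
  finally show ?thesis .
qed

lemma sym_state_toeplitz:
  fixes a :: "int \<Rightarrow> 'a::field"
  assumes c: "catalan_straightening m c" and a: "a \<in> sym_params m" and N: "m \<le> N"
  shows "sym_state m (toeplitz a (N + 1)) = sym_transfer m c a (sym_state m (toeplitz a N))"
proof
  fix q
  have T: "toeplitz a N \<in> carrier_mat N N" "transpose_mat (toeplitz a N) = toeplitz a N"
  proof -
    have "a (int i - int j) = a (int j - int i)" for i j
      using a by (metis (mono_tags, lifting) mem_Collect_eq minus_diff_eq sym_params_def)
    then show "transpose_mat (toeplitz a N) = toeplitz a N"
      by (intro eq_matI) (auto simp: toeplitz_def)
  qed (simp add: toeplitz_def)
  have "straighten m c (sym_state m (toeplitz a N)) p = compl_minor (toeplitz a N) p"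
    if "p \<in> boundary_pairs m" for p
  proof -
    have "compl_minor (toeplitz a N) p = (\<Sum>q\<in>std_pairs m. c p q * compl_minor (toeplitz a N) q)"
      using c T N that unfolding catalan_straightening_def by blast
    also have "\<dots> = straighten m c (sym_state m (toeplitz a N)) p"
      using that by (simp add: straighten_def sym_state_def cong: sum.cong)
    finally show ?thesis by simp
  qed
  then have "laplace_transfer m a (straighten m c (sym_state m (toeplitz a N))) q =
      compl_minor (toeplitz a (N + 1)) q" if "q \<in> std_pairs m"
    using a N that std_subset_boundary by (intro laplace_transfer_toeplitz) (auto simp: sym_params_def)
  then show "sym_state m (toeplitz a (N + 1)) q = sym_transfer m c a (sym_state m (toeplitz a N)) q"
    by (simp add: sym_state_def sym_transfer_def)
qed

section \<open>Minimal polynomials\<close>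

lemma op_poly_bound:
  assumes "degree p \<le> n"
  shows "op_poly p L w = (\<Sum>k\<le>n. fscale (coeff p k) ((L ^^ k) w))"
  unfolding op_poly_def using assms
  by (intro sum.mono_neutral_left) (auto simp: coeff_eq_0)

lemma op_poly_0: "op_poly 0 L w = 0"
  by (simp add: op_poly_def)

lemma op_poly_add: "op_poly (p + q) L w = op_poly p L w + op_poly q L w"
proof -
  let ?n = "max (degree p) (degree q)"
  have "op_poly (p + q) L w = (\<Sum>k\<le>?n. fscale (coeff (p + q) k) ((L ^^ k) w))"
    by (intro op_poly_bound degree_add_le_max)
  moreover have "op_poly p L w = (\<Sum>k\<le>?n. fscale (coeff p k) ((L ^^ k) w))"
    "op_poly q L w = (\<Sum>k\<le>?n. fscale (coeff q k) ((L ^^ k) w))"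
    by (intro op_poly_bound; simp)+
  ultimately show ?thesis by (simp add: fs.scale_left_distrib sum.distrib)
qed

lemma op_poly_smult: "op_poly (Polynomial.smult k p) L w = fscale k (op_poly p L w)"
proof -
  have "op_poly (Polynomial.smult k p) L w = (\<Sum>j\<le>degree p. fscale (coeff (Polynomial.smult k p) j) ((L ^^ j) w))"
    by (intro op_poly_bound degree_smult_le)
  then show ?thesis by (simp add: op_poly_def fs.scale_sum_right)
qed

lemma op_poly_minus: "op_poly (p - q) L w = op_poly p L w - op_poly q L w"
  using op_poly_add[of p "- q" L w] op_poly_smult[of "- 1" q L w] by simp

lemma flinear_funpow:
  fixes L :: "('i \<Rightarrow> 'a::field) \<Rightarrow> 'i \<Rightarrow> 'a"
  shows "flinear L \<Longrightarrow> flinear (L ^^ k)"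
proof (induction k)
  case (Suc k)
  then show ?case using flinear_comp[of L "L ^^ k"] by (simp add: o_def)
next
  case 0
  then show ?case unfolding funpow_0 by (intro flinearI) (simp_all add: id_def)
qed

lemma flinear_op_poly:
  assumes "flinear L"
  shows "flinear (op_poly p L)"
  using flinear_funpow[OF assms]
  by (intro flinearI)
    (simp_all add: op_poly_def flinear_add flinear_scale fs.scale_right_distrib sum.distrib
      fs.scale_sum_right mult.commute)

lemma op_poly_pCons:
  assumes "flinear L"
  shows "op_poly (pCons b p) L w = fscale b w + L (op_poly p L w)"
proof -
  have "op_poly (pCons b p) L w = (\<Sum>k\<le>Suc (degree p). fscale (coeff (pCons b p) k) ((L ^^ k) w))"
    by (intro op_poly_bound degree_pCons_le)
  also have "\<dots> = fscale b w + (\<Sum>k\<le>degree p. fscale (coeff p k) (L ((L ^^ k) w)))"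
    by (subst sum.atMost_Suc_shift) simp
  finally show ?thesis
    by (simp add: op_poly_def flinear_sum[OF assms] flinear_scale[OF assms])
qed

lemma op_poly_mult:
  assumes "flinear L"
  shows "op_poly (p * q) L w = op_poly p L (op_poly q L w)"
  by (induction p)
    (simp_all only: mult_zero_left op_poly_0 mult_pCons_left op_poly_add op_poly_smult
      op_poly_pCons[OF assms] flinear_0[OF assms] fs.scale_zero_left add_0_left)

lemma annihilates_mult:
  assumes "flinear L" "annihilates p L W"
  shows "annihilates (r * p) L W"
  using assms by (simp add: annihilates_def op_poly_mult flinear_0[OF flinear_op_poly])

lemma annihilates_minus: "annihilates p L W \<Longrightarrow> annihilates q L W \<Longrightarrow> annihilates (p - q) L W"
  by (simp add: annihilates_def op_poly_minus)

text \<open>A monic annihilator of least degree divides all others by division with remainder, which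
  justifies the definite description. Some nonzero annihilator must be supplied for it to
  exist.\<close>

lemma min_poly_properties:
  assumes L: "flinear L" and p: "annihilates p L W" "p \<noteq> 0"
  shows "lead_coeff (min_poly L W) = 1" "annihilates (min_poly L W) L W"
    "\<And>r. annihilates r L W \<Longrightarrow> min_poly L W dvd r"
proof -
  obtain g where g: "annihilates g L W" "g \<noteq> 0"
    and min: "\<And>r. annihilates r L W \<Longrightarrow> r \<noteq> 0 \<Longrightarrow> degree g \<le> degree r"
    using ex_has_least_nat[of "\<lambda>g. annihilates g L W \<and> g \<noteq> 0" p degree] p by blast
  have dvd: "g dvd r" if "annihilates r L W" for r
  proof (rule ccontr)
    assume "\<not> g dvd r"
    then have nz: "r mod g \<noteq> 0" by (simp add: dvd_eq_mod_eq_0)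
    have "r mod g = r - r div g * g" by (rule minus_div_mult_eq_mod[symmetric])
    then have "annihilates (r mod g) L W"
      using annihilates_minus[OF that annihilates_mult[OF L g(1)]] by simp
    then have "degree g \<le> degree (r mod g)" using nz by (rule min)
    then show False using degree_mod_less'[OF g(2) nz] by simp
  qed
  define h where "h = Polynomial.smult (inverse (lead_coeff g)) g"
  have lg: "lead_coeff g \<noteq> 0" using g(2) by simp
  let ?min = "\<lambda>p. lead_coeff p = 1 \<and> annihilates p L W \<and> (\<forall>r. annihilates r L W \<longrightarrow> p dvd r)"
  have "?min h"
    using g lg dvd annihilates_mult[OF L g(1), of "[:inverse (lead_coeff g):]"]
    by (simp add: h_def lead_coeff_smult smult_dvd_iff)
  then have "\<exists>!p. ?min p"
    by (intro ex1I[of _ h]) (auto intro: poly_dvd_antisym)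
  then have "?min (min_poly L W)" unfolding min_poly_def by (rule theI')
  then show "lead_coeff (min_poly L W) = 1" "annihilates (min_poly L W) L W"
    "\<And>r. annihilates r L W \<Longrightarrow> min_poly L W dvd r" by blast+
qed

lemma degree_min_poly_le:
  assumes "flinear L" "annihilates p L W" "p \<noteq> 0"
  shows "degree (min_poly L W) \<le> degree p"
  using min_poly_properties(3)[OF assms assms(2)] assms(3) by (rule dvd_imp_degree_le)

lemma op_poly_conjugate:
  assumes L: "flinear L" and \<Theta>: "flinear \<Theta>"
    and W: "w \<in> W" "\<And>w. w \<in> W \<Longrightarrow> L w \<in> W"
    and diag: "\<And>w. w \<in> W \<Longrightarrow> \<Theta> (L w) = (\<lambda>i. \<mu> i * \<Theta> w i)"
  shows "\<Theta> (op_poly p L w) = (\<lambda>i. poly p (\<mu> i) * \<Theta> w i)"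
proof -
  have pow: "(L ^^ k) w \<in> W \<and> \<Theta> ((L ^^ k) w) = (\<lambda>i. \<mu> i ^ k * \<Theta> w i)" for k
    by (induction k) (use W diag in \<open>auto simp: mult_ac\<close>)
  show ?thesis
    unfolding op_poly_def flinear_sum[OF \<Theta>] flinear_scale[OF \<Theta>]
    using pow by (intro ext) (simp add: sum_fun_apply fscale_apply poly_altdef sum_distrib_right mult.assoc)
qed

section \<open>Diagonalization of the symmetry-adapted transfer\<close>

lemma flinear_laplace_transfer: "flinear (laplace_transfer m a)"
proof -
  have col: "col_expansion m a (v + w) I J = col_expansion m a v I J + col_expansion m a w I J"
    "col_expansion m a (fscale k v) I J = k * col_expansion m a v I J" for v w I J k
    by (simp_all add: col_expansion_def pointwise fscale_apply algebra_simps sum.distrib sum_distrib_left)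
  have row: "row_expansion m a (v + w) I J = row_expansion m a v I J + row_expansion m a w I J"
    "row_expansion m a (fscale k v) I J = k * row_expansion m a v I J" for v w I J k
    by (simp_all add: row_expansion_def col algebra_simps sum.distrib sum_distrib_left)
  show ?thesis
    by (rule flinearI) (auto simp: laplace_transfer_def row pointwise fscale_apply)
qed

lemma flinear_sym_transfer: "flinear (sym_transfer m c a)"
proof -
  have "flinear (\<lambda>w. restr (std_pairs m) (laplace_transfer m a (straighten m c w)))"
    by (rule flinear_comp[OF flinear_restr flinear_comp[OF flinear_laplace_transfer flinear_straighten]])
  then show ?thesis by (simp only: sym_transfer_eq[symmetric])
qed

lemma laplace_transfer_coord_space: "laplace_transfer m a v \<in> coord_space (boundary_pairs m)"
  by (simp add: laplace_transfer_def coord_space_def)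

lemma sym_transfer_in_sym_state_space: "sym_transfer m c a w \<in> sym_state_space m"
  by (simp add: sym_transfer_def sym_state_space_def coord_space_def)

abbreviation diag_mat_of :: "nat \<Rightarrow> (nat \<Rightarrow> 'a::field) \<Rightarrow> 'a mat" where
  "diag_mat_of n d \<equiv> mat n n (\<lambda>(i, j). if i = j then d j else 0)"

lemma psi_fock: "psi m v \<in> fock (2 * m)"
  using psi_ext_power ext_power_fock by blast

text \<open>\<open>ext (2 * m) B\<close> passes to coordinates in the eigenbasis of M, the columns
  of \<open>A\<close>.\<close>

lemma laplace_transfer_eigen_coordinates:
  fixes a :: "int \<Rightarrow> 'a::field_char_0"
  assumes a: "a \<in> sym_params m"
    and A: "A \<in> carrier_mat (2 * m) (2 * m)" "B \<in> carrier_mat (2 * m) (2 * m)"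
      "A * B = 1\<^sub>m (2 * m)" "B * A = 1\<^sub>m (2 * m)"
    and MA: "transfer_mat m a * A = A * diag_mat_of (2 * m) (pair_diag m x)"
  shows "ext (2 * m) B (psi m (laplace_transfer m a v)) =
    fscale ((- 1) ^ m * a (int m)) (diag_op (pair_diag m x) (ext (2 * m) B (psi m v)))"
proof -
  let ?D = "diag_mat_of (2 * m) (pair_diag m x)" and ?M = "transfer_mat m a"
  let ?\<omega> = "ext (2 * m) B (psi m v)"
  have M: "?M \<in> carrier_mat (2 * m) (2 * m)" by (simp add: transfer_mat_def)
  have D: "?D \<in> carrier_mat (2 * m) (2 * m)" by simp
  have \<omega>: "?\<omega> \<in> fock (2 * m)" by (rule ext_fock)
  have "ext (2 * m) ?M (psi m v) = ext (2 * m) ?M (ext (2 * m) A ?\<omega>)"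
    by (simp add: ext_inverse[OF A(1,2,3) psi_fock])
  also have "\<dots> = ext (2 * m) (A * ?D) ?\<omega>"
    unfolding MA[symmetric] by (rule ext_mult[OF M A(1) \<omega>, symmetric])
  also have "\<dots> = ext (2 * m) A (diag_op (pair_diag m x) ?\<omega>)"
    unfolding ext_mult[OF A(1) D \<omega>] ext_diag[OF \<omega>] ..
  finally have "ext (2 * m) B (ext (2 * m) ?M (psi m v)) =
      ext (2 * m) B (ext (2 * m) A (diag_op (pair_diag m x) ?\<omega>))" by simp
  also have "\<dots> = diag_op (pair_diag m x) ?\<omega>"
    by (rule ext_inverse[OF A(2,1,4)]) (use \<omega> in \<open>auto simp: diag_op_def coord_space_def\<close>)
  finally show ?thesis
    unfolding psi_laplace_ext[OF a] flinear_scale[OF flinear_ext] by simp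
qed

text \<open>On a single weight the operator is a scalar, and the weight components of a primitive
  vector are primitive.\<close>

lemma diag_op_primitive:
  fixes x :: "nat \<Rightarrow> 'a::field"
  assumes x: "\<And>i. i < m \<Longrightarrow> x i \<noteq> 0" and \<omega>: "\<omega> \<in> primitive_module m (std_form m)"
  shows "diag_op (pair_diag m x) \<omega> \<in> primitive_module m (std_form m)"
proof -
  have "diag_op (pair_diag m x) \<omega> =
      (\<Sum>\<epsilon>\<in>sign_vectors m. fscale (\<Prod>i<m. x i powi \<epsilon> i) (weight_part m \<epsilon> \<omega>))"
  proof
    fix S
    have "(\<Sum>\<epsilon>\<in>sign_vectors m. fscale (\<Prod>i<m. x i powi \<epsilon> i) (weight_part m \<epsilon> \<omega>)) S =
        (\<Sum>\<epsilon>\<in>sign_vectors m. if wedge_weight m S = \<epsilon> then (\<Prod>i<m. x i powi \<epsilon> i) * \<omega> S else 0)"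
      by (simp add: sum_fun_apply weight_part_def fscale_apply if_distrib cong: if_cong)
    also have "\<dots> = (\<Prod>i<m. x i powi wedge_weight m S i) * \<omega> S"
      using wedge_weight_sign_vector[of m S] finite_sign_vectors[of m] by simp
    also have "\<dots> = diag_op (pair_diag m x) \<omega> S"
    proof (cases "S \<in> ksubsets (2 * m) m")
      case True
      then show ?thesis using prod_pair_diag[OF _ x, of S m] by (simp add: diag_op_def ksubsets_def)
    next
      case False
      then have "\<omega> S = 0" using \<omega> by (simp add: primitive_module_def ext_power_def coord_space_def)
      then show ?thesis by (simp add: diag_op_def)
    qed
    finally show "diag_op (pair_diag m x) \<omega> S =
        (\<Sum>\<epsilon>\<in>sign_vectors m. fscale (\<Prod>i<m. x i powi \<epsilon> i) (weight_part m \<epsilon> \<omega>)) S" by simp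
  qed
  then show ?thesis
    using weight_part_in_std_weight_space[OF \<omega>] std_weight_space_subset
    by (auto intro!: fs.subspace_sum fs.subspace_scale subspace_primitive_module)
qed

lemma bij_betw_eigen_coordinates:
  fixes A :: "'a::field_char_0 mat"
  assumes A: "A \<in> carrier_mat (2 * m) (2 * m)" "B \<in> carrier_mat (2 * m) (2 * m)"
      "A * B = 1\<^sub>m (2 * m)" "B * A = 1\<^sub>m (2 * m)"
    and AJA: "transpose_mat A * std_form m * A = std_form m"
  shows "bij_betw (\<lambda>v. ext (2 * m) B (psi m v)) (sym_module m) (primitive_module m (std_form m))"
proof -
  have "bij_betw (ext (2 * m) A) (primitive_module m (std_form m)) (primitive_module m (std_form m))"
    using bij_betw_ext_primitive[OF A std_form_alternating] unfolding AJA .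
  then have img: "ext (2 * m) A ` primitive_module m (std_form m) = primitive_module m (std_form m)"
    by (rule bij_betw_imp_surj_on)
  have fock: "\<omega> \<in> fock (2 * m)" if "\<omega> \<in> primitive_module m (std_form m)" for \<omega> :: "nat set \<Rightarrow> 'a"
    using that ext_power_fock by (auto simp: primitive_module_def)
  have "bij_betw (ext (2 * m) B) (primitive_module m (std_form m)) (primitive_module m (std_form m))"
  proof (rule bij_betw_byWitness[where f' = "ext (2 * m) A"])
    show "ext (2 * m) B ` primitive_module m (std_form m) \<subseteq> primitive_module m (std_form m)"
    proof
      fix \<omega> :: "nat set \<Rightarrow> 'a" assume "\<omega> \<in> ext (2 * m) B ` primitive_module m (std_form m)"
      then obtain \<omega>' where "\<omega>' \<in> primitive_module m (std_form m)" "\<omega> = ext (2 * m) B (ext (2 * m) A \<omega>')"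
        using img by (metis (no_types, lifting) imageE)
      then show "\<omega> \<in> primitive_module m (std_form m)"
        using ext_inverse[OF A(2,1,4) fock] by simp
    qed
  qed (use img in \<open>auto simp: ext_inverse[OF A(1-3)] ext_inverse[OF A(2,1,4)] fock\<close>)
  then show ?thesis using bij_betw_trans[OF bij_betw_psi_sym_module] by (simp add: o_def)
qed

text \<open>In eigencoordinates the module is the primitive module of the standard form and the
  transfer is diagonal. Invariance is what makes straightening after a step lossless, see
  \<open>straighten_sym_transfer\<close>.\<close>

lemma laplace_transfer_sym_module:
  fixes a :: "int \<Rightarrow> 'a::field_char_0"
  assumes a: "a \<in> sym_params m" "rsquarefree (symbol_poly m a)" "reciprocal_roots m a x"
    and v: "v \<in> sym_module m"
  shows "laplace_transfer m a v \<in> sym_module m"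
proof -
  obtain A where A: "A \<in> carrier_mat (2 * m) (2 * m)" "transpose_mat A * std_form m * A = std_form m"
    and MA: "transfer_mat m a * A = A * diag_mat_of (2 * m) (pair_diag m x)"
    by (rule transfer_mat_diagonalization[OF a])
  obtain B where B: "B \<in> carrier_mat (2 * m) (2 * m)" "A * B = 1\<^sub>m (2 * m)" "B * A = 1\<^sub>m (2 * m)"
    by (rule symplectic_invertible[OF A(1) _ A(2)]) (simp add: std_form_def)
  let ?\<theta> = "\<lambda>v. ext (2 * m) B (psi m v)"
  have x: "x i \<noteq> 0" if "i < m" for i by (rule reciprocal_roots_nonzero[OF a(1,3) that])
  have "bij_betw ?\<theta> (sym_module m) (primitive_module m (std_form m))"
    by (rule bij_betw_eigen_coordinates[OF A(1) B A(2)])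
  then have "?\<theta> v \<in> primitive_module m (std_form m)"
    using v bij_betw_apply by fastforce
  then have "?\<theta> (laplace_transfer m a v) \<in> primitive_module m (std_form m)"
    unfolding laplace_transfer_eigen_coordinates[OF a(1) A(1) B MA]
    by (intro fs.subspace_scale subspace_primitive_module diag_op_primitive x)
  then have "ext (2 * m) A (?\<theta> (laplace_transfer m a v)) \<in> primitive_module m (std_form m)"
    using bij_betw_apply[OF bij_betw_ext_primitive[OF A(1) B std_form_alternating]]
    unfolding A(2) by blast
  then show ?thesis
    unfolding ext_inverse[OF A(1) B(1,2) psi_fock]
    by (simp add: sym_module_def laplace_transfer_coord_space)
qed

lemma straighten_sym_transfer:
  fixes a :: "int \<Rightarrow> 'a::field_char_0"
  assumes c: "catalan_straightening m c"
    and a: "a \<in> sym_params m" "rsquarefree (symbol_poly m a)" "reciprocal_roots m a x"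
    and w: "w \<in> sym_state_space m"
  shows "straighten m c (sym_transfer m c a w) = laplace_transfer m a (straighten m c w)"
  unfolding sym_transfer_eq
  by (intro straighten_restr c laplace_transfer_sym_module[OF a] restr_straighten(1)[OF c w])

definition parity_weights :: "nat \<Rightarrow> (nat \<Rightarrow> int) set" where
  "parity_weights m = {\<epsilon> \<in> sign_vectors m. support_size m \<epsilon> mod 2 = m mod 2}"

lemma finite_parity_weights: "finite (parity_weights m)"
  by (simp add: parity_weights_def finite_sign_vectors)

lemma wedge_weight_parity: "S \<in> ksubsets (2 * m) m \<Longrightarrow> wedge_weight m S \<in> parity_weights m"
  using card_eq_support_size[of S m] wedge_weight_sign_vector[of m S]
  by (auto simp: parity_weights_def ksubsets_def) presburger

text \<open>In eigencoordinates p(T) multiplies the coordinate at S by the value of p at the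
  eigenvalue of the weight of S. Every weight of the right parity is tested, because its weight
  space is nonzero.\<close>

lemma annihilates_sym_transfer_iff:
  fixes a :: "int \<Rightarrow> 'a::field_char_0"
  assumes c: "catalan_straightening m c"
    and a: "a \<in> sym_params m" "rsquarefree (symbol_poly m a)" "reciprocal_roots m a x"
  shows "annihilates p (sym_transfer m c a) (sym_state_space m) \<longleftrightarrow>
    (\<forall>\<epsilon>\<in>parity_weights m. poly p (transfer_eigenvalue m a x \<epsilon>) = 0)"
proof -
  obtain A where A: "A \<in> carrier_mat (2 * m) (2 * m)" "transpose_mat A * std_form m * A = std_form m"
    and MA: "transfer_mat m a * A = A * diag_mat_of (2 * m) (pair_diag m x)"
    by (rule transfer_mat_diagonalization[OF a])
  obtain B where B: "B \<in> carrier_mat (2 * m) (2 * m)" "A * B = 1\<^sub>m (2 * m)" "B * A = 1\<^sub>m (2 * m)"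
    by (rule symplectic_invertible[OF A(1) _ A(2)]) (simp add: std_form_def)
  have x: "x i \<noteq> 0" if "i < m" for i by (rule reciprocal_roots_nonzero[OF a(1,3) that])
  define \<Theta> where "\<Theta> w = ext (2 * m) B (psi m (straighten m c w))" for w :: "nat set \<times> nat set \<Rightarrow> 'a"
  define \<mu> where "\<mu> S = (- 1) ^ m * a (int m) * (\<Prod>k\<in>S. pair_diag m x k)" for S
  let ?P = "primitive_module m (std_form m) :: (nat set \<Rightarrow> 'a) set" and ?T = "sym_transfer m c a"
  have lin: "flinear \<Theta>"
    unfolding \<Theta>_def by (rule flinear_comp[OF flinear_ext flinear_comp[OF flinear_psi flinear_straighten]])
  have bij: "bij_betw \<Theta> (sym_state_space m) ?P"
    using bij_betw_trans[OF bij_betw_straighten[OF c] bij_betw_eigen_coordinates[OF A(1) B A(2)]]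
    by (simp add: o_def \<Theta>_def[abs_def])
  have diag: "\<Theta> (?T w) = (\<lambda>S. \<mu> S * \<Theta> w S)" if "w \<in> sym_state_space m" for w
    unfolding \<Theta>_def straighten_sym_transfer[OF c a that]
      laplace_transfer_eigen_coordinates[OF a(1) A(1) B MA]
    by (simp add: fscale_def diag_op_def \<mu>_def mult.assoc)
  have op: "\<Theta> (op_poly p ?T w) = (\<lambda>S. poly p (\<mu> S) * \<Theta> w S)" if "w \<in> sym_state_space m" for w
    by (rule op_poly_conjugate[where W = "sym_state_space m" and L = ?T and \<Theta> = \<Theta> and \<mu> = \<mu>])
      (use that diag in \<open>simp_all add: flinear_sym_transfer lin sym_transfer_in_sym_state_space\<close>)
  have "(op_poly p ?T w = 0) = (\<Theta> (op_poly p ?T w) = 0)" if w: "w \<in> sym_state_space m" for w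
  proof
    have "(?T ^^ k) w \<in> sym_state_space m" for k
      by (cases k) (simp_all add: w sym_transfer_in_sym_state_space)
    then have "op_poly p ?T w \<in> sym_state_space m" "0 \<in> sym_state_space m"
      unfolding op_poly_def sym_state_space_def
      by (auto intro!: fs.subspace_sum fs.subspace_scale subspace_coord_space simp: coord_space_0)
    moreover assume "\<Theta> (op_poly p ?T w) = 0"
    ultimately show "op_poly p ?T w = 0"
      using bij flinear_0[OF lin] by (metis bij_betw_imp_inj_on inj_onD)
  qed (simp add: flinear_0[OF lin])
  then have "annihilates p ?T (sym_state_space m) \<longleftrightarrow>
      (\<forall>w\<in>sym_state_space m. (\<lambda>S. poly p (\<mu> S) * \<Theta> w S) = 0)"
    by (simp add: annihilates_def op cong: ball_cong)
  also have "\<dots> \<longleftrightarrow> (\<forall>\<omega>\<in>?P. (\<lambda>S. poly p (\<mu> S) * \<omega> S) = 0)"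
    unfolding bij_betw_imp_surj_on[OF bij, symmetric] by blast
  also have "\<dots> \<longleftrightarrow> (\<forall>\<epsilon>\<in>parity_weights m. poly p (transfer_eigenvalue m a x \<epsilon>) = 0)"
  proof -
    have \<mu>: "\<mu> S = transfer_eigenvalue m a x (wedge_weight m S)" if "S \<in> ksubsets (2 * m) m" for S
      using that prod_pair_diag[OF _ x, of S m]
      by (simp add: \<mu>_def transfer_eigenvalue_def ksubsets_def)
    show ?thesis
    proof (intro iffI ballI)
      fix \<epsilon> assume all: "\<forall>\<omega>\<in>?P. (\<lambda>S. poly p (\<mu> S) * \<omega> S) = 0" and \<epsilon>: "\<epsilon> \<in> parity_weights m"
      then have "(std_weight_space m \<epsilon> :: (nat set \<Rightarrow> 'a) set) \<noteq> {0}"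
        using std_weight_space_nontrivial[of \<epsilon> m] by (auto simp: parity_weights_def)
      moreover have "(0 :: nat set \<Rightarrow> 'a) \<in> std_weight_space m \<epsilon>"
        using subspace_std_weight_space by (rule fs.subspace_0)
      ultimately obtain \<omega> :: "nat set \<Rightarrow> 'a" where \<omega>: "\<omega> \<in> std_weight_space m \<epsilon>" "\<omega> \<noteq> 0" by blast
      then obtain S where S: "\<omega> S \<noteq> 0" by (metis ext zero_fun_apply)
      then have "S \<in> weight_sets m \<epsilon> m" using \<omega>(1) by (auto simp: std_weight_space_def coord_space_def)
      then have mem: "S \<in> ksubsets (2 * m) m" "wedge_weight m S = \<epsilon>"
        by (auto simp: graded_def ksubsets_def)
      have "(\<lambda>S. poly p (\<mu> S) * \<omega> S) = 0" using all \<omega>(1) std_weight_space_subset by blast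
      then have "poly p (\<mu> S) * \<omega> S = 0" by (metis zero_fun_apply)
      then show "poly p (transfer_eigenvalue m a x \<epsilon>) = 0" using S mem \<mu> by simp
    next
      fix \<omega> assume all: "\<forall>\<epsilon>\<in>parity_weights m. poly p (transfer_eigenvalue m a x \<epsilon>) = 0" and \<omega>: "\<omega> \<in> ?P"
      show "(\<lambda>S. poly p (\<mu> S) * \<omega> S) = 0"
      proof
        fix S
        show "poly p (\<mu> S) * \<omega> S = 0 S"
        proof (cases "S \<in> ksubsets (2 * m) m")
          case True
          then show ?thesis using all \<mu> wedge_weight_parity by (simp add: pointwise)
        next
          case False
          then show ?thesis
            using \<omega> by (simp add: primitive_module_def ext_power_def coord_space_def pointwise)
        qed
      qed
    qed
  qed
  finally show ?thesis .
qed

text \<open>One factor per weight even where eigenvalues coincide, so that the degree is the number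
  of weights at every parameter.\<close>

definition weight_poly :: "nat \<Rightarrow> (int \<Rightarrow> 'a::field) \<Rightarrow> (nat \<Rightarrow> 'a) \<Rightarrow> 'a poly" where
  "weight_poly m a x = (\<Prod>\<epsilon>\<in>parity_weights m. [:- transfer_eigenvalue m a x \<epsilon>, 1:])"

lemma degree_weight_poly: "degree (weight_poly m a x) = card (parity_weights m)"
  and lead_coeff_weight_poly: "lead_coeff (weight_poly m a x) = 1"
  unfolding weight_poly_def lead_coeff_prod by (simp_all add: degree_prod_eq_sum_degree)

lemma annihilates_weight_poly:
  fixes a :: "int \<Rightarrow> 'a::field_char_0"
  assumes "catalan_straightening m c"
    and "a \<in> sym_params m" "rsquarefree (symbol_poly m a)" "reciprocal_roots m a x"
  shows "annihilates (weight_poly m a x) (sym_transfer m c a) (sym_state_space m)"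
  unfolding annihilates_sym_transfer_iff[OF assms]
  using finite_parity_weights by (auto simp: weight_poly_def poly_prod)

lemma degree_min_poly_sym_transfer_le:
  fixes a :: "int \<Rightarrow> 'a::field_char_0"
  assumes "catalan_straightening m c"
    and "a \<in> sym_params m" "rsquarefree (symbol_poly m a)" "reciprocal_roots m a x"
  shows "degree (min_poly (sym_transfer m c a) (sym_state_space m)) \<le> card (parity_weights m)"
proof -
  have "weight_poly m a x \<noteq> 0" using lead_coeff_weight_poly[of m a x] by auto
  then show ?thesis
    using degree_min_poly_le[OF flinear_sym_transfer annihilates_weight_poly[OF assms]]
    by (simp add: degree_weight_poly)
qed

section \<open>Reciprocal roots over an algebraically closed field\<close>

text \<open>Taking out an element with its inverse leaves a set of the same kind, so the set can be
  listed in reciprocal pairs.\<close>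

lemma prod_over_inverse_pairs:
  fixes R :: "'a::field set" and g :: "'a \<Rightarrow> 'b::comm_monoid_mult"
  assumes "finite R" "\<And>r. r \<in> R \<Longrightarrow> inverse r \<in> R \<and> inverse r \<noteq> r"
  shows "\<exists>k x. card R = 2 * k \<and> (\<Prod>r\<in>R. g r) = (\<Prod>i<k. g (x i) * g (inverse (x i)))"
  using assms
proof (induction "card R" arbitrary: R rule: less_induct)
  case less
  show ?case
  proof (cases "R = {}")
    case True
    then show ?thesis by (intro exI[of _ 0]) simp
  next
    case False
    then obtain r where r: "r \<in> R" by blast
    let ?R = "R - {r} - {inverse r}"
    have ir: "inverse r \<in> R - {r}" using less.prems(2)[OF r] by blast
    have card: "card R = Suc (Suc (card ?R))"
      using card.remove[OF less.prems(1) r] card.remove[of "R - {r}" "inverse r"] ir less.prems(1) by simp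
    have "\<exists>k x. card ?R = 2 * k \<and> (\<Prod>r\<in>?R. g r) = (\<Prod>i<k. g (x i) * g (inverse (x i)))"
    proof (rule less.hyps)
      show "inverse s \<in> ?R \<and> inverse s \<noteq> s" if "s \<in> ?R" for s
      proof -
        have "inverse s \<noteq> r" "inverse s \<noteq> inverse r" using that by auto
        then show ?thesis using that less.prems(2)[of s] by simp
      qed
    qed (use card less.prems(1) in auto)
    then obtain k x where k: "card ?R = 2 * k"
      and x: "(\<Prod>r\<in>?R. g r) = (\<Prod>i<k. g (x i) * g (inverse (x i)))" by blast
    have "(\<Prod>r\<in>R. g r) = g r * (g (inverse r) * (\<Prod>r\<in>?R. g r))"
      using prod.remove[OF less.prems(1) r, of g] prod.remove[of "R - {r}" "inverse r" g] ir less.prems(1)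
      by simp
    also have "\<dots> = (\<Prod>i<Suc k. g ((x(k := r)) i) * g (inverse ((x(k := r)) i)))"
    proof -
      have "(\<Prod>i<k. g ((x(k := r)) i) * g (inverse ((x(k := r)) i))) = (\<Prod>i<k. g (x i) * g (inverse (x i)))"
        by (rule prod.cong) auto
      then show ?thesis unfolding x by (simp add: mult_ac)
    qed
    finally show ?thesis
      using card k by (intro exI[of _ "Suc k"] exI[of _ "x(k := r)"]) simp
  qed
qed

lemma reciprocal_roots_exist:
  fixes a :: "int \<Rightarrow> 'a::{alg_closed_field, field_char_0}"
  assumes a: "a \<in> sym_params m" and sf: "rsquarefree (symbol_poly m a)"
  obtains x where "reciprocal_roots m a x"
proof -
  let ?q = "symbol_poly m a"
  have q: "?q \<noteq> 0" using sf by (simp add: rsquarefree_def)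
  have sym: "\<And>s. a (- s) = a s" using a by (simp add: sym_params_def)
  have simple: "poly (pderiv ?q) z \<noteq> 0" if "poly ?q z = 0" for z
    using sf that by (auto simp: rsquarefree_roots)
  obtain M where M: "size M = degree ?q" "?q = Polynomial.smult (lead_coeff ?q) (\<Prod>x\<in>#M. [:- x, 1:])"
    using alg_closed_imp_factorization[OF q] by blast
  have root: "poly ?q z = 0" if "z \<in># M" for z
    using that by (subst M(2)) (auto simp: poly_prod_mset prod_mset_zero_iff)
  have count1: "count M z = 1" if z: "z \<in># M" for z
  proof (rule ccontr)
    assume "count M z \<noteq> 1"
    moreover have "count M z > 0" using z by (rule count_greater_zero_iff[THEN iffD2])
    moreover have "count (M - {#z#}) z = count M z - 1" by simp
    ultimately have "count (M - {#z#}) z > 0" by linarith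
    then have "z \<in># M - {#z#}" by (rule count_greater_zero_iff[THEN iffD1])
    then obtain M' where "M = add_mset z (add_mset z M')" using z by (metis insert_DiffM)
    then have "?q = [:- z, 1:] * ([:- z, 1:] * Polynomial.smult (lead_coeff ?q) (\<Prod>x\<in>#M'. [:- x, 1:]))"
      by (subst M(2)) simp
    then obtain g where "?q = [:- z, 1:] * ([:- z, 1:] * g)" by blast
    moreover have "poly (pderiv ([:- z, 1:] * ([:- z, 1:] * g))) z = 0"
      unfolding pderiv_mult poly_add poly_mult by simp
    ultimately have "poly (pderiv ?q) z = 0" by simp
    then show False using simple root[OF z] by blast
  qed
  have MR: "mset_set (set_mset M) = M"
  proof (rule multiset_eqI)
    show "count (mset_set (set_mset M)) z = count M z" for z
      using count1[of z] by (cases "z \<in># M") (auto simp: not_in_iff)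
  qed
  let ?R = "set_mset M"
  have "(\<Prod>x\<in>#M. [:- x, 1:]) = (\<Prod>x\<in>#mset_set ?R. [:- x, 1:])" by (simp only: MR)
  then have prodR: "(\<Prod>x\<in>#M. [:- x, 1:]) = (\<Prod>x\<in>?R. [:- x, 1:])" by (simp only: prod_unfold_prod_mset)
  have mem: "z \<in> ?R \<longleftrightarrow> poly ?q z = 0" for z
  proof
    assume "poly ?q z = 0"
    then have "poly (Polynomial.smult (lead_coeff ?q) (\<Prod>x\<in>?R. [:- x, 1:])) z = 0"
      using M(2) prodR by metis
    then show "z \<in> ?R" using q by (auto simp: poly_prod)
  qed (rule root)
  have nz: "z \<noteq> 0" if "poly ?q z = 0" for z
  proof
    assume "z = 0"
    then show False
      using that a by (simp add: poly_0_coeff_0 coeff_symbol_poly sym_params_def)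
  qed
  have "inverse z \<in> ?R \<and> inverse z \<noteq> z" if z: "z \<in> ?R" for z
  proof -
    have r: "poly ?q z = 0" "z \<noteq> 0" using z mem nz by auto
    then have L: "laurent m a z = 0" using poly_symbol_poly[where a = a, OF sym r(2)] by simp
    then have "laurent m a (inverse z) = 0" by (simp add: laurent_def add.commute)
    then have "poly ?q (inverse z) = 0" using poly_symbol_poly[where a = a, OF sym, of "inverse z"] r(2) by simp
    \<comment> \<open>A root equal to its inverse would be a critical point of the symmetric symbol
      and hence a multiple root.\<close>
    moreover have "inverse z \<noteq> z"
    proof
      assume "inverse z = z"
      then have "laurent_deriv m a z = 0" by (simp add: laurent_deriv_def)
      then have "z * poly (pderiv ?q) z = 0" using poly_pderiv_symbol_poly[where a = a, OF sym r(2) L] by simp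
      then show False using r simple by simp
    qed
    ultimately show ?thesis using mem by blast
  qed
  note inverse_closed = this
  obtain k x where k: "card ?R = 2 * k"
    and x: "(\<Prod>r\<in>?R. [:- r, 1:]) = (\<Prod>i<k. [:- x i, 1:] * [:- inverse (x i), 1:])"
    using prod_over_inverse_pairs[of ?R "\<lambda>r. [:- r, 1:]", OF finite_set_mset inverse_closed] by blast
  have "card ?R = size M" by (metis MR size_mset_set)
  then have "k = m" using k M(1) degree_symbol_poly[OF a] by simp
  then have "reciprocal_roots m a x"
    using M(2) prodR x lead_coeff_symbol_poly[OF a] unfolding reciprocal_roots_def by metis
  then show ?thesis by (rule that)
qed

section \<open>Descent from the algebraic closure\<close>

text \<open>The coordinate of 1 in a basis of the closure over the ground field. It is linear over
  the ground field only, which is enough to move relations between vectors with coordinates in that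
  field.\<close>

lemma coordinate_retraction:
  obtains \<pi> :: "'a::field alg_closure \<Rightarrow> 'a"
  where "\<And>x y. \<pi> (x + y) = \<pi> x + \<pi> y" "\<And>k x. \<pi> (to_ac k * x) = k * \<pi> x" "\<pi> 1 = 1"
proof -
  interpret vp: vector_space_pair "\<lambda>k x. to_ac k * x :: 'a alg_closure" "(*) :: 'a \<Rightarrow> 'a \<Rightarrow> 'a"
    by unfold_locales (auto simp: algebra_simps)
  have "vp.vs1.independent {1}" by (simp add: vp.vs1.dependent_single)
  then obtain \<pi> where "Vector_Spaces.linear (\<lambda>k x. to_ac k * x) (*) \<pi>" "\<forall>x\<in>{1}. \<pi> x = (1 :: 'a)"
    using vp.linear_independent_extend[of "{1}" "\<lambda>_. 1"] by blast
  then show ?thesis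
    by (intro that[of \<pi>]) (auto simp: Vector_Spaces.linear_iff)
qed

lemma laplace_transfer_to_ac:
  "laplace_transfer m (\<lambda>s. to_ac (a s)) (\<lambda>p. to_ac (v p)) = (\<lambda>p. to_ac (laplace_transfer m a v p))"
proof -
  have col: "col_expansion m (\<lambda>s. to_ac (a s)) (\<lambda>p. to_ac (v p)) I J = to_ac (col_expansion m a v I J)" for I J
    by (simp add: col_expansion_def to_ac_sum)
  have "row_expansion m (\<lambda>s. to_ac (a s)) (\<lambda>p. to_ac (v p)) I J = to_ac (row_expansion m a v I J)" for I J
    by (simp add: row_expansion_def col to_ac_sum)
  then show ?thesis by (simp add: laplace_transfer_def fun_eq_iff)
qed

lemma sym_module_to_ac:
  assumes "v \<in> sym_module m"
  shows "(\<lambda>p. to_ac (v p)) \<in> sym_module m"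
proof -
  have psi: "psi m (\<lambda>p. to_ac (v p)) = (\<lambda>S. to_ac (psi m v S))"
    by (simp add: psi_def tau_def fun_eq_iff)
  have std: "std_form m $$ (i, j) = to_ac (std_form m $$ (i, j) :: 'a)" if "i < 2 * m" "j < 2 * m" for i j
    using that by (simp add: std_form_def)
  have "contraction (2 * m) m (std_form m) (\<lambda>S. to_ac (\<omega> S)) =
      (\<lambda>R. to_ac (contraction (2 * m) m (std_form m) \<omega> R))" for \<omega> :: "nat set \<Rightarrow> 'a"
  proof -
    have "(\<Sum>(i, j)\<in>{(i, j). i < j \<and> j < 2 * m \<and> i \<notin> R \<and> j \<notin> R}.
        (- 1) ^ (card (R \<inter> {..<i}) + card (R \<inter> {..<j})) * std_form m $$ (i, j) * to_ac (\<omega> (insert i (insert j R)))) =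
      (\<Sum>p\<in>{(i, j). i < j \<and> j < 2 * m \<and> i \<notin> R \<and> j \<notin> R}. to_ac (case p of (i, j) \<Rightarrow>
        (- 1) ^ (card (R \<inter> {..<i}) + card (R \<inter> {..<j})) * std_form m $$ (i, j) * \<omega> (insert i (insert j R))))" for R
      by (rule sum.cong) (auto simp: std)
    then show ?thesis by (simp add: contraction_def to_ac_sum fun_eq_iff)
  qed
  then show ?thesis
    using assms unfolding sym_module_def primitive_module_def ext_power_def
    by (auto simp: psi coord_space_def fun_eq_iff pointwise)
qed

text \<open>\<open>c\<close> and \<open>c'\<close> are compared through the module: the embedded
  straightened vector lies in the module over the closure and has the given standard coordinates, so
  \<open>c'\<close> reproduces it.\<close>

lemma sym_transfer_to_ac:
  fixes c :: "nat set \<times> nat set \<Rightarrow> nat set \<times> nat set \<Rightarrow> 'a::field_char_0"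
  assumes c: "catalan_straightening m c" and c': "catalan_straightening m c'"
    and w: "w \<in> sym_state_space m"
  shows "sym_transfer m c' (\<lambda>s. to_ac (a s)) (\<lambda>q. to_ac (w q)) = (\<lambda>q. to_ac (sym_transfer m c a w q))"
proof -
  let ?v = "straighten m c w"
  have "restr (std_pairs m) (\<lambda>p. to_ac (?v p)) = (\<lambda>q. to_ac (restr (std_pairs m) ?v q))"
    by (simp add: restr_def fun_eq_iff)
  also have "\<dots> = (\<lambda>q. to_ac (w q))" by (simp only: restr_straighten(2)[OF c w])
  finally have str: "straighten m c' (\<lambda>q. to_ac (w q)) = (\<lambda>p. to_ac (?v p))"
    using straighten_restr[OF c' sym_module_to_ac[OF restr_straighten(1)[OF c w]]] by simp
  show ?thesis
    unfolding sym_transfer_eq str laplace_transfer_to_ac by (simp add: restr_def fun_eq_iff)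
qed

lemma sym_transfer_annihilator:
  fixes c :: "nat set \<times> nat set \<Rightarrow> nat set \<times> nat set \<Rightarrow> 'a::field_char_0"
  assumes c: "catalan_straightening m c" and a: "a \<in> sym_params m"
    and sf: "rsquarefree (symbol_poly m (\<lambda>s. to_ac (a s)))"
  obtains p where "annihilates p (sym_transfer m c a) (sym_state_space m)" "p \<noteq> 0"
    "degree p \<le> card (parity_weights m)"
proof -
  let ?a = "\<lambda>s. to_ac (a s)"
  have a': "?a \<in> sym_params m" using a by (simp add: sym_params_def)
  obtain x where x: "reciprocal_roots m ?a x" by (rule reciprocal_roots_exist[OF a' sf])
  obtain c' :: "nat set \<times> nat set \<Rightarrow> nat set \<times> nat set \<Rightarrow> 'a alg_closure"
    where c': "catalan_straightening m c'" by (rule catalan_straightening_exists)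
  obtain \<pi> :: "'a alg_closure \<Rightarrow> 'a"
    where add: "\<And>x y. \<pi> (x + y) = \<pi> x + \<pi> y" and scale: "\<And>k x. \<pi> (to_ac k * x) = k * \<pi> x" and one: "\<pi> 1 = 1"
    by (rule coordinate_retraction) blast
  have zero: "\<pi> 0 = 0" using add[of 0 0] by simp
  have sum: "\<pi> (\<Sum>k\<in>K. f k) = (\<Sum>k\<in>K. \<pi> (f k))" for K :: "nat set" and f
    by (induction K rule: infinite_finite_induct) (simp_all add: add zero)
  let ?P = "weight_poly m ?a x" and ?T = "sym_transfer m c a" and ?d = "card (parity_weights m)"
  \<comment> \<open>In the annihilation relation the powers of the transfer have entries in the
    ground field and only the coefficients lie in the closure. Applying \<pi> to these keeps the
    relation, and the leading coefficient remains 1.\<close>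
  define p where "p = (\<Sum>k\<le>?d. Polynomial.monom (\<pi> (coeff ?P k)) k)"
  have cp: "coeff p k = (if k \<le> ?d then \<pi> (coeff ?P k) else 0)" for k
    by (simp add: p_def coeff_sum)
  have deg: "degree p \<le> ?d" by (intro degree_le) (simp add: cp)
  have "op_poly p ?T w q = 0" if w: "w \<in> sym_state_space m" for w q
  proof -
    have pow: "(?T ^^ k) w \<in> sym_state_space m \<and>
        (sym_transfer m c' ?a ^^ k) (\<lambda>q. to_ac (w q)) = (\<lambda>q. to_ac ((?T ^^ k) w q))" for k
      by (induction k) (use w in \<open>auto simp: sym_transfer_in_sym_state_space sym_transfer_to_ac[OF c c']\<close>)
    have "(\<lambda>q. to_ac (w q)) \<in> sym_state_space m"
      using w by (simp add: sym_state_space_def coord_space_def)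
    then have "op_poly ?P (sym_transfer m c' ?a) (\<lambda>q. to_ac (w q)) q = 0"
      using annihilates_weight_poly[OF c' a' sf x] by (simp add: annihilates_def pointwise)
    then have "(\<Sum>k\<le>?d. coeff ?P k * to_ac ((?T ^^ k) w q)) = 0"
      using pow by (simp add: op_poly_def degree_weight_poly sum_fun_apply fscale_apply)
    then have "\<pi> (\<Sum>k\<le>?d. to_ac ((?T ^^ k) w q) * coeff ?P k) = 0"
      by (simp add: zero mult.commute)
    then have "(\<Sum>k\<le>?d. \<pi> (coeff ?P k) * (?T ^^ k) w q) = 0"
      by (simp add: sum scale mult.commute)
    then show ?thesis by (simp add: op_poly_bound[OF deg] sum_fun_apply fscale_apply cp)
  qed
  then have "annihilates p ?T (sym_state_space m)"
    by (auto simp: annihilates_def pointwise intro!: ext)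
  moreover have "coeff p ?d = 1"
    using lead_coeff_weight_poly[of m ?a x] by (simp add: cp degree_weight_poly one)
  then have "p \<noteq> 0" by auto
  ultimately show ?thesis using deg that by blast
qed

section \<open>Polynomial functions of the parameters\<close>

lemma poly_functions_sum:
  "(\<And>i. i \<in> Z \<Longrightarrow> (\<lambda>a. f i a) \<in> poly_functions) \<Longrightarrow> (\<lambda>a. \<Sum>i\<in>Z. f i a) \<in> poly_functions"
  by (induction Z rule: infinite_finite_induct) (auto intro: poly_functions.intros)

lemma poly_functions_prod:
  "(\<And>i. i \<in> Z \<Longrightarrow> (\<lambda>a. f i a) \<in> poly_functions) \<Longrightarrow> (\<lambda>a. \<Prod>i\<in>Z. f i a) \<in> poly_functions"
  by (induction Z rule: infinite_finite_induct) (auto intro: poly_functions.intros)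

lemma poly_functions_det:
  assumes "\<And>i j. i < n \<Longrightarrow> j < n \<Longrightarrow> (\<lambda>a. f a i j) \<in> poly_functions"
  shows "(\<lambda>a. det (mat n n (\<lambda>(i, j). f a i j))) \<in> poly_functions"
proof -
  have "det (mat n n (\<lambda>(i, j). f a i j)) =
      (\<Sum>p\<in>{p. p permutes {0..<n}}. signof p * (\<Prod>i = 0..<n. f a i (p i)))" for a
    by (subst det_def'[of _ n], simp) (auto intro!: sum.cong prod.cong simp: permutes_in_image)
  moreover have "(\<lambda>a. f a i (p i)) \<in> poly_functions" if "p permutes {0..<n}" "i \<in> {0..<n}" for i p
    using that permutes_in_image[of p "{0..<n}" i] by (intro assms) auto
  ultimately show ?thesis
    by (simp only:) (intro poly_functions_sum poly_functions.mult poly_functions.const poly_functions_prod, auto)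
qed

text \<open>The straightening coefficients are constants, so the parameters enter only through the
  Laplace expansions.\<close>

lemma poly_functions_sym_transfer:
  assumes "\<And>q. (\<lambda>a. w a q) \<in> poly_functions"
  shows "(\<lambda>a. sym_transfer m c a (w a) q) \<in> poly_functions"
proof -
  have str: "(\<lambda>a. straighten m c (w a) p) \<in> poly_functions" for p
    unfolding straighten_def
    by (cases "p \<in> boundary_pairs m")
      (simp_all add: poly_functions.const poly_functions_sum poly_functions.mult assms)
  have col: "(\<lambda>a. col_expansion m a (straighten m c (w a)) I J) \<in> poly_functions" for I J
    unfolding col_expansion_def
    by (cases "0 \<in> J")
      (simp_all add: str poly_functions_sum poly_functions.mult poly_functions.const poly_functions.coordinate)
  have row: "(\<lambda>a. row_expansion m a (straighten m c (w a)) I J) \<in> poly_functions" for I J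
    unfolding row_expansion_def
    by (cases "0 \<in> I")
      (simp_all add: col poly_functions_sum poly_functions.mult poly_functions.const poly_functions.coordinate)
  show ?thesis
    unfolding sym_transfer_def laplace_transfer_def
    by (cases "q \<in> std_pairs m"; cases "q \<in> boundary_pairs m") (simp_all add: row poly_functions.const)
qed

section \<open>A nonempty open set of parameters\<close>

text \<open>
  The rows of the Sylvester matrix are coefficient vectors of multiples of the symbol and of its
  derivative, so the vector of powers of a common root lies in its kernel.
\<close>

definition sylvester_row :: "nat \<Rightarrow> (int \<Rightarrow> 'a::field) \<Rightarrow> nat \<Rightarrow> 'a poly" where
  "sylvester_row m a i =
     (if i < 2 * m - 1 then Polynomial.monom 1 i * symbol_poly m a
      else Polynomial.monom 1 (i - (2 * m - 1)) * pderiv (symbol_poly m a))"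

definition discriminant :: "nat \<Rightarrow> (int \<Rightarrow> 'a::field) \<Rightarrow> 'a" where
  "discriminant m a =
     det (mat (4 * m - 1) (4 * m - 1) (\<lambda>(i, k). coeff (sylvester_row m a i) k))"

lemma discriminant_poly_function: "discriminant m \<in> poly_functions"
proof -
  have sp: "(\<lambda>a. coeff (symbol_poly m a) k) \<in> poly_functions" for k
    by (cases "k \<le> 2 * m") (simp_all add: coeff_symbol_poly poly_functions.const poly_functions.coordinate)
  have dp: "(\<lambda>a. coeff (pderiv (symbol_poly m a)) k) \<in> poly_functions" for k
    unfolding coeff_pderiv by (intro poly_functions.mult poly_functions.const sp)
  have "(\<lambda>a. coeff (sylvester_row m a i) k) \<in> poly_functions" for i k
  proof (cases "i < 2 * m - 1")
    case True
    then show ?thesis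
      unfolding sylvester_row_def
      by (cases "k < i") (simp_all add: coeff_monom_mult sp poly_functions.const)
  next
    case False
    then show ?thesis
      unfolding sylvester_row_def
      by (cases "k < i - (2 * m - 1)") (simp_all add: coeff_monom_mult dp poly_functions.const)
  qed
  then have "(\<lambda>a. det (mat (4 * m - 1) (4 * m - 1) (\<lambda>(i, k). coeff (sylvester_row m a i) k))) \<in> poly_functions"
    by (rule poly_functions_det)
  then show ?thesis unfolding discriminant_def[abs_def] .
qed

lemma degree_sylvester_row:
  fixes a :: "int \<Rightarrow> 'a::field_char_0"
  assumes a: "a \<in> sym_params m" and i: "i < 4 * m - 1"
  shows "degree (sylvester_row m a i) < 4 * m - 1"
proof -
  have q: "degree (symbol_poly m a) = 2 * m" by (rule degree_symbol_poly[OF a])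
  have d: "degree (pderiv (symbol_poly m a)) \<le> 2 * m - 1"
    using degree_pderiv[of "symbol_poly m a"] q by simp
  show ?thesis
  proof (cases "i < 2 * m - 1")
    case True
    then have "sylvester_row m a i = Polynomial.monom 1 i * symbol_poly m a" by (simp add: sylvester_row_def)
    then have "degree (sylvester_row m a i) \<le> i + 2 * m"
      using degree_mult_le[of "Polynomial.monom 1 i" "symbol_poly m a"] degree_monom_le[of "1 :: 'a" i] q by simp
    then show ?thesis using True by simp
  next
    case False
    let ?j = "i - (2 * m - 1)"
    have row: "sylvester_row m a i = Polynomial.monom 1 ?j * pderiv (symbol_poly m a)"
      using False by (simp only: sylvester_row_def if_False)
    have "degree (sylvester_row m a i) \<le> ?j + (2 * m - 1)"
      unfolding row using degree_mult_le[of "Polynomial.monom 1 ?j" "pderiv (symbol_poly m a)"]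
        degree_monom_le[of "1 :: 'a" ?j] d by linarith
    then show ?thesis using False i by simp
  qed
qed

lemma rsquarefree_if_discriminant:
  fixes a :: "int \<Rightarrow> 'a::field_char_0"
  assumes a: "a \<in> sym_params m" and D: "discriminant m a \<noteq> 0"
  shows "rsquarefree (symbol_poly m (\<lambda>s. to_ac (a s)))"
  unfolding rsquarefree_roots
proof (intro allI notI)
  let ?a = "\<lambda>s. to_ac (a s)" and ?N = "4 * m - 1"
  fix z
  assume z: "poly (symbol_poly m ?a) z = 0 \<and> poly (pderiv (symbol_poly m ?a)) z = 0"
  have a': "?a \<in> sym_params m" using a by (simp add: sym_params_def)
  \<comment> \<open>For m = 0 the matrix is empty and the vector of powers would be no kernel
    vector; but then the symbol is a nonzero constant without roots.\<close>
  have "m \<noteq> 0"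
  proof
    assume m: "m = 0"
    then obtain b where b: "symbol_poly m ?a = [:b:]"
      using degree_symbol_poly[OF a'] degree_0_id by (metis mult_0_right)
    have "lead_coeff (symbol_poly m ?a) \<noteq> 0"
      using lead_coeff_symbol_poly[OF a'] a' by (simp add: sym_params_def)
    then show False using z b by simp
  qed
  then have N: "0 < ?N" by simp
  interpret to_ac: comm_ring_hom "to_ac :: 'a \<Rightarrow> 'a alg_closure" by unfold_locales auto
  let ?S = "mat ?N ?N (\<lambda>(i, k). coeff (sylvester_row m ?a i) k)"
  have "coeff (sylvester_row m ?a i) k = to_ac (coeff (sylvester_row m a i) k)" for i k
    by (simp add: sylvester_row_def coeff_monom_mult coeff_pderiv coeff_symbol_poly)
  then have "?S = map_mat to_ac (mat ?N ?N (\<lambda>(i, k). coeff (sylvester_row m a i) k))"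
    by (intro eq_matI) auto
  then have "det ?S = to_ac (discriminant m a)" by (simp add: discriminant_def)
  then have "det ?S \<noteq> 0" using D by simp
  moreover have "?S *\<^sub>v vec ?N (\<lambda>k. z ^ k) = 0\<^sub>v ?N"
  proof (rule eq_vecI)
    fix i assume "i < dim_vec (0\<^sub>v ?N :: 'a alg_closure vec)"
    then have i: "i < ?N" by simp
    have "(?S *\<^sub>v vec ?N (\<lambda>k. z ^ k)) $ i = (\<Sum>k<?N. coeff (sylvester_row m ?a i) k * z ^ k)"
      using i by (simp add: scalar_prod_def lessThan_atLeast0)
    also have "\<dots> = poly (sylvester_row m ?a i) z"
      unfolding poly_altdef using degree_sylvester_row[OF a' i]
      by (intro sum.mono_neutral_right) (auto simp: coeff_eq_0)
    also have "\<dots> = 0" using z by (simp add: sylvester_row_def)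
    finally show "(?S *\<^sub>v vec ?N (\<lambda>k. z ^ k)) $ i = 0\<^sub>v ?N $ i" using i by simp
  qed simp
  moreover have "vec ?N (\<lambda>k. z ^ k) \<noteq> 0\<^sub>v ?N"
  proof
    assume "vec ?N (\<lambda>k. z ^ k) = 0\<^sub>v ?N"
    then have "vec ?N (\<lambda>k. z ^ k) $ 0 = 0\<^sub>v ?N $ 0" by simp
    then show False using N by simp
  qed
  ultimately show False
    using det_0_iff_vec_prod_zero_field[of ?S ?N] by (metis mat_carrier vec_carrier)
qed

text \<open>A vanishing determinant gives a relation u q + w q' = 0 with deg w < 2m and u, w not
  both 0. At the 2m distinct simple roots q' does not vanish, so w does; hence w = 0 and then u =
  0.\<close>

lemma discriminant_nonzero:
  fixes a :: "int \<Rightarrow> 'a::field_char_0"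
  assumes a: "a \<in> sym_params m"
    and r: "symbol_poly m a = Polynomial.smult b (\<Prod>k<2 * m. [:- r k, 1:])" and inj: "inj_on r {..<2 * m}"
    and sf: "rsquarefree (symbol_poly m a)"
  shows "discriminant m a \<noteq> 0"
proof
  let ?N = "4 * m - 1" and ?q = "symbol_poly m a"
  let ?S = "mat ?N ?N (\<lambda>(i, k). coeff (sylvester_row m a i) k)"
  assume "discriminant m a = 0"
  then have "det (transpose_mat ?S) = 0"
    unfolding discriminant_def by (subst det_transpose[of _ ?N]) simp_all
  then obtain v where v: "v \<in> carrier_vec ?N" "v \<noteq> 0\<^sub>v ?N" "transpose_mat ?S *\<^sub>v v = 0\<^sub>v ?N"
    using det_0_iff_vec_prod_zero_field[of "transpose_mat ?S" ?N] by auto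
  have "(\<Sum>i<?N. Polynomial.smult (v $ i) (sylvester_row m a i)) = 0"
  proof (rule poly_eqI)
    fix k
    show "coeff (\<Sum>i<?N. Polynomial.smult (v $ i) (sylvester_row m a i)) k = coeff 0 k"
    proof (cases "k < ?N")
      case True
      have "0 = (transpose_mat ?S *\<^sub>v v) $ k" unfolding v(3) using True by simp
      also have "\<dots> = (\<Sum>i<?N. coeff (sylvester_row m a i) k * v $ i)"
        using True v(1) by (simp add: scalar_prod_def lessThan_atLeast0)
      finally show ?thesis by (simp add: coeff_sum mult.commute)
    next
      case False
      then have "coeff (sylvester_row m a i) k = 0" if "i < ?N" for i
        using degree_sylvester_row[OF a that] by (intro coeff_eq_0) simp
      then show ?thesis by (simp add: coeff_sum)
    qed
  qed
  moreover define u where "u = (\<Sum>i<2 * m - 1. Polynomial.monom (v $ i) i)"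
  define w where "w = (\<Sum>i<2 * m. Polynomial.monom (v $ (2 * m - 1 + i)) i)"
  have "(\<Sum>i<?N. Polynomial.smult (v $ i) (sylvester_row m a i)) = u * ?q + w * pderiv ?q"
  proof -
    have N: "?N = (2 * m - 1) + 2 * m" if "m \<noteq> 0" using that by simp
    have "(\<Sum>i<(2 * m - 1) + 2 * m. Polynomial.smult (v $ i) (sylvester_row m a i)) =
        (\<Sum>i<2 * m - 1. Polynomial.smult (v $ i) (sylvester_row m a i)) +
        (\<Sum>i<2 * m. Polynomial.smult (v $ (2 * m - 1 + i)) (sylvester_row m a (2 * m - 1 + i)))"
    proof -
      have "(\<Sum>i<k + l. f i) = (\<Sum>i<k. f i) + (\<Sum>i<l. f (k + i))" for k l and f :: "nat \<Rightarrow> 'a poly"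
        by (induction l) (simp_all add: add.assoc)
      then show ?thesis .
    qed
    also have "(\<Sum>i<2 * m - 1. Polynomial.smult (v $ i) (sylvester_row m a i)) = u * ?q"
      unfolding u_def sum_distrib_right
      by (rule sum.cong) (auto simp: sylvester_row_def smult_monom simp flip: mult_smult_left)
    also have "(\<Sum>i<2 * m. Polynomial.smult (v $ (2 * m - 1 + i)) (sylvester_row m a (2 * m - 1 + i))) = w * pderiv ?q"
      unfolding w_def sum_distrib_right
      by (rule sum.cong) (auto simp: sylvester_row_def smult_monom simp flip: mult_smult_left)
    finally show ?thesis using N by (cases "m = 0") (simp_all add: u_def w_def)
  qed
  ultimately have eq: "u * ?q + w * pderiv ?q = 0" by simp
  have root: "poly ?q (r k) = 0" if "k < 2 * m" for k
    unfolding r using that by (auto simp: poly_prod)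
  have "w = 0"
  proof (rule ccontr)
    assume w: "w \<noteq> 0"
    have "poly w (r k) = 0" if k: "k < 2 * m" for k
    proof -
      have "poly (u * ?q + w * pderiv ?q) (r k) = 0" using eq by simp
      then have "poly w (r k) * poly (pderiv ?q) (r k) = 0" using root[OF k] by simp
      then show ?thesis using root[OF k] sf by (auto simp: rsquarefree_roots)
    qed
    then have "r ` {..<2 * m} \<subseteq> {z. poly w z = 0}" by auto
    then have "card (r ` {..<2 * m}) \<le> degree w"
      using card_mono[OF poly_roots_finite[OF w]] card_poly_roots_bound[OF w] by (meson order_trans)
    then have "2 * m \<le> degree w" by (simp add: card_image[OF inj])
    moreover have "coeff w k = 0" if "k \<ge> 2 * m" for k using that by (simp add: w_def coeff_sum)
    ultimately show False using w by (metis leading_coeff_0_iff)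
  qed
  moreover have "?q \<noteq> 0" using sf by (simp add: rsquarefree_def)
  ultimately have "u = 0" using eq by simp
  have "v $ i = 0" if i: "i < ?N" for i
  proof (cases "i < 2 * m - 1")
    case True
    then have "v $ i = coeff u i" by (simp add: u_def coeff_sum)
    then show ?thesis using \<open>u = 0\<close> by simp
  next
    case False
    then have "v $ i = coeff w (i - (2 * m - 1))" using i by (simp add: w_def coeff_sum)
    then show ?thesis using \<open>w = 0\<close> by simp
  qed
  then have "v = 0\<^sub>v ?N" using v(1) by (intro eq_vecI) auto
  then show False using v(2) by blast
qed

subsection \<open>A parameter with distinct eigenvalues\<close>

text \<open>
  With \<open>x\<^sub>i = 2\<^bsup>3^i\<^esup>\<close> the eigenvalue at \<open>\<epsilon>\<close> is \<open>(-1)\<^bsup>m\<^esup> 2\<^bsup>e\<^esup>\<close>, where \<open>e\<close> has balanced ternary digits \<open>\<epsilon>\<close>.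
\<close>

definition ternary_root :: "nat \<Rightarrow> 'a::field" where
  "ternary_root i = 2 powi (3 ^ i)"

definition ternary_param :: "nat \<Rightarrow> int \<Rightarrow> 'a::field" where
  "ternary_param m s = (if \<bar>s\<bar> \<le> int m then
     coeff (\<Prod>i<m. [:- ternary_root i, 1:] * [:- inverse (ternary_root i), 1:]) (nat (s + int m)) else 0)"

text \<open>In characteristic 0 the element 2 is not a root of unity.\<close>

lemma two_powi_inj:
  assumes "(2 :: 'a::field_char_0) powi k = 2 powi l"
  shows "k = l"
proof -
  have le: "k \<le> l" if "(2 :: 'a) powi k = 2 powi l" for k l
  proof (rule ccontr)
    assume "\<not> k \<le> l"
    define n where "n = nat (k - l)"
    then have n: "k = l + int n" "n \<noteq> 0" using \<open>\<not> k \<le> l\<close> by auto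
    have "(2 :: 'a) powi l * 2 ^ n = 2 powi l * 1"
      using that unfolding n by (simp add: power_int_add)
    then have "(2 :: 'a) ^ n = 1" by simp
    then have "of_nat (2 ^ n) = (of_nat 1 :: 'a)" by simp
    then have "(2 :: nat) ^ n = 1" by (simp only: of_nat_eq_iff)
    then show False using n(2) by simp
  qed
  show ?thesis using le[OF assms] le[OF assms[symmetric]] by simp
qed

text \<open>The lowest digit is determined modulo 3, since it lies between -1 and 1; the others
  follow after division by 3.\<close>

lemma balanced_ternary_inj:
  assumes "\<And>i. i < m \<Longrightarrow> \<bar>\<epsilon> i\<bar> \<le> 1 \<and> \<bar>\<delta> i\<bar> \<le> (1 :: int)"
    and "(\<Sum>i<m. \<epsilon> i * 3 ^ i) = (\<Sum>i<m. \<delta> i * 3 ^ i)" and "i < m"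
  shows "\<epsilon> i = \<delta> i"
  using assms
proof (induction m arbitrary: \<epsilon> \<delta> i)
  case (Suc m)
  have shift: "(\<Sum>i<Suc m. f i * 3 ^ i) = f 0 + 3 * (\<Sum>i<m. f (Suc i) * 3 ^ i)" for f :: "nat \<Rightarrow> int"
    by (subst sum.lessThan_Suc_shift) (simp add: sum_distrib_left mult_ac)
  have e: "\<epsilon> 0 + 3 * (\<Sum>i<m. \<epsilon> (Suc i) * 3 ^ i) = \<delta> 0 + 3 * (\<Sum>i<m. \<delta> (Suc i) * 3 ^ i)"
    using Suc.prems(2) unfolding shift .
  have b: "\<bar>\<epsilon> 0\<bar> \<le> 1" "\<bar>\<delta> 0\<bar> \<le> 1" using Suc.prems(1)[of 0] by auto
  then have 0: "\<epsilon> 0 = \<delta> 0" using e by presburger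
  have "(\<Sum>i<m. \<epsilon> (Suc i) * 3 ^ i) = (\<Sum>i<m. \<delta> (Suc i) * 3 ^ i)" using e 0 by simp
  then have "\<epsilon> (Suc j) = \<delta> (Suc j)" if "j < m" for j
    using Suc.IH[of "\<lambda>i. \<epsilon> (Suc i)" "\<lambda>i. \<delta> (Suc i)" j] Suc.prems(1) that by simp
  then show ?case using 0 Suc.prems(3) by (cases i) auto
qed simp

lemma ternary_root_nonzero: "ternary_root i \<noteq> (0 :: 'a::field_char_0)"
  by (simp add: ternary_root_def)

lemma ternary_param_properties:
  fixes m :: nat
  defines "a \<equiv> ternary_param m :: int \<Rightarrow> 'a::field_char_0"
  shows "a \<in> sym_params m" "reciprocal_roots m a ternary_root"
    "symbol_poly m a = Polynomial.smult 1 (\<Prod>k<2 * m. [:- pair_diag m ternary_root k, 1:])"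
    "inj_on (pair_diag m ternary_root :: nat \<Rightarrow> 'a) {..<2 * m}"
    "rsquarefree (symbol_poly m a)"
proof -
  let ?x = "ternary_root :: nat \<Rightarrow> 'a"
  define P where "P = (\<Prod>i<m. [:- ?x i, 1:] * [:- inverse (?x i), 1:])"
  have a_eq: "a s = (if \<bar>s\<bar> \<le> int m then coeff P (nat (s + int m)) else 0)" for s
    by (simp only: a_def ternary_param_def P_def)
  have deg: "degree P = 2 * m"
    unfolding P_def
    by (subst degree_prod_eq_sum_degree) (auto simp: degree_mult_eq simp del: mult_pCons_left mult_pCons_right)
  have lead: "lead_coeff P = 1"
    unfolding P_def
    by (subst lead_coeff_prod) (auto simp: lead_coeff_mult simp del: mult_pCons_left mult_pCons_right)
  \<comment> \<open>Each pair of factors multiplies to the palindromic z^2 - (x + 1/x) z + 1. This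
    yields the symmetry of the parameters.\<close>
  have "reflect_poly P = P"
    unfolding P_def reflect_poly_prod
  proof (rule prod.cong)
    fix i
    have x: "?x i \<noteq> 0" by (rule ternary_root_nonzero)
    have e: "[:- ?x i, 1:] * [:- inverse (?x i), 1:] = [:1, - ?x i - inverse (?x i), 1:]" using x by simp
    show "reflect_poly ([:- ?x i, 1:] * [:- inverse (?x i), 1:]) = [:- ?x i, 1:] * [:- inverse (?x i), 1:]"
      unfolding e by (simp add: reflect_poly_def)
  qed simp
  then have refl: "coeff P k = coeff P (2 * m - k)" if "k \<le> 2 * m" for k
    using coeff_reflect_poly[of P k] deg that by simp
  have sym: "a (- s) = a s" for s
  proof (cases "\<bar>s\<bar> \<le> int m")
    case True
    then have "nat (s + int m) = 2 * m - nat (- s + int m)" "nat (- s + int m) \<le> 2 * m" by auto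
    then show ?thesis using refl[of "nat (- s + int m)"] True by (simp add: a_eq)
  qed (simp add: a_eq)
  have am: "a (int m) = 1"
  proof -
    have "nat (int m + int m) = 2 * m" by simp
    then show ?thesis using lead deg by (simp add: a_eq)
  qed
  show a: "a \<in> sym_params m" using sym am by (simp add: sym_params_def) (simp add: a_eq)
  have q: "symbol_poly m a = P"
  proof (rule poly_eqI)
    fix k
    show "coeff (symbol_poly m a) k = coeff P k"
    proof (cases "k \<le> 2 * m")
      case True
      then show ?thesis by (auto simp: coeff_symbol_poly a_eq)
    next
      case False
      then show ?thesis using deg by (simp add: coeff_symbol_poly coeff_eq_0)
    qed
  qed
  then show rr: "reciprocal_roots m a ?x" by (simp only: reciprocal_roots_def am P_def smult_1_left)
  show q': "symbol_poly m a = Polynomial.smult 1 (\<Prod>k<2 * m. [:- pair_diag m ?x k, 1:])"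
    using symbol_poly_roots[OF rr] unfolding am .
  let ?e = "\<lambda>k. if k < m then 3 ^ k else - (3 ^ (k - m)) :: int"
  have pd: "pair_diag m ?x k = 2 powi ?e k" for k
    by (simp add: pair_diag_def ternary_root_def power_int_minus)
  show inj: "inj_on (pair_diag m ?x) {..<2 * m}"
  proof (rule inj_onI)
    fix k l assume kl: "k \<in> {..<2 * m}" "l \<in> {..<2 * m}" "pair_diag m ?x k = pair_diag m ?x l"
    then have e: "?e k = ?e l" unfolding pd by (rule_tac two_powi_inj)
    have pos: "(0 :: int) < 3 ^ j" for j :: nat by simp
    \<comment> \<open>Exponents of the roots are positive and those of their inverses
      negative.\<close>
    have "k < m \<longleftrightarrow> l < m"
      using e pos[of k] pos[of l] pos[of "k - m"] pos[of "l - m"] by (smt (verit))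
    then show "k = l" using e by (auto split: if_splits)
  qed
  show "rsquarefree (symbol_poly m a)"
    unfolding rsquarefree_roots
  proof (intro allI notI)
    fix z assume z: "poly (symbol_poly m a) z = 0 \<and> poly (pderiv (symbol_poly m a)) z = 0"
    then obtain k where k: "k < 2 * m" "z = pair_diag m ?x k" unfolding q' by (auto simp: poly_prod)
    let ?g = "\<Prod>l\<in>{..<2 * m} - {k}. [:- pair_diag m ?x l, 1:]"
    have "symbol_poly m a = [:- z, 1:] * ?g"
      unfolding q' k(2) using k(1) by (subst prod.remove[of _ k]) auto
    then have "poly (pderiv ([:- z, 1:] * ?g)) z = 0" using z by metis
    then have "poly ?g z = 0" unfolding pderiv_mult poly_add poly_mult by (simp add: pderiv_pCons)
    then obtain l where "l < 2 * m" "l \<noteq> k" "z = pair_diag m ?x l" by (auto simp: poly_prod)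
    then show False using inj k by (auto dest: inj_onD)
  qed
qed

lemma ternary_eigenvalues_distinct:
  "inj_on (transfer_eigenvalue m (ternary_param m) (ternary_root :: nat \<Rightarrow> 'a::field_char_0)) (sign_vectors m)"
proof (rule inj_onI)
  let ?a = "ternary_param m :: int \<Rightarrow> 'a" and ?x = "ternary_root :: nat \<Rightarrow> 'a"
  fix \<epsilon> \<delta>
  assume \<epsilon>: "\<epsilon> \<in> sign_vectors m" and \<delta>: "\<delta> \<in> sign_vectors m"
    and e: "transfer_eigenvalue m ?a ?x \<epsilon> = transfer_eigenvalue m ?a ?x \<delta>"
  have am: "?a (int m) \<noteq> 0" using ternary_param_properties(1)[of m, where 'a = 'a] by (simp add: sym_params_def)
  have powi: "(\<Prod>i<k. ?x i powi \<gamma> i) = 2 powi (\<Sum>i<k. \<gamma> i * 3 ^ i)" for \<gamma> k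
  proof (induction k)
    case (Suc k)
    have "?x k powi \<gamma> k = 2 powi (\<gamma> k * 3 ^ k)"
      by (simp add: ternary_root_def power_int_mult[symmetric] mult.commute)
    then show ?case using Suc by (simp add: power_int_add)
  qed simp
  have "(2 :: 'a) powi (\<Sum>i<m. \<epsilon> i * 3 ^ i) = 2 powi (\<Sum>i<m. \<delta> i * 3 ^ i)"
    using e am by (simp add: transfer_eigenvalue_def powi)
  then have s: "(\<Sum>i<m. \<epsilon> i * 3 ^ i) = (\<Sum>i<m. \<delta> i * 3 ^ i)" by (rule two_powi_inj)
  have "\<epsilon> i = \<delta> i" if "i < m" for i
  proof (rule balanced_ternary_inj[OF _ s that])
    fix j assume "j < m"
    then have "\<epsilon> j \<in> {- 1, 0, 1}" "\<delta> j \<in> {- 1, 0, 1}" using \<epsilon> \<delta> by (auto simp: sign_vectors_def)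
    then show "\<bar>\<epsilon> j\<bar> \<le> 1 \<and> \<bar>\<delta> j\<bar> \<le> 1" by auto
  qed
  then show "\<epsilon> = \<delta>" using \<epsilon> \<delta> unfolding sign_vectors_def by (intro PiE_ext) auto
qed

subsection \<open>Independence of the powers of the transfer\<close>

text \<open>The functionals come from a linear left inverse at one parameter point. They are kept
  fixed while the parameters vary, so that the test determinant built from them is
  polynomial.\<close>

lemma dual_functional_family:
  fixes u :: "nat \<Rightarrow> 'i \<Rightarrow> 'a::field"
  assumes indep: "\<And>b. (\<Sum>k<n. fscale (b k) (u k)) = 0 \<Longrightarrow> \<forall>k<n. b k = 0"
  obtains g :: "('i \<Rightarrow> 'a) \<Rightarrow> nat \<Rightarrow> 'a" where "flinear g" "\<And>k. k < n \<Longrightarrow> g (u k) = ind k"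
proof -
  let ?U = "\<lambda>b. \<Sum>k<n. fscale (b k) (u k)"
  let ?V = "coord_space {..<n} :: (nat \<Rightarrow> 'a) set"
  have U: "flinear ?U"
    by (rule flinearI)
      (simp_all add: pointwise fscale_apply fs.scale_left_distrib sum.distrib fs.scale_sum_right)
  have span: "fs.span ?V = ?V" using subspace_coord_space by (simp add: fs.span_eq_iff)
  have "inj_on ?U (fs.span ?V)"
    unfolding span
  proof (rule inj_onI)
    fix b b' assume b: "b \<in> ?V" "b' \<in> ?V" and "?U b = ?U b'"
    then have "?U (b - b') = 0" using flinear_diff[OF U, of b b'] by simp
    then have "\<forall>k<n. (b - b') k = 0" by (rule indep)
    then show "b = b'" using b by (auto simp: coord_space_def pointwise fun_eq_iff) (metis lessThan_iff)
  qed
  then obtain g where g: "flinear g" "\<forall>b\<in>?V. g (?U b) = b"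
    using fsp.linear_inj_on_left_inverse[OF U, of ?V] unfolding span by blast
  have "g (u k) = ind k" if k: "k < n" for k
  proof -
    have "?U (ind k) = (\<Sum>j<n. if j = k then u j else 0)"
      by (rule sum.cong) (auto simp: ind_def)
    then have "?U (ind k) = u k" using k by simp
    moreover have "ind k \<in> ?V" using k by (intro ind_in_coord_space) simp
    ultimately show ?thesis using g(2) by metis
  qed
  then show ?thesis using that g(1) by blast
qed

text \<open>The matrix of the k-th power, written as a vector indexed by pairs of standard pairs.
  Independence of powers becomes independence in a coordinate space.\<close>

definition transfer_power ::
  "nat \<Rightarrow> (nat set \<times> nat set \<Rightarrow> nat set \<times> nat set \<Rightarrow> 'a::field) \<Rightarrow> (int \<Rightarrow> 'a) \<Rightarrow> nat
     \<Rightarrow> (nat set \<times> nat set) \<times> (nat set \<times> nat set) \<Rightarrow> 'a" where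
  "transfer_power m c a k = (\<lambda>(q', q). if q' \<in> std_pairs m \<and> q \<in> std_pairs m
     then (sym_transfer m c a ^^ k) (ind q') q else 0)"

lemma transfer_power_combination:
  assumes p: "degree p \<le> n"
  shows "(\<Sum>k\<le>n. fscale (coeff p k) (transfer_power m c a k)) = 0 \<longleftrightarrow>
    annihilates p (sym_transfer m c a) (sym_state_space m)"
proof -
  let ?T = "sym_transfer m c a"
  have L: "flinear (op_poly p ?T)" by (rule flinear_op_poly[OF flinear_sym_transfer])
  have pow: "(?T ^^ k) w \<in> sym_state_space m" if "w \<in> sym_state_space m" for k w
    by (cases k) (simp_all add: that sym_transfer_in_sym_state_space)
  have space: "op_poly p ?T w \<in> sym_state_space m" if "w \<in> sym_state_space m" for w
    unfolding op_poly_def sym_state_space_def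
    by (intro fs.subspace_sum fs.subspace_scale subspace_coord_space)
      (use pow[OF that] in \<open>simp add: sym_state_space_def\<close>)
  have ind: "ind q \<in> sym_state_space m" if "q \<in> std_pairs m" for q
    using that unfolding sym_state_space_def by (rule ind_in_coord_space)
  have "annihilates p ?T (sym_state_space m) \<longleftrightarrow> (\<forall>q'\<in>std_pairs m. op_poly p ?T (ind q') = 0)"
  proof
    assume all: "\<forall>q'\<in>std_pairs m. op_poly p ?T (ind q') = 0"
    have "op_poly p ?T w = 0" if w: "w \<in> sym_state_space m" for w
    proof -
      have "op_poly p ?T w = op_poly p ?T (\<Sum>q\<in>std_pairs m. fscale (w q) (ind q))"
        using coord_space_expand[OF finite_std_pairs] w unfolding sym_state_space_def by metis
      also have "\<dots> = 0"
        unfolding flinear_sum[OF L] flinear_scale[OF L] using all by (intro sum.neutral) simp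
      finally show ?thesis .
    qed
    then show "annihilates p ?T (sym_state_space m)" by (simp add: annihilates_def)
  qed (use ind in \<open>auto simp: annihilates_def\<close>)
  also have "\<dots> \<longleftrightarrow> (\<forall>q'\<in>std_pairs m. \<forall>q\<in>std_pairs m. op_poly p ?T (ind q') q = 0)"
  proof (intro ball_cong refl iffI ballI)
    fix q' assume q': "q' \<in> std_pairs m" and 0: "\<forall>q\<in>std_pairs m. op_poly p ?T (ind q') q = 0"
    have "op_poly p ?T (ind q') q = 0" for q
      using space[OF ind[OF q']] 0 unfolding sym_state_space_def coord_space_def by blast
    then show "op_poly p ?T (ind q') = 0" by (intro ext) (simp add: pointwise)
  qed (simp add: pointwise)
  also have "\<dots> \<longleftrightarrow> (\<Sum>k\<le>n. fscale (coeff p k) (transfer_power m c a k)) = 0"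
  proof -
    let ?F = "\<Sum>k\<le>n. fscale (coeff p k) (transfer_power m c a k)"
    have val: "?F (q', q) = (if q' \<in> std_pairs m \<and> q \<in> std_pairs m then op_poly p ?T (ind q') q else 0)" for q' q
      by (auto simp: op_poly_bound[OF p] sum_fun_apply fscale_apply transfer_power_def)
    have "(\<forall>q'\<in>std_pairs m. \<forall>q\<in>std_pairs m. op_poly p ?T (ind q') q = 0) \<longleftrightarrow> (\<forall>q' q. ?F (q', q) = 0)"
      unfolding val if_split[of "\<lambda>x. x = 0"] by blast
    also have "\<dots> \<longleftrightarrow> ?F = 0" unfolding fun_eq_iff zero_fun_apply by (metis surj_pair)
    finally show ?thesis .
  qed
  finally show ?thesis by blast
qed

lemma transfer_power_poly_function: "(\<lambda>a. transfer_power m c a k y) \<in> poly_functions"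
proof -
  have "(\<lambda>a. (sym_transfer m c a ^^ k) w q) \<in> poly_functions" for w q
    by (induction k arbitrary: q) (simp_all add: poly_functions.const poly_functions_sym_transfer)
  then show ?thesis
    by (cases y; cases "fst y \<in> std_pairs m \<and> snd y \<in> std_pairs m")
      (auto simp: transfer_power_def poly_functions.const)
qed

lemma generic_min_poly_degree:
  fixes c :: "nat set \<times> nat set \<Rightarrow> nat set \<times> nat set \<Rightarrow> 'a::field_char_0"
  assumes c: "catalan_straightening m c"
  obtains U where "zariski_open (sym_params m) U" "U \<noteq> {}"
    "\<And>a. a \<in> U \<Longrightarrow> degree (min_poly (sym_transfer m c a) (sym_state_space m)) = card (parity_weights m)"
proof -
  let ?d = "card (parity_weights m)" and ?X = "std_pairs m \<times> std_pairs m"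
  let ?a = "ternary_param m :: int \<Rightarrow> 'a" and ?x = "ternary_root :: nat \<Rightarrow> 'a"
  note tern = ternary_param_properties[of m, where 'a = 'a]
  \<comment> \<open>At the special point the eigenvalues of the parity weights are distinct, and an
    annihilator vanishes at all of them.\<close>
  have low: "p = 0" if "annihilates p (sym_transfer m c ?a) (sym_state_space m)" "degree p < ?d" for p
  proof (rule ccontr)
    assume p: "p \<noteq> 0"
    have inj: "inj_on (transfer_eigenvalue m ?a ?x) (parity_weights m)"
      by (rule inj_on_subset[OF ternary_eigenvalues_distinct]) (auto simp: parity_weights_def)
    have "transfer_eigenvalue m ?a ?x ` parity_weights m \<subseteq> {z. poly p z = 0}"
      using that(1) unfolding annihilates_sym_transfer_iff[OF c tern(1,5,2)] by auto
    then have "card (transfer_eigenvalue m ?a ?x ` parity_weights m) \<le> degree p"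
      using card_mono[OF poly_roots_finite[OF p]] card_poly_roots_bound[OF p] by (meson order_trans)
    then show False using that(2) by (simp add: card_image[OF inj])
  qed
  \<comment> \<open>Allows passing between sums below \<open>?d\<close> and sums up to
    \<open>?d - 1\<close>, the form used for polynomials of bounded degree.\<close>
  have d: "?d \<noteq> 0"
  proof -
    have "odd ((3 :: nat) ^ m)" by simp
    then show ?thesis
      using card_parity_sign_vectors[of m] unfolding parity_weights_def by (auto elim!: oddE)
  qed
  have shift: "(\<Sum>k<?d. f k) = (\<Sum>k\<le>?d - 1. f k)" for f :: "nat \<Rightarrow> 'b::comm_monoid_add"
    using d by (intro sum.cong) auto
  have comb: "(\<Sum>k<?d. fscale (coeff p k) (transfer_power m c a k)) = 0 \<longleftrightarrow>
      annihilates p (sym_transfer m c a) (sym_state_space m)" if "degree p < ?d" for p a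
    unfolding shift using that by (intro transfer_power_combination) simp
  have indep: "\<forall>k<?d. b k = 0" if "(\<Sum>k<?d. fscale (b k) (transfer_power m c ?a k)) = 0" for b
  proof -
    define p where "p = (\<Sum>k<?d. Polynomial.monom (b k) k)"
    have cp: "coeff p k = (if k < ?d then b k else 0)" for k by (simp add: p_def coeff_sum)
    have "degree p \<le> ?d - 1" by (rule degree_le) (auto simp: cp)
    then have deg: "degree p < ?d" using d by simp
    have "(\<Sum>k<?d. fscale (coeff p k) (transfer_power m c ?a k)) = 0" using that by (simp add: cp)
    then have "p = 0" using comb[OF deg] low deg by blast
    then show ?thesis using cp by (metis coeff_0)
  qed
  obtain g :: "((nat set \<times> nat set) \<times> (nat set \<times> nat set) \<Rightarrow> 'a) \<Rightarrow> nat \<Rightarrow> 'a"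
    where g: "flinear g" "\<And>k. k < ?d \<Longrightarrow> g (transfer_power m c ?a k) = ind k"
    using dual_functional_family[OF indep] by blast
  have expand: "g (transfer_power m c a k) j = (\<Sum>y\<in>?X. transfer_power m c a k y * g (ind y) j)" for a k j
  proof -
    have "transfer_power m c a k \<in> coord_space ?X"
      by (auto simp: coord_space_def transfer_power_def)
    then have "transfer_power m c a k = (\<Sum>y\<in>?X. fscale (transfer_power m c a k y) (ind y))"
      by (intro coord_space_expand finite_cartesian_product finite_std_pairs)
    then have "g (transfer_power m c a k) = (\<Sum>y\<in>?X. fscale (transfer_power m c a k y) (g (ind y)))"
      by (metis (no_types, lifting) flinear_sum[OF g(1)] flinear_scale[OF g(1)] sum.cong)
    then show ?thesis by (simp add: sum_fun_apply fscale_apply)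
  qed
  \<comment> \<open>The powers at \<open>a\<close> in the functionals dual to the powers at the
    special point, where the matrix is the identity. A nonzero determinant makes the powers at
    \<open>a\<close> independent.\<close>
  define K where "K a = mat ?d ?d (\<lambda>(j, k). g (transfer_power m c a k) j)" for a
  have "(\<lambda>a. det (mat ?d ?d (\<lambda>(j, k). g (transfer_power m c a k) j))) \<in> poly_functions"
    unfolding expand
    by (intro poly_functions_det poly_functions_sum poly_functions.mult transfer_power_poly_function
        poly_functions.const)
  then have KP: "(\<lambda>a. det (K a)) \<in> poly_functions" unfolding K_def .
  have "K ?a = 1\<^sub>m ?d" by (rule eq_matI) (auto simp: K_def g(2) ind_def)
  then have K1: "det (K ?a) = 1" by simp
  have lower: "?d \<le> degree p"
    if K: "det (K a) \<noteq> 0" and p: "annihilates p (sym_transfer m c a) (sym_state_space m)" "p \<noteq> 0" for a p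
  proof (rule ccontr)
    assume "\<not> ?d \<le> degree p"
    then have deg: "degree p < ?d" by simp
    have 0: "(\<Sum>k<?d. fscale (coeff p k) (transfer_power m c a k)) = 0" using comb[OF deg] p(1) by blast
    have "K a *\<^sub>v vec ?d (coeff p) = 0\<^sub>v ?d"
    proof (rule eq_vecI)
      fix j assume "j < dim_vec (0\<^sub>v ?d :: 'a vec)"
      then have j: "j < ?d" by simp
      have "(K a *\<^sub>v vec ?d (coeff p)) $ j = (\<Sum>k<?d. g (transfer_power m c a k) j * coeff p k)"
        using j by (simp add: K_def scalar_prod_def lessThan_atLeast0)
      also have "\<dots> = g (\<Sum>k<?d. fscale (coeff p k) (transfer_power m c a k)) j"
        unfolding flinear_sum[OF g(1)] flinear_scale[OF g(1)]
        by (simp add: sum_fun_apply fscale_apply mult.commute)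
      also have "\<dots> = 0" unfolding 0 flinear_0[OF g(1)] by (simp add: pointwise)
      finally show "(K a *\<^sub>v vec ?d (coeff p)) $ j = 0\<^sub>v ?d $ j" using j by simp
    qed (simp add: K_def)
    moreover have "vec ?d (coeff p) \<noteq> 0\<^sub>v ?d"
    proof
      assume "vec ?d (coeff p) = 0\<^sub>v ?d"
      then have "vec ?d (coeff p) $ degree p = 0\<^sub>v ?d $ degree p" by simp
      then show False using deg p(2) by simp
    qed
    moreover have "K a \<in> carrier_mat ?d ?d" by (simp add: K_def)
    ultimately show False using det_0_iff_vec_prod_zero_field K by (metis vec_carrier)
  qed
  \<comment> \<open>The first factor ensures simple roots and thereby the upper bound on the degree,
    the second ensures the lower bound.\<close>
  let ?P = "\<lambda>a. discriminant m a * det (K a)"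
  define U where "U = {a \<in> sym_params m. ?P a \<noteq> 0}"
  have "?P \<in> poly_functions" by (intro poly_functions.mult KP discriminant_poly_function)
  then have "zariski_open (sym_params m) U"
    unfolding zariski_open_def U_def by (intro exI[of _ "{?P}"]) auto
  moreover have "?a \<in> U"
    unfolding U_def using K1 discriminant_nonzero[OF tern(1,3,4,5)] tern(1) by simp
  moreover have "degree (min_poly (sym_transfer m c a) (sym_state_space m)) = ?d" if "a \<in> U" for a
  proof -
    have a: "a \<in> sym_params m" "discriminant m a \<noteq> 0" "det (K a) \<noteq> 0" using that by (auto simp: U_def)
    obtain p where p: "annihilates p (sym_transfer m c a) (sym_state_space m)" "p \<noteq> 0" "degree p \<le> ?d"
      by (rule sym_transfer_annihilator[OF c a(1) rsquarefree_if_discriminant[OF a(1,2)]])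
    note min = min_poly_properties[OF flinear_sym_transfer p(1,2)]
    have "min_poly (sym_transfer m c a) (sym_state_space m) \<noteq> 0" using min(1) by auto
    then show ?thesis
      using lower[OF a(3) min(2)] degree_min_poly_le[OF flinear_sym_transfer p(1,2)] p(3) by simp
  qed
  ultimately show ?thesis using that by blast
qed

section \<open>Realization of the primitive module\<close>

definition basis_mat :: "nat \<Rightarrow> (nat \<Rightarrow> 'a::field vec) \<Rightarrow> (nat \<Rightarrow> 'a vec) \<Rightarrow> 'a mat" where
  "basis_mat m e f = mat (2 * m) (2 * m) (\<lambda>(i, k). (if k < m then e k else f (k - m)) $ i)"

lemma fw_map_cong:
  assumes "\<And>k i. k \<in> set ks \<Longrightarrow> i < n \<Longrightarrow> u k i = v k i"
  shows "fw n (map u ks) = fw n (map v ks)"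
  using assms by (induction ks) (simp_all add: crv_def)

lemma C_q_carrier:
  assumes "a \<in> sym_params m"
  shows "C_q m a \<in> carrier_mat (2 * m) (2 * m)"
proof -
  have "inverse (a (int m)) \<noteq> 0" using assms by (simp add: sym_params_def)
  then have "degree (Polynomial.smult (inverse (a (int m))) (symbol_poly m a)) = 2 * m"
    using degree_symbol_poly[OF assms] by simp
  then show ?thesis by (simp add: C_q_def frobenius_companion_def)
qed

context
  fixes m :: nat and a :: "int \<Rightarrow> 'a::field_char_0" and x e f G
  assumes a: "a \<in> sym_params m" and basis: "symplectic_eigenbasis m (C_q m a) x e f G"
begin

lemma form_alternating: "alternating (2 * m) G"
  using basis unfolding symplectic_eigenbasis_def alternating_def by blast

lemma form_carrier: "G \<in> carrier_mat (2 * m) (2 * m)"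
  using form_alternating unfolding alternating_def by blast

lemma basis_eigenvectors:
  assumes "i < m"
  shows "eigenvector (C_q m a) (e i) (x i)" "eigenvector (C_q m a) (f i) (inverse (x i))"
  using basis assms unfolding symplectic_eigenbasis_def by blast+

lemma basis_pairings:
  assumes "i < m" "j < m"
  shows "e i \<bullet> (G *\<^sub>v f j) = (if i = j then 1 else 0)" "e i \<bullet> (G *\<^sub>v e j) = 0" "f i \<bullet> (G *\<^sub>v f j) = 0"
  using basis assms unfolding symplectic_eigenbasis_def by blast+

lemma basis_vec_carrier:
  assumes "k < 2 * m"
  shows "(if k < m then e k else f (k - m)) \<in> carrier_vec (2 * m)"
proof -
  have "e i \<in> carrier_vec (2 * m) \<and> f i \<in> carrier_vec (2 * m)" if "i < m" for i
    using basis_eigenvectors[OF that] C_q_carrier[OF a] by (auto simp: eigenvector_def)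
  then show ?thesis using assms by auto
qed

lemma basis_mat_carrier: "basis_mat m e f \<in> carrier_mat (2 * m) (2 * m)"
  by (simp add: basis_mat_def)

lemma col_basis_mat: "k < 2 * m \<Longrightarrow> col (basis_mat m e f) k = (if k < m then e k else f (k - m))"
  using basis_vec_carrier[of k] by (intro eq_vecI) (auto simp: basis_mat_def)

lemma companion_basis_mat:
  "C_q m a * basis_mat m e f = basis_mat m e f * diag_mat_of (2 * m) (pair_diag m x)"
proof (rule eq_matI)
  let ?g = "basis_mat m e f" and ?D = "diag_mat_of (2 * m) (pair_diag m x)"
  fix i k assume "i < dim_row (?g * ?D)" "k < dim_col (?g * ?D)"
  then have ik: "i < 2 * m" "k < 2 * m" by (auto simp: basis_mat_def)
  let ?v = "if k < m then e k else f (k - m)"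
  have eig: "C_q m a *\<^sub>v ?v = pair_diag m x k \<cdot>\<^sub>v ?v"
    using basis_eigenvectors[of k] basis_eigenvectors[of "k - m"] ik(2)
    by (auto simp: eigenvector_def pair_diag_def)
  have "(C_q m a * ?g) $$ (i, k) = (C_q m a *\<^sub>v col ?g k) $ i"
    using ik C_q_carrier[OF a] basis_mat_carrier by simp
  also have "\<dots> = pair_diag m x k * ?v $ i"
    unfolding col_basis_mat[OF ik(2)] eig using basis_vec_carrier[OF ik(2)] ik(1) by simp
  also have "\<dots> = (\<Sum>j<2 * m. if j = k then ?g $$ (i, k) * pair_diag m x k else 0)"
    using ik by (simp add: basis_mat_def mult.commute)
  also have "\<dots> = (\<Sum>j<2 * m. ?g $$ (i, j) * ?D $$ (j, k))"
    using ik by (intro sum.cong) auto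
  also have "\<dots> = (?g * ?D) $$ (i, k)"
    using ik basis_mat_carrier by (simp add: scalar_prod_def lessThan_atLeast0)
  finally show "(C_q m a * ?g) $$ (i, k) = (?g * ?D) $$ (i, k)" .
qed (use C_q_carrier[OF a] in \<open>auto simp: basis_mat_def\<close>)

text \<open>The pairing relations say that the form is standard in the given basis. They list e with
  f only, so the block of f with e is supplied by antisymmetry.\<close>

lemma gram_basis_mat: "transpose_mat (basis_mat m e f) * G * basis_mat m e f = std_form m"
proof (rule eq_matI)
  let ?g = "basis_mat m e f" and ?v = "\<lambda>k. if k < m then e k else f (k - m)"
  note G = form_carrier
  fix k l assume "k < dim_row (std_form m :: 'a mat)" "l < dim_col (std_form m :: 'a mat)"
  then have kl: "k < 2 * m" "l < 2 * m" by (auto simp: std_form_def)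
  have "(transpose_mat ?g * G * ?g) $$ (k, l) = (transpose_mat ?g * (G * ?g)) $$ (k, l)"
    using G basis_mat_carrier by (simp add: assoc_mult_mat[of _ "2 * m" "2 * m" _ "2 * m" _ "2 * m"])
  also have "\<dots> = ?v k \<bullet> (G *\<^sub>v ?v l)"
  proof -
    have "(transpose_mat ?g * (G * ?g)) $$ (k, l) = row (transpose_mat ?g) k \<bullet> col (G * ?g) l"
      using kl G basis_mat_carrier by (intro index_mult_mat(1)) auto
    also have "row (transpose_mat ?g) k = col ?g k" using kl basis_mat_carrier by (intro row_transpose) auto
    also have "col (G * ?g) l = G *\<^sub>v col ?g l" by (rule col_mult2[OF G basis_mat_carrier kl(2)])
    finally show ?thesis by (simp only: col_basis_mat[OF kl(1)] col_basis_mat[OF kl(2)])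
  qed
  also have "\<dots> = std_form m $$ (k, l)"
  proof -
    note pair = basis_pairings
    have swap: "u \<bullet> (G *\<^sub>v w) = - (w \<bullet> (G *\<^sub>v u))"
      if u: "u \<in> carrier_vec (2 * m)" and w: "w \<in> carrier_vec (2 * m)" for u w
    proof -
      have expand: "u \<bullet> (G *\<^sub>v w) = (\<Sum>i<2 * m. \<Sum>j<2 * m. u $ i * G $$ (i, j) * w $ j)"
        if "u \<in> carrier_vec (2 * m)" "w \<in> carrier_vec (2 * m)" for u w
        using that G by (simp add: scalar_prod_def lessThan_atLeast0 sum_distrib_left mult.assoc)
      have "u \<bullet> (G *\<^sub>v w) = (\<Sum>j<2 * m. \<Sum>i<2 * m. u $ i * G $$ (i, j) * w $ j)"
        unfolding expand[OF u w] by (rule sum.swap)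
      also have "\<dots> = (\<Sum>j<2 * m. \<Sum>i<2 * m. - (w $ j * G $$ (j, i) * u $ i))"
      proof (rule sum.cong, rule refl, rule sum.cong, rule refl)
        fix i j assume "j \<in> {..<2 * m}" "i \<in> {..<2 * m}"
        then have "G $$ (j, i) = - G $$ (i, j)"
          using form_alternating unfolding alternating_def by blast
        then show "u $ i * G $$ (i, j) * w $ j = - (w $ j * G $$ (j, i) * u $ i)"
          by (simp only: mult_minus_left mult_minus_right minus_minus) (simp only: mult_ac)
      qed
      also have "\<dots> = - (w \<bullet> (G *\<^sub>v u))" unfolding expand[OF w u] by (simp only: sum_negf)
      finally show ?thesis .
    qed
    consider "k < m" "l < m" | "k < m" "\<not> l < m" | "\<not> k < m" "l < m" | "\<not> k < m" "\<not> l < m" by blast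
    then show ?thesis
    proof cases
      case 1
      then show ?thesis using kl pair(2)[of k l] by (simp add: std_form_def)
    next
      case 2
      then have "l = m + k \<longleftrightarrow> k = l - m" by auto
      then show ?thesis using 2 kl pair(1)[of k "l - m"] by (auto simp: std_form_def)
    next
      case 3
      then have "f (k - m) \<bullet> (G *\<^sub>v e l) = - (e l \<bullet> (G *\<^sub>v f (k - m)))"
        using basis_vec_carrier[OF kl(1)] basis_vec_carrier[OF kl(2)] by (intro swap) auto
      moreover have "k = m + l \<longleftrightarrow> l = k - m" using 3 by auto
      ultimately show ?thesis using 3 kl pair(1)[of l "k - m"] by (auto simp: std_form_def)
    next
      case 4
      then show ?thesis using kl pair(3)[of "k - m" "l - m"] by (simp add: std_form_def)
    qed
  qed
  finally show "(transpose_mat ?g * G * ?g) $$ (k, l) = std_form m $$ (k, l)" .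
qed (auto simp: basis_mat_def std_form_def)

lemma basis_mat_inverse:
  obtains h where "h \<in> carrier_mat (2 * m) (2 * m)" "basis_mat m e f * h = 1\<^sub>m (2 * m)"
    "h * basis_mat m e f = 1\<^sub>m (2 * m)"
  by (rule symplectic_invertible[OF basis_mat_carrier form_carrier gram_basis_mat])

text \<open>From coordinates in the given eigenbasis of C_q to standard ones; it takes the primitive
  module of the standard form to that of \<open>G\<close>.\<close>

abbreviation eigen_ext :: "(nat set \<Rightarrow> 'a) \<Rightarrow> nat set \<Rightarrow> 'a" where
  "eigen_ext \<equiv> ext (2 * m) (basis_mat m e f)"

lemma bij_betw_eigen_ext: "bij_betw eigen_ext (ext_power (2 * m) m) (ext_power (2 * m) m)"
  by (rule basis_mat_inverse) (rule bij_betw_ext[OF basis_mat_carrier])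

lemma bij_betw_eigen_ext_primitive:
  "bij_betw eigen_ext (primitive_module m (std_form m)) (primitive_module m G)"
  by (rule basis_mat_inverse)
    (use bij_betw_ext_primitive[OF basis_mat_carrier _ _ _ form_alternating] gram_basis_mat in auto)

lemma compound_transfer_eigen_ext:
  assumes \<omega>: "\<omega> \<in> ext_power (2 * m) m"
  shows "compound_transfer m a (eigen_ext \<omega>) =
    fscale ((- 1) ^ m * a (int m)) (eigen_ext (diag_op (pair_diag m x) \<omega>))"
proof -
  let ?D = "diag_mat_of (2 * m) (pair_diag m x)"
  have fock: "\<omega> \<in> fock (2 * m)" by (rule ext_power_fock[OF \<omega>])
  have "compound (2 * m) m (C_q m a) (eigen_ext \<omega>) = ext (2 * m) (C_q m a) (eigen_ext \<omega>)"
    by (rule compound_eq_ext[OF C_q_carrier[OF a] ext_degree[OF \<omega>]])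
  also have "\<dots> = ext (2 * m) (basis_mat m e f * ?D) \<omega>"
    unfolding companion_basis_mat[symmetric]
    by (rule ext_mult[OF C_q_carrier[OF a] basis_mat_carrier fock, symmetric])
  also have "\<dots> = eigen_ext (diag_op (pair_diag m x) \<omega>)"
    unfolding ext_mult[OF basis_mat_carrier mat_carrier fock] ext_diag[OF fock] ..
  finally show ?thesis by (simp add: compound_transfer_def)
qed

lemma basis_wedge_eq_eigen_ext:
  assumes B: "B \<in> ksubsets (2 * m) m"
  shows "basis_wedge m e f B = eigen_ext (ind B)"
proof -
  let ?v = "\<lambda>k. if k < m then e k else f (k - m)"
  have sub: "B \<subseteq> {..<2 * m}" "finite B" using B finite_subset by (auto simp: ksubsets_def)
  have "basis_wedge m e f B = fw (2 * m) (map (\<lambda>v i. v $ i) (map ?v (sorted_list_of_set B)))"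
    unfolding basis_wedge_def
  proof (rule wedge_eq_fw)
    fix v assume "v \<in> set (map ?v (sorted_list_of_set B))"
    then obtain k where "k \<in> B" "v = ?v k" using sub(2) by auto
    then show "v \<in> carrier_vec (2 * m)" using basis_vec_carrier[of k] sub(1) by auto
  qed
  also have "\<dots> = eb (2 * m) (basis_mat m e f) B"
    unfolding eb_def map_map
  proof (rule fw_map_cong)
    fix k i assume "k \<in> set (sorted_list_of_set B)" "i < 2 * m"
    then show "((\<lambda>v i. v $ i) \<circ> ?v) k i = basis_mat m e f $$ (i, k)"
      using sub by (auto simp: basis_mat_def)
  qed
  also have "\<dots> = eigen_ext (ind B)" by (rule ext_ind[OF sub(1), symmetric])
  finally show ?thesis .
qed

text \<open>Basis wedges are images of unit vectors, so their span is the image of a coordinate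
  space. Injectivity lets the image commute with the intersection with the primitive module.\<close>

lemma primitive_weight_space_eq:
  "primitive_weight_space m e f G \<epsilon> = eigen_ext ` std_weight_space m \<epsilon>"
proof -
  let ?ws = "weight_sets m \<epsilon> m" and ?P = "primitive_module m (std_form m) :: (nat set \<Rightarrow> 'a) set"
  have ws: "?ws = {B. B \<in> ksubsets (2 * m) m \<and> wedge_weight m B = \<epsilon>}"
    by (auto simp: graded_def ksubsets_def)
  have span: "fs.span (ind ` ?ws) = (coord_space ?ws :: (nat set \<Rightarrow> 'a) set)"
  proof
    show "fs.span (ind ` ?ws) \<subseteq> (coord_space ?ws :: (nat set \<Rightarrow> 'a) set)"
      by (rule fs.span_minimal) (auto simp: subspace_coord_space intro: ind_in_coord_space)
    show "coord_space ?ws \<subseteq> (fs.span (ind ` ?ws) :: (nat set \<Rightarrow> 'a) set)"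
    proof
      fix v :: "nat set \<Rightarrow> 'a" assume "v \<in> coord_space ?ws"
      then have "v = (\<Sum>S\<in>?ws. fscale (v S) (ind S))" by (rule coord_space_expand[OF finite_graded])
      also have "\<dots> \<in> fs.span (ind ` ?ws)"
        by (intro fs.span_sum fs.span_scale fs.span_base imageI)
      finally show "v \<in> fs.span (ind ` ?ws)" .
    qed
  qed
  have "{basis_wedge m e f B | B. B \<in> ksubsets (2 * m) m \<and> wedge_weight m B = \<epsilon>} = basis_wedge m e f ` ?ws"
    unfolding ws by blast
  also have "\<dots> = (\<lambda>B. eigen_ext (ind B)) ` ?ws"
    by (rule image_cong) (simp_all add: ws basis_wedge_eq_eigen_ext)
  also have "\<dots> = eigen_ext ` ind ` ?ws" by (simp only: image_image)
  finally have "fs.span {basis_wedge m e f B | B. B \<in> ksubsets (2 * m) m \<and> wedge_weight m B = \<epsilon>} =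
      eigen_ext ` coord_space ?ws"
    using fsp.linear_span_image[OF flinear_ext[of "2 * m" "basis_mat m e f"], of "ind ` ?ws"]
    by (simp add: span)
  then have "primitive_weight_space m e f G \<epsilon> = eigen_ext ` ?P \<inter> eigen_ext ` coord_space ?ws"
    unfolding primitive_weight_space_def bij_betw_imp_surj_on[OF bij_betw_eigen_ext_primitive] by simp
  also have "\<dots> = eigen_ext ` (?P \<inter> coord_space ?ws)"
  proof (rule inj_on_image_Int[symmetric])
    show "inj_on eigen_ext (ext_power (2 * m) m)" using bij_betw_eigen_ext by (rule bij_betw_imp_inj_on)
    show "?P \<subseteq> ext_power (2 * m) m" by (auto simp: primitive_module_def)
    show "coord_space ?ws \<subseteq> (ext_power (2 * m) m :: (nat set \<Rightarrow> 'a) set)"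
      using graded_ksubsets by (auto simp: ext_power_def)
  qed
  also have "?P \<inter> coord_space ?ws = std_weight_space m \<epsilon>"
    using graded_ksubsets by (auto simp: std_weight_space_def primitive_module_alt ext_power_def)
  finally show ?thesis .
qed

lemma inj_on_eigen_ext: "inj_on eigen_ext (std_weight_space m \<epsilon>)"
  using bij_betw_imp_inj_on[OF bij_betw_eigen_ext_primitive] std_weight_space_subset
  by (rule inj_on_subset)

lemma span_primitive_weight_spaces:
  "fs.span (\<Union>\<epsilon>\<in>sign_vectors m. primitive_weight_space m e f G \<epsilon>) = primitive_module m G"
proof
  show "fs.span (\<Union>\<epsilon>\<in>sign_vectors m. primitive_weight_space m e f G \<epsilon>) \<subseteq> primitive_module m G"
    by (rule fs.span_minimal) (auto simp: primitive_weight_space_def subspace_primitive_module)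
  show "primitive_module m G \<subseteq> fs.span (\<Union>\<epsilon>\<in>sign_vectors m. primitive_weight_space m e f G \<epsilon>)"
  proof
    fix \<omega> assume "\<omega> \<in> primitive_module m G"
    then obtain \<eta> where \<eta>: "\<eta> \<in> primitive_module m (std_form m)" "\<omega> = eigen_ext \<eta>"
      using bij_betw_imp_surj_on[OF bij_betw_eigen_ext_primitive] by blast
    have "\<omega> = eigen_ext (\<Sum>\<epsilon>\<in>sign_vectors m. weight_part m \<epsilon> \<eta>)"
      by (simp only: sum_weight_part \<eta>(2))
    also have "\<dots> = (\<Sum>\<epsilon>\<in>sign_vectors m. eigen_ext (weight_part m \<epsilon> \<eta>))"
      by (rule flinear_sum[OF flinear_ext])
    also have "\<dots> \<in> fs.span (\<Union>\<epsilon>\<in>sign_vectors m. primitive_weight_space m e f G \<epsilon>)"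
      using weight_part_in_std_weight_space[OF \<eta>(1)]
      by (intro fs.span_sum fs.span_base) (auto simp: primitive_weight_space_eq)
    finally show "\<omega> \<in> fs.span (\<Union>\<epsilon>\<in>sign_vectors m. primitive_weight_space m e f G \<epsilon>)" .
  qed
qed

lemma primitive_weight_space_nontrivial:
  assumes "\<epsilon> \<in> sign_vectors m"
  shows "primitive_weight_space m e f G \<epsilon> \<noteq> {0} \<longleftrightarrow> support_size m \<epsilon> mod 2 = m mod 2"
proof -
  have 0: "(0 :: nat set \<Rightarrow> 'a) \<in> std_weight_space m \<epsilon>" using subspace_std_weight_space by (rule fs.subspace_0)
  have "eigen_ext ` std_weight_space m \<epsilon> = {0} \<longleftrightarrow> std_weight_space m \<epsilon> = {0 :: nat set \<Rightarrow> 'a}"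
  proof
    assume img: "eigen_ext ` std_weight_space m \<epsilon> = {0}"
    have "\<omega> = 0" if \<omega>: "\<omega> \<in> std_weight_space m \<epsilon>" for \<omega> :: "nat set \<Rightarrow> 'a"
    proof -
      have "eigen_ext \<omega> \<in> {0}" unfolding img[symmetric] using \<omega> by (rule imageI)
      moreover have "eigen_ext 0 = 0" by (rule flinear_0[OF flinear_ext])
      ultimately have "eigen_ext \<omega> = eigen_ext 0" by simp
      then show ?thesis by (rule inj_onD[OF inj_on_eigen_ext _ \<omega> 0])
    qed
    with 0 show "std_weight_space m \<epsilon> = {0 :: nat set \<Rightarrow> 'a}" by blast
  qed (simp add: flinear_0[OF flinear_ext])
  then show ?thesis
    using std_weight_space_nontrivial[OF assms, where 'a = 'a] by (simp add: primitive_weight_space_eq)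
qed

lemma dim_primitive_weight_space:
  assumes "\<epsilon> \<in> sign_vectors m" "m - support_size m \<epsilon> = 2 * r"
  shows "fs.dim (primitive_weight_space m e f G \<epsilon>) = catalan r"
  unfolding primitive_weight_space_eq
    dim_image[OF subspace_std_weight_space flinear_ext inj_on_eigen_ext]
  by (rule dim_std_weight_space[OF assms])

lemma compound_transfer_primitive_weight_space:
  assumes r: "reciprocal_roots m a x" and \<omega>: "\<omega> \<in> primitive_weight_space m e f G \<epsilon>"
  shows "compound_transfer m a \<omega> = fscale (transfer_eigenvalue m a x \<epsilon>) \<omega>"
proof -
  obtain \<eta> where \<eta>: "\<eta> \<in> std_weight_space m \<epsilon>" "\<omega> = eigen_ext \<eta>"
    using \<omega> by (auto simp: primitive_weight_space_eq)
  have ext: "\<eta> \<in> ext_power (2 * m) m"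
    using \<eta>(1) std_weight_space_subset by (auto simp: primitive_module_def)
  have x: "x i \<noteq> 0" if "i < m" for i by (rule reciprocal_roots_nonzero[OF a r that])
  have "diag_op (pair_diag m x) \<eta> = fscale (\<Prod>i<m. x i powi \<epsilon> i) \<eta>"
  proof
    fix S
    show "diag_op (pair_diag m x) \<eta> S = fscale (\<Prod>i<m. x i powi \<epsilon> i) \<eta> S"
    proof (cases "S \<in> weight_sets m \<epsilon> m")
      case True
      then have "S \<subseteq> {..<2 * m}" "wedge_weight m S = \<epsilon>" by (auto simp: graded_def)
      then show ?thesis using prod_pair_diag[OF _ x, of S m] by (simp add: diag_op_def fscale_def)
    next
      case False
      then have "\<eta> S = 0" using \<eta>(1) by (simp add: std_weight_space_def coord_space_def)
      then show ?thesis by (simp add: diag_op_def fscale_def)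
    qed
  qed
  then show ?thesis
    unfolding \<eta>(2) compound_transfer_eigen_ext[OF ext] transfer_eigenvalue_def
    by (simp add: flinear_scale[OF flinear_ext])
qed

lemma primitive_realization:
  assumes c: "catalan_straightening m c"
    and sf: "rsquarefree (symbol_poly m a)" and r: "reciprocal_roots m a x"
  shows "\<exists>\<Phi>. Vector_Spaces.linear fscale fscale \<Phi> \<and>
    bij_betw \<Phi> (coord_space (boundary_pairs m)) (ext_power (2 * m) m) \<and>
    (\<forall>v\<in>coord_space (boundary_pairs m).
       \<Phi> (laplace_transfer m a v) = compound_transfer m a (\<Phi> v)) \<and>
    bij_betw (\<lambda>w. \<Phi> (straighten m c w)) (sym_state_space m) (primitive_module m G) \<and>
    (\<forall>w\<in>sym_state_space m.
       \<Phi> (straighten m c (sym_transfer m c a w)) =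
         compound_transfer m a (\<Phi> (straighten m c w)))"
proof -
  obtain A where A: "A \<in> carrier_mat (2 * m) (2 * m)" "transpose_mat A * std_form m * A = std_form m"
    and MA: "transfer_mat m a * A = A * diag_mat_of (2 * m) (pair_diag m x)"
    by (rule transfer_mat_diagonalization[OF a sf r])
  obtain B where B: "B \<in> carrier_mat (2 * m) (2 * m)" "A * B = 1\<^sub>m (2 * m)" "B * A = 1\<^sub>m (2 * m)"
    by (rule symplectic_invertible[OF A(1) _ A(2)]) (simp add: std_form_def)
  \<comment> \<open>Into eigencoordinates of M and out again along the eigenbasis of C_q. On the
    coordinates in between, both transfers are the same diagonal operator.\<close>
  define \<Phi> where "\<Phi> v = eigen_ext (ext (2 * m) B (psi m v))" for v :: "nat set \<times> nat set \<Rightarrow> 'a"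
  have lin: "flinear \<Phi>"
    unfolding \<Phi>_def by (rule flinear_comp[OF flinear_ext flinear_comp[OF flinear_ext flinear_psi]])
  have bij: "bij_betw \<Phi> (coord_space (boundary_pairs m)) (ext_power (2 * m) m)"
    using bij_betw_trans[OF bij_betw_trans[OF bij_betw_psi bij_betw_ext[OF B(1) A(1) B(3,2)]] bij_betw_eigen_ext]
    by (simp add: o_def \<Phi>_def[abs_def])
  have intertwine: "\<Phi> (laplace_transfer m a v) = compound_transfer m a (\<Phi> v)" for v
    unfolding \<Phi>_def laplace_transfer_eigen_coordinates[OF a A(1) B MA]
      compound_transfer_eigen_ext[OF ext_degree[OF psi_ext_power]]
    by (rule flinear_scale[OF flinear_ext])
  have "bij_betw (\<lambda>w. \<Phi> (straighten m c w)) (sym_state_space m) (primitive_module m G)"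
    using bij_betw_trans[OF bij_betw_trans[OF bij_betw_straighten[OF c] bij_betw_eigen_coordinates[OF A(1) B A(2)]]
      bij_betw_eigen_ext_primitive]
    by (simp add: o_def \<Phi>_def[abs_def])
  moreover have "\<Phi> (straighten m c (sym_transfer m c a w)) = compound_transfer m a (\<Phi> (straighten m c w))"
    if "w \<in> sym_state_space m" for w
    unfolding straighten_sym_transfer[OF c a sf r that] by (rule intertwine)
  ultimately show ?thesis using lin bij intertwine by blast
qed

end

theorem theorem3p6:
  fixes m :: nat
  shows "(\<exists>c :: nat set \<times> nat set \<Rightarrow> nat set \<times> nat set \<Rightarrow> 'a::field_char_0.
            catalan_straightening m c) \<and>
    (\<forall>c :: nat set \<times> nat set \<Rightarrow> nat set \<times> nat set \<Rightarrow> 'a. catalan_straightening m c \<longrightarrow>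
       fs.dim (sym_state_space m :: (nat set \<times> nat set \<Rightarrow> 'a) set) = catalan (m + 1) \<and>
       (\<forall>a\<in>sym_params m. \<forall>N\<ge>m.
          sym_state m (toeplitz a (N + 1)) = sym_transfer m c a (sym_state m (toeplitz a N))) \<and>
       (\<forall>a\<in>sym_params m. \<forall>x. rsquarefree (symbol_poly m a) \<and> reciprocal_roots m a x \<longrightarrow>
          (\<forall>e f G. symplectic_eigenbasis m (C_q m a) x e f G \<longrightarrow>
             (\<exists>\<Phi>. Vector_Spaces.linear fscale fscale \<Phi> \<and>
                bij_betw \<Phi> (coord_space (boundary_pairs m)) (ext_power (2 * m) m) \<and>
                (\<forall>v\<in>coord_space (boundary_pairs m).
                   \<Phi> (laplace_transfer m a v) = compound_transfer m a (\<Phi> v)) \<and>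
                bij_betw (\<lambda>w. \<Phi> (straighten m c w)) (sym_state_space m) (primitive_module m G) \<and>
                (\<forall>w\<in>sym_state_space m.
                   \<Phi> (straighten m c (sym_transfer m c a w)) =
                     compound_transfer m a (\<Phi> (straighten m c w)))) \<and>
             fs.span (\<Union>\<epsilon>\<in>sign_vectors m. primitive_weight_space m e f G \<epsilon>) = primitive_module m G \<and>
             (\<forall>\<epsilon>\<in>sign_vectors m.
                (primitive_weight_space m e f G \<epsilon> \<noteq> {0} \<longleftrightarrow> support_size m \<epsilon> mod 2 = m mod 2) \<and>
                (\<forall>\<omega>\<in>primitive_weight_space m e f G \<epsilon>.
                   compound_transfer m a \<omega> = fscale (transfer_eigenvalue m a x \<epsilon>) \<omega>) \<and>
                (\<forall>r. m - support_size m \<epsilon> = 2 * r \<longrightarrow>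
                   fs.dim (primitive_weight_space m e f G \<epsilon>) = catalan r))) \<and>
          degree (min_poly (sym_transfer m c a) (sym_state_space m))
            \<le> card {\<epsilon> \<in> sign_vectors m. support_size m \<epsilon> mod 2 = m mod 2}) \<and>
       card {\<epsilon> \<in> sign_vectors m. support_size m \<epsilon> mod 2 = m mod 2} = (3 ^ m + 1) div 2 \<and>
       (\<exists>U. zariski_open (sym_params m) U \<and> U \<noteq> {} \<and>
          (\<forall>a\<in>U. degree (min_poly (sym_transfer m c a) (sym_state_space m)) = (3 ^ m + 1) div 2)))"
proof (intro conjI allI impI)
  show "\<exists>c :: nat set \<times> nat set \<Rightarrow> nat set \<times> nat set \<Rightarrow> 'a. catalan_straightening m c"
    using catalan_straightening_exists by blast
next
  show "fs.dim (sym_state_space m :: (nat set \<times> nat set \<Rightarrow> 'a) set) = catalan (m + 1)"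
    by (rule dim_sym_state_space)
next
  fix c :: "nat set \<times> nat set \<Rightarrow> nat set \<times> nat set \<Rightarrow> 'a"
  assume c: "catalan_straightening m c"
  show "\<forall>a\<in>sym_params m. \<forall>N\<ge>m.
      sym_state m (toeplitz a (N + 1)) = sym_transfer m c a (sym_state m (toeplitz a N))"
    using sym_state_toeplitz[OF c] by blast
next
  show "card {\<epsilon> \<in> sign_vectors m. support_size m \<epsilon> mod 2 = m mod 2} = (3 ^ m + 1) div 2"
    by (rule card_parity_sign_vectors)
next
  fix c :: "nat set \<times> nat set \<Rightarrow> nat set \<times> nat set \<Rightarrow> 'a"
  assume "catalan_straightening m c"
  then show "\<exists>U. zariski_open (sym_params m) U \<and> U \<noteq> {} \<and>
      (\<forall>a\<in>U. degree (min_poly (sym_transfer m c a) (sym_state_space m)) = (3 ^ m + 1) div 2)"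
    using generic_min_poly_degree card_parity_sign_vectors unfolding parity_weights_def by metis
next
  fix c :: "nat set \<times> nat set \<Rightarrow> nat set \<times> nat set \<Rightarrow> 'a"
  assume c: "catalan_straightening m c"
  show "\<forall>a\<in>sym_params m. \<forall>x. rsquarefree (symbol_poly m a) \<and> reciprocal_roots m a x \<longrightarrow>
          (\<forall>e f G. symplectic_eigenbasis m (C_q m a) x e f G \<longrightarrow>
             (\<exists>\<Phi>. Vector_Spaces.linear fscale fscale \<Phi> \<and>
                bij_betw \<Phi> (coord_space (boundary_pairs m)) (ext_power (2 * m) m) \<and>
                (\<forall>v\<in>coord_space (boundary_pairs m).
                   \<Phi> (laplace_transfer m a v) = compound_transfer m a (\<Phi> v)) \<and>
                bij_betw (\<lambda>w. \<Phi> (straighten m c w)) (sym_state_space m) (primitive_module m G) \<and>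
                (\<forall>w\<in>sym_state_space m.
                   \<Phi> (straighten m c (sym_transfer m c a w)) =
                     compound_transfer m a (\<Phi> (straighten m c w)))) \<and>
             fs.span (\<Union>\<epsilon>\<in>sign_vectors m. primitive_weight_space m e f G \<epsilon>) = primitive_module m G \<and>
             (\<forall>\<epsilon>\<in>sign_vectors m.
                (primitive_weight_space m e f G \<epsilon> \<noteq> {0} \<longleftrightarrow> support_size m \<epsilon> mod 2 = m mod 2) \<and>
                (\<forall>\<omega>\<in>primitive_weight_space m e f G \<epsilon>.
                   compound_transfer m a \<omega> = fscale (transfer_eigenvalue m a x \<epsilon>) \<omega>) \<and>
                (\<forall>r. m - support_size m \<epsilon> = 2 * r \<longrightarrow>
                   fs.dim (primitive_weight_space m e f G \<epsilon>) = catalan r))) \<and>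
          degree (min_poly (sym_transfer m c a) (sym_state_space m))
            \<le> card {\<epsilon> \<in> sign_vectors m. support_size m \<epsilon> mod 2 = m mod 2}"
  proof (rule ballI, rule allI, rule impI, rule conjI)
    fix a :: "int \<Rightarrow> 'a" and x
    assume a: "a \<in> sym_params m" and "rsquarefree (symbol_poly m a) \<and> reciprocal_roots m a x"
    then have r: "rsquarefree (symbol_poly m a)" "reciprocal_roots m a x" by auto
    show "degree (min_poly (sym_transfer m c a) (sym_state_space m))
        \<le> card {\<epsilon> \<in> sign_vectors m. support_size m \<epsilon> mod 2 = m mod 2}"
      using degree_min_poly_sym_transfer_le[OF c a r] by (simp only: parity_weights_def)
  qed (intro allI impI conjI ballI; elim conjE;
      (rule primitive_realization[OF _ _ c] span_primitive_weight_spaces primitive_weight_space_nontrivial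
        compound_transfer_primitive_weight_space dim_primitive_weight_space; assumption))
qed

end
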